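(* Let $u\ge 0$ be a locally integrable function on $\mathbb{R}^n$, let $q>1$, and let $v\in \mathrm{RH}_\infty\cap A_q$. Let $T$ be a Calderón-Zygmund operator on $\mathbb{R}^n$, let $\delta>0$ and $\varphi(z)=z(1+\log^+z)^\delta$ for $z\ge 0$. Then for every $p>\max\{q,1+1/\delta\}$ there exists a constant $C>0$ such that the inequality $$uv\left(\left\{x\in \mathbb{R}^n: \frac{|T(fv)(x)|}{v(x)}>t\right\}\right)\leq \frac{C}{t}\int_{\mathbb{R}^n}|f(x)|\,M_{\varphi, v^{1-q'}}u(x)\,M(\Psi(v))(x)\,dx$$ holds for every $t>0$ and every bounded function $f$ with compact support, where $\Psi(z)=z^{p'+1-q'}\mathcal{X}_{[0,1]}(z)+z^{p'}\mathcal{X}_{[1,\infty)}(z)$.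
   Context: Notation. $\mathcal{X}_E$ is the characteristic function of $E$; $p'=p/(p-1)$ and $q'=q/(q-1)$ are conjugate exponents; $\log^+z=\max\{\log z,0\}$. For a nonnegative function $g$ and a measurable set $E$, $g(E)=\int_E g(x)\,dx$; thus $uv(E)=\int_E u(x)v(x)\,dx$. Cubes are cubes in $\mathbb{R}^n$ with sides parallel to the coordinate axes. $A\lesssim B$ means that $A\le cB$ for some constant $c>0$. $\Psi(v)$ denotes the composition $\Psi\circ v$. Weights. A weight is a locally integrable function $w$ with $0<w(x)<\infty$ for almost every $x$. For $1<q<\infty$, $w\in A_q$ if there is $C>0$ with $\left(\frac{1}{|Q|}\int_Q w\right)\left(\frac{1}{|Q|}\int_Q w^{1-q'}\right)^{q-1}\leq C$ for every cube $Q$. A weight $w$ belongs to $\mathrm{RH}_\infty$ if there is $C>0$ with $\sup_Q w\leq \frac{C}{|Q|}\int_Q w$ for every cube $Q$ (essential supremum). Maximal operators. For a function $\varphi:[0,\infty)\to[0,\infty)$ that is convex, strictly increasing, with $\varphi(0)=0$ and $\lim_{t\to\infty}\varphi(t)=\infty$ (a Young function), and a weight $w$, define $$\|f\|_{\varphi,Q,w}=\inf\left\{\lambda>0: \frac{1}{w(Q)}\int_Q \varphi\left(\frac{|f(y)|}{\lambda}\right)w(y)\,dy\leq 1\right\}$$ (with $\inf\emptyset=\infty$) and $M_{\varphi,w}f(x)=\sup_{Q\ni x}\|f\|_{\varphi,Q,w}$, the supremum being over all cubes $Q$ containing $x$. $M$ is the classical Hardy-Littlewood maximal operator, $Mf(x)=\sup_{Q\ni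 x}\frac{1}{|Q|}\int_Q|f|$. Calderón-Zygmund operators. $T$ is a Calderón-Zygmund operator if it is a linear operator, bounded on $L^2(\mathbb{R}^n)$, such that for every $f\in L^2(\mathbb{R}^n)$ with compact support $$Tf(x)=\int_{\mathbb{R}^n}K(x-y)f(y)\,dy,\qquad x\notin \mathrm{supp}\, f,$$ where $K:\mathbb{R}^n\setminus\{0\}\to\mathbb{C}$ is a measurable function satisfying $|K(x)|\lesssim |x|^{-n}$ and $$|K(x-y)-K(x-z)|\lesssim \frac{|y-z|}{|x-y|^{n+1}}\quad\text{if } |x-y|>2|y-z|.$$ *)

theory Defs
  imports "HOL-Analysis.Analysis" "HOL-Probability.Essential_Supremum"
begin

definition conj_exp :: "real \<Rightarrow> real" where
  "conj_exp p = p / (p - 1)"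

definition log_plus :: "real \<Rightarrow> real" where
  "log_plus z = max (ln z) 0"

text \<open>
  Cubes are nondegenerate and closed. Taking open cubes instead changes none of the notions below.
\<close>

definition cubes :: "(real ^ 'n) set set" where
  "cubes = {cbox a (a + (\<chi> i. l)) | a l. 0 < l}"

definition locally_integrable :: "(real ^ 'n \<Rightarrow> real) \<Rightarrow> bool" where
  "locally_integrable g \<longleftrightarrow> (\<forall>S. compact S \<longrightarrow> g absolutely_integrable_on S)"

text \<open>
  Weights are real-valued, so that finiteness is implicit; as they are only determined up to
  null sets, nothing is required of their values on a null set.
\<close>

definition weight :: "(real ^ 'n \<Rightarrow> real) \<Rightarrow> bool" where
  "weight w \<longleftrightarrow> locally_integrable w \<and> (AE x in lebesgue. 0 < w x)"

definition avg :: "(real ^ 'n \<Rightarrow> real) \<Rightarrow> (real ^ 'n) set \<Rightarrow> real" where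
  "avg g Q = (1 / measure lebesgue Q) * (\<integral>x\<in>Q. g x \<partial>lebesgue)"

text \<open>
  Integrability of \<open>w powr (1 - q')\<close> on cubes is part of the finiteness of the \<open>A_q\<close> bound;
  it is stated explicitly because the Bochner integral of a non-integrable function is \<open>0\<close>.
\<close>

definition A_class :: "real \<Rightarrow> (real ^ 'n \<Rightarrow> real) set" where
  "A_class q = {w. weight w \<and> (\<exists>C>0. \<forall>Q\<in>cubes.
     (\<lambda>x. w x powr (1 - conj_exp q)) absolutely_integrable_on Q \<and>
     avg w Q * avg (\<lambda>x. w x powr (1 - conj_exp q)) Q powr (q - 1) \<le> C)}"

definition RH_infinity :: "(real ^ 'n \<Rightarrow> real) set" where
  "RH_infinity = {w. weight w \<and> (\<exists>C>0. \<forall>Q\<in>cubes.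
     esssup (lebesgue_on Q) (\<lambda>x. ereal (w x)) \<le> ereal (C * avg w Q))}"

definition mass :: "(real ^ 'n \<Rightarrow> real) \<Rightarrow> (real ^ 'n) set \<Rightarrow> ennreal" where
  "mass g E = (\<integral>\<^sup>+x\<in>E. ennreal (g x) \<partial>lebesgue)"

text \<open>
  The next two definitions are meant for Young functions \<open>\<phi>\<close> and weights \<open>w\<close>. Values lie in
  \<open>[0, \<infinity>]\<close>; in particular, the infimum of the empty set is \<open>\<infinity>\<close>.
\<close>

definition luxemburg_norm ::
    "(real \<Rightarrow> real) \<Rightarrow> (real ^ 'n) set \<Rightarrow> (real ^ 'n \<Rightarrow> real) \<Rightarrow> (real ^ 'n \<Rightarrow> real) \<Rightarrow> ennreal" where
  "luxemburg_norm \<phi> Q w f =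
     (INF s\<in>{s. 0 < s \<and>
        (\<integral>\<^sup>+y\<in>Q. ennreal (\<phi> (\<bar>f y\<bar> / s) * w y) \<partial>lebesgue) / mass w Q \<le> 1}. ennreal s)"

definition orlicz_maximal ::
    "(real \<Rightarrow> real) \<Rightarrow> (real ^ 'n \<Rightarrow> real) \<Rightarrow> (real ^ 'n \<Rightarrow> real) \<Rightarrow> real ^ 'n \<Rightarrow> ennreal" where
  "orlicz_maximal \<phi> w f x = (SUP Q\<in>{Q\<in>cubes. x \<in> Q}. luxemburg_norm \<phi> Q w f)"

definition hl_maximal :: "(real ^ 'n \<Rightarrow> real) \<Rightarrow> real ^ 'n \<Rightarrow> ennreal" where
  "hl_maximal f x =
     (SUP Q\<in>{Q\<in>cubes. x \<in> Q}. (\<integral>\<^sup>+y\<in>Q. ennreal \<bar>f y\<bar> \<partial>lebesgue) / emeasure lebesgue Q)"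

definition L2 :: "(real ^ 'n \<Rightarrow> complex) set" where
  "L2 = {f \<in> borel_measurable lebesgue. integrable lebesgue (\<lambda>x. (norm (f x))\<^sup>2)}"

definition supp :: "(real ^ 'n \<Rightarrow> complex) \<Rightarrow> (real ^ 'n) set" where
  "supp f = closure {x. f x \<noteq> 0}"

text \<open>
  An operator on \<open>L\<^sup>2\<close> acts on representatives, and identities between its values hold almost
  everywhere. Linearity together with boundedness implies that it respects equality almost
  everywhere.
\<close>

definition bounded_linear_L2 ::
    "((real ^ 'n \<Rightarrow> complex) \<Rightarrow> real ^ 'n \<Rightarrow> complex) \<Rightarrow> bool" where
  "bounded_linear_L2 T \<longleftrightarrow>
     (\<forall>f\<in>L2. T f \<in> L2) \<and>
     (\<forall>f\<in>L2. \<forall>g\<in>L2. \<forall>a b. AE x in lebesgue.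
        T (\<lambda>y. a * f y + b * g y) x = a * T f x + b * T g x) \<and>
     (\<exists>C>0. \<forall>f\<in>L2. sqrt (\<integral>x. (norm (T f x))\<^sup>2 \<partial>lebesgue)
        \<le> C * sqrt (\<integral>x. (norm (f x))\<^sup>2 \<partial>lebesgue))"

definition cz_kernel :: "(real ^ 'n \<Rightarrow> complex) \<Rightarrow> bool" where
  "cz_kernel K \<longleftrightarrow>
     K \<in> borel_measurable (lebesgue_on (- {0})) \<and>
     (\<exists>c>0. \<forall>x. x \<noteq> 0 \<longrightarrow> norm (K x) \<le> c * (1 / norm x ^ CARD('n))) \<and>
     (\<exists>c>0. \<forall>x y z. norm (x - y) > 2 * norm (y - z) \<longrightarrow>
        norm (K (x - y) - K (x - z)) \<le> c * (norm (y - z) / norm (x - y) ^ (CARD('n) + 1)))"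

definition calderon_zygmund ::
    "((real ^ 'n \<Rightarrow> complex) \<Rightarrow> real ^ 'n \<Rightarrow> complex) \<Rightarrow> bool" where
  "calderon_zygmund T \<longleftrightarrow> bounded_linear_L2 T \<and>
     (\<exists>K. cz_kernel K \<and>
        (\<forall>f\<in>L2. compact (supp f) \<longrightarrow>
           (AE x in lebesgue. x \<notin> supp f \<longrightarrow> T f x = (\<integral>y. K (x - y) * f y \<partial>lebesgue))))"

definition phi_log :: "real \<Rightarrow> real \<Rightarrow> real" where
  "phi_log \<delta> z = z * (1 + log_plus z) powr \<delta>"

text \<open>
  Both indicators equal \<open>1\<close> at \<open>z = 1\<close>, so the value there is \<open>2\<close>.
\<close>

definition Psi :: "real \<Rightarrow> real \<Rightarrow> real \<Rightarrow> real" where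
  "Psi p q z = z powr (conj_exp p + 1 - conj_exp q) * indicator {0..1} z
     + z powr conj_exp p * indicator {1..} z"

end

theory Submission
  imports Defs
begin

text \<open>
  Since \<open>p > q\<close> gives \<open>z \<le> \<Psi>(z)\<close>, the condition \<open>RH\<^sub>\<infinity>\<close> yields \<open>v \<le> C M(\<Psi>(v))\<close> almost everywhere, and it suffices to
  prove the estimate with \<open>v\<close> in place of \<open>M(\<Psi>(v))\<close>; the exponent \<open>p\<close> plays no further role. Put \<open>\<nu>(R) = \<integral>\<^sub>R |f| v\<close>,
  and let \<open>\<lambda>\<^sub>R\<close> be the Luxemburg norm of \<open>u\<close> on \<open>R\<close>. On a grid of small mesh, \<open>T\<close> becomes a kernel on integer points, for
  which a Calderon-Zygmund decomposition on stopping cubes gives a sparse bound: the pairing of \<open>T(f v)\<close> with \<open>H\<close> is at most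
  a constant times the sum of \<open>\<nu>(3Q) |Q|\<^sup>-\<^sup>1 \<integral>\<^sub>Q |H|\<close> over a family of dyadic cubes with a Carleson packing condition, up to
  an arbitrarily small error. The cubes \<open>3Q\<close> split into finitely many nested families.

  Let \<open>\<Omega>\<close> be the union of the cubes \<open>3Q\<close> with \<open>\<nu>(3Q) > t v(3Q)\<close>. As \<open>u v(R) \<lesssim> \<lambda>\<^sub>R v(R)\<close> by \<open>RH\<^sub>\<infinity>\<close> and \<open>A\<^sub>q\<close>, the maximal
  cubes bound \<open>u v(\<Omega>)\<close>. On the rest \<open>E\<close> of the level set, where \<open>u\<close> may be assumed bounded, take for \<open>H\<close> the product of
  \<open>u\<close> with the conjugate sign of \<open>T(f v)\<close>, so that \<open>t u v(E)\<close> is at most the sparse sum. The cubes with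
  \<open>\<nu>(R) \<approx> 2\<^sup>-\<^sup>k t v(R)\<close> are treated together, after the argument of Domingo-Salazar, Lacey and Rey: points covered
  at most \<open>2\<^sup>k\<^sup>/\<^sup>2\<close> times contribute a small multiple of \<open>t u v(E)\<close>, which is absorbed; points covered more often form an
  exponentially small part of \<open>R\<close>, on which the Luxemburg norm with \<open>\<phi>(z) = z (1 + log\<^sup>+ z)\<^sup>\<delta>\<close> gains a factor \<open>2\<^sup>-\<^sup>k\<^sup>\<delta>\<^sup>/\<^sup>2\<close>,
  and the points where \<open>v\<close> is small compared with its mean are controlled by \<open>A\<^sub>q\<close>.
\<close>

text \<open>\<open>T\<close> is known only as an operator on \<open>L2\<close> with a kernel formula
  off the support, so all selections of cubes are made for finite sums. Averaged over cells, the
  form of \<open>T\<close> has size and smoothness bounds whose constants do not depend on the mesh,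
  and small cells cost only the error term of the sparse bound.

  The sparse form pairs \<open>f v\<close> with \<open>u\<close> against Lebesgue measure, while the
  left side carries \<open>u v\<close>. The weight \<open>v powr (1 - q')\<close> of the Orlicz norm
  links the two. On a subset of R where \<open>v\<close> is at most h times its mean over R, this
  weight is at least that bound raised to the power 1 - q', and A_q bounds its total mass on R.
  Hence the integral of \<open>u\<close> over the subset is at most a constant times h powr (q' - 1)
  times |R| times the Luxemburg norm. RH_infinity provides a fixed h on all of R, and a small h
  gives decay. Where \<open>v\<close> is comparable to its mean, the density of \<open>f v\<close>
  on a cube that is not in the exceptional set is at most a multiple of t \<open>v\<close>, which
  restores \<open>u v\<close>.\<close>

subsection \<open>Dyadic cubes of integer points\<close>

text \<open>
  The pair \<open>(j, a)\<close> stands for the dyadic cube of the points \<open>x\<close> with \<open>x k div 2 ^ j = a k\<close> for all \<open>k\<close>, and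
  \<open>dil c (j, a)\<close> is its dilate with the same centre by the factor \<open>2 * c + 1\<close>.
\<close>

definition dil :: "int \<Rightarrow> nat \<times> ('n::finite \<Rightarrow> int) \<Rightarrow> ('n \<Rightarrow> int) set" where
  "dil c P = {x. \<forall>k. \<bar>x k div 2 ^ fst P - snd P k\<bar> \<le> c}"

definition anc :: "nat \<Rightarrow> nat \<times> ('n::finite \<Rightarrow> int) \<Rightarrow> nat \<times> ('n \<Rightarrow> int)" where
  "anc m P = (fst P + m, \<lambda>k. snd P k div 2 ^ m)"

definition cube_at :: "nat \<Rightarrow> ('n::finite \<Rightarrow> int) \<Rightarrow> nat \<times> ('n \<Rightarrow> int)" where
  "cube_at j x = (j, \<lambda>k. x k div 2 ^ j)"

text \<open>The discrete substitute for a distance of at most about \<open>2 ^ j\<close>: the cubes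
  of level \<open>j\<close> that contain \<open>x\<close> and \<open>y\<close> coincide or are
  adjacent, diagonally included.\<close>

definition near :: "nat \<Rightarrow> ('n::finite \<Rightarrow> int) \<Rightarrow> ('n \<Rightarrow> int) \<Rightarrow> bool" where
  "near j x y \<longleftrightarrow> (\<forall>k. \<bar>x k div 2 ^ j - y k div 2 ^ j\<bar> \<le> 1)"

text \<open>Adjacency of two cubes of possibly different sizes, measured at the scale of the smaller
  one.\<close>

definition touch :: "nat \<times> ('n::finite \<Rightarrow> int) \<Rightarrow> nat \<times> ('n \<Rightarrow> int) \<Rightarrow> bool" where
  "touch P R \<longleftrightarrow> (\<exists>x\<in>dil 0 P. \<exists>y\<in>dil 0 R. near (min (fst P) (fst R)) x y)"

text \<open>Division by \<open>m\<close> does not increase integer distances: a shift by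
  \<open>c\<close> is at most a shift by \<open>c * m\<close>, which moves the quotient by exactly
  \<open>c\<close>. Dilates and the relation \<open>near\<close> are therefore monotone in the
  level.\<close>

lemma abs_div_diff_le:
  fixes a b c m :: int
  assumes "\<bar>a - b\<bar> \<le> c" "0 < m"
  shows "\<bar>a div m - b div m\<bar> \<le> c"
proof -
  have c0: "0 \<le> c" using assms(1) by linarith
  have *: "x div m \<le> y div m + c" if "x \<le> y + c" for x y
  proof -
    have "x div m \<le> (y + c * m) div m"
      using that assms(2) c0
      by (intro zdiv_mono1) (auto intro: order_trans[OF that] simp: mult_le_cancel_left1)
    also have "\<dots> = y div m + c" using assms(2) by simp
    finally show ?thesis .
  qed
  from *[of a b] *[of b a] assms show ?thesis by linarith
qed

lemma div_pow_add: "(x::int) div 2 ^ (j + m) = x div 2 ^ j div 2 ^ m"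
  by (simp add: power_add zdiv_zmult2_eq)

lemma mem_dil0_iff: "x \<in> dil 0 P \<longleftrightarrow> P = cube_at (fst P) x"
  by (cases P) (auto simp: dil_def cube_at_def)

lemma mem_cube_at [simp]: "x \<in> dil 0 (cube_at j x)"
  by (simp add: mem_dil0_iff cube_at_def)

lemma fst_cube_at [simp]: "fst (cube_at j x) = j" by (simp add: cube_at_def)
lemma fst_anc [simp]: "fst (anc m P) = fst P + m" by (simp add: anc_def)
lemma anc_0 [simp]: "anc 0 P = P" by (simp add: anc_def)
lemma anc_anc [simp]: "anc m (anc l P) = anc (l + m) P"
  by (simp add: anc_def div_pow_add add.assoc)
lemma anc_cube_at [simp]: "anc m (cube_at j x) = cube_at (j + m) x"
  by (simp add: anc_def cube_at_def div_pow_add)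

lemma dil_mono: "c \<le> d \<Longrightarrow> dil c P \<subseteq> dil d P"
  by (auto simp: dil_def intro: order_trans)

lemma dil_anc: "dil c P \<subseteq> dil c (anc m P)"
  by (auto simp: dil_def anc_def div_pow_add intro!: abs_div_diff_le)

lemma mem_dil1_iff: "y \<in> dil 0 P \<Longrightarrow> x \<in> dil 1 P \<longleftrightarrow> near (fst P) x y"
  by (auto simp: dil_def near_def)

lemma near_sym: "near j x y \<Longrightarrow> near j y x" by (auto simp: near_def abs_minus_commute)
lemma near_refl [simp]: "near j x x" by (auto simp: near_def)

lemma near_mono: "near j x y \<Longrightarrow> j \<le> i \<Longrightarrow> near i x y"
proof -
  assume "near j x y" "j \<le> i"
  then obtain m where "i = j + m" by (auto simp: le_iff_add)
  with \<open>near j x y\<close> show ?thesis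
    unfolding near_def \<open>i = j + m\<close> div_pow_add by (auto intro: abs_div_diff_le)
qed

text \<open>Two steps of at most 1 add up to at most 2 in the coordinates of level \<open>j\<close>,
  and halving brings this down to 1.\<close>

lemma near_trans_Suc: assumes "near j x y" "near j y z" shows "near (Suc j) x z"
  unfolding near_def
proof
  fix k
  have "\<bar>x k div 2 ^ j - y k div 2 ^ j\<bar> \<le> 1" "\<bar>y k div 2 ^ j - z k div 2 ^ j\<bar> \<le> 1"
    using assms by (auto simp: near_def)
  then have "\<bar>x k div 2 ^ j div 2 - z k div 2 ^ j div 2\<bar> \<le> 1" by linarith
  then show "\<bar>x k div 2 ^ Suc j - z k div 2 ^ Suc j\<bar> \<le> 1"
    using div_pow_add[of "x k" j 1] div_pow_add[of "z k" j 1] by simp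
qed

lemma cube_at_mono: "cube_at j x = cube_at j y \<Longrightarrow> j \<le> i \<Longrightarrow> cube_at i x = cube_at i y"
  by (metis anc_cube_at le_iff_add)

lemma near_cube_at_cong: "cube_at j x = cube_at j y \<Longrightarrow> near j x z = near j y z"
  by (auto simp: near_def cube_at_def fun_eq_iff)

lemma dil_laminar:
  assumes "x \<in> dil 0 P" "x \<in> dil 0 R" "fst P \<le> fst R" shows "R = anc (fst R - fst P) P"
proof -
  have "P = cube_at (fst P) x" "R = cube_at (fst R) x" using assms by (auto simp: mem_dil0_iff)
  then show ?thesis using anc_cube_at[of "fst R - fst P" "fst P" x] assms(3) by simp
qed

lemma le_div_iff_int:
  fixes b x p :: int
  assumes "0 < p" shows "b \<le> x div p \<longleftrightarrow> b * p \<le> x"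
proof
  assume "b \<le> x div p"
  then have "b * p \<le> x div p * p" using assms by (simp add: mult_right_mono)
  moreover have "x div p * p + x mod p = x" "0 \<le> x mod p" using assms by simp_all
  ultimately show "b * p \<le> x" by linarith
next
  assume "b * p \<le> x"
  then have "b * p div p \<le> x div p" using assms by (intro zdiv_mono1) auto
  then show "b \<le> x div p" using assms by simp
qed

lemma dil_box:
  "dil c (j, a) = (\<Pi>\<^sub>E k\<in>UNIV. {(a k - c) * 2 ^ j ..< (a k + c + 1) * 2 ^ j})"
proof -
  have "\<bar>x div 2 ^ j - b\<bar> \<le> c \<longleftrightarrow> (b - c) * 2 ^ j \<le> x \<and> x < (b + c + 1) * 2 ^ j" for x b :: int
  proof -
    have 1: "b - c \<le> x div 2 ^ j \<longleftrightarrow> (b - c) * 2 ^ j \<le> x"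
      by (rule le_div_iff_int) simp
    have 2: "b + c + 1 \<le> x div 2 ^ j \<longleftrightarrow> (b + c + 1) * 2 ^ j \<le> x"
      by (rule le_div_iff_int) simp
    have "\<bar>x div 2 ^ j - b\<bar> \<le> c \<longleftrightarrow> b - c \<le> x div 2 ^ j \<and> \<not> b + c + 1 \<le> x div 2 ^ j"
      by linarith
    then show ?thesis unfolding 1 2 by linarith
  qed
  then show ?thesis by (auto simp: dil_def PiE_def Pi_def extensional_def)
qed

lemma finite_dil [simp]: "finite (dil c P)"
  by (cases P) (simp add: dil_box finite_PiE)

lemma card_dil:
  assumes "0 \<le> c"
  shows "card (dil c (P :: nat \<times> ('n::finite \<Rightarrow> int))) = nat (2 * c + 1) ^ CARD('n) * 2 ^ (fst P * CARD('n))"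
proof -
  obtain j a where P: "P = (j, a)" by (cases P)
  have "nat ((a k + c + 1) * 2 ^ j - (a k - c) * 2 ^ j) = nat (2 * c + 1) * 2 ^ j" for k
  proof -
    have "(a k + c + 1) * 2 ^ j - (a k - c) * 2 ^ j = (2 * c + 1) * 2 ^ j" by (simp add: algebra_simps)
    then show ?thesis using assms by (simp add: nat_mult_distrib nat_power_eq)
  qed
  then show ?thesis
    unfolding P dil_box by (simp add: card_PiE power_mult_distrib power_mult)
qed

lemma dil1_partition: "dil 1 (j, a) = (\<Union>b\<in>dil 1 (0, a). dil 0 (j, b))"
  by (fastforce simp: dil_def)

lemma dil0_disjoint: "b \<noteq> b' \<Longrightarrow> dil 0 (j, b) \<inter> dil 0 (j, b') = {}"
  by (auto simp: dil_def)

subsection \<open>Stopping cubes of a finite set\<close>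

text \<open>A Whitney-type decomposition of \<open>Om\<close>. Triples grow along ancestors by
  \<open>dil_anc\<close>, so the failure of the parent excludes all larger ancestors as
  well.\<close>

definition stopping :: "('n::finite \<Rightarrow> int) set \<Rightarrow> (nat \<times> ('n \<Rightarrow> int)) set" where
  "stopping Om = {P. dil 1 P \<subseteq> Om \<and> \<not> dil 1 (anc 1 P) \<subseteq> Om}"

text \<open>Takes the place of the triple of \<open>P\<close>. Being a union of stopping cubes, it
  either contains a given stopping cube or misses it, so cutting a function off to it never splits
  an oscillation; a triple has no such property.\<close>

definition nbhd :: "('n::finite \<Rightarrow> int) set \<Rightarrow> nat \<times> ('n \<Rightarrow> int) \<Rightarrow> ('n \<Rightarrow> int) set" where
  "nbhd Om P = (\<Union>R\<in>{R\<in>stopping Om. touch P R}. dil 0 R)"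

text \<open>The crude bound \<open>j < 2 ^ j\<close> suffices. It bounds the levels inside a finite
  set, so that greatest ancestors exist and only finitely many cubes occur.\<close>

lemma level_le_card:
  assumes "finite Om" "dil c (P :: nat \<times> ('n::finite \<Rightarrow> int)) \<subseteq> Om" "0 \<le> c" shows "fst P < card Om"
proof -
  have "fst P < 2 ^ fst P" by simp
  also have "\<dots> \<le> (2::nat) ^ (fst P * CARD('n))" by (intro power_increasing) auto
  also have "\<dots> \<le> card (dil 0 P)" by (simp add: card_dil)
  also have "\<dots> \<le> card Om" using assms by (meson card_mono dil_mono order_trans)
  finally show ?thesis .
qed

lemma finite_cubes_in:
  assumes "finite (Om :: ('n::finite \<Rightarrow> int) set)" shows "finite {P. dil 0 P \<subseteq> Om}"
proof (rule finite_subset)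
  show "{P. dil 0 P \<subseteq> Om} \<subseteq> (\<lambda>(j, x). cube_at j x) ` ({..<card Om} \<times> Om)"
  proof
    fix P assume "P \<in> {P. dil 0 P \<subseteq> Om}"
    then have P: "dil 0 P \<subseteq> Om" by simp
    have "card (dil 0 P) > 0" by (simp add: card_dil)
    then obtain x where x: "x \<in> dil 0 P" by (metis all_not_in_conv card.empty less_irrefl)
    then have "P = cube_at (fst P) x" by (simp add: mem_dil0_iff)
    moreover have "fst P < card Om" using level_le_card[OF assms P] by simp
    ultimately show "P \<in> (\<lambda>(j, x). cube_at j x) ` ({..<card Om} \<times> Om)"
      using P x by (intro image_eqI[of _ _ "(fst P, x)"]) auto
  qed
qed (use assms in auto)

lemma finite_stopping: "finite Om \<Longrightarrow> finite (stopping Om)"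
  by (rule finite_subset[OF _ finite_cubes_in]) (use dil_mono[of 0 1] in \<open>auto simp: stopping_def\<close>)

lemma stopping_unique:
  assumes "P \<in> stopping Om" "R \<in> stopping Om" "x \<in> dil 0 P" "x \<in> dil 0 R" shows "P = R"
proof -
  have *: "fst P \<ge> fst R" if "P \<in> stopping Om" "R \<in> stopping Om" "x \<in> dil 0 P" "x \<in> dil 0 R" for P R
  proof (rule ccontr)
    assume "\<not> fst P \<ge> fst R"
    then have "R = anc (fst R - fst P) P" using dil_laminar[OF that(3,4)] by simp
    moreover have "anc (fst R - fst P) P = anc (fst R - fst P - 1) (anc 1 P)"
      using \<open>\<not> fst P \<ge> fst R\<close> by (simp del: One_nat_def)
    ultimately have "R = anc (fst R - fst P - 1) (anc 1 P)" by simp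
    then have "dil 1 (anc 1 P) \<subseteq> dil 1 R" by (metis dil_anc)
    then show False using that by (auto simp: stopping_def)
  qed
  have "fst P = fst R" using *[of P R] *[of R P] assms by simp
  then show ?thesis using dil_laminar[OF assms(3,4)] by simp
qed

lemma stopping_exists:
  assumes "finite Om" "dil 1 X \<subseteq> Om" obtains m where "anc m X \<in> stopping Om"
proof -
  define m where "m = (GREATEST m. dil 1 (anc m X) \<subseteq> Om)"
  have b: "\<forall>m. dil 1 (anc m X) \<subseteq> Om \<longrightarrow> m \<le> card Om"
    using level_le_card[OF assms(1), of 1] by fastforce
  have "dil 1 (anc m X) \<subseteq> Om" unfolding m_def
    by (rule GreatestI_nat[where k = 0 and b = "card Om"]) (use b assms in auto)
  moreover have "\<not> dil 1 (anc (m + 1) X) \<subseteq> Om"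
  proof
    assume "dil 1 (anc (m + 1) X) \<subseteq> Om"
    then have "m + 1 \<le> m" unfolding m_def using b by (intro Greatest_le_nat) auto
    then show False by simp
  qed
  ultimately show ?thesis using that[of m] by (simp add: stopping_def)
qed

lemma touch_sym: "touch P R \<Longrightarrow> touch R P"
  unfolding touch_def by (metis min.commute near_sym)

lemma touch_refl [simp]: "touch P P"
proof -
  have "card (dil 0 P) > 0" by (simp add: card_dil)
  then obtain x where x: "x \<in> dil 0 P" by (metis all_not_in_conv card.empty less_irrefl)
  then show ?thesis unfolding touch_def using near_refl by blast
qed

lemma dil0_sub_nbhd: "P \<in> stopping Om \<Longrightarrow> dil 0 P \<subseteq> nbhd Om P"
  by (auto simp: nbhd_def)

text \<open>If \<open>x\<close> were near \<open>y\<close> one level below \<open>P\<close>, the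
  cube of that level around \<open>x\<close> would have its triple inside the triple of
  \<open>P\<close>, hence inside \<open>Om\<close>. It would then lie in a stopping cube, and that
  cube touches \<open>P\<close>. At level 0 there is no lower level, and only
  \<open>x \<noteq> y\<close> remains.\<close>

lemma not_nbhd_far:
  assumes "finite Om" "P \<in> stopping Om" "x \<notin> nbhd Om P" "y \<in> dil 0 P"
  shows "x \<noteq> y" and "fst P > 0 \<Longrightarrow> \<not> near (fst P - 1) x y"
proof -
  show "x \<noteq> y" using assms dil0_sub_nbhd by blast
  assume pos: "fst P > 0"
  show "\<not> near (fst P - 1) x y"
  proof
    assume nr: "near (fst P - 1) x y"
    let ?X = "cube_at (fst P - 1) x"
    have "dil 1 ?X \<subseteq> dil 1 P"
    proof
      fix z assume "z \<in> dil 1 ?X"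
      then have "near (fst P - 1) z x" using mem_dil1_iff[of x ?X z] by simp
      then have "near (Suc (fst P - 1)) z y" using near_trans_Suc nr by blast
      then show "z \<in> dil 1 P" using pos mem_dil1_iff[OF assms(4)] by simp
    qed
    then have "dil 1 ?X \<subseteq> Om" using assms(2) by (auto simp: stopping_def)
    then obtain m where m: "anc m ?X \<in> stopping Om" using stopping_exists[OF assms(1)] by blast
    have "x \<in> dil 0 (anc m ?X)" by (metis dil_anc mem_cube_at subsetD)
    moreover have "touch P (anc m ?X)"
      unfolding touch_def using assms(4) \<open>x \<in> dil 0 (anc m ?X)\<close> pos
      by (intro bexI[of _ y] bexI[of _ x]) (auto intro!: near_mono[OF near_sym[OF nr]])
    ultimately show False using m assms(3) unfolding nbhd_def by blast
  qed
qed

text \<open>The triple of a touching cube that is two or more levels larger contains the triple of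
  the parent of \<open>P\<close>, and the latter leaves \<open>Om\<close>. As touching is symmetric,
  neighbouring stopping cubes differ by at most one level.\<close>

lemma touch_level:
  assumes "P \<in> stopping Om" "R \<in> stopping Om" "touch P R" shows "fst R \<le> fst P + 1"
proof (rule ccontr)
  assume "\<not> fst R \<le> fst P + 1"
  then have lt: "fst P + 2 \<le> fst R" by simp
  obtain x y where xy: "x \<in> dil 0 P" "y \<in> dil 0 R" "near (fst P) x y"
    using assms(3) lt unfolding touch_def by (auto simp: min_def split: if_splits)
  have "dil 1 (anc 1 P) \<subseteq> dil 1 R"
  proof
    fix z assume "z \<in> dil 1 (anc 1 P)"
    moreover have "x \<in> dil 0 (anc 1 P)" using xy(1) dil_anc by blast
    ultimately have "near (Suc (fst P)) z x" using mem_dil1_iff by fastforce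
    moreover have "near (Suc (fst P)) x y" using near_mono[OF xy(3)] by simp
    ultimately have "near (Suc (Suc (fst P))) z y" by (rule near_trans_Suc)
    then have "near (fst R) z y" using lt near_mono by fastforce
    then show "z \<in> dil 1 R" using mem_dil1_iff[OF xy(2)] by simp
  qed
  then show False using assms by (auto simp: stopping_def)
qed

lemma nbhd_sub:
  assumes "P \<in> stopping Om" shows "nbhd Om P \<subseteq> dil 1 (anc 1 P)"
proof
  fix z assume "z \<in> nbhd Om P"
  then obtain R where R: "R \<in> stopping Om" "touch P R" "z \<in> dil 0 R" by (auto simp: nbhd_def)
  then obtain x y where xy: "x \<in> dil 0 P" "y \<in> dil 0 R" "near (min (fst P) (fst R)) x y"
    unfolding touch_def by auto
  have l: "fst R \<le> fst P + 1" using touch_level assms R by blast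
  have "near (fst P + 1) y x" using near_mono[OF near_sym[OF xy(3)]] by simp
  moreover have "cube_at (fst R) z = cube_at (fst R) y" using R(3) xy(2) by (metis mem_dil0_iff)
  then have "cube_at (fst P + 1) z = cube_at (fst P + 1) y" using l cube_at_mono by blast
  ultimately have "near (fst P + 1) z x" using near_cube_at_cong by blast
  moreover have "x \<in> dil 0 (anc 1 P)" using xy(1) dil_anc by blast
  ultimately show "z \<in> dil 1 (anc 1 P)" using mem_dil1_iff by fastforce
qed

text \<open>The reason why \<open>Om\<close> will be built from the dilates \<open>dil 2\<close> of
  cubes with large averages: \<open>dil 2 R\<close> contains every triple of a cube of the same
  level that contains \<open>R\<close>. So a cube inside the triple of a proper ancestor of a
  stopping cube cannot be one of the selected cubes, and its averages are controlled.\<close>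

lemma stopping_parent_far:
  assumes "P \<in> stopping Om" "0 < m" "dil 0 R \<subseteq> dil 1 (anc m P)" "fst R = fst P + m"
  shows "\<not> dil 2 R \<subseteq> Om"
proof
  assume R: "dil 2 R \<subseteq> Om"
  have "dil 1 (anc m P) \<subseteq> dil 2 R"
  proof -
    have "card (dil 0 R) > 0" by (simp add: card_dil)
    then obtain x where x: "x \<in> dil 0 R" by (metis all_not_in_conv card.empty less_irrefl)
    then have "x \<in> dil 1 (anc m P)" using assms(3) by auto
    have "z \<in> dil 2 R" if "z \<in> dil 1 (anc m P)" for z
      unfolding dil_def
    proof (clarify)
      fix k
      have "\<bar>z k div 2 ^ (fst P + m) - snd (anc m P) k\<bar> \<le> 1" "\<bar>x k div 2 ^ (fst P + m) - snd (anc m P) k\<bar> \<le> 1"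
        "x k div 2 ^ fst R = snd R k"
        using that x \<open>x \<in> dil 1 (anc m P)\<close> by (auto simp: dil_def)
      then show "\<bar>z k div 2 ^ fst R - snd R k\<bar> \<le> 2" using assms(4) by simp
    qed
    then show ?thesis by blast
  qed
  moreover have "dil 1 (anc 1 P) \<subseteq> dil 1 (anc m P)"
    using dil_anc[of 1 "anc 1 P" "m - 1"] assms(2) by simp
  ultimately show False using R assms(1) by (auto simp: stopping_def)
qed

subsection \<open>Discrete singular kernels\<close>

definition restr :: "('a \<Rightarrow> complex) \<Rightarrow> 'a set \<Rightarrow> 'a \<Rightarrow> complex" where
  "restr F X = (\<lambda>x. if x \<in> X then F x else 0)"

definition asum :: "('a \<Rightarrow> complex) \<Rightarrow> 'a set \<Rightarrow> real" where
  "asum F X = (\<Sum>x\<in>X. norm (F x))"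

lemma asum_nonneg [simp]: "0 \<le> asum F X" by (simp add: asum_def sum_nonneg)

lemma asum_mono: "finite Y \<Longrightarrow> X \<subseteq> Y \<Longrightarrow> asum F X \<le> asum F Y"
  unfolding asum_def by (rule sum_mono2) auto

lemma sum_power_half: "(\<Sum>m\<le>M. (1/2::real) ^ m) \<le> 2"
proof -
  have "(\<Sum>m\<le>M. (1/2::real) ^ m) = 2 - (1/2) ^ M" by (induction M) auto
  then show ?thesis by simp
qed

text \<open>The ancestors themselves need not exhaust the grid, because dyadic cubes never cross the
  coordinate hyperplanes through 0. Their triples do: at a high level all coordinates of a given
  point and of the ancestor are -1 or 0.\<close>

lemma anc_covers:
  assumes "finite U" obtains M where "U \<subseteq> dil 1 (anc M (P :: nat \<times> ('n::finite \<Rightarrow> int)))"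
proof -
  have *: "\<exists>M. \<forall>m\<ge>M. x \<in> dil 1 (anc m P)" for x
  proof -
    define N where "N = (\<Sum>k\<in>UNIV. nat \<bar>x k\<bar> + nat \<bar>snd P k\<bar>)"
    have "x \<in> dil 1 (anc m P)" if "m \<ge> N" for m
      unfolding dil_def
    proof (clarify)
      fix k
      have z: "z div 2 ^ i \<in> {-1, 0}" if "nat \<bar>z\<bar> \<le> i" for z :: int and i
      proof -
        have "int i < 2 ^ i" by (metis of_nat_less_two_power)
        then have "\<bar>z\<bar> < 2 ^ i" using that by linarith
        then have "- (2 ^ i) \<le> z" "z < 2 ^ i" by linarith+
        then have "- 1 \<le> z div 2 ^ i" "\<not> 1 \<le> z div 2 ^ i"
          by (simp_all add: le_div_iff_int)
        then show ?thesis by auto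
      qed
      have "nat \<bar>x k\<bar> + nat \<bar>snd P k\<bar> \<le> N" unfolding N_def by (rule member_le_sum) auto
      then have "nat \<bar>x k\<bar> \<le> fst P + m" "nat \<bar>snd P k\<bar> \<le> m" using that by linarith+
      then have "x k div 2 ^ (fst P + m) \<in> {-1, 0}" "snd P k div 2 ^ m \<in> {-1, 0}" using z by blast+
      then show "\<bar>x k div 2 ^ fst (anc m P) - snd (anc m P) k\<bar> \<le> 1" by (auto simp: anc_def)
    qed
    then show ?thesis by blast
  qed
  then obtain f where f: "\<And>x m. m \<ge> f x \<Longrightarrow> x \<in> dil 1 (anc m P)" by metis
  have "U \<subseteq> dil 1 (anc (sum f U) P)"
    using f member_le_sum[of _ U f] assms by blast
  then show ?thesis using that by blast
qed

text \<open>Here \<open>\<not> near j x y\<close> stands for a distance of at least about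
  \<open>2 ^ j\<close>, so \<open>size\<close> and the two smoothness conditions are the usual decay
  of order n and n + 1. The condition \<open>bounded\<close> covers the neighbourhood of the
  diagonal. All conditions are symmetric in the two variables, which yields
  \<open>transposed\<close>.\<close>

locale dyadic_kernel =
  fixes \<kappa> :: "('n::finite \<Rightarrow> int) \<Rightarrow> ('n \<Rightarrow> int) \<Rightarrow> complex" and B :: real and U :: "('n \<Rightarrow> int) set"
  assumes finite_U: "finite U" and B_nonneg: "0 \<le> B"
    and L2: "\<And>F H. norm (\<Sum>x\<in>U. \<Sum>y\<in>U. \<kappa> x y * F y * H x)
      \<le> B * sqrt (\<Sum>x\<in>U. (norm (F x))\<^sup>2) * sqrt (\<Sum>x\<in>U. (norm (H x))\<^sup>2)"
    and bounded: "\<And>x y. norm (\<kappa> x y) \<le> B"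
    and size: "\<And>j x y. \<not> near j x y \<Longrightarrow> norm (\<kappa> x y) \<le> B / 2 ^ (j * CARD('n))"
    and smooth2: "\<And>j m x y y'. cube_at j y = cube_at j y' \<Longrightarrow> j \<le> m \<Longrightarrow> \<not> near m x y \<Longrightarrow>
      norm (\<kappa> x y - \<kappa> x y') \<le> B * 2 ^ j / 2 ^ (m * (CARD('n) + 1))"
    and smooth1: "\<And>j m x x' y. cube_at j x = cube_at j x' \<Longrightarrow> j \<le> m \<Longrightarrow> \<not> near m x y \<Longrightarrow>
      norm (\<kappa> x y - \<kappa> x' y) \<le> B * 2 ^ j / 2 ^ (m * (CARD('n) + 1))"
begin

definition bf :: "(('n \<Rightarrow> int) \<Rightarrow> complex) \<Rightarrow> (('n \<Rightarrow> int) \<Rightarrow> complex) \<Rightarrow> complex" where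
  "bf F H = (\<Sum>x\<in>U. \<Sum>y\<in>U. \<kappa> x y * F y * H x)"

lemma transposed: "dyadic_kernel (\<lambda>x y. \<kappa> y x) B U"
proof
  fix F H :: "('n \<Rightarrow> int) \<Rightarrow> complex"
  have "(\<Sum>x\<in>U. \<Sum>y\<in>U. \<kappa> y x * F y * H x) = (\<Sum>x\<in>U. \<Sum>y\<in>U. \<kappa> x y * H y * F x)"
    by (subst sum.swap) (simp add: mult_ac)
  then show "norm (\<Sum>x\<in>U. \<Sum>y\<in>U. \<kappa> y x * F y * H x)
      \<le> B * sqrt (\<Sum>x\<in>U. (norm (F x))\<^sup>2) * sqrt (\<Sum>x\<in>U. (norm (H x))\<^sup>2)"
    using L2[of H F] by (simp add: mult_ac)
qed (use finite_U B_nonneg bounded size smooth1 smooth2 near_sym in blast)+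

lemma bf_transposed: "dyadic_kernel.bf (\<lambda>x y. \<kappa> y x) U F H = bf H F"
  unfolding dyadic_kernel.bf_def[OF transposed] bf_def by (subst sum.swap) (simp add: mult_ac)

lemma bf_L2: "norm (bf F H) \<le> B * sqrt (\<Sum>x\<in>U. (norm (F x))\<^sup>2) * sqrt (\<Sum>x\<in>U. (norm (H x))\<^sup>2)"
  using L2 by (simp add: bf_def)

lemma bf_diff_left: "bf (\<lambda>x. F x - G x) H = bf F H - bf G H"
  by (simp add: bf_def algebra_simps sum_subtractf)
lemma bf_add_left: "bf (\<lambda>x. F x + G x) H = bf F H + bf G H"
  by (simp add: bf_def algebra_simps sum.distrib)
lemma bf_add_right: "bf H (\<lambda>x. F x + G x) = bf H F + bf H G"
  by (simp add: bf_def algebra_simps sum.distrib)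
lemma bf_zero [simp]: "bf (\<lambda>x. 0) H = 0" "bf H (\<lambda>x. 0) = 0"
  by (simp_all add: bf_def)
lemma bf_sum_left: "finite I \<Longrightarrow> bf (\<lambda>x. \<Sum>i\<in>I. F i x) H = (\<Sum>i\<in>I. bf (F i) H)"
  by (induction I rule: finite_induct) (simp_all add: bf_add_left)
lemma bf_sum_right: "finite I \<Longrightarrow> bf H (\<lambda>x. \<Sum>i\<in>I. F i x) = (\<Sum>i\<in>I. bf H (F i))"
  by (induction I rule: finite_induct) (simp_all add: bf_add_right)

lemma bf_size:
  assumes "\<And>x y. x \<in> U \<Longrightarrow> y \<in> U \<Longrightarrow> F y \<noteq> 0 \<Longrightarrow> H x \<noteq> 0 \<Longrightarrow> norm (\<kappa> x y) \<le> c" "0 \<le> c"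
  shows "norm (bf F H) \<le> c * asum F U * asum H U"
proof -
  have "norm (bf F H) \<le> (\<Sum>x\<in>U. \<Sum>y\<in>U. norm (\<kappa> x y * F y * H x))"
    unfolding bf_def by (intro order_trans[OF norm_sum] sum_mono norm_sum)
  also have "\<dots> \<le> (\<Sum>x\<in>U. \<Sum>y\<in>U. c * norm (F y) * norm (H x))"
  proof (intro sum_mono)
    fix x y assume "x \<in> U" "y \<in> U"
    then show "norm (\<kappa> x y * F y * H x) \<le> c * norm (F y) * norm (H x)"
      using assms(1)[of x y] assms(2)
      by (cases "F y = 0"; cases "H x = 0") (simp_all add: norm_mult mult_right_mono)
  qed
  also have "\<dots> = c * asum F U * asum H U"
    unfolding asum_def by (simp add: sum_distrib_left sum_distrib_right mult_ac) (subst sum.swap, simp)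
  finally show ?thesis .
qed

text \<open>The bound is governed by the first ancestor whose triple contains \<open>x\<close>. At
  \<open>m = 0\<close> the two kernel values are estimated separately, by \<open>size\<close> one
  level below \<open>P\<close> or by \<open>bounded\<close> at level 0. For \<open>m > 0\<close> the
  point lies outside the preceding triple, and smoothness gives the factor \<open>(1/2) ^ m\<close>.
  In the form of a sum over all \<open>m\<close>, summation over \<open>x\<close> will produce
  averages over triples.\<close>

lemma kernel_diff_bound:
  assumes "y \<in> dil 0 P" "y0 \<in> dil 0 P" "x \<in> dil 1 (anc M P)"
    and "x \<noteq> y" "x \<noteq> y0" and far: "fst P > 0 \<Longrightarrow> \<not> near (fst P - 1) x y \<and> \<not> near (fst P - 1) x y0"
  shows "norm (\<kappa> x y - \<kappa> x y0) \<le>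
    (\<Sum>m\<le>M. if x \<in> dil 1 (anc m P) then 2 ^ (CARD('n) + 1) * B * (1/2) ^ m / 2 ^ ((fst P + m) * CARD('n)) else 0)"
    (is "_ \<le> (\<Sum>m\<le>M. ?t m)")
proof -
  define m where "m = (LEAST m. x \<in> dil 1 (anc m P))"
  have xm: "x \<in> dil 1 (anc m P)" unfolding m_def by (rule LeastI[of _ M]) (rule assms(3))
  have mM: "m \<le> M" unfolding m_def by (rule Least_le) (rule assms(3))
  have "norm (\<kappa> x y - \<kappa> x y0) \<le> 2 ^ (CARD('n) + 1) * B * (1/2) ^ m / 2 ^ ((fst P + m) * CARD('n))"
  proof (cases m)
    case 0
    show ?thesis
    proof (cases "fst P")
      case 0
      have "norm (\<kappa> x y - \<kappa> x y0) \<le> 2 * B"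
        using norm_triangle_ineq4[of "\<kappa> x y" "\<kappa> x y0"] bounded[of x y] bounded[of x y0] by linarith
      also have "\<dots> \<le> 2 ^ (CARD('n) + 1) * B"
        using B_nonneg by (intro mult_right_mono) auto
      finally show ?thesis using \<open>m = 0\<close> 0 by simp
    next
      case (Suc i)
      then have "\<not> near i x y" "\<not> near i x y0" using far by auto
      from size[OF this(1)] size[OF this(2)]
      have "norm (\<kappa> x y - \<kappa> x y0) \<le> 2 * (B / 2 ^ (i * CARD('n)))"
        using norm_triangle_ineq4[of "\<kappa> x y" "\<kappa> x y0"] by linarith
      also have "\<dots> = 2 ^ (CARD('n) + 1) * B / 2 ^ (Suc i * CARD('n))" by (simp add: power_add)
      finally show ?thesis using \<open>m = 0\<close> Suc by simp
    qed
  next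
    case (Suc i)
    then have "i < m" by simp
    then have "x \<notin> dil 1 (anc i P)" unfolding m_def by (rule not_less_Least)
    moreover have "y \<in> dil 0 (anc i P)" using assms(1) dil_anc by blast
    ultimately have "\<not> near (fst P + i) x y" using mem_dil1_iff[of y "anc i P" x] by simp
    then have "norm (\<kappa> x y - \<kappa> x y0) \<le> B * 2 ^ fst P / 2 ^ ((fst P + i) * (CARD('n) + 1))"
    proof (intro smooth2)
      show "cube_at (fst P) y = cube_at (fst P) y0" using assms(1,2) by (metis mem_dil0_iff)
    qed auto
    also have "\<dots> = 2 ^ (CARD('n) + 1) * B * (1/2) ^ m / 2 ^ ((fst P + m) * CARD('n))"
      unfolding Suc by (simp add: power_add power_one_over field_simps)
    finally show ?thesis .
  qed
  also have "\<dots> = ?t m" using xm by simp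
  also have "\<dots> \<le> (\<Sum>m\<le>M. ?t m)"
    by (rule member_le_sum) (use mM B_nonneg in auto)
  finally show ?thesis .
qed

text \<open>The vanishing sum of \<open>b\<close> permits subtracting the kernel at a fixed point
  \<open>y0\<close> of \<open>P\<close>. Summing \<open>kernel_diff_bound\<close> over
  \<open>x\<close> leaves the averages of \<open>G\<close> over the triples of the ancestors, each
  at most \<open>\<mu>\<close>, with geometric weights.\<close>

lemma bf_far:
  assumes P: "dil 0 P \<subseteq> U" and b0: "\<And>y. y \<notin> dil 0 P \<Longrightarrow> b y = 0" and bz: "(\<Sum>y\<in>dil 0 P. b y) = 0"
    and far: "\<And>x y. x \<in> U \<Longrightarrow> G x \<noteq> 0 \<Longrightarrow> y \<in> dil 0 P \<Longrightarrow> x \<noteq> y \<and> (fst P > 0 \<longrightarrow> \<not> near (fst P - 1) x y)"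
    and avg: "\<And>m. asum G (dil 1 (anc m P)) \<le> \<mu> * 2 ^ ((fst P + m) * CARD('n))"
  shows "norm (bf b G) \<le> 2 ^ (CARD('n) + 2) * B * \<mu> * asum b (dil 0 P)"
proof -
  have "card (dil 0 P) > 0" by (simp add: card_dil)
  then obtain y0 where y0: "y0 \<in> dil 0 P" by (metis all_not_in_conv card.empty less_irrefl)
  obtain M where M: "U \<subseteq> dil 1 (anc M P)" using anc_covers[OF finite_U] by blast
  let ?c = "\<lambda>m. 2 ^ (CARD('n) + 1) * B * (1/2) ^ m / 2 ^ ((fst P + m) * CARD('n))"
  let ?D = "\<lambda>x. \<Sum>m\<le>M. if x \<in> dil 1 (anc m P) then ?c m else 0"
  have c0: "0 \<le> ?c m" for m using B_nonneg by simp
  have \<mu>0: "0 \<le> \<mu>" using order_trans[OF asum_nonneg avg[of 0]]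
    by (metis mult_less_0_iff not_le zero_less_numeral zero_less_power)
  have eq: "bf b G = (\<Sum>x\<in>U. \<Sum>y\<in>dil 0 P. (\<kappa> x y - \<kappa> x y0) * b y * G x)"
    unfolding bf_def
  proof (rule sum.cong[OF refl])
    fix x assume "x \<in> U"
    have "(\<Sum>y\<in>U. \<kappa> x y * b y * G x) = (\<Sum>y\<in>dil 0 P. \<kappa> x y * b y * G x)"
      by (rule sum.mono_neutral_right) (use finite_U P b0 in auto)
    also have "\<dots> = (\<Sum>y\<in>dil 0 P. \<kappa> x y * b y * G x) - \<kappa> x y0 * (\<Sum>y\<in>dil 0 P. b y) * G x"
      using bz by simp
    also have "\<dots> = (\<Sum>y\<in>dil 0 P. (\<kappa> x y - \<kappa> x y0) * b y * G x)"
      by (simp add: sum_distrib_left sum_distrib_right left_diff_distrib sum_subtractf)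
    finally show "(\<Sum>y\<in>U. \<kappa> x y * b y * G x) = \<dots>" .
  qed
  have "norm (bf b G) \<le> (\<Sum>x\<in>U. \<Sum>y\<in>dil 0 P. norm ((\<kappa> x y - \<kappa> x y0) * b y * G x))"
    unfolding eq by (intro order_trans[OF norm_sum] sum_mono norm_sum)
  also have "\<dots> \<le> (\<Sum>x\<in>U. \<Sum>y\<in>dil 0 P. ?D x * norm (b y) * norm (G x))"
  proof (intro sum_mono)
    fix x y assume x: "x \<in> U" and y: "y \<in> dil 0 P"
    show "norm ((\<kappa> x y - \<kappa> x y0) * b y * G x) \<le> ?D x * norm (b y) * norm (G x)"
    proof (cases "G x = 0")
      case False
      have "norm (\<kappa> x y - \<kappa> x y0) \<le> ?D x"
        by (rule kernel_diff_bound) (use x y y0 M far[OF x False y] far[OF x False y0] in auto)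
      then show ?thesis by (simp add: norm_mult mult_right_mono)
    qed simp
  qed
  also have "\<dots> = asum b (dil 0 P) * (\<Sum>x\<in>U. ?D x * norm (G x))"
  proof -
    have "(\<Sum>y\<in>dil 0 P. d * norm (b y) * g) = asum b (dil 0 P) * (d * g)" for d g :: real
      unfolding asum_def sum_distrib_right by (rule sum.cong) (simp_all add: mult_ac)
    then show ?thesis unfolding sum_distrib_left[of "asum b (dil 0 P)"] by (intro sum.cong refl)
  qed
  finally have A: "norm (bf b G) \<le> asum b (dil 0 P) * (\<Sum>x\<in>U. ?D x * norm (G x))" .
  have "(\<Sum>x\<in>U. ?D x * norm (G x)) = (\<Sum>m\<le>M. ?c m * asum G (U \<inter> dil 1 (anc m P)))"
  proof -
    have "(\<Sum>x\<in>U. ?D x * norm (G x)) = (\<Sum>m\<le>M. \<Sum>x\<in>U. (if x \<in> dil 1 (anc m P) then ?c m else 0) * norm (G x))"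
      unfolding sum_distrib_right by (rule sum.swap)
    also have "\<dots> = (\<Sum>m\<le>M. ?c m * asum G (U \<inter> dil 1 (anc m P)))"
    proof (rule sum.cong[OF refl])
      fix m
      have "(\<Sum>x\<in>U. (if x \<in> dil 1 (anc m P) then ?c m else 0) * norm (G x))
        = (\<Sum>x\<in>U. if x \<in> dil 1 (anc m P) then ?c m * norm (G x) else 0)"
        by (rule sum.cong[OF refl]) simp
      also have "\<dots> = (\<Sum>x\<in>U \<inter> dil 1 (anc m P). ?c m * norm (G x))"
        by (rule sum.inter_restrict[OF finite_U, symmetric])
      finally show "(\<Sum>x\<in>U. (if x \<in> dil 1 (anc m P) then ?c m else 0) * norm (G x))
         = ?c m * asum G (U \<inter> dil 1 (anc m P))"
        by (simp add: asum_def sum_distrib_left)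
    qed
    finally show ?thesis .
  qed
  also have "\<dots> \<le> (\<Sum>m\<le>M. 2 ^ (CARD('n) + 1) * B * \<mu> * (1/2) ^ m)"
  proof (rule sum_mono)
    fix m
    have "asum G (U \<inter> dil 1 (anc m P)) \<le> \<mu> * 2 ^ ((fst P + m) * CARD('n))"
      by (rule order_trans[OF asum_mono avg]) auto
    then have "?c m * asum G (U \<inter> dil 1 (anc m P)) \<le> ?c m * (\<mu> * 2 ^ ((fst P + m) * CARD('n)))"
      using c0 by (rule mult_left_mono)
    then show "?c m * asum G (U \<inter> dil 1 (anc m P)) \<le> 2 ^ (CARD('n) + 1) * B * \<mu> * (1/2) ^ m"
      by (simp add: mult_ac)
  qed
  also have "\<dots> \<le> 2 ^ (CARD('n) + 1) * B * \<mu> * 2"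
    unfolding sum_distrib_left[symmetric]
    using sum_power_half[of M] B_nonneg \<mu>0 by (intro mult_left_mono) auto
  finally have "asum b (dil 0 P) * (\<Sum>x\<in>U. ?D x * norm (G x))
      \<le> asum b (dil 0 P) * (2 ^ (CARD('n) + 1) * B * \<mu> * 2)"
    by (rule mult_left_mono) simp
  with A show ?thesis by (simp add: mult_ac)
qed

section \<open>Means and oscillations on dyadic cubes\<close>

definition av :: "(('n \<Rightarrow> int) \<Rightarrow> complex) \<Rightarrow> nat \<times> ('n \<Rightarrow> int) \<Rightarrow> complex" where
  "av G P = (\<Sum>x\<in>dil 0 P. G x) / of_nat (card (dil 0 P))"

definition osc :: "(('n \<Rightarrow> int) \<Rightarrow> complex) \<Rightarrow> nat \<times> ('n \<Rightarrow> int) \<Rightarrow> ('n \<Rightarrow> int) \<Rightarrow> complex" where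
  "osc G P = (\<lambda>x. if x \<in> dil 0 P then G x - av G P else 0)"

lemma card_dil0: "card (dil 0 (P :: nat \<times> ('n \<Rightarrow> int))) = 2 ^ (fst P * CARD('n))"
  by (simp add: card_dil)

lemma norm_av: "norm (av G P) \<le> asum G (dil 0 P) / 2 ^ (fst P * CARD('n))"
  unfolding av_def asum_def card_dil0 by (simp add: norm_divide norm_power divide_right_mono norm_sum)

lemma sum_osc: "(\<Sum>x\<in>dil 0 P. osc G P x) = 0"
proof -
  have "(\<Sum>x\<in>dil 0 P. osc G P x) = (\<Sum>x\<in>dil 0 P. G x - av G P)"
    by (rule sum.cong) (auto simp: osc_def)
  then show ?thesis by (simp add: sum_subtractf av_def card_dil0)
qed

lemma asum_osc: "asum (osc G P) (dil 0 P) \<le> 2 * asum G (dil 0 P)"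
proof -
  have "asum (osc G P) (dil 0 P) \<le> (\<Sum>x\<in>dil 0 P. norm (G x) + norm (av G P))"
    unfolding asum_def osc_def by (rule sum_mono) (simp add: norm_triangle_ineq4)
  also have "\<dots> = asum G (dil 0 P) + 2 ^ (fst P * CARD('n)) * norm (av G P)"
    by (simp add: sum.distrib asum_def card_dil0)
  also have "\<dots> \<le> asum G (dil 0 P) + asum G (dil 0 P)"
    using norm_av[of G P] by (simp add: pos_le_divide_eq mult.commute)
  finally show ?thesis by simp
qed

end

lemma le_sum_if_le_mean: "s \<le> (a + b) / 2 \<Longrightarrow> 0 \<le> a \<Longrightarrow> 0 \<le> b \<Longrightarrow> s \<le> b + (a::real)"
  by simp

context dyadic_kernel begin

text \<open>
  Calderon-Zygmund decomposition of both functions on the stopping cubes: replacing the triple cube by the union of the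
  touching stopping cubes costs the size of the kernel, replacing a function by its mean on a stopping cube costs the
  smoothness of the kernel, and what remains is bounded in square mean.
\<close>

lemma step_estimate:
  fixes Om :: "('n \<Rightarrow> int) set"
  defines "W \<equiv> stopping Om"
  assumes Om: "finite Om"
    and F0: "\<And>x. x \<notin> U \<Longrightarrow> F x = 0" and H0: "\<And>x. x \<notin> U \<Longrightarrow> H x = 0"
    and loc: "\<And>P. P \<in> W \<Longrightarrow> dil 0 P \<subseteq> U \<or> (\<forall>x\<in>dil 0 P. F x = 0 \<and> H x = 0)"
    and avF: "\<And>P m. P \<in> W \<Longrightarrow> asum F (dil 1 (anc m P)) \<le> p * 2 ^ ((fst P + m) * CARD('n))"
    and avH: "\<And>P. P \<in> W \<Longrightarrow> asum H (dil 0 P) \<le> r * 2 ^ (fst P * CARD('n))"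
    and freeF: "\<And>x. x \<notin> (\<Union>P\<in>W. dil 0 P) \<Longrightarrow> norm (F x) \<le> p"
    and freeH: "\<And>x. x \<notin> (\<Union>P\<in>W. dil 0 P) \<Longrightarrow> norm (H x) \<le> r"
    and p0: "0 \<le> p" and r0: "0 \<le> r"
  shows "norm (bf F H - (\<Sum>P\<in>W. bf (restr F (dil 1 P)) (restr H (dil 0 P))))
    \<le> 10 * 6 ^ CARD('n) * B * (p * asum H U + r * asum F U + p * r * (\<Sum>P\<in>W. 2 ^ (fst P * CARD('n))))"
proof -
  let ?n = "CARD('n)"
  let ?N = "nbhd Om"
  define Ft where "Ft = (\<lambda>x. F x - (\<Sum>P\<in>W. osc F P x))"
  define Ht where "Ht = (\<lambda>x. H x - (\<Sum>P\<in>W. osc H P x))"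
  have finW: "finite W" using finite_stopping[OF Om] by (simp add: W_def)
  have uniq: "P = R" if "P \<in> W" "R \<in> W" "x \<in> dil 0 P" "x \<in> dil 0 R" for P R x
    using stopping_unique that unfolding W_def by blast
  \<comment> \<open>Distinct stopping cubes are disjoint, so at each point at most one oscillation
    is nonzero, and removing all of them leaves the mean.\<close>
  have on: "G x - (\<Sum>P\<in>W. osc G P x) = av G P" if "P \<in> W" "x \<in> dil 0 P" for G P x
  proof -
    have "osc G R x = 0" if "R \<in> W - {P}" for R
      using that uniq[OF \<open>P \<in> W\<close> _ \<open>x \<in> dil 0 P\<close>, of R] unfolding osc_def by auto
    then have "(\<Sum>R\<in>W. osc G R x) = (\<Sum>R\<in>{P}. osc G R x)"
      using finW that(1) by (intro sum.mono_neutral_right) blast+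
    then show ?thesis using that by (simp add: osc_def)
  qed
  have off: "G x - (\<Sum>P\<in>W. osc G P x) = G x" if "x \<notin> (\<Union>P\<in>W. dil 0 P)" for G x
  proof -
    have "(\<Sum>R\<in>W. osc G R x) = 0"
      by (rule sum.neutral) (use that in \<open>auto simp: osc_def\<close>)
    then show ?thesis by simp
  qed
  have avFP: "norm (av F P) \<le> p" if "P \<in> W" for P
  proof -
    have "asum F (dil 0 P) \<le> asum F (dil 1 (anc 0 P))" by (rule asum_mono) (simp_all add: dil_mono)
    then have "asum F (dil 0 P) \<le> p * 2 ^ (fst P * ?n)" using avF[OF that, of 0] by simp
    then have "asum F (dil 0 P) / 2 ^ (fst P * ?n) \<le> p" by (simp add: pos_divide_le_eq)
    with norm_av[of F P] show ?thesis by (rule order_trans)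
  qed
  have avHP: "norm (av H P) \<le> r" if "P \<in> W" for P
  proof -
    have "asum H (dil 0 P) / 2 ^ (fst P * ?n) \<le> r" using avH[OF that] by (simp add: pos_divide_le_eq)
    with norm_av[of H P] show ?thesis by (rule order_trans)
  qed
  have Ft_le: "norm (Ft x) \<le> p" for x
    using on[of _ x F] off[of x F] avFP freeF[of x] unfolding Ft_def
    by (cases "x \<in> (\<Union>P\<in>W. dil 0 P)") auto
  have Ht_le: "norm (Ht x) \<le> r" for x
    using on[of _ x H] off[of x H] avHP freeH[of x] unfolding Ht_def
    by (cases "x \<in> (\<Union>P\<in>W. dil 0 P)") auto
  have zero_out: "\<And>x. x \<notin> U \<Longrightarrow> Ft x = 0" "\<And>x. x \<notin> U \<Longrightarrow> Ht x = 0"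
  proof -
    fix x assume x: "x \<notin> U"
    have "Ft x = 0 \<and> Ht x = 0"
    proof (cases "x \<in> (\<Union>P\<in>W. dil 0 P)")
      case True
      then obtain P where P: "P \<in> W" "x \<in> dil 0 P" by blast
      then have "\<forall>x\<in>dil 0 P. F x = 0 \<and> H x = 0" using loc x by blast
      then show ?thesis using on[OF P, of F] on[OF P, of H] by (simp add: Ft_def Ht_def av_def)
    next
      case False
      then show ?thesis using off[of x F] off[of x H] x F0 H0 by (simp add: Ft_def Ht_def)
    qed
    then show "Ft x = 0" "Ht x = 0" by auto
  qed
  have asum_disj: "(\<Sum>P\<in>W. asum G (dil 0 P)) \<le> asum G U" if "G = F \<or> G = H" for G
  proof -
    have G: "asum G (dil 0 P) = asum G (dil 0 P \<inter> U)" if "P \<in> W" for P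
    proof -
      have "G x = 0" if "x \<notin> U" for x using that \<open>G = F \<or> G = H\<close> F0 H0 by blast
      then show ?thesis unfolding asum_def by (intro sum.mono_neutral_right) auto
    qed
    have "(\<Sum>P\<in>W. asum G (dil 0 P)) = (\<Sum>P\<in>W. asum G (dil 0 P \<inter> U))"
      using G by (rule sum.cong[OF refl])
    also have "\<dots> = asum G (\<Union>P\<in>W. dil 0 P \<inter> U)"
      unfolding asum_def by (rule sum.UNION_disjoint[symmetric]) (use finW uniq in auto)
    also have "\<dots> \<le> asum G U" by (rule asum_mono) (use finite_U in auto)
    finally show ?thesis .
  qed
  have asum_t: "asum (\<lambda>x. G x - (\<Sum>P\<in>W. osc G P x)) U \<le> asum G U" if G: "G = F \<or> G = H" for G
  proof -
    have "norm (G x - (\<Sum>P\<in>W. osc G P x))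
       \<le> (if x \<in> (\<Union>P\<in>W. dil 0 P) then 0 else norm (G x)) + (\<Sum>P\<in>W. if x \<in> dil 0 P then norm (av G P) else 0)" for x
    proof (cases "x \<in> (\<Union>P\<in>W. dil 0 P)")
      case True
      then obtain P where P: "P \<in> W" "x \<in> dil 0 P" by blast
      have "norm (av G P) = (if x \<in> dil 0 P then norm (av G P) else 0)" using P by simp
      also have "\<dots> \<le> (\<Sum>P\<in>W. if x \<in> dil 0 P then norm (av G P) else 0)"
        by (rule member_le_sum) (use P finW in auto)
      finally show ?thesis using on[OF P, of G] True by simp
    next
      case False
      then show ?thesis using off[of x G] by (simp add: sum_nonneg)
    qed
    then have "asum (\<lambda>x. G x - (\<Sum>P\<in>W. osc G P x)) U \<le>
      (\<Sum>x\<in>U. (if x \<in> (\<Union>P\<in>W. dil 0 P) then 0 else norm (G x)) + (\<Sum>P\<in>W. if x \<in> dil 0 P then norm (av G P) else 0))"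
      unfolding asum_def by (rule sum_mono)
    also have "\<dots> = (\<Sum>x\<in>U - (\<Union>P\<in>W. dil 0 P). norm (G x)) + (\<Sum>P\<in>W. \<Sum>x\<in>U. if x \<in> dil 0 P then norm (av G P) else 0)"
    proof -
      have "(\<Sum>x\<in>U. if x \<in> (\<Union>P\<in>W. dil 0 P) then 0 else norm (G x)) = (\<Sum>x\<in>U - (\<Union>P\<in>W. dil 0 P). norm (G x))"
        by (rule sum.mono_neutral_cong_right) (use finite_U in auto)
      moreover have "(\<Sum>x\<in>U. \<Sum>P\<in>W. if x \<in> dil 0 P then norm (av G P) else 0)
        = (\<Sum>P\<in>W. \<Sum>x\<in>U. if x \<in> dil 0 P then norm (av G P) else 0)" by (rule sum.swap)
      ultimately show ?thesis by (simp only: sum.distrib)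
    qed
    also have "\<dots> \<le> (\<Sum>x\<in>U - (\<Union>P\<in>W. dil 0 P). norm (G x)) + (\<Sum>P\<in>W. asum G (dil 0 P \<inter> U))"
    proof (intro add_left_mono sum_mono)
      fix P assume P: "P \<in> W"
      have e: "(\<Sum>x\<in>U. if x \<in> dil 0 P then norm (av G P) else 0) = card (U \<inter> dil 0 P) * norm (av G P)"
        using sum.inter_restrict[OF finite_U, of "\<lambda>_. norm (av G P)" "dil 0 P"] by simp
      \<comment> \<open>For a cube inside \<open>U\<close> all its points enter the mean; a cube
        that leaves \<open>U\<close> carries neither function, and its mean is 0.\<close>
      consider "dil 0 P \<subseteq> U" | "\<forall>x\<in>dil 0 P. G x = 0" using loc[OF P] G by blast
      then show "(\<Sum>x\<in>U. if x \<in> dil 0 P then norm (av G P) else 0) \<le> asum G (dil 0 P \<inter> U)"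
      proof cases
        case 1
        then have "U \<inter> dil 0 P = dil 0 P" "dil 0 P \<inter> U = dil 0 P" by auto
        then show ?thesis unfolding e using norm_av[of G P]
          by (simp add: card_dil0 pos_le_divide_eq mult.commute)
      next
        case 2
        then have "av G P = 0" by (simp add: av_def)
        then show ?thesis unfolding e by simp
      qed
    qed
    also have "\<dots> = (\<Sum>x\<in>U - (\<Union>P\<in>W. dil 0 P). norm (G x)) + asum G (\<Union>P\<in>W. dil 0 P \<inter> U)"
      unfolding asum_def by (subst sum.UNION_disjoint) (use finW uniq in auto)
    also have "\<dots> = asum G U"
      unfolding asum_def by (subst sum.union_disjoint[symmetric]) (use finW finite_U in \<open>auto intro!: sum.cong\<close>)
    finally show ?thesis .
  qed
  have sq_le: "(\<Sum>x\<in>U. (norm (G x))\<^sup>2) \<le> c * asum G U" if "\<And>x. norm (G x) \<le> c" for G c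
    unfolding asum_def sum_distrib_left power2_eq_square
    by (intro sum_mono mult_right_mono that) auto

  have dec_H: "bf F (restr H (dil 0 P)) = bf F (restr Ht (dil 0 P)) + bf F (osc H P)" if P: "P \<in> W" for P F
  proof -
    have "restr H (dil 0 P) x = restr Ht (dil 0 P) x + osc H P x" for x
    proof (cases "x \<in> dil 0 P")
      case True
      then have "Ht x = av H P" using on[OF P, of x H] by (simp add: Ht_def)
      then show ?thesis using True by (simp add: restr_def osc_def)
    qed (simp add: restr_def osc_def)
    then have "restr H (dil 0 P) = (\<lambda>x. restr Ht (dil 0 P) x + osc H P x)" by blast
    then show ?thesis by (simp add: bf_add_right)
  qed
  have nb: "x \<in> ?N P \<longleftrightarrow> (\<exists>R\<in>W. touch P R \<and> x \<in> dil 0 R)" for x P by (auto simp: nbhd_def W_def)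

  \<comment> \<open>Each function is a mean part plus oscillations. \<open>?E1\<close> exchanges the
    triple for the neighbourhood, \<open>?E2\<close> pairs an oscillation of \<open>H\<close> with
    \<open>F\<close> far away, \<open>?E3\<close> pairs the two mean parts, and \<open>?E5\<close>
    pairs an oscillation of \<open>F\<close> with the far mean part of \<open>H\<close>.
    \<open>?E4\<close> is subtracted because the local terms contain all of \<open>F\<close>, mean
    part included, while \<open>?E3\<close> has already counted the mean parts everywhere.\<close>
  let ?E1 = "\<Sum>P\<in>W. bf (\<lambda>x. restr F (?N P) x - restr F (dil 1 P) x) (restr H (dil 0 P))"
  let ?E2 = "\<Sum>P\<in>W. bf (restr F (- ?N P)) (osc H P)"
  let ?E3 = "bf Ft Ht"
  let ?E4 = "\<Sum>P\<in>W. bf (restr Ft (?N P)) (restr Ht (dil 0 P))"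
  let ?E5 = "\<Sum>R\<in>W. bf (osc F R) (restr Ht (- ?N R))"
  have main: "bf F H - (\<Sum>P\<in>W. bf (restr F (dil 1 P)) (restr H (dil 0 P))) = ?E1 + ?E2 + ?E3 - ?E4 + ?E5"
  proof -
    have "bf F H = bf F Ht + (\<Sum>P\<in>W. bf F (osc H P))"
    proof -
      have "H = (\<lambda>x. Ht x + (\<Sum>P\<in>W. osc H P x))" by (simp add: Ht_def)
      then have "bf F H = bf F (\<lambda>x. Ht x + (\<Sum>P\<in>W. osc H P x))" by simp
      then show ?thesis using finW by (simp add: bf_add_right bf_sum_right)
    qed
    moreover have "(\<Sum>P\<in>W. bf F (osc H P)) = ?E2 + (\<Sum>P\<in>W. bf (restr F (?N P)) (osc H P))"
    proof -
      have "bf F (osc H P) = bf (restr F (- ?N P)) (osc H P) + bf (restr F (?N P)) (osc H P)" for P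
      proof -
        have "F = (\<lambda>x. restr F (- ?N P) x + restr F (?N P) x)" by (auto simp: restr_def)
        then have "bf F (osc H P) = bf (\<lambda>x. restr F (- ?N P) x + restr F (?N P) x) (osc H P)" by simp
        then show ?thesis by (simp add: bf_add_left)
      qed
      then show ?thesis by (simp add: sum.distrib)
    qed
    moreover have "bf F Ht = ?E3 + (\<Sum>R\<in>W. bf (osc F R) Ht)"
    proof -
      have "F = (\<lambda>x. Ft x + (\<Sum>P\<in>W. osc F P x))" by (simp add: Ft_def)
      then have "bf F Ht = bf (\<lambda>x. Ft x + (\<Sum>P\<in>W. osc F P x)) Ht" by simp
      then show ?thesis using finW by (simp add: bf_add_left bf_sum_left)
    qed
    moreover have "(\<Sum>R\<in>W. bf (osc F R) Ht) = ?E5 + (\<Sum>R\<in>W. bf (osc F R) (restr Ht (?N R)))"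
    proof -
      have "bf (osc F R) Ht = bf (osc F R) (restr Ht (- ?N R)) + bf (osc F R) (restr Ht (?N R))" for R
      proof -
        have "Ht = (\<lambda>x. restr Ht (- ?N R) x + restr Ht (?N R) x)" by (auto simp: restr_def)
        then have "bf (osc F R) Ht = bf (osc F R) (\<lambda>x. restr Ht (- ?N R) x + restr Ht (?N R) x)" by simp
        then show ?thesis by (simp add: bf_add_right)
      qed
      then show ?thesis by (simp add: sum.distrib)
    qed
    \<comment> \<open>The remaining double sum runs over touching pairs \<open>(P, R)\<close>. By
      the symmetry of \<open>touch\<close> it can be collected over \<open>R\<close>, giving the
      mean part of \<open>H\<close> on the neighbourhood of \<open>R\<close>, or over
      \<open>P\<close>, giving the oscillations of \<open>F\<close> in the neighbourhood of
      \<open>P\<close>, that is, \<open>F\<close> minus its mean part there.\<close>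
    moreover have "(\<Sum>R\<in>W. bf (osc F R) (restr Ht (?N R)))
        = (\<Sum>P\<in>W. bf (restr F (?N P)) (restr Ht (dil 0 P))) - ?E4"
    proof -
      have "bf (restr F (?N P)) G = bf (restr Ft (?N P)) G + (\<Sum>R\<in>W. if touch P R then bf (osc F R) G else 0)" for P G
      proof -
        have "restr F (?N P) x = restr Ft (?N P) x + (\<Sum>R\<in>W. if touch P R then osc F R x else 0)" for x
        proof (cases "x \<in> (\<Union>P\<in>W. dil 0 P)")
          case True
          then obtain R where R: "R \<in> W" "x \<in> dil 0 R" by blast
          have "(\<Sum>R\<in>W. if touch P R then osc F R x else 0) = (\<Sum>R\<in>{R}. if touch P R then osc F R x else 0)"
          proof (rule sum.mono_neutral_right)
            show "\<forall>R'\<in>W - {R}. (if touch P R' then osc F R' x else 0) = 0"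
            proof
              fix R' assume "R' \<in> W - {R}"
              then have "x \<notin> dil 0 R'" using uniq[OF R(1) _ R(2), of R'] by blast
              then show "(if touch P R' then osc F R' x else 0) = 0" by (simp add: osc_def)
            qed
          qed (use finW R in simp_all)
          moreover have "x \<in> ?N P \<longleftrightarrow> touch P R" unfolding nb using R uniq by blast
          moreover have "Ft x = av F R" using on[OF R, of F] by (simp add: Ft_def)
          ultimately show ?thesis using R by (simp add: restr_def osc_def)
        next
          case False
          then have "(\<Sum>R\<in>W. if touch P R then osc F R x else 0) = 0"
            by (intro sum.neutral) (auto simp: osc_def)
          moreover have "x \<notin> ?N P" using False nb by blast
          ultimately show ?thesis by (simp add: restr_def)
        qed
        then have "restr F (?N P) = (\<lambda>x. restr Ft (?N P) x + (\<Sum>R\<in>W. if touch P R then osc F R x else 0))" by blast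
        then have "bf (restr F (?N P)) G = bf (\<lambda>x. restr Ft (?N P) x + (\<Sum>R\<in>W. if touch P R then osc F R x else 0)) G" by simp
        also have "\<dots> = bf (restr Ft (?N P)) G + (\<Sum>R\<in>W. bf (\<lambda>x. if touch P R then osc F R x else 0) G)"
          using finW by (simp add: bf_add_left bf_sum_left)
        also have "(\<Sum>R\<in>W. bf (\<lambda>x. if touch P R then osc F R x else 0) G) = (\<Sum>R\<in>W. if touch P R then bf (osc F R) G else 0)"
          by (rule sum.cong) auto
        finally show ?thesis .
      qed
      then have "(\<Sum>P\<in>W. bf (restr F (?N P)) (restr Ht (dil 0 P))) - ?E4
        = (\<Sum>P\<in>W. \<Sum>R\<in>W. if touch P R then bf (osc F R) (restr Ht (dil 0 P)) else 0)"
        by (simp add: sum.distrib)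
      also have "\<dots> = (\<Sum>R\<in>W. \<Sum>P\<in>W. if touch P R then bf (osc F R) (restr Ht (dil 0 P)) else 0)"
        by (rule sum.swap)
      also have "\<dots> = (\<Sum>R\<in>W. bf (osc F R) (restr Ht (?N R)))"
      proof (rule sum.cong[OF refl])
        fix R assume "R \<in> W"
        have "restr Ht (?N R) x = (\<Sum>P\<in>W. if touch P R then restr Ht (dil 0 P) x else 0)" for x
        proof (cases "x \<in> (\<Union>P\<in>W. dil 0 P)")
          case True
          then obtain P where P: "P \<in> W" "x \<in> dil 0 P" by blast
          have "(\<Sum>P\<in>W. if touch P R then restr Ht (dil 0 P) x else 0) = (\<Sum>P\<in>{P}. if touch P R then restr Ht (dil 0 P) x else 0)"
          proof (rule sum.mono_neutral_right)
            show "\<forall>P'\<in>W - {P}. (if touch P' R then restr Ht (dil 0 P') x else 0) = 0"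
            proof
              fix P' assume "P' \<in> W - {P}"
              then have "x \<notin> dil 0 P'" using uniq[OF P(1) _ P(2), of P'] by blast
              then show "(if touch P' R then restr Ht (dil 0 P') x else 0) = 0" by (simp add: restr_def)
            qed
          qed (use finW P in simp_all)
          moreover have "x \<in> ?N R \<longleftrightarrow> touch P R" unfolding nb using P uniq touch_sym by blast
          ultimately show ?thesis using P by (simp add: restr_def)
        next
          case False
          then have "(\<Sum>P\<in>W. if touch P R then restr Ht (dil 0 P) x else 0) = 0"
            by (intro sum.neutral) (auto simp: restr_def)
          moreover have "x \<notin> ?N R" using False nb by blast
          ultimately show ?thesis by (simp add: restr_def)
        qed
        then have "restr Ht (?N R) = (\<lambda>x. \<Sum>P\<in>W. if touch P R then restr Ht (dil 0 P) x else 0)" by blast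
        then have "bf (osc F R) (restr Ht (?N R)) = (\<Sum>P\<in>W. bf (osc F R) (\<lambda>x. if touch P R then restr Ht (dil 0 P) x else 0))"
          using finW by (simp add: bf_sum_right)
        also have "\<dots> = (\<Sum>P\<in>W. if touch P R then bf (osc F R) (restr Ht (dil 0 P)) else 0)"
          by (rule sum.cong) auto
        finally show "(\<Sum>P\<in>W. if touch P R then bf (osc F R) (restr Ht (dil 0 P)) else 0) = bf (osc F R) (restr Ht (?N R))" by simp
      qed
      finally show ?thesis by simp
    qed
    moreover have "(\<Sum>P\<in>W. bf (restr F (?N P)) (osc H P)) + (\<Sum>P\<in>W. bf (restr F (?N P)) (restr Ht (dil 0 P)))
        = (\<Sum>P\<in>W. bf (restr F (dil 1 P)) (restr H (dil 0 P))) + ?E1"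
      unfolding sum.distrib[symmetric] by (rule sum.cong) (auto simp: dec_H bf_diff_left)
    ultimately show ?thesis by (simp add: algebra_simps)
  qed

  have E1: "norm ?E1 \<le> 4 ^ ?n * B * p * asum H U"
  proof -
    have "norm (bf (\<lambda>x. restr F (?N P) x - restr F (dil 1 P) x) (restr H (dil 0 P))) \<le> 4 ^ ?n * B * p * asum H (dil 0 P)"
      if P: "P \<in> W" for P
    proof -
      let ?G = "\<lambda>x. restr F (?N P) x - restr F (dil 1 P) x"
      have PS: "P \<in> stopping Om" using P by (simp add: W_def)
      have sub: "?N P \<subseteq> dil 1 (anc 1 P)" "dil 1 P \<subseteq> dil 1 (anc 1 P)"
        by (rule nbhd_sub[OF PS], rule dil_anc)
      have "norm (bf ?G (restr H (dil 0 P))) \<le> (2 ^ ?n * B / 2 ^ (fst P * ?n)) * asum ?G U * asum (restr H (dil 0 P)) U"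
      proof (rule bf_size)
        fix x y assume "?G y \<noteq> 0" "restr H (dil 0 P) x \<noteq> 0"
        then have x: "x \<in> dil 0 P" and y: "y \<notin> ?N P \<or> y \<notin> dil 1 P" by (auto simp: restr_def split: if_splits)
        show "norm (\<kappa> x y) \<le> 2 ^ ?n * B / 2 ^ (fst P * ?n)"
        proof (cases "fst P")
          case 0
          then show ?thesis using bounded[of x y] mult_right_mono[of 1 "2 ^ ?n" B] B_nonneg by simp
        next
          case (Suc i)
          \<comment> \<open>The neighbourhood and the triple both contain every point that is near a
            point of \<open>P\<close> one level down, so where they differ the kernel is controlled
            by \<open>size\<close>.\<close>
          have "\<not> near i x y"
          proof
            assume a: "near i x y"
            from y show False
            proof
              assume "y \<notin> ?N P" then show False
                using not_nbhd_far(2)[OF Om PS _ x, of y] a Suc near_sym by auto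
            next
              have "near (fst P) y x" using near_mono[OF near_sym[OF a]] Suc by simp
              then have "y \<in> dil 1 P" using mem_dil1_iff[OF x, of y] by simp
              moreover assume "y \<notin> dil 1 P"
              ultimately show False by simp
            qed
          qed
          from size[OF this] show ?thesis using Suc by (simp add: power_add)
        qed
      qed (use B_nonneg in simp)
      also have "\<dots> \<le> (2 ^ ?n * B / 2 ^ (fst P * ?n)) * (p * 2 ^ ((fst P + 1) * ?n)) * asum H (dil 0 P)"
      proof (intro mult_mono)
        have "asum ?G U \<le> asum F (dil 1 (anc 1 P))"
        proof -
          have "asum ?G U = asum ?G (U \<inter> dil 1 (anc 1 P))"
            unfolding asum_def by (rule sum.mono_neutral_right) (use finite_U sub in \<open>auto simp: restr_def\<close>)
          also have "\<dots> \<le> asum F (U \<inter> dil 1 (anc 1 P))"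
            unfolding asum_def by (rule sum_mono) (auto simp: restr_def)
          also have "\<dots> \<le> asum F (dil 1 (anc 1 P))" by (rule asum_mono) auto
          finally show ?thesis .
        qed
        then show "asum ?G U \<le> p * 2 ^ ((fst P + 1) * ?n)" using avF[OF P, of 1] by simp
        have "asum (restr H (dil 0 P)) U = asum (restr H (dil 0 P)) (U \<inter> dil 0 P)"
            unfolding asum_def by (rule sum.mono_neutral_right) (use finite_U in \<open>auto simp: restr_def\<close>)
        also have "\<dots> \<le> asum H (dil 0 P)" using asum_mono[of "dil 0 P" "U \<inter> dil 0 P" H]
          by (simp add: asum_def restr_def)
        finally show "asum (restr H (dil 0 P)) U \<le> asum H (dil 0 P)" .
      qed (use B_nonneg p0 in auto)
      also have "\<dots> = (2 * 2) ^ ?n * B * p * asum H (dil 0 P)"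
        unfolding power_mult_distrib by (simp add: power_add field_simps)
      finally show ?thesis by simp
    qed
    then have "norm ?E1 \<le> (\<Sum>P\<in>W. 4 ^ ?n * B * p * asum H (dil 0 P))"
      by (rule order_trans[OF norm_sum sum_mono])
    also have "\<dots> \<le> 4 ^ ?n * B * p * asum H U"
      unfolding sum_distrib_left[symmetric] using asum_disj[of H] B_nonneg p0 by (intro mult_left_mono) auto
    finally show ?thesis .
  qed

  have E2: "norm ?E2 \<le> 8 * 2 ^ ?n * B * p * asum H U"
  proof -
    have "norm (bf (restr F (- ?N P)) (osc H P)) \<le> 8 * 2 ^ ?n * B * p * asum H (dil 0 P)"
      if P: "P \<in> W" for P
    proof (cases "dil 0 P \<subseteq> U")
      case False
      then have "osc H P x = 0" for x using loc[OF P] by (auto simp: osc_def av_def)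
      then have "osc H P = (\<lambda>x. 0)" by blast
      then show ?thesis using B_nonneg p0 by simp
    next
      case True
      have PS: "P \<in> stopping Om" using P by (simp add: W_def)
      \<comment> \<open>The function of mean zero now stands in the second argument, hence the
        transposed kernel.\<close>
      have "norm (bf (restr F (- ?N P)) (osc H P)) \<le> 2 ^ (?n + 2) * B * p * asum (osc H P) (dil 0 P)"
        unfolding bf_transposed[symmetric]
      proof (rule dyadic_kernel.bf_far[OF transposed])
        show "dil 0 P \<subseteq> U" by fact
        show "(\<Sum>y\<in>dil 0 P. osc H P y) = 0" by (rule sum_osc)
        show "osc H P y = 0" if "y \<notin> dil 0 P" for y using that by (simp add: osc_def)
        show "asum (restr F (- ?N P)) (dil 1 (anc m P)) \<le> p * 2 ^ ((fst P + m) * ?n)" for m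
        proof -
          have "asum (restr F (- ?N P)) (dil 1 (anc m P)) \<le> asum F (dil 1 (anc m P))"
            unfolding asum_def by (rule sum_mono) (simp add: restr_def)
          from this avF[OF P] show ?thesis by (rule order_trans)
        qed
        fix x y assume "restr F (- ?N P) x \<noteq> 0" "y \<in> dil 0 P"
        then have "x \<notin> ?N P" by (simp add: restr_def split: if_splits)
        then show "x \<noteq> y \<and> (fst P > 0 \<longrightarrow> \<not> near (fst P - 1) x y)"
          using not_nbhd_far[OF Om PS _ \<open>y \<in> dil 0 P\<close>] by blast
      qed
      also have "\<dots> \<le> 2 ^ (?n + 2) * B * p * (2 * asum H (dil 0 P))"
        using B_nonneg p0 asum_osc by (intro mult_left_mono) auto
      finally show ?thesis by (simp add: mult_ac)
    qed
    then have "norm ?E2 \<le> (\<Sum>P\<in>W. 8 * 2 ^ ?n * B * p * asum H (dil 0 P))"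
      by (rule order_trans[OF norm_sum sum_mono])
    also have "\<dots> \<le> 8 * 2 ^ ?n * B * p * asum H U"
      unfolding sum_distrib_left[symmetric] using asum_disj[of H] B_nonneg p0 by (intro mult_left_mono) auto
    finally show ?thesis .
  qed

  have E3: "norm ?E3 \<le> B * (p * asum H U + r * asum F U)"
  proof -
    let ?a = "r * asum F U" and ?b = "p * asum H U"
    have "norm ?E3 \<le> B * sqrt (\<Sum>x\<in>U. (norm (Ft x))\<^sup>2) * sqrt (\<Sum>x\<in>U. (norm (Ht x))\<^sup>2)" by (rule bf_L2)
    also have "\<dots> \<le> B * sqrt (p * asum F U) * sqrt (r * asum H U)"
    proof (intro mult_mono real_sqrt_le_mono)
      have "asum Ft U \<le> asum F U" using asum_t[of F] by (simp add: Ft_def)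
      then show "(\<Sum>x\<in>U. (norm (Ft x))\<^sup>2) \<le> p * asum F U"
        by (rule order_trans[OF sq_le[of Ft p, OF Ft_le] mult_left_mono[OF _ p0]])
      have "asum Ht U \<le> asum H U" using asum_t[of H] by (simp add: Ht_def)
      then show "(\<Sum>x\<in>U. (norm (Ht x))\<^sup>2) \<le> r * asum H U"
        by (rule order_trans[OF sq_le[of Ht r, OF Ht_le] mult_left_mono[OF _ r0]])
    qed (use B_nonneg p0 in \<open>auto intro!: mult_nonneg_nonneg sum_nonneg\<close>)
    \<comment> \<open>Regrouping pairs \<open>r\<close> with \<open>F\<close> and \<open>p\<close>
      with \<open>H\<close>. The inequality between geometric and arithmetic mean then gives the
      same two quantities as in the other errors.\<close>
    also have "\<dots> = B * sqrt (?a * ?b)" by (simp add: real_sqrt_mult[symmetric] mult_ac)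
    also have "\<dots> \<le> B * (?b + ?a)"
    proof (rule mult_left_mono[OF _ B_nonneg])
      have "sqrt (?a * ?b) \<le> (?a + ?b) / 2" by (rule arith_geo_mean_sqrt) (use p0 r0 in auto)
      moreover have "0 \<le> ?a" "0 \<le> ?b" using p0 r0 by auto
      ultimately show "sqrt (?a * ?b) \<le> ?b + ?a" by (rule le_sum_if_le_mean)
    qed
    finally show ?thesis .
  qed

  have E4: "norm ?E4 \<le> 6 ^ ?n * B * (p * r) * (\<Sum>P\<in>W. 2 ^ (fst P * ?n))"
  proof -
    have card1: "card (dil 1 (anc 1 P)) = 6 ^ ?n * 2 ^ (fst P * ?n)" for P :: "nat \<times> ('n \<Rightarrow> int)"
    proof -
      have "card (dil 1 (anc 1 P)) = (3 * 2) ^ ?n * 2 ^ (fst P * ?n)"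
        unfolding power_mult_distrib by (simp add: card_dil power_add)
      then show ?thesis by simp
    qed
    have cutb: "(\<Sum>x\<in>U. (norm (restr G X x))\<^sup>2) \<le> real (card Y) * c\<^sup>2"
      if "\<And>x. norm (G x) \<le> c" "X \<subseteq> Y" "finite Y" for G c X Y
    proof -
      have "(\<Sum>x\<in>U. (norm (restr G X x))\<^sup>2) = (\<Sum>x\<in>U \<inter> Y. (norm (restr G X x))\<^sup>2)"
        by (rule sum.mono_neutral_right) (use finite_U that in \<open>auto simp: restr_def\<close>)
      also have "\<dots> \<le> (\<Sum>x\<in>U \<inter> Y. c\<^sup>2)"
        by (rule sum_mono) (use that(1) order_trans[OF norm_ge_zero that(1)] in \<open>auto simp: restr_def intro!: power_mono\<close>)
      also have "\<dots> \<le> real (card Y) * c\<^sup>2"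
        using card_mono[of Y "U \<inter> Y"] that by (simp add: mult_right_mono)
      finally show ?thesis .
    qed
    have "norm (bf (restr Ft (?N P)) (restr Ht (dil 0 P))) \<le> 6 ^ ?n * B * (p * r) * 2 ^ (fst P * ?n)" if P: "P \<in> W" for P
    proof -
      have PS: "P \<in> stopping Om" using P by (simp add: W_def)
      let ?q = "2 ^ (fst P * ?n) :: real"
      have "norm (bf (restr Ft (?N P)) (restr Ht (dil 0 P)))
        \<le> B * sqrt (\<Sum>x\<in>U. (norm (restr Ft (?N P) x))\<^sup>2) * sqrt (\<Sum>x\<in>U. (norm (restr Ht (dil 0 P) x))\<^sup>2)" by (rule bf_L2)
      also have "\<dots> \<le> B * sqrt (6 ^ ?n * ?q * p\<^sup>2) * sqrt (?q * r\<^sup>2)"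
      proof (intro mult_mono real_sqrt_le_mono)
        show "(\<Sum>x\<in>U. (norm (restr Ft (?N P) x))\<^sup>2) \<le> 6 ^ ?n * ?q * p\<^sup>2"
          using cutb[of Ft p "?N P" "dil 1 (anc 1 P)"] Ft_le nbhd_sub[OF PS] by (simp add: card1 del: One_nat_def)
        show "(\<Sum>x\<in>U. (norm (restr Ht (dil 0 P) x))\<^sup>2) \<le> ?q * r\<^sup>2"
          using cutb[of Ht r "dil 0 P" "dil 0 P"] Ht_le by (simp add: card_dil0)
      qed (use B_nonneg in \<open>auto intro!: mult_nonneg_nonneg sum_nonneg\<close>)
      also have "\<dots> = B * (sqrt (6 ^ ?n) * (sqrt ?q * sqrt ?q) * p * r)"
        using p0 r0 by (simp add: real_sqrt_mult mult_ac)
      also have "\<dots> \<le> B * (6 ^ ?n * ?q * p * r)"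
      proof -
        have "sqrt (6 ^ ?n) \<le> (6::real) ^ ?n"
          by (rule real_le_lsqrt) (auto simp: power2_eq_square mult_le_cancel_left1)
        then show ?thesis using B_nonneg p0 r0 by (simp add: mult_left_mono mult_right_mono)
      qed
      finally show ?thesis by (simp add: mult_ac)
    qed
    then have "norm ?E4 \<le> (\<Sum>P\<in>W. 6 ^ ?n * B * (p * r) * 2 ^ (fst P * ?n))"
      by (rule order_trans[OF norm_sum sum_mono])
    then show ?thesis by (simp add: sum_distrib_left)
  qed

  have E5: "norm ?E5 \<le> 8 * 6 ^ ?n * B * r * asum F U"
  proof -
    have "norm (bf (osc F P) (restr Ht (- ?N P))) \<le> 8 * 6 ^ ?n * B * r * asum F (dil 0 P)"
      if P: "P \<in> W" for P
    proof (cases "dil 0 P \<subseteq> U")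
      case False
      then have "osc F P x = 0" for x using loc[OF P] by (auto simp: osc_def av_def)
      then have "osc F P = (\<lambda>x. 0)" by blast
      then show ?thesis using B_nonneg r0 by simp
    next
      case True
      have PS: "P \<in> stopping Om" using P by (simp add: W_def)
      have "norm (bf (osc F P) (restr Ht (- ?N P))) \<le> 2 ^ (?n + 2) * B * (3 ^ ?n * r) * asum (osc F P) (dil 0 P)"
      proof (rule bf_far)
        show "dil 0 P \<subseteq> U" by fact
        show "(\<Sum>y\<in>dil 0 P. osc F P y) = 0" by (rule sum_osc)
        show "osc F P y = 0" if "y \<notin> dil 0 P" for y using that by (simp add: osc_def)
        show "asum (restr Ht (- ?N P)) (dil 1 (anc m P)) \<le> 3 ^ ?n * r * 2 ^ ((fst P + m) * ?n)" for m
        proof -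
          have "asum (restr Ht (- ?N P)) (dil 1 (anc m P)) \<le> (\<Sum>x\<in>dil 1 (anc m P). r)"
            unfolding asum_def by (rule sum_mono) (use Ht_le r0 in \<open>simp add: restr_def\<close>)
          then show ?thesis by (simp add: card_dil mult_ac)
        qed
        fix x y assume "restr Ht (- ?N P) x \<noteq> 0" "y \<in> dil 0 P"
        then have "x \<notin> ?N P" by (simp add: restr_def split: if_splits)
        then show "x \<noteq> y \<and> (fst P > 0 \<longrightarrow> \<not> near (fst P - 1) x y)"
          using not_nbhd_far[OF Om PS _ \<open>y \<in> dil 0 P\<close>] by blast
      qed
      also have "\<dots> \<le> 2 ^ (?n + 2) * B * (3 ^ ?n * r) * (2 * asum F (dil 0 P))"
        using B_nonneg r0 asum_osc by (intro mult_left_mono) auto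
      also have "\<dots> = 8 * (2 * 3) ^ ?n * B * r * asum F (dil 0 P)"
        unfolding power_mult_distrib by (simp add: mult_ac)
      finally show ?thesis by simp
    qed
    then have "norm ?E5 \<le> (\<Sum>P\<in>W. 8 * 6 ^ ?n * B * r * asum F (dil 0 P))"
      by (rule order_trans[OF norm_sum sum_mono])
    also have "\<dots> \<le> 8 * 6 ^ ?n * B * r * asum F U"
      unfolding sum_distrib_left[symmetric] using asum_disj[of F] B_nonneg r0 by (intro mult_left_mono) auto
    finally show ?thesis .
  qed

  define a where "a = B * (p * asum H U)"
  define b where "b = B * (r * asum F U)"
  define c where "c = B * (p * r) * (\<Sum>P\<in>W. 2 ^ (fst P * ?n))"
  define K where "K = (6::real) ^ ?n"
  have abc: "0 \<le> a" "0 \<le> b" "0 \<le> c"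
    using B_nonneg p0 r0 by (auto simp: a_def b_def c_def intro!: mult_nonneg_nonneg sum_nonneg)
  have K: "1 \<le> K" "4 ^ ?n \<le> K" "2 ^ ?n \<le> K" unfolding K_def by (auto intro: power_mono)
  have "norm (?E1 + ?E2 + ?E3 - ?E4 + ?E5) \<le> norm ?E1 + norm ?E2 + norm ?E3 + norm ?E4 + norm ?E5"
    by (intro order_trans[OF norm_triangle_ineq] add_mono order_trans[OF norm_triangle_ineq4] order_refl norm_triangle_ineq)
  also have "\<dots> \<le> K * a + 8 * K * a + (K * a + K * b) + K * c + 8 * K * b"
  proof (intro add_mono)
    show "norm ?E1 \<le> K * a" using E1 mult_right_mono[OF K(2) abc(1)] by (simp add: a_def mult_ac)
    show "norm ?E2 \<le> 8 * K * a" using E2 mult_right_mono[OF K(3) abc(1)] by (simp add: a_def mult_ac)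
    show "norm ?E3 \<le> K * a + K * b"
      using E3 mult_right_mono[OF K(1) abc(1)] mult_right_mono[OF K(1) abc(2)]
      by (simp add: a_def b_def distrib_left)
    show "norm ?E4 \<le> K * c" using E4 by (simp add: c_def K_def mult_ac)
    show "norm ?E5 \<le> 8 * K * b" using E5 by (simp add: b_def K_def mult_ac)
  qed
  also have "\<dots> \<le> 10 * K * (a + b + c)"
  proof -
    have "0 \<le> K * a" "0 \<le> K * b" "0 \<le> K * c" using K abc by auto
    then show ?thesis by (simp add: algebra_simps)
  qed
  also have "\<dots> = 10 * 6 ^ ?n * B * (p * asum H U + r * asum F U + p * r * (\<Sum>P\<in>W. 2 ^ (fst P * ?n)))"
    by (simp add: a_def b_def c_def K_def algebra_simps)
  finally show ?thesis unfolding main .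
qed

end

section \<open>One stopping step and its iteration to a sparse bound\<close>

context dyadic_kernel begin

lemma mem_dil_same:
  assumes "x \<in> dil 0 P" "y \<in> dil 0 P" "fst P \<le> fst Q" "x \<in> dil c Q" shows "y \<in> dil c Q"
proof -
  have "cube_at (fst P) x = cube_at (fst P) y" using assms(1,2) by (metis mem_dil0_iff)
  then have "cube_at (fst Q) x = cube_at (fst Q) y" using assms(3) cube_at_mono by blast
  then have "x k div 2 ^ fst Q = y k div 2 ^ fst Q" for k by (auto simp: cube_at_def fun_eq_iff)
  then show ?thesis using assms(4) by (auto simp: dil_def)
qed

lemma dil_subset_anc:
  assumes "dil 0 P \<subseteq> dil 0 Q" shows "fst P \<le> fst Q" "Q = anc (fst Q - fst P) P"
proof -
  have "(2::nat) ^ (fst P * CARD('n)) \<le> 2 ^ (fst Q * CARD('n))"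
    using card_mono[OF _ assms] by (simp add: card_dil)
  then show le: "fst P \<le> fst Q" by simp
  have "card (dil 0 P) > 0" by (simp add: card_dil)
  then obtain x where "x \<in> dil 0 P" by (metis all_not_in_conv card.empty less_irrefl)
  then show "Q = anc (fst Q - fst P) P" using assms le dil_laminar by blast
qed

lemma card_disjoint_family:
  assumes "finite W" "\<And>P R x. P \<in> W \<Longrightarrow> R \<in> W \<Longrightarrow> x \<in> dil 0 P \<Longrightarrow> x \<in> dil 0 R \<Longrightarrow> P = R"
    "\<And>P. P \<in> W \<Longrightarrow> dil 0 P \<inter> Y \<subseteq> X" "finite X"
  shows "(\<Sum>P\<in>W. card (dil 0 P \<inter> Y)) \<le> card X"
proof -
  have "(\<Sum>P\<in>W. card (dil 0 P \<inter> Y)) = card (\<Union>P\<in>W. dil 0 P \<inter> Y)"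
  proof (rule card_UN_disjoint[symmetric])
    show "\<forall>i\<in>W. \<forall>j\<in>W. i \<noteq> j \<longrightarrow> dil 0 i \<inter> Y \<inter> (dil 0 j \<inter> Y) = {}" using assms(2) by blast
  qed (use assms in auto)
  also have "\<dots> \<le> card X" using assms(3,4) by (intro card_mono UN_least)
  finally show ?thesis .
qed

text \<open>With \<open>a = 6 ^ n * (4 * 5 ^ n)\<close>, the thresholds fed into
  \<open>step_estimate\<close> are \<open>a\<close> times the sums of \<open>F\<close> and
  \<open>H\<close> divided by the number of points of \<open>Q\<close>. Its three terms then
  contribute \<open>a\<close>, \<open>a\<close> and \<open>a ^ 2\<close>.\<close>

definition Cst :: real where
  "Cst = 10 * 6 ^ CARD('n) * (2 * (6 ^ CARD('n) * (4 * 5 ^ CARD('n))) + (6 ^ CARD('n) * (4 * 5 ^ CARD('n)))\<^sup>2)"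

lemma Cst_pos: "0 < Cst" unfolding Cst_def by (intro mult_pos_pos add_pos_nonneg) auto

text \<open>\<open>Om\<close> is the union of the dilates \<open>dil 2\<close> of all cubes on which
  an average exceeds \<open>A\<close> times the overall mean. It has at most half as many points as
  \<open>Q\<close>, which gives the packing bound for the stopping cubes, and
  \<open>stopping_parent_far\<close> controls all averages that \<open>step_estimate\<close> asks
  for.\<close>

lemma one_step:
  assumes U: "dil 1 Q \<subseteq> U"
    and F0: "\<And>x. x \<notin> dil 1 Q \<Longrightarrow> F x = 0" and H0: "\<And>x. x \<notin> dil 0 Q \<Longrightarrow> H x = 0"
  obtains W where "finite W" "\<And>P. P \<in> W \<Longrightarrow> dil 0 P \<subseteq> dil 0 Q \<and> fst P < fst Q"
    "\<And>P R x. P \<in> W \<Longrightarrow> R \<in> W \<Longrightarrow> x \<in> dil 0 P \<Longrightarrow> x \<in> dil 0 R \<Longrightarrow> P = R"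
    "2 * (\<Sum>P\<in>W. 2 ^ (fst P * CARD('n))) \<le> (2 ^ (fst Q * CARD('n)) :: nat)"
    "norm (bf F H - (\<Sum>P\<in>W. bf (restr F (dil 1 P)) (restr H (dil 0 P))))
       \<le> Cst * B * (asum F (dil 1 Q) * asum H (dil 0 Q) / 2 ^ (fst Q * CARD('n)))"
proof (cases "asum F (dil 1 Q) = 0 \<or> asum H (dil 0 Q) = 0")
  case True
  have "bf F H = 0"
  proof -
    have "(\<forall>x. F x = 0) \<or> (\<forall>x. H x = 0)"
      using True F0 H0 unfolding asum_def by (subst (asm) (1 2) sum_nonneg_eq_0_iff) auto
    then have "F = (\<lambda>_. 0) \<or> H = (\<lambda>_. 0)" by blast
    then show ?thesis by auto
  qed
  then show ?thesis using that[of "{}"] Cst_pos B_nonneg by simp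
next
  case False
  let ?n = "CARD('n)"
  let ?q = "2 ^ (fst Q * CARD('n)) :: real"
  let ?SF = "asum F (dil 1 Q)" and ?SH = "asum H (dil 0 Q)"
  \<comment> \<open>The factor \<open>5 ^ n\<close> pays for passing from a bad cube to its dilate
    \<open>dil 2\<close>, one factor 2 for having two functions, and the other makes
    \<open>Om\<close> at most half as large as \<open>Q\<close>.\<close>
  define A where "A = 4 * (5::real) ^ ?n"
  define p where "p = A * ?SF / ?q"
  define r where "r = A * ?SH / ?q"
  have A1: "1 \<le> A" unfolding A_def using one_le_power[of "5::real" ?n] by linarith
  have SF: "0 < ?SF" and SH: "0 < ?SH" using False by (auto simp: less_le)
  have pr: "0 < p" "0 < r" unfolding p_def r_def using A1 SF SH by auto
  define bad where "bad = {R. asum F (dil 0 R) > p * 2 ^ (fst R * ?n) \<or> asum H (dil 0 R) > r * 2 ^ (fst R * ?n)}"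
  have F0': "F x = 0" "H x = 0" if "x \<notin> U" for x
    using that U F0[of x] H0[of x] dil_mono[of 0 1 Q] by auto
  have totF: "asum F X \<le> ?SF" if "finite X" for X
  proof -
    have "asum F X = asum F (X \<inter> dil 1 Q)" unfolding asum_def
      by (rule sum.mono_neutral_right) (use that F0 in auto)
    also have "\<dots> \<le> ?SF" by (rule asum_mono) auto
    finally show ?thesis .
  qed
  have totH: "asum H X \<le> ?SH" if "finite X" for X
  proof -
    have "asum H X = asum H (X \<inter> dil 0 Q)" unfolding asum_def
      by (rule sum.mono_neutral_right) (use that H0 in auto)
    also have "\<dots> \<le> ?SH" by (rule asum_mono) auto
    finally show ?thesis .
  qed
  have UF: "asum F U = ?SF" unfolding asum_def
    by (rule sum.mono_neutral_right) (use finite_U U F0 in auto)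
  have UH: "asum H U = ?SH" unfolding asum_def
    by (rule sum.mono_neutral_right) (use finite_U U H0 dil_mono[of 0 1 Q] in auto)
  have bad_level: "fst R < fst Q" if "R \<in> bad" for R
  proof (rule ccontr)
    assume "\<not> fst R < fst Q"
    then have q: "?q \<le> 2 ^ (fst R * ?n)" by (intro power_increasing) auto
    have "?SF \<le> p * 2 ^ (fst R * ?n)" "?SH \<le> r * 2 ^ (fst R * ?n)"
    proof -
      have "?SF \<le> A * ?SF" "?SH \<le> A * ?SH" using A1 SF SH by (simp_all add: mult_le_cancel_right1)
      moreover have "A * ?SF = p * ?q" "A * ?SH = r * ?q" by (simp_all add: p_def r_def)
      moreover have "p * ?q \<le> p * 2 ^ (fst R * ?n)" "r * ?q \<le> r * 2 ^ (fst R * ?n)"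
        using q pr by (simp_all add: mult_left_mono)
      ultimately show "?SF \<le> p * 2 ^ (fst R * ?n)" "?SH \<le> r * 2 ^ (fst R * ?n)" by linarith+
    qed
    then show False using that totF[of "dil 0 R"] totH[of "dil 0 R"] by (auto simp: bad_def)
  qed
  have bad_meets: "\<exists>x\<in>U. x \<in> dil 0 R" if "R \<in> bad" for R
  proof (rule ccontr)
    assume "\<not> (\<exists>x\<in>U. x \<in> dil 0 R)"
    then have "\<And>x. x \<in> dil 0 R \<Longrightarrow> F x = 0 \<and> H x = 0" using F0' by blast
    then have "asum F (dil 0 R) = 0" "asum H (dil 0 R) = 0" by (simp_all add: asum_def)
    then show False using that pr by (auto simp: bad_def mult_less_0_iff)
  qed
  have fin_bad: "finite bad"
  proof (rule finite_subset)
    show "bad \<subseteq> (\<lambda>(j, x). cube_at j x) ` ({..<fst Q} \<times> U)"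
    proof
      fix R assume R: "R \<in> bad"
      then obtain x where "x \<in> U" "x \<in> dil 0 R" using bad_meets by blast
      then show "R \<in> (\<lambda>(j, x). cube_at j x) ` ({..<fst Q} \<times> U)"
        using bad_level[OF R] by (intro image_eqI[of _ _ "(fst R, x)"]) (auto simp: mem_dil0_iff)
    qed
  qed (use finite_U in auto)
  define Om where "Om = (\<Union>R\<in>bad. dil 2 R)"
  have finOm: "finite Om" unfolding Om_def using fin_bad by auto
  define M where "M = {R\<in>bad. \<forall>m>0. anc m R \<notin> bad}"
  have finM: "finite M" unfolding M_def using fin_bad by auto
  have M_ex: "\<exists>m. anc m R \<in> M" if R: "R \<in> bad" for R
  proof -
    define m where "m = (GREATEST m. anc m R \<in> bad)"
    have b: "\<forall>m. anc m R \<in> bad \<longrightarrow> m \<le> fst Q" using bad_level by fastforce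
    have "anc m R \<in> bad" unfolding m_def
      by (rule GreatestI_nat[where k = 0 and b = "fst Q"]) (use b R in auto)
    moreover have "anc k (anc m R) \<notin> bad" if "k > 0" for k
    proof
      assume "anc k (anc m R) \<in> bad"
      then have "m + k \<le> m" unfolding m_def using b by (intro Greatest_le_nat) auto
      then show False using that by simp
    qed
    ultimately show ?thesis unfolding M_def by blast
  qed
  have M_disj: "P = R" if "P \<in> M" "R \<in> M" "x \<in> dil 0 P" "x \<in> dil 0 R" for P R x
  proof -
    have *: "\<not> fst P < fst R" if "P \<in> M" "R \<in> M" "x \<in> dil 0 P" "x \<in> dil 0 R" for P R
    proof
      assume "fst P < fst R"
      then have "R = anc (fst R - fst P) P" "fst R - fst P > 0" using dil_laminar[OF that(3,4)] by auto
      then show False using that(1,2) unfolding M_def by (metis (mono_tags, lifting) mem_Collect_eq)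
    qed
    have "fst P = fst R" using *[of P R] *[of R P] that by simp
    then show ?thesis using dil_laminar[OF that(3,4)] by simp
  qed
  have cardOm: "2 * real (card Om) \<le> ?q"
  proof -
    have "Om \<subseteq> (\<Union>R\<in>M. dil 2 R)"
      unfolding Om_def using M_ex dil_anc by blast
    then have "card Om \<le> card (\<Union>R\<in>M. dil 2 R)" using finM by (intro card_mono) auto
    also have "\<dots> \<le> (\<Sum>R\<in>M. card (dil 2 R))" by (rule card_UN_le[OF finM])
    finally have "real (card Om) \<le> (\<Sum>R\<in>M. real (card (dil 2 R)))" by (simp flip: of_nat_sum)
    also have "\<dots> \<le> (\<Sum>R\<in>M. 5 ^ ?n * (asum F (dil 0 R) / p + asum H (dil 0 R) / r))"
    proof (rule sum_mono)
      fix R assume "R \<in> M"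
      then consider "p * 2 ^ (fst R * ?n) < asum F (dil 0 R)" | "r * 2 ^ (fst R * ?n) < asum H (dil 0 R)"
        by (auto simp: M_def bad_def)
      then have "2 ^ (fst R * ?n) \<le> asum F (dil 0 R) / p + asum H (dil 0 R) / r"
      proof cases
        case 1
        then have "2 ^ (fst R * ?n) \<le> asum F (dil 0 R) / p" using pr by (simp add: pos_le_divide_eq mult.commute)
        moreover have "0 \<le> asum H (dil 0 R) / r" using pr by simp
        ultimately show ?thesis by linarith
      next
        case 2
        then have "2 ^ (fst R * ?n) \<le> asum H (dil 0 R) / r" using pr by (simp add: pos_le_divide_eq mult.commute)
        moreover have "0 \<le> asum F (dil 0 R) / p" using pr by simp
        ultimately show ?thesis by linarith
      qed
      then show "real (card (dil 2 R)) \<le> 5 ^ ?n * (asum F (dil 0 R) / p + asum H (dil 0 R) / r)"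
        by (simp add: card_dil)
    qed
    also have "\<dots> = 5 ^ ?n * ((\<Sum>R\<in>M. asum F (dil 0 R)) / p + (\<Sum>R\<in>M. asum H (dil 0 R)) / r)"
      by (simp add: sum_distrib_left[symmetric] sum.distrib sum_divide_distrib)
    also have "\<dots> \<le> 5 ^ ?n * (?SF / p + ?SH / r)"
    proof -
      have "(\<Sum>R\<in>M. asum G (dil 0 R)) = asum G (\<Union>R\<in>M. dil 0 R)" for G
        unfolding asum_def by (rule sum.UNION_disjoint[symmetric]) (use finM M_disj in auto)
      then have "(\<Sum>R\<in>M. asum F (dil 0 R)) \<le> ?SF" "(\<Sum>R\<in>M. asum H (dil 0 R)) \<le> ?SH"
        using totF totH finM by simp_all
      then show ?thesis using pr by (intro mult_left_mono add_mono divide_right_mono) auto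
    qed
    also have "\<dots> = 5 ^ ?n * (2 * (?q / A))"
    proof -
      have "?SF / p = ?q / A" "?SH / r = ?q / A" using SF SH A1 by (simp_all add: p_def r_def)
      then show ?thesis by simp
    qed
    also have "\<dots> = ?q / 2" by (simp add: A_def)
    finally show ?thesis by simp
  qed
  \<comment> \<open>For \<open>m > 0\<close> the triple splits into \<open>3 ^ n\<close> cubes of
    its own level, none of which is bad. For \<open>m = 0\<close> it is enlarged to the triple of
    the parent, which costs another \<open>2 ^ n\<close>.\<close>
  have nb_le: "asum F (dil 1 (anc m P)) \<le> 6 ^ ?n * p * 2 ^ ((fst P + m) * ?n)"
      "asum H (dil 1 (anc m P)) \<le> 6 ^ ?n * r * 2 ^ ((fst P + m) * ?n)" if P: "P \<in> stopping Om" for P m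
  proof -
    have big: "asum F (dil 1 (anc m P)) \<le> 3 ^ ?n * p * 2 ^ ((fst P + m) * ?n) \<and>
      asum H (dil 1 (anc m P)) \<le> 3 ^ ?n * r * 2 ^ ((fst P + m) * ?n)" if m: "0 < m" for m
    proof -
      let ?R = "anc m P"
      have part: "dil 1 ?R = (\<Union>b\<in>dil 1 (0, snd ?R). dil 0 (fst ?R, b))"
        using dil1_partition[of "fst ?R" "snd ?R"] by (simp del: fst_anc)
      have as: "asum G (dil 1 ?R) = (\<Sum>b\<in>dil 1 (0, snd ?R). asum G (dil 0 (fst ?R, b)))" for G
        unfolding asum_def part by (rule sum.UNION_disjoint) (auto dest: dil0_disjoint)
      have nbad: "(fst ?R, b) \<notin> bad" if "b \<in> dil 1 (0, snd ?R)" for b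
      proof
        assume "(fst ?R, b) \<in> bad"
        then have "dil 2 (fst ?R, b) \<subseteq> Om" unfolding Om_def by blast
        moreover have "dil 0 (fst ?R, b) \<subseteq> dil 1 ?R" using part that by blast
        ultimately show False using stopping_parent_far[OF P m, of "(fst ?R, b)"] by simp
      qed
      have c: "card (dil 1 (0::nat, snd ?R)) = 3 ^ ?n" by (simp add: card_dil)
      have "asum F (dil 1 ?R) \<le> (\<Sum>b\<in>dil 1 (0::nat, snd ?R). p * 2 ^ ((fst P + m) * ?n))"
        unfolding as by (rule sum_mono) (use nbad in \<open>force simp: bad_def\<close>)
      moreover have "asum H (dil 1 ?R) \<le> (\<Sum>b\<in>dil 1 (0::nat, snd ?R). r * 2 ^ ((fst P + m) * ?n))"
        unfolding as by (rule sum_mono) (use nbad in \<open>force simp: bad_def\<close>)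
      ultimately show ?thesis by (simp add: c mult_ac)
    qed
    have "asum F (dil 1 (anc m P)) \<le> 6 ^ ?n * p * 2 ^ ((fst P + m) * ?n) \<and>
      asum H (dil 1 (anc m P)) \<le> 6 ^ ?n * r * 2 ^ ((fst P + m) * ?n)"
    proof (cases "m = 0")
      case True
      have s: "asum G (dil 1 P) \<le> asum G (dil 1 (anc 1 P))" for G
        by (rule asum_mono[OF finite_dil dil_anc])
      have e: "3 ^ ?n * c * 2 ^ ((fst P + 1) * ?n) = 6 ^ ?n * c * 2 ^ (fst P * ?n)" for c :: real
      proof -
        have "3 ^ ?n * c * 2 ^ ((fst P + 1) * ?n) = (3 * 2) ^ ?n * c * 2 ^ (fst P * ?n)"
          unfolding power_mult_distrib by (simp add: power_add mult_ac)
        then show ?thesis by simp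
      qed
      show ?thesis using big[of 1] s[of F] s[of H] unfolding e True by simp
    next
      case False
      have "3 ^ ?n * c * 2 ^ ((fst P + m) * ?n) \<le> 6 ^ ?n * c * 2 ^ ((fst P + m) * ?n)" if "0 < c" for c :: real
        using that by (intro mult_right_mono power_mono) auto
      then show ?thesis using big[of m] False pr by (meson order_trans neq0_conv)
    qed
    then show "asum F (dil 1 (anc m P)) \<le> 6 ^ ?n * p * 2 ^ ((fst P + m) * ?n)"
      "asum H (dil 1 (anc m P)) \<le> 6 ^ ?n * r * 2 ^ ((fst P + m) * ?n)" by auto
  qed
  have lev: "fst P < fst Q" if "P \<in> stopping Om" for P
  proof -
    have "dil 0 P \<subseteq> Om" using that dil_mono[of 0 1 P] by (auto simp: stopping_def)
    then have "card (dil 0 P) \<le> card Om" using finOm by (intro card_mono)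
    then have "2 ^ (fst P * ?n) \<le> real (card Om)" by (simp add: card_dil0 flip: of_nat_le_iff)
    then have "2 * 2 ^ (fst P * ?n) \<le> ?q" using cardOm by linarith
    moreover have "(0::real) < 2 ^ (fst P * ?n)" by simp
    ultimately have "(2::real) ^ (fst P * ?n) < ?q" by linarith
    then show ?thesis by simp
  qed
  have loc1: "dil 0 P \<subseteq> dil c Q" if "P \<in> stopping Om" "x \<in> dil 0 P" "x \<in> dil c Q" for P x c
    using mem_dil_same[OF that(2) _ _ that(3)] lev[OF that(1)] by auto
  have free: "norm (F x) \<le> p \<and> norm (H x) \<le> r" if "x \<notin> (\<Union>P\<in>stopping Om. dil 0 P)" for x
  proof -
    have "\<not> dil 1 (cube_at 0 x) \<subseteq> Om"
    proof
      assume "dil 1 (cube_at 0 x) \<subseteq> Om"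
      then obtain m where "anc m (cube_at 0 x) \<in> stopping Om" using stopping_exists[OF finOm] by blast
      moreover have "x \<in> dil 0 (anc m (cube_at 0 x))" by simp
      ultimately show False using that by blast
    qed
    then have nb: "cube_at 0 x \<notin> bad" using dil_mono[of 1 2 "cube_at 0 x"] unfolding Om_def by auto
    have "dil 0 (cube_at 0 x) = {x}" by (auto simp: dil_def cube_at_def)
    then show ?thesis using nb by (auto simp: bad_def asum_def)
  qed
  have finW: "finite (stopping Om)" by (rule finite_stopping[OF finOm])
  have sumW: "2 * (\<Sum>P\<in>stopping Om. 2 ^ (fst P * ?n)) \<le> (2 ^ (fst Q * ?n) :: nat)"
  proof -
    have "(\<Sum>P\<in>stopping Om. card (dil 0 P \<inter> UNIV)) \<le> card Om"
    proof (rule card_disjoint_family[OF finW])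
      show "dil 0 P \<inter> UNIV \<subseteq> Om" if "P \<in> stopping Om" for P
        using that dil_mono[of 0 1 P] by (auto simp: stopping_def)
    qed (use finOm stopping_unique in blast)+
    then have "(\<Sum>P\<in>stopping Om. 2 ^ (fst P * ?n)) \<le> card Om" by (simp add: card_dil0)
    moreover have "real (2 * card Om) \<le> real (2 ^ (fst Q * ?n))" using cardOm by simp
    then have "2 * card Om \<le> 2 ^ (fst Q * ?n)" by (simp only: of_nat_le_iff)
    ultimately show ?thesis by linarith
  qed
  let ?W = "{P \<in> stopping Om. dil 0 P \<subseteq> dil 0 Q}"
  \<comment> \<open>A stopping cube has a smaller level than \<open>Q\<close>, so it lies in
    \<open>Q\<close> or is disjoint from it, and \<open>H\<close> vanishes outside
    \<open>Q\<close>.\<close>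
  have drop: "(\<Sum>P\<in>stopping Om. bf (restr F (dil 1 P)) (restr H (dil 0 P)))
      = (\<Sum>P\<in>?W. bf (restr F (dil 1 P)) (restr H (dil 0 P)))"
  proof (rule sum.mono_neutral_right[OF finW])
    show "\<forall>P\<in>stopping Om - ?W. bf (restr F (dil 1 P)) (restr H (dil 0 P)) = 0"
    proof
      fix P assume P: "P \<in> stopping Om - ?W"
      have "H x = 0" if x: "x \<in> dil 0 P" for x
      proof (rule H0, rule notI)
        assume "x \<in> dil 0 Q"
        then have "dil 0 P \<subseteq> dil 0 Q" using loc1 x P by blast
        then show False using P by blast
      qed
      then have "restr H (dil 0 P) = (\<lambda>_. 0)" by (auto simp: restr_def)
      then show "bf (restr F (dil 1 P)) (restr H (dil 0 P)) = 0" by simp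
    qed
  qed auto
  show ?thesis
  proof (rule that[of ?W])
    show "finite ?W" using finW by simp
    show "dil 0 P \<subseteq> dil 0 Q \<and> fst P < fst Q" if "P \<in> ?W" for P using that lev by auto
    show "P = R" if "P \<in> ?W" "R \<in> ?W" "x \<in> dil 0 P" "x \<in> dil 0 R" for P R x
      using that stopping_unique by blast
    have "(\<Sum>P\<in>?W. 2 ^ (fst P * ?n)) \<le> (\<Sum>P\<in>stopping Om. 2 ^ (fst P * ?n) :: nat)"
      by (rule sum_mono2[OF finW]) auto
    then show "2 * (\<Sum>P\<in>?W. 2 ^ (fst P * ?n)) \<le> (2 ^ (fst Q * ?n) :: nat)" using sumW by linarith
    let ?p = "6 ^ ?n * p" and ?r = "6 ^ ?n * r"
    have "norm (bf F H - (\<Sum>P\<in>stopping Om. bf (restr F (dil 1 P)) (restr H (dil 0 P))))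
      \<le> 10 * 6 ^ ?n * B * (?p * asum H U + ?r * asum F U + ?p * ?r * (\<Sum>P\<in>stopping Om. 2 ^ (fst P * ?n)))"
    proof (rule step_estimate[OF finOm])
      show "\<And>x. x \<notin> U \<Longrightarrow> F x = 0" "\<And>x. x \<notin> U \<Longrightarrow> H x = 0" by (rule F0', assumption)+
      show "dil 0 P \<subseteq> U \<or> (\<forall>x\<in>dil 0 P. F x = 0 \<and> H x = 0)" if P: "P \<in> stopping Om" for P
      proof (cases "\<exists>x\<in>dil 0 P. x \<in> dil 1 Q")
        case True
        then have "dil 0 P \<subseteq> dil 1 Q" using loc1[OF P] by blast
        then show ?thesis using U by blast
      next
        case False
        then have "F x = 0 \<and> H x = 0" if "x \<in> dil 0 P" for x
          using F0[of x] H0[of x] that dil_mono[of 0 1 Q] by auto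
        then show ?thesis by blast
      qed
      show "asum F (dil 1 (anc m P)) \<le> ?p * 2 ^ ((fst P + m) * ?n)" if "P \<in> stopping Om" for P m
        by (rule nb_le[OF that])
      show "asum H (dil 0 P) \<le> ?r * 2 ^ (fst P * ?n)" if "P \<in> stopping Om" for P
      proof -
        have "asum H (dil 0 P) \<le> asum H (dil 1 (anc 0 P))" by (rule asum_mono) (simp_all add: dil_mono)
        also have "\<dots> \<le> ?r * 2 ^ ((fst P + 0) * ?n)" by (rule nb_le(2)[OF that])
        finally show ?thesis by simp
      qed
      have six: "1 \<le> (6::real) ^ ?n" by simp
      have up: "p \<le> ?p" "r \<le> ?r" using six pr by (simp_all add: mult_le_cancel_right1)
      fix x assume "x \<notin> (\<Union>P\<in>stopping Om. dil 0 P)"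
      then show "norm (F x) \<le> ?p" "norm (H x) \<le> ?r" using free[of x] up by (auto intro: order_trans)
    qed (use pr in auto)
    also have "\<dots> \<le> 10 * 6 ^ ?n * B * (?p * ?SH + ?r * ?SF + ?p * ?r * ?q)"
    proof -
      have "real (\<Sum>P\<in>stopping Om. 2 ^ (fst P * ?n)) \<le> real (2 ^ (fst Q * ?n))"
        using sumW by (intro of_nat_mono) linarith
      then have "(\<Sum>P\<in>stopping Om. 2 ^ (fst P * ?n)) \<le> ?q" by simp
      then show ?thesis unfolding UF UH using B_nonneg pr by (intro mult_left_mono add_left_mono) auto
    qed
    also have "\<dots> = Cst * B * (?SF * ?SH / ?q)"
      by (simp add: Cst_def p_def r_def A_def field_simps power2_eq_square)
    finally show "norm (bf F H - (\<Sum>P\<in>?W. bf (restr F (dil 1 P)) (restr H (dil 0 P))))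
      \<le> Cst * B * (?SF * ?SH / ?q)" unfolding drop .
  qed
qed

lemma cubes_Int_cases:
  fixes P R :: "nat \<times> ('n \<Rightarrow> int)"
  shows "dil 0 P \<subseteq> dil 0 R \<or> dil 0 R \<subseteq> dil 0 P \<or> dil 0 P \<inter> dil 0 R = {}"
proof (rule ccontr)
  assume c: "\<not> ?thesis"
  then obtain x where x: "x \<in> dil 0 P" "x \<in> dil 0 R" by blast
  have "dil 0 P \<subseteq> dil 0 R" if "fst P \<le> fst R"
    using dil_laminar[OF x that] dil_anc by metis
  moreover have "dil 0 R \<subseteq> dil 0 P" if "fst R \<le> fst P"
    using dil_laminar[OF x(2,1) that] dil_anc by metis
  ultimately show False using c by linarith
qed

lemma asum_restr_le: "asum (restr F X) Y \<le> asum F Y"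
  unfolding asum_def by (rule sum_mono) (simp add: restr_def)

text \<open>Induction on the level of \<open>Q\<close>: the new collection consists of
  \<open>Q\<close> and the collections of its stopping cubes. These cubes have at most half as many
  points as \<open>Q\<close>, so the packing constant reproduces itself as
  \<open>1 + 2 * (1/2) = 2\<close>. Packing is asserted for every dyadic \<open>R\<close>, also for
  those outside the collection, since \<open>tripled_carleson\<close> applies it to neighbours of a
  member; hence the intersections with \<open>R\<close> in the proof.\<close>

theorem sparse_domination:
  assumes "dil 1 Q \<subseteq> U"
    and "\<And>x. x \<notin> dil 1 Q \<Longrightarrow> F x = 0" and "\<And>x. x \<notin> dil 0 Q \<Longrightarrow> H x = 0"
  shows "\<exists>S. finite S \<and> (\<forall>R\<in>S. dil 0 R \<subseteq> dil 0 Q) \<and>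
    (\<forall>R. (\<Sum>P\<in>{P\<in>S. dil 0 P \<subseteq> dil 0 R}. card (dil 0 P)) \<le> 2 * card (dil 0 R)) \<and>
    norm (bf F H) \<le> Cst * B * (\<Sum>P\<in>S. asum F (dil 1 P) * asum H (dil 0 P) / 2 ^ (fst P * CARD('n)))"
  using assms
proof (induction "fst Q" arbitrary: Q F H rule: less_induct)
  case less
  let ?n = "CARD('n)"
  obtain W where W: "finite W" "\<And>P. P \<in> W \<Longrightarrow> dil 0 P \<subseteq> dil 0 Q \<and> fst P < fst Q"
    "\<And>P R x. P \<in> W \<Longrightarrow> R \<in> W \<Longrightarrow> x \<in> dil 0 P \<Longrightarrow> x \<in> dil 0 R \<Longrightarrow> P = R"
    "2 * (\<Sum>P\<in>W. 2 ^ (fst P * ?n)) \<le> (2 ^ (fst Q * ?n) :: nat)"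
    "norm (bf F H - (\<Sum>P\<in>W. bf (restr F (dil 1 P)) (restr H (dil 0 P))))
       \<le> Cst * B * (asum F (dil 1 Q) * asum H (dil 0 Q) / 2 ^ (fst Q * ?n))"
    by (rule one_step[of Q F H, OF less.prems]) (assumption | rule that; assumption | blast)+
  let ?ok = "\<lambda>P S. finite S \<and> (\<forall>R\<in>S. dil 0 R \<subseteq> dil 0 P) \<and>
    (\<forall>R. (\<Sum>P\<in>{P\<in>S. dil 0 P \<subseteq> dil 0 R}. card (dil 0 P)) \<le> 2 * card (dil 0 R)) \<and>
    norm (bf (restr F (dil 1 P)) (restr H (dil 0 P))) \<le> Cst * B *
      (\<Sum>R\<in>S. asum (restr F (dil 1 P)) (dil 1 R) * asum (restr H (dil 0 P)) (dil 0 R) / 2 ^ (fst R * ?n))"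
  have "\<exists>S. ?ok P S" if P: "P \<in> W" for P
  proof (rule less.hyps)
    show "fst P < fst Q" using W(2)[OF P] by blast
    have "Q = anc (fst Q - fst P) P" using dil_subset_anc W(2)[OF P] by blast
    then have "dil 1 P \<subseteq> dil 1 Q" by (metis dil_anc)
    then show "dil 1 P \<subseteq> U" using less.prems(1) by blast
  qed (simp_all add: restr_def)
  then have "\<forall>P\<in>W. \<exists>S. ?ok P S" by (rule ballI)
  from bchoice[OF this] obtain S where S: "\<forall>P\<in>W. ?ok P (S P)" ..
  have Sfin: "finite (S P)" and Ssub: "\<And>R. R \<in> S P \<Longrightarrow> dil 0 R \<subseteq> dil 0 P"
    and Scar: "\<And>R. (\<Sum>R'\<in>{R'\<in>S P. dil 0 R' \<subseteq> dil 0 R}. card (dil 0 R')) \<le> 2 * card (dil 0 R)"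
    and Sbd: "norm (bf (restr F (dil 1 P)) (restr H (dil 0 P))) \<le> Cst * B *
      (\<Sum>R\<in>S P. asum (restr F (dil 1 P)) (dil 1 R) * asum (restr H (dil 0 P)) (dil 0 R) / 2 ^ (fst R * ?n))"
    if "P \<in> W" for P using bspec[OF S that] by blast+
  have ne: "dil 0 R \<noteq> {}" for R :: "nat \<times> ('n \<Rightarrow> int)"
  proof -
    have "card (dil 0 R) > 0" by (simp add: card_dil)
    then show ?thesis by (metis card.empty less_irrefl)
  qed
  have Sdisj: "S P \<inter> S P' = {}" if "P \<in> W" "P' \<in> W" "P \<noteq> P'" for P P'
  proof (rule ccontr)
    assume "S P \<inter> S P' \<noteq> {}"
    then obtain R where R: "R \<in> S P" "R \<in> S P'" by blast
    then obtain x where "x \<in> dil 0 R" using ne by blast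
    then have "x \<in> dil 0 P" "x \<in> dil 0 P'" using Ssub that R by blast+
    then show False using W(3) that by blast
  qed
  have QS: "Q \<notin> (\<Union>P\<in>W. S P)"
  proof
    assume "Q \<in> (\<Union>P\<in>W. S P)"
    then obtain P where P: "P \<in> W" "dil 0 Q \<subseteq> dil 0 P" using Ssub by blast
    then show False using dil_subset_anc(1)[OF P(2)] W(2)[OF P(1)] by simp
  qed
  let ?S = "insert Q (\<Union>P\<in>W. S P)"
  show ?case
  proof (intro exI[of _ ?S] conjI allI)
    show "finite ?S" using W(1) Sfin by blast
    show "\<forall>R\<in>?S. dil 0 R \<subseteq> dil 0 Q" using Ssub W(2) by blast
    let ?t = "\<lambda>R. asum F (dil 1 R) * asum H (dil 0 R) / 2 ^ (fst R * ?n)"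
    have tP: "norm (bf (restr F (dil 1 P)) (restr H (dil 0 P))) \<le> Cst * B * (\<Sum>R\<in>S P. ?t R)" if P: "P \<in> W" for P
    proof -
      have "(\<Sum>R\<in>S P. asum (restr F (dil 1 P)) (dil 1 R) * asum (restr H (dil 0 P)) (dil 0 R) / 2 ^ (fst R * ?n)) \<le> (\<Sum>R\<in>S P. ?t R)"
        by (intro sum_mono divide_right_mono mult_mono asum_restr_le) auto
      then have "Cst * B * (\<Sum>R\<in>S P. asum (restr F (dil 1 P)) (dil 1 R) * asum (restr H (dil 0 P)) (dil 0 R) / 2 ^ (fst R * ?n))
         \<le> Cst * B * (\<Sum>R\<in>S P. ?t R)"
        using Cst_pos B_nonneg by (intro mult_left_mono) auto
      with Sbd[OF P] show ?thesis by (rule order_trans)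
    qed
    have "norm (bf F H) \<le> norm (bf F H - (\<Sum>P\<in>W. bf (restr F (dil 1 P)) (restr H (dil 0 P))))
       + norm (\<Sum>P\<in>W. bf (restr F (dil 1 P)) (restr H (dil 0 P)))"
      using norm_triangle_ineq[of "bf F H - (\<Sum>P\<in>W. bf (restr F (dil 1 P)) (restr H (dil 0 P)))"
         "\<Sum>P\<in>W. bf (restr F (dil 1 P)) (restr H (dil 0 P))"] by simp
    also have "\<dots> \<le> Cst * B * ?t Q + (\<Sum>P\<in>W. Cst * B * (\<Sum>R\<in>S P. ?t R))"
      using W(5) tP by (intro add_mono order_trans[OF norm_sum sum_mono]) auto
    also have "\<dots> = Cst * B * (?t Q + (\<Sum>P\<in>W. \<Sum>R\<in>S P. ?t R))"
      by (simp only: sum_distrib_left distrib_left)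
    also have "(\<Sum>P\<in>W. \<Sum>R\<in>S P. ?t R) = (\<Sum>R\<in>(\<Union>P\<in>W. S P). ?t R)"
      by (rule sum.UNION_disjoint[symmetric]) (use W(1) Sfin Sdisj in blast)+
    also have "?t Q + (\<Sum>R\<in>(\<Union>P\<in>W. S P). ?t R) = (\<Sum>R\<in>?S. ?t R)"
      by (rule sum.insert[symmetric]) (use W(1) Sfin QS in blast)+
    finally show "norm (bf F H) \<le> Cst * B * (\<Sum>R\<in>?S. ?t R)" .
    fix R :: "nat \<times> ('n \<Rightarrow> int)"
    define c where "c = (\<lambda>P. \<Sum>R'\<in>{R'\<in>S P. dil 0 R' \<subseteq> dil 0 R}. card (dil 0 R'))"
    have cP: "c P \<le> 2 * card (dil 0 P \<inter> dil 0 R)" if P: "P \<in> W" for P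
    proof -
      consider "dil 0 P \<subseteq> dil 0 R" | "dil 0 R \<subseteq> dil 0 P" | "dil 0 P \<inter> dil 0 R = {}"
        using cubes_Int_cases[of P R] by blast
      then show ?thesis
      proof cases
        case 1
        then have "{R'\<in>S P. dil 0 R' \<subseteq> dil 0 R} = {R'\<in>S P. dil 0 R' \<subseteq> dil 0 P}" using Ssub[OF P] by blast
        then show ?thesis using Scar[OF P, of P] 1 by (simp add: c_def Int_absorb2)
      next
        case 2
        then show ?thesis using Scar[OF P, of R] by (simp add: c_def Int_absorb1)
      next
        case 3
        then have "{R'\<in>S P. dil 0 R' \<subseteq> dil 0 R} = {}" using Ssub[OF P] ne by blast
        then show ?thesis unfolding c_def by (simp only: sum.empty)
      qed
    qed
    have un: "(\<Sum>R'\<in>{R'\<in>(\<Union>P\<in>W. S P). dil 0 R' \<subseteq> dil 0 R}. card (dil 0 R')) \<le> (\<Sum>P\<in>W. c P)"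
    proof -
      have "{R'\<in>(\<Union>P\<in>W. S P). dil 0 R' \<subseteq> dil 0 R} = (\<Union>P\<in>W. {R'\<in>S P. dil 0 R' \<subseteq> dil 0 R})" by blast
      then have "(\<Sum>R'\<in>{R'\<in>(\<Union>P\<in>W. S P). dil 0 R' \<subseteq> dil 0 R}. card (dil 0 R')) = (\<Sum>P\<in>W. c P)"
        unfolding c_def
      proof (simp only:, intro sum.UNION_disjoint ballI impI)
        fix P P' assume "P \<in> W" "P' \<in> W" "P \<noteq> P'"
        then show "{R' \<in> S P. dil 0 R' \<subseteq> dil 0 R} \<inter> {R' \<in> S P'. dil 0 R' \<subseteq> dil 0 R} = {}"
          using Sdisj by blast
      qed (use W(1) Sfin in simp_all)
      then show ?thesis by simp
    qed
    have disjW: "(\<Sum>P\<in>W. card (dil 0 P \<inter> Y)) \<le> card X" if "\<And>P. P \<in> W \<Longrightarrow> dil 0 P \<inter> Y \<subseteq> X" "finite X" for X Y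
      by (rule card_disjoint_family[OF W(1)]) (use W(3) that in blast)+
    show "(\<Sum>P\<in>{P\<in>?S. dil 0 P \<subseteq> dil 0 R}. card (dil 0 P)) \<le> 2 * card (dil 0 R)"
    proof (cases "dil 0 Q \<subseteq> dil 0 R")
      case True
      then have "{P\<in>?S. dil 0 P \<subseteq> dil 0 R} = insert Q {R'\<in>(\<Union>P\<in>W. S P). dil 0 R' \<subseteq> dil 0 R}" by blast
      then have "(\<Sum>P\<in>{P\<in>?S. dil 0 P \<subseteq> dil 0 R}. card (dil 0 P))
        = card (dil 0 Q) + (\<Sum>R'\<in>{R'\<in>(\<Union>P\<in>W. S P). dil 0 R' \<subseteq> dil 0 R}. card (dil 0 R'))"
        by (simp only:) (rule sum.insert, use W(1) Sfin QS in auto)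
      also have "\<dots> \<le> card (dil 0 Q) + (\<Sum>P\<in>W. 2 * card (dil 0 P \<inter> dil 0 R))"
        by (intro add_left_mono order_trans[OF un] sum_mono cP)
      also have "\<dots> \<le> card (dil 0 Q) + (\<Sum>P\<in>W. 2 * card (dil 0 P))"
        by (intro add_left_mono sum_mono mult_left_mono card_mono) auto
      also have "\<dots> \<le> 2 * card (dil 0 Q)"
        using W(4) by (simp add: card_dil0 sum_distrib_left[symmetric])
      also have "\<dots> \<le> 2 * card (dil 0 R)" using True by (intro mult_left_mono card_mono) auto
      finally show ?thesis .
    next
      case False
      then have "{P\<in>?S. dil 0 P \<subseteq> dil 0 R} = {R'\<in>(\<Union>P\<in>W. S P). dil 0 R' \<subseteq> dil 0 R}" by blast
      then have "(\<Sum>P\<in>{P\<in>?S. dil 0 P \<subseteq> dil 0 R}. card (dil 0 P)) \<le> (\<Sum>P\<in>W. 2 * card (dil 0 P \<inter> dil 0 R))"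
        using order_trans[OF un sum_mono[OF cP]] by simp
      also have "\<dots> \<le> 2 * card (dil 0 R)"
        unfolding sum_distrib_left[symmetric] by (intro mult_left_mono disjW) auto
      finally show ?thesis .
    qed
  qed
qed

end

subsection \<open>Laminar families\<close>

definition laminar :: "'a set set \<Rightarrow> bool" where
  "laminar \<F> \<longleftrightarrow> (\<forall>R\<in>\<F>. \<forall>R'\<in>\<F>. R \<inter> R' = {} \<or> R \<subseteq> R' \<or> R' \<subseteq> R)"

text \<open>In a laminar family the members that contain \<open>x\<close> form a chain, and this is
  the rank of \<open>R\<close> in that chain, counted from the smallest member.\<close>

definition cnt :: "'a set set \<Rightarrow> 'a set \<Rightarrow> 'a \<Rightarrow> nat" where
  "cnt \<F> R x = card {R'\<in>\<F>. x \<in> R' \<and> R' \<subseteq> R}"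

lemma laminar_subset: "laminar \<F> \<Longrightarrow> \<G> \<subseteq> \<F> \<Longrightarrow> laminar \<G>"
  unfolding laminar_def by blast

lemma cnt_pos: "finite \<F> \<Longrightarrow> R \<in> \<F> \<Longrightarrow> x \<in> R \<Longrightarrow> 0 < cnt \<F> R x"
  unfolding cnt_def by (subst card_gt_0_iff) auto

lemma cnt_less:
  assumes "finite \<F>" "R' \<in> \<F>" "x \<in> R'" "R \<subset> R'" shows "cnt \<F> R x < cnt \<F> R' x"
  unfolding cnt_def by (rule psubset_card_mono) (use assms in auto)

lemma cnt_inj:
  assumes "finite \<F>" "laminar \<F>" "R \<in> \<F>" "R' \<in> \<F>" "x \<in> R" "x \<in> R'" "cnt \<F> R x = cnt \<F> R' x"
  shows "R = R'"
proof -
  have "R \<subseteq> R' \<or> R' \<subseteq> R" using assms unfolding laminar_def by blast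
  then show ?thesis
    using cnt_less[of \<F> R' x R] cnt_less[of \<F> R x R'] assms by (auto simp: psubset_eq)
qed

text \<open>Along the chain at \<open>x\<close> the ranks are distinct positive integers. This is
  the bounded overlap of the parts of small rank.\<close>

lemma card_cnt_le:
  assumes "finite \<F>" "laminar \<F>" shows "card {R\<in>\<F>. x \<in> R \<and> cnt \<F> R x \<le> L} \<le> L"
proof -
  have "card {R\<in>\<F>. x \<in> R \<and> cnt \<F> R x \<le> L} = card ((\<lambda>R. cnt \<F> R x) ` {R\<in>\<F>. x \<in> R \<and> cnt \<F> R x \<le> L})"
    by (rule card_image[symmetric], rule inj_onI, rule cnt_inj[OF assms]) auto
  also have "\<dots> \<le> card {1..L}"
    by (rule card_mono) (use cnt_pos[OF assms(1)] in \<open>auto simp: Suc_le_eq\<close>)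
  finally show ?thesis by simp
qed

lemma cnt_image:
  assumes "finite \<F>" "laminar \<F>"
  shows "(\<lambda>R'. cnt \<F> R' x) ` {R'\<in>\<F>. x \<in> R' \<and> R' \<subseteq> R} = {1..cnt \<F> R x}"
proof (rule card_subset_eq)
  let ?A = "{R'\<in>\<F>. x \<in> R' \<and> R' \<subseteq> R}"
  have "cnt \<F> R' x \<le> cnt \<F> R x" if "R' \<subseteq> R" for R'
    unfolding cnt_def by (rule card_mono) (use assms that in auto)
  then show "(\<lambda>R'. cnt \<F> R' x) ` ?A \<subseteq> {1..cnt \<F> R x}"
    using cnt_pos[OF assms(1)] by (auto simp: Suc_le_eq)
  have "card ((\<lambda>R'. cnt \<F> R' x) ` ?A) = card ?A"
    by (rule card_image, rule inj_onI, rule cnt_inj[OF assms]) auto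
  then show "card ((\<lambda>R'. cnt \<F> R' x) ` ?A) = card {1..cnt \<F> R x}" by (simp add: cnt_def)
qed auto

text \<open>A geometric series over the ranks from 1 to \<open>cnt \<F> R x\<close>, all of which
  occur by \<open>cnt_image\<close>. It expresses the exponential of the counting function of
  \<open>R\<close> through those of the members inside \<open>R\<close>, the recursion behind
  \<open>exp_moment\<close>.\<close>

lemma cnt_power_sum:
  assumes "finite \<F>" "laminar \<F>" "0 < (z::real)"
  shows "z ^ cnt \<F> R x = 1 + (z - 1) / z * (\<Sum>R'\<in>{R'\<in>\<F>. x \<in> R' \<and> R' \<subseteq> R}. z ^ cnt \<F> R' x)"
proof -
  let ?A = "{R'\<in>\<F>. x \<in> R' \<and> R' \<subseteq> R}"
  have "(\<Sum>R'\<in>?A. z ^ cnt \<F> R' x) = (\<Sum>i\<in>(\<lambda>R'. cnt \<F> R' x) ` ?A. z ^ i)"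
  proof (rule sum.reindex[symmetric, unfolded comp_def])
    show "inj_on (\<lambda>R'. cnt \<F> R' x) ?A" by (rule inj_onI, rule cnt_inj[OF assms(1,2)]) auto
  qed
  also have "\<dots> = (\<Sum>i\<in>{1..cnt \<F> R x}. z ^ i)" by (simp only: cnt_image[OF assms(1,2)])
  also have "\<dots> = z * (\<Sum>i<cnt \<F> R x. z ^ i)"
    by (simp add: sum_distrib_left sum.atLeast1_atMost_eq)
  finally have "(z - 1) / z * (\<Sum>R'\<in>?A. z ^ cnt \<F> R' x) = (z - 1) * (\<Sum>i<cnt \<F> R x. z ^ i)"
    using assms(3) by simp
  also have "\<dots> = z ^ cnt \<F> R x - 1" by (rule power_diff_1_eq[symmetric])
  finally show ?thesis by simp
qed

lemma cnt_indicator: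
  assumes "finite \<F>" shows "real (cnt \<F> R x) = (\<Sum>R'\<in>{R'\<in>\<F>. R' \<subseteq> R}. indicator R' x)"
proof -
  have "(\<Sum>R'\<in>{R'\<in>\<F>. R' \<subseteq> R}. indicator R' x) = (\<Sum>R'\<in>{R'\<in>\<F>. x \<in> R' \<and> R' \<subseteq> R}. 1::real)"
    by (rule sum.mono_neutral_cong_right) (use assms in \<open>auto simp: indicator_def\<close>)
  then show ?thesis by (simp add: cnt_def)
qed

lemma measurable_cnt [measurable]:
  assumes "finite \<F>" "\<F> \<subseteq> sets M" shows "(\<lambda>x. real (cnt \<F> R x)) \<in> borel_measurable M"
  unfolding cnt_indicator[OF assms(1)] using assms(2) by (intro borel_measurable_sum) auto

lemma sets_cnt:
  assumes "finite \<F>" "\<F> \<subseteq> sets M" "R \<in> sets M"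
  shows "{x\<in>R. L < cnt \<F> R x} \<in> sets M" "{x\<in>R. cnt \<F> R x \<le> L} \<in> sets M"
proof -
  note [measurable] = measurable_cnt[OF assms(1,2), of R] assms(3)
  have R: "R \<subseteq> space M" using assms(3) sets.sets_into_space by blast
  have "{x\<in>R. L < cnt \<F> R x} = R \<inter> {x\<in>space M. real L < real (cnt \<F> R x)}" using R by auto
  also have "\<dots> \<in> sets M" by measurable
  finally show "{x\<in>R. L < cnt \<F> R x} \<in> sets M" .
  have "{x\<in>R. cnt \<F> R x \<le> L} = R \<inter> {x\<in>space M. real (cnt \<F> R x) \<le> real L}" using R by auto
  also have "\<dots> \<in> sets M" by measurable
  finally show "{x\<in>R. cnt \<F> R x \<le> L} \<in> sets M" .
qed

text \<open>An estimate of John-Nirenberg type: packing makes the counting function exponentially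
  integrable. The induction on the number of members inside \<open>R\<close> closes because
  \<open>(z - 1) * \<Lambda> = 1/2\<close> and \<open>z \<le> 3/2\<close>, so that
  \<open>z + 3/2 \<le> 3\<close>.\<close>

lemma exp_moment:
  fixes \<Lambda> z :: real
  assumes fin: "finite \<F>" and lam: "laminar \<F>" and sets: "\<F> \<subseteq> sets M"
    and m: "\<And>R. R \<in> \<F> \<Longrightarrow> emeasure M R = ennreal (m R)" "\<And>R. R \<in> \<F> \<Longrightarrow> 0 \<le> m R"
    and car: "\<And>R. R \<in> \<F> \<Longrightarrow> (\<Sum>R'\<in>{R'\<in>\<F>. R' \<subseteq> R}. m R') \<le> \<Lambda> * m R"
    and \<Lambda>: "1 \<le> \<Lambda>" and z: "z = 1 + 1 / (2 * \<Lambda>)"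
    and R: "R \<in> \<F>"
  shows "(\<integral>\<^sup>+x. ennreal (z ^ cnt \<F> R x) * indicator R x \<partial>M) \<le> ennreal (3 * m R)"
  using R
proof (induction "card {R'\<in>\<F>. R' \<subseteq> R}" arbitrary: R rule: less_induct)
  case less
  have z1: "1 < z" using \<Lambda> by (simp add: z)
  then have z0: "0 < z" by simp
  have RM: "R \<in> sets M" using sets less.prems by blast
  let ?X = "\<lambda>R. \<integral>\<^sup>+x. ennreal (z ^ cnt \<F> R x) * indicator R x \<partial>M"
  let ?c = "(z - 1) / z"
  let ?D = "{R'\<in>\<F>. R' \<subseteq> R}"
  have c0: "0 \<le> ?c" using z1 by simp
  have finD: "finite ?D" using fin by simp
  have meas: "(\<lambda>x. ennreal (z ^ cnt \<F> R' x) * indicator R' x) \<in> borel_measurable M" if "R' \<in> \<F>" for R'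
  proof -
    note [measurable] = measurable_cnt[OF fin sets, of R']
    have "R' \<in> sets M" using sets that by blast
    moreover have "(\<lambda>x. ennreal (z powr real (cnt \<F> R' x))) \<in> borel_measurable M" by measurable
    ultimately show ?thesis using z1 by (simp add: powr_realpow)
  qed
  have pw: "ennreal (z ^ cnt \<F> R x) * indicator R x
     = indicator R x + (\<Sum>R'\<in>?D. ennreal ?c * (ennreal (z ^ cnt \<F> R' x) * indicator R' x))" for x
  proof (cases "x \<in> R")
    case True
    have "(\<Sum>R'\<in>?D. ennreal ?c * (ennreal (z ^ cnt \<F> R' x) * indicator R' x))
      = (\<Sum>R'\<in>{R'\<in>\<F>. x \<in> R' \<and> R' \<subseteq> R}. ennreal (?c * z ^ cnt \<F> R' x))"
      by (rule sum.mono_neutral_cong_right) (use fin c0 z1 in \<open>auto simp: indicator_def ennreal_mult'[symmetric]\<close>)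
    also have "\<dots> = ennreal (\<Sum>R'\<in>{R'\<in>\<F>. x \<in> R' \<and> R' \<subseteq> R}. ?c * z ^ cnt \<F> R' x)"
      by (rule sum_ennreal) (use c0 z1 in auto)
    also have "\<dots> = ennreal (z ^ cnt \<F> R x - 1)"
      using cnt_power_sum[OF fin lam z0, of R x] by (simp add: sum_distrib_left)
    finally have e: "(\<Sum>R'\<in>?D. ennreal ?c * (ennreal (z ^ cnt \<F> R' x) * indicator R' x)) = ennreal (z ^ cnt \<F> R x - 1)" .
    have "ennreal 1 + ennreal (z ^ cnt \<F> R x - 1) = ennreal (1 + (z ^ cnt \<F> R x - 1))"
      by (rule ennreal_plus[symmetric]) (use z1 in \<open>auto intro: one_le_power\<close>)
    then show ?thesis unfolding e using True by simp
  next
    case False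
    then have "(\<Sum>R'\<in>?D. ennreal ?c * (ennreal (z ^ cnt \<F> R' x) * indicator R' x)) = 0"
      by (intro sum.neutral) (auto simp: indicator_def)
    then show ?thesis using False by simp
  qed
  have Xeq: "?X R = ennreal (m R) + (\<Sum>R'\<in>?D. ennreal ?c * ?X R')"
  proof -
    have "?X R = (\<integral>\<^sup>+x. indicator R x + (\<Sum>R'\<in>?D. ennreal ?c * (ennreal (z ^ cnt \<F> R' x) * indicator R' x)) \<partial>M)"
      unfolding pw by simp
    also have "\<dots> = (\<integral>\<^sup>+x. indicator R x \<partial>M) + (\<integral>\<^sup>+x. (\<Sum>R'\<in>?D. ennreal ?c * (ennreal (z ^ cnt \<F> R' x) * indicator R' x)) \<partial>M)"
      by (rule nn_integral_add) (use sets less.prems meas in auto)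
    also have "(\<integral>\<^sup>+x. (\<Sum>R'\<in>?D. ennreal ?c * (ennreal (z ^ cnt \<F> R' x) * indicator R' x)) \<partial>M)
       = (\<Sum>R'\<in>?D. \<integral>\<^sup>+x. ennreal ?c * (ennreal (z ^ cnt \<F> R' x) * indicator R' x) \<partial>M)"
      by (rule nn_integral_sum) (use meas in auto)
    also have "\<dots> = (\<Sum>R'\<in>?D. ennreal ?c * ?X R')"
      by (rule sum.cong[OF refl], rule nn_integral_cmult) (use meas in auto)
    also have "(\<integral>\<^sup>+x. indicator R x \<partial>M) = ennreal (m R)"
      using m(1)[OF less.prems] RM by (simp only: nn_integral_indicator)
    finally show ?thesis .
  qed
  \<comment> \<open>The term of \<open>R\<close> itself recurs on the right and has to be moved to
    the left, which requires it to be finite.\<close>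
  have fX: "?X R < \<infinity>"
  proof -
    have "?X R \<le> (\<integral>\<^sup>+x. ennreal (z ^ card \<F>) * indicator R x \<partial>M)"
    proof (rule nn_integral_mono)
      fix x
      have "cnt \<F> R x \<le> card \<F>" unfolding cnt_def by (rule card_mono) (use fin in auto)
      then have "z ^ cnt \<F> R x \<le> z ^ card \<F>" using z1 by (intro power_increasing) auto
      then show "ennreal (z ^ cnt \<F> R x) * indicator R x \<le> ennreal (z ^ card \<F>) * indicator R x"
        by (intro mult_right_mono ennreal_leI) auto
    qed
    also have "\<dots> = ennreal (z ^ card \<F>) * ennreal (m R)"
      using m(1)[OF less.prems] RM by (simp only: nn_integral_cmult_indicator)
    also have "\<dots> < \<infinity>" by (simp add: ennreal_mult_less_top)
    finally show ?thesis .
  qed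
  then obtain X where X: "?X R = ennreal X" "0 \<le> X" by (cases "?X R") auto
  have "ennreal X \<le> ennreal (m R + ?c * X + ?c * (3 * \<Lambda> * m R))"
  proof -
    have sub: "?X R' \<le> ennreal (3 * m R')" if "R' \<in> ?D - {R}" for R'
    proof (rule less.hyps)
      show "R' \<in> \<F>" using that by simp
      show "card {R''\<in>\<F>. R'' \<subseteq> R'} < card {R''\<in>\<F>. R'' \<subseteq> R}"
        by (rule psubset_card_mono) (use fin that less.prems in auto)
    qed
    have "(\<Sum>R'\<in>?D. ennreal ?c * ?X R') = ennreal ?c * ?X R + (\<Sum>R'\<in>?D - {R}. ennreal ?c * ?X R')"
      by (rule sum.remove) (use finD less.prems in auto)
    also have "\<dots> \<le> ennreal (?c * X) + (\<Sum>R'\<in>?D - {R}. ennreal (?c * (3 * m R')))"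
    proof (intro add_mono sum_mono)
      show "ennreal ?c * ?X R \<le> ennreal (?c * X)" unfolding X(1) using c0 by (simp only: ennreal_mult')
      fix R' assume "R' \<in> ?D - {R}"
      from sub[OF this] have "ennreal ?c * ?X R' \<le> ennreal ?c * ennreal (3 * m R')" by (rule mult_left_mono) simp
      also have "\<dots> = ennreal (?c * (3 * m R'))" by (rule ennreal_mult'[symmetric, OF c0])
      finally show "ennreal ?c * ?X R' \<le> ennreal (?c * (3 * m R'))" .
    qed
    also have "(\<Sum>R'\<in>?D - {R}. ennreal (?c * (3 * m R'))) = ennreal (\<Sum>R'\<in>?D - {R}. ?c * (3 * m R'))"
      by (rule sum_ennreal, rule mult_nonneg_nonneg[OF c0]) (use m(2) in simp)
    also have "\<dots> \<le> ennreal (?c * (3 * \<Lambda> * m R))"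
    proof (rule ennreal_leI)
      have "(\<Sum>R'\<in>?D - {R}. ?c * (3 * m R')) \<le> (\<Sum>R'\<in>?D. ?c * (3 * m R'))"
        by (rule sum_mono2[OF finD], blast, rule mult_nonneg_nonneg[OF c0]) (use m(2) in simp)
      also have "\<dots> = ?c * (3 * (\<Sum>R'\<in>?D. m R'))" by (simp only: sum_distrib_left)
      also have "\<dots> \<le> ?c * (3 * (\<Lambda> * m R))" using car[OF less.prems] c0 by (intro mult_left_mono) auto
      finally show "(\<Sum>R'\<in>?D - {R}. ?c * (3 * m R')) \<le> ?c * (3 * \<Lambda> * m R)" by (simp add: mult_ac)
    qed
    finally have "ennreal X \<le> ennreal (m R) + (ennreal (?c * X) + ennreal (?c * (3 * \<Lambda> * m R)))"
      using Xeq X by (simp add: add_left_mono)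
    also have "\<dots> = ennreal (m R + ?c * X + ?c * (3 * \<Lambda> * m R))"
    proof -
      have "ennreal a + (ennreal b + ennreal c) = ennreal (a + b + c)" if "0 \<le> a" "0 \<le> b" "0 \<le> c" for a b c
        using that by (simp add: add.assoc)
      then show ?thesis
        using mult_nonneg_nonneg[OF c0 X(2)] mult_nonneg_nonneg[OF c0, of "3 * \<Lambda> * m R"] m(2)[OF less.prems] \<Lambda>
        by simp
    qed
    finally show ?thesis .
  qed
  then have le: "X \<le> m R + ?c * X + ?c * (3 * \<Lambda> * m R)"
    using mult_nonneg_nonneg[OF c0 X(2)] mult_nonneg_nonneg[OF c0, of "3 * \<Lambda> * m R"] m(2)[OF less.prems] \<Lambda>
    by (subst (asm) ennreal_le_iff) (auto simp del: times_divide_eq_left intro!: add_nonneg_nonneg)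
  have "X * z \<le> m R * z + (z - 1) * X + (z - 1) * (3 * \<Lambda> * m R)"
  proof -
    have "X * z \<le> (m R + ?c * X + ?c * (3 * \<Lambda> * m R)) * z" using le z1 by (intro mult_right_mono) auto
    also have "\<dots> = m R * z + (z - 1) * X + (z - 1) * (3 * \<Lambda> * m R)" using z1 by (simp add: field_simps)
    finally show ?thesis .
  qed
  then have "X \<le> m R * z + (z - 1) * (3 * \<Lambda> * m R)" by (simp add: algebra_simps)
  also have "(z - 1) * (3 * \<Lambda> * m R) = 3 / 2 * m R" using \<Lambda> by (simp add: z)
  also have "m R * z \<le> m R * (3 / 2)"
    using m(2)[OF less.prems] \<Lambda> by (intro mult_left_mono) (auto simp: z field_simps)
  finally have "X \<le> 3 * m R" by simp
  then show ?case unfolding X(1) by (rule ennreal_leI)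
qed

text \<open>Markov's inequality for \<open>z ^ cnt \<F> R x\<close>.\<close>

lemma cnt_tail:
  fixes \<Lambda> z :: real
  assumes "finite \<F>" "laminar \<F>" "\<F> \<subseteq> sets M"
    and "\<And>R. R \<in> \<F> \<Longrightarrow> emeasure M R = ennreal (m R)" "\<And>R. R \<in> \<F> \<Longrightarrow> 0 \<le> m R"
    and "\<And>R. R \<in> \<F> \<Longrightarrow> (\<Sum>R'\<in>{R'\<in>\<F>. R' \<subseteq> R}. m R') \<le> \<Lambda> * m R"
    and \<Lambda>: "1 \<le> \<Lambda>" and z: "z = 1 + 1 / (2 * \<Lambda>)"
    and R: "R \<in> \<F>"
  shows "emeasure M {x\<in>R. L < cnt \<F> R x} \<le> ennreal (3 * z powr (- real L) * m R)"
proof -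
  have z1: "1 < z" using \<Lambda> by (simp add: z)
  have RM: "R \<in> sets M" using assms(3) R by blast
  have "ennreal (z ^ L) * emeasure M {x\<in>R. L < cnt \<F> R x} = (\<integral>\<^sup>+x. ennreal (z ^ L) * indicator {x\<in>R. L < cnt \<F> R x} x \<partial>M)"
    by (subst nn_integral_cmult_indicator) (use sets_cnt[OF assms(1,3) RM] in auto)
  also have "\<dots> \<le> (\<integral>\<^sup>+x. ennreal (z ^ cnt \<F> R x) * indicator R x \<partial>M)"
    by (rule nn_integral_mono) (use z1 in \<open>auto simp: indicator_def intro!: ennreal_leI power_increasing\<close>)
  also have "\<dots> \<le> ennreal (3 * m R)" by (rule exp_moment[OF assms])
  finally have "ennreal (z powr - real L) * (ennreal (z ^ L) * emeasure M {x\<in>R. L < cnt \<F> R x}) \<le> ennreal (z powr - real L) * ennreal (3 * m R)"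
    by (rule mult_left_mono) simp
  moreover have "ennreal (z powr - real L) * ennreal (z ^ L) = 1"
    using z1 by (simp add: ennreal_mult'[symmetric] powr_minus powr_realpow)
  moreover have "ennreal (z powr - real L) * ennreal (3 * m R) = ennreal (3 * z powr (- real L) * m R)"
    using z1 by (simp add: ennreal_mult'[symmetric] mult_ac)
  ultimately show ?thesis by (simp add: mult.assoc[symmetric])
qed

text \<open>With respect to \<open>g\<close>, the counting function of \<open>R\<close> has mean at
  most \<open>K\<close> on \<open>R\<close>. By Markov's inequality and
  \<open>2 * K \<le> L\<close>, at least half of the mass of \<open>g\<close> in \<open>R\<close>
  sits at points of rank at most \<open>L\<close>. These parts overlap at most \<open>L\<close>
  times, whence the factor \<open>2 * L\<close>.\<close>

lemma laminar_sum_le: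
  fixes K :: real and g :: "'a \<Rightarrow> ennreal" and lam X :: "_ \<Rightarrow> ennreal"
  assumes fin: "finite \<F>" and lami: "laminar \<F>" and sets: "\<F> \<subseteq> sets M"
    and g [measurable]: "g \<in> borel_measurable M"
    and b: "\<And>R. R \<in> \<F> \<Longrightarrow> (\<integral>\<^sup>+x. g x * indicator R x \<partial>M) = ennreal (b R)" "\<And>R. R \<in> \<F> \<Longrightarrow> 0 \<le> b R"
    and car: "\<And>R. R \<in> \<F> \<Longrightarrow> (\<Sum>R'\<in>{R'\<in>\<F>. R' \<subseteq> R}. b R') \<le> K * b R"
    and K: "0 \<le> K" "2 * K \<le> real L" "0 < L"
    and X: "AE x in M. \<forall>R\<in>\<F>. x \<in> R \<longrightarrow> lam R * g x \<le> X x"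
  shows "(\<Sum>R\<in>\<F>. lam R * ennreal (b R)) \<le> ennreal (2 * real L) * (\<integral>\<^sup>+x. X x \<partial>M)"
proof -
  let ?G = "\<lambda>R. {x\<in>R. cnt \<F> R x \<le> L}" and ?B = "\<lambda>R. {x\<in>R. L < cnt \<F> R x}"
  have Gs: "?G R \<in> sets M" "?B R \<in> sets M" if "R \<in> \<F>" for R
    using sets_cnt[OF fin sets] sets that by auto
  have half: "ennreal (b R) \<le> 2 * (\<integral>\<^sup>+x. g x * indicator (?G R) x \<partial>M)" if R: "R \<in> \<F>" for R
  proof -
    have [measurable]: "R' \<in> sets M" if "R' \<in> \<F>" for R' using sets that by blast
    let ?IB = "\<integral>\<^sup>+x. g x * indicator (?B R) x \<partial>M" and ?IG = "\<integral>\<^sup>+x. g x * indicator (?G R) x \<partial>M"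
    have "ennreal (real L) * ?IB = (\<integral>\<^sup>+x. ennreal (real L) * (g x * indicator (?B R) x) \<partial>M)"
      by (rule nn_integral_cmult[symmetric]) (use Gs[OF R] in measurable)
    also have "\<dots> \<le> (\<integral>\<^sup>+x. (\<Sum>R'\<in>{R'\<in>\<F>. R' \<subseteq> R}. g x * indicator R' x) \<partial>M)"
    proof (rule nn_integral_mono)
      fix x
      show "ennreal (real L) * (g x * indicator (?B R) x) \<le> (\<Sum>R'\<in>{R'\<in>\<F>. R' \<subseteq> R}. g x * indicator R' x)"
      proof (cases "x \<in> ?B R")
        case True
        have "(\<Sum>R'\<in>{R'\<in>\<F>. R' \<subseteq> R}. g x * indicator R' x) = g x * (\<Sum>R'\<in>{R'\<in>\<F>. R' \<subseteq> R}. indicator R' x)"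
          by (simp add: sum_distrib_left)
        also have "(\<Sum>R'\<in>{R'\<in>\<F>. R' \<subseteq> R}. indicator R' x :: ennreal) = ennreal (real (cnt \<F> R x))"
          unfolding cnt_indicator[OF fin] by (subst sum_ennreal[symmetric]) (auto simp: ennreal_indicator)
        finally have "(\<Sum>R'\<in>{R'\<in>\<F>. R' \<subseteq> R}. g x * indicator R' x) = g x * ennreal (real (cnt \<F> R x))" .
        moreover have "g x * ennreal (real L) \<le> g x * ennreal (real (cnt \<F> R x))"
          using True by (intro mult_left_mono ennreal_leI) auto
        ultimately show ?thesis using True by (simp add: mult.commute)
      qed simp
    qed
    also have "\<dots> = (\<Sum>R'\<in>{R'\<in>\<F>. R' \<subseteq> R}. \<integral>\<^sup>+x. g x * indicator R' x \<partial>M)"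
      by (rule nn_integral_sum) auto
    also have "\<dots> = (\<Sum>R'\<in>{R'\<in>\<F>. R' \<subseteq> R}. ennreal (b R'))" by (rule sum.cong) (use b in auto)
    also have "\<dots> = ennreal (\<Sum>R'\<in>{R'\<in>\<F>. R' \<subseteq> R}. b R')" by (rule sum_ennreal) (use b in auto)
    also have "\<dots> \<le> ennreal (K * b R)" by (rule ennreal_leI[OF car[OF R]])
    finally have 1: "ennreal (real L) * ?IB \<le> ennreal (K * b R)" .
    have 2: "ennreal (b R) = ?IG + ?IB"
    proof -
      have "(\<integral>\<^sup>+x. g x * indicator R x \<partial>M) = (\<integral>\<^sup>+x. g x * indicator (?G R) x + g x * indicator (?B R) x \<partial>M)"
        by (rule nn_integral_cong) (auto simp: indicator_def)
      also have "\<dots> = ?IG + ?IB" by (rule nn_integral_add) (use Gs[OF R] in measurable)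
      finally show ?thesis using b(1)[OF R] by simp
    qed
    have "?IG + ?IB < \<infinity>" unfolding 2[symmetric] by simp
    then have "?IG < \<infinity>" "?IB < \<infinity>" by auto
    then obtain i j where ij: "?IB = ennreal i" "0 \<le> i" "?IG = ennreal j" "0 \<le> j"
      by (cases ?IB; cases ?IG) auto
    have bij: "b R = j + i" using 2 ij b(2)[OF R] by (simp flip: ennreal_plus)
    have "real L * i \<le> K * b R"
      using 1 ij K b(2)[OF R] by (simp flip: ennreal_mult' add: ennreal_le_iff)
    then have "2 * (real L * i) \<le> (2 * K) * b R" by simp
    also have "\<dots> \<le> real L * b R" using K(2) b(2)[OF R] by (rule mult_right_mono)
    finally have "real L * (2 * i) \<le> real L * b R" by (simp add: mult_ac)
    then have "2 * i \<le> b R" using K(3) by simp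
    then have "b R \<le> 2 * j" using bij by simp
    then show ?thesis unfolding ij using ij(4) by (simp flip: ennreal_mult' ennreal_numeral add: ennreal_leI)
  qed
  let ?h = "\<lambda>x. \<Sum>R\<in>\<F>. lam R * (g x * indicator (?G R) x)"
  have hm: "?h \<in> borel_measurable M"
  proof (rule borel_measurable_sum)
    fix R assume "R \<in> \<F>"
    then show "(\<lambda>x. lam R * (g x * indicator (?G R) x)) \<in> borel_measurable M"
      by (intro borel_measurable_times_ennreal borel_measurable_const g borel_measurable_indicator Gs)
  qed
  \<comment> \<open>The factor \<open>1 / L\<close> stays on the side of the measurable function,
    because \<open>X\<close> carries no measurability assumption.\<close>
  have hX: "AE x in M. ennreal (1 / real L) * ?h x \<le> X x"
    using X
  proof eventually_elim
    case (elim x)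
    have "?h x = (\<Sum>R\<in>{R\<in>\<F>. x \<in> R \<and> cnt \<F> R x \<le> L}. lam R * g x)"
      by (rule sum.mono_neutral_cong_right) (use fin in \<open>auto simp: indicator_def\<close>)
    also have "\<dots> \<le> (\<Sum>R\<in>{R\<in>\<F>. x \<in> R \<and> cnt \<F> R x \<le> L}. X x)"
      by (rule sum_mono) (use elim in auto)
    also have "\<dots> = of_nat (card {R\<in>\<F>. x \<in> R \<and> cnt \<F> R x \<le> L}) * X x" by simp
    also have "\<dots> \<le> of_nat L * X x"
      using card_cnt_le[OF fin lami, of x L] by (intro mult_right_mono of_nat_mono) auto
    finally have "ennreal (1 / real L) * ?h x \<le> ennreal (1 / real L) * (of_nat L * X x)"
      by (rule mult_left_mono) simp
    also have "\<dots> = (ennreal (1 / real L) * ennreal (real L)) * X x" by (simp add: mult.assoc ennreal_of_nat_eq_real_of_nat)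
    also have "ennreal (1 / real L) * ennreal (real L) = 1" using K(3) by (simp flip: ennreal_mult')
    finally show ?case by simp
  qed
  have "(\<Sum>R\<in>\<F>. lam R * ennreal (b R)) \<le> (\<Sum>R\<in>\<F>. lam R * (2 * (\<integral>\<^sup>+x. g x * indicator (?G R) x \<partial>M)))"
    by (intro sum_mono mult_left_mono half) auto
  also have "\<dots> = 2 * (\<Sum>R\<in>\<F>. lam R * (\<integral>\<^sup>+x. g x * indicator (?G R) x \<partial>M))"
    by (simp add: sum_distrib_left mult_ac)
  also have "(\<Sum>R\<in>\<F>. lam R * (\<integral>\<^sup>+x. g x * indicator (?G R) x \<partial>M)) = (\<integral>\<^sup>+x. ?h x \<partial>M)"
  proof -
    have m1: "(\<lambda>x. g x * indicator (?G R) x) \<in> borel_measurable M" if "R \<in> \<F>" for R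
      by (intro borel_measurable_times_ennreal g borel_measurable_indicator Gs that)
    have "(\<integral>\<^sup>+x. ?h x \<partial>M) = (\<Sum>R\<in>\<F>. \<integral>\<^sup>+x. lam R * (g x * indicator (?G R) x) \<partial>M)"
      by (rule nn_integral_sum) (intro borel_measurable_times_ennreal borel_measurable_const m1)
    also have "\<dots> = (\<Sum>R\<in>\<F>. lam R * (\<integral>\<^sup>+x. g x * indicator (?G R) x \<partial>M))"
      by (rule sum.cong[OF refl], rule nn_integral_cmult[OF m1])
    finally show ?thesis by simp
  qed
  also have "(\<integral>\<^sup>+x. ?h x \<partial>M) \<le> ennreal (real L) * (\<integral>\<^sup>+x. X x \<partial>M)"
  proof -
    have "ennreal (1 / real L) * (\<integral>\<^sup>+x. ?h x \<partial>M) = (\<integral>\<^sup>+x. ennreal (1 / real L) * ?h x \<partial>M)"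
      by (rule nn_integral_cmult[symmetric, OF hm])
    also have "\<dots> \<le> (\<integral>\<^sup>+x. X x \<partial>M)" by (rule nn_integral_mono_AE[OF hX])
    finally have "ennreal (real L) * (ennreal (1 / real L) * (\<integral>\<^sup>+x. ?h x \<partial>M)) \<le> ennreal (real L) * (\<integral>\<^sup>+x. X x \<partial>M)"
      by (rule mult_left_mono) simp
    moreover have "ennreal (real L) * ennreal (1 / real L) = 1" using K(3) by (simp flip: ennreal_mult')
    ultimately show ?thesis by (simp add: mult.assoc[symmetric])
  qed
  finally show ?thesis by (simp add: mult_left_mono ennreal_mult' mult.assoc)
qed

text \<open>At the points of \<open>E \<inter> R\<close> of rank at most \<open>L\<close> with
  \<open>v x \<ge> \<epsilon> * a R\<close>, the density \<open>b R / m R\<close> is at most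
  \<open>\<tau> * a R\<close>, hence at most \<open>\<tau> / \<epsilon> * v x\<close>. This is where
  \<open>u\<close> turns into \<open>u * v\<close>, and the overlap costs \<open>L\<close>. The
  other two parts fall under \<open>Cb\<close>, with the smallness supplied by
  \<open>cnt_tail\<close>, and under \<open>Ca\<close>.\<close>

lemma one_level:
  fixes u v :: "'a \<Rightarrow> real" and lam :: "'a set \<Rightarrow> ennreal"
  assumes fin: "finite \<F>" and lami: "laminar \<F>" and sets: "\<F> \<subseteq> sets M"
    and u [measurable]: "u \<in> borel_measurable M" and v [measurable]: "v \<in> borel_measurable M"
    and u0: "\<And>x. 0 \<le> u x" and E [measurable]: "E \<in> sets M"
    and m: "\<And>R. R \<in> \<F> \<Longrightarrow> emeasure M R = ennreal (m R)" "\<And>R. R \<in> \<F> \<Longrightarrow> 0 < m R"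
    and a: "\<And>R. R \<in> \<F> \<Longrightarrow> 0 < a R" and b: "\<And>R. R \<in> \<F> \<Longrightarrow> 0 \<le> b R" "\<And>R. R \<in> \<F> \<Longrightarrow> b R \<le> \<tau> * a R * m R"
    and car: "\<And>R. R \<in> \<F> \<Longrightarrow> (\<Sum>R'\<in>{R'\<in>\<F>. R' \<subseteq> R}. m R') \<le> \<Lambda> * m R"
    and \<Lambda>: "1 \<le> \<Lambda>" and z: "z = 1 + 1 / (2 * \<Lambda>)"
    and Ca: "\<And>R. R \<in> \<F> \<Longrightarrow> (\<integral>\<^sup>+x. ennreal (u x) * indicator {x\<in>R. v x < \<epsilon> * a R} x \<partial>M) \<le> ennreal (c2 * m R) * lam R"
    and Cb: "\<And>R G. R \<in> \<F> \<Longrightarrow> G \<in> sets M \<Longrightarrow> G \<subseteq> R \<Longrightarrow> emeasure M G \<le> ennreal (3 * z powr (- real L) * m R) \<Longrightarrow>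
      (\<integral>\<^sup>+x. ennreal (u x) * indicator G x \<partial>M) \<le> ennreal (c3 * m R) * lam R"
    and pos: "0 < \<epsilon>" "0 \<le> \<tau>" "0 \<le> c2" "0 \<le> c3"
  shows "(\<Sum>R\<in>\<F>. ennreal (b R / m R) * (\<integral>\<^sup>+x. ennreal (u x) * indicator (E \<inter> R) x \<partial>M))
    \<le> ennreal (\<tau> / \<epsilon> * real L) * (\<integral>\<^sup>+x. ennreal (u x * v x) * indicator E x \<partial>M)
      + ennreal (c3 + c2) * (\<Sum>R\<in>\<F>. lam R * ennreal (b R))"
proof -
  let ?I = "\<integral>\<^sup>+x. ennreal (u x * v x) * indicator E x \<partial>M"
  let ?g = "\<lambda>R x. ennreal (\<tau> / \<epsilon>) * (ennreal (u x * v x) * indicator E x * indicator {x\<in>R. cnt \<F> R x \<le> L} x)"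
  have Rs [measurable]: "R \<in> sets M" if "R \<in> \<F>" for R using sets that by blast
  have each: "ennreal (b R / m R) * (\<integral>\<^sup>+x. ennreal (u x) * indicator (E \<inter> R) x \<partial>M)
     \<le> (\<integral>\<^sup>+x. ?g R x \<partial>M) + ennreal (c3 + c2) * (lam R * ennreal (b R))" if R: "R \<in> \<F>" for R
  proof -
    let ?c = "b R / m R"
    let ?A = "{x\<in>R. cnt \<F> R x \<le> L}" and ?B = "{x\<in>R. L < cnt \<F> R x}" and ?V = "{x\<in>R. v x < \<epsilon> * a R}"
    have c0: "0 \<le> ?c" using b(1)[OF R] m(2)[OF R] by simp
    have RS: "R \<subseteq> space M" using Rs[OF R] sets.sets_into_space by blast
    have As [measurable]: "?A \<in> sets M" and Bs [measurable]: "?B \<in> sets M"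
      using sets_cnt[OF fin sets Rs[OF R]] by auto
    have "?V = R \<inter> {x\<in>space M. v x < \<epsilon> * a R}" using RS by auto
    also have "\<dots> \<in> sets M" using Rs[OF R] by measurable
    finally have Vs [measurable]: "?V \<in> sets M" .
    have ca: "?c \<le> \<tau> * a R" using b(2)[OF R] m(2)[OF R] by (simp add: pos_divide_le_eq)
    have pw: "ennreal ?c * (ennreal (u x) * indicator (E \<inter> R) x)
      \<le> ?g R x + (ennreal ?c * (ennreal (u x) * indicator ?B x) + ennreal ?c * (ennreal (u x) * indicator ?V x))" for x
    proof (cases "x \<in> E \<inter> R \<and> x \<notin> ?B \<and> x \<notin> ?V")
      case True
      then have x: "x \<in> E" "x \<in> R" "x \<in> ?A" "\<epsilon> * a R \<le> v x" by auto
      have "?c * u x \<le> \<tau> * a R * u x" using ca u0 by (rule mult_right_mono)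
      also have "\<dots> = \<tau> / \<epsilon> * (u x * (\<epsilon> * a R))" using pos by simp
      also have "\<dots> \<le> \<tau> / \<epsilon> * (u x * v x)" using x(4) u0 pos by (intro mult_left_mono) auto
      finally have "ennreal (?c * u x) \<le> ennreal (\<tau> / \<epsilon> * (u x * v x))" by (rule ennreal_leI)
      then have "ennreal ?c * ennreal (u x) \<le> ennreal (\<tau> / \<epsilon>) * ennreal (u x * v x)"
        using c0 pos by (simp add: ennreal_mult'[symmetric])
      then show ?thesis using x by (simp add: add_increasing2)
    next
      case False
      then consider "x \<notin> E \<inter> R" | "x \<in> ?B" | "x \<in> ?V" by blast
      then show ?thesis
      proof cases
        case 2
        then have "ennreal ?c * (ennreal (u x) * indicator (E \<inter> R) x) \<le> ennreal ?c * (ennreal (u x) * indicator ?B x)"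
          by (intro mult_left_mono) (auto simp: indicator_def)
        then show ?thesis by (rule order_trans) (simp add: add_increasing add_increasing2)
      next
        case 3
        then have "ennreal ?c * (ennreal (u x) * indicator (E \<inter> R) x) \<le> ennreal ?c * (ennreal (u x) * indicator ?V x)"
          by (intro mult_left_mono) (auto simp: indicator_def)
        then show ?thesis by (rule order_trans) (simp add: add_increasing add_increasing2)
      qed simp
    qed
    have gm: "?g R \<in> borel_measurable M" by measurable
    have "ennreal ?c * (\<integral>\<^sup>+x. ennreal (u x) * indicator (E \<inter> R) x \<partial>M)
      = (\<integral>\<^sup>+x. ennreal ?c * (ennreal (u x) * indicator (E \<inter> R) x) \<partial>M)"
      by (rule nn_integral_cmult[symmetric]) (use Rs[OF R] in measurable)
    also have "\<dots> \<le> (\<integral>\<^sup>+x. ?g R x + (ennreal ?c * (ennreal (u x) * indicator ?B x) + ennreal ?c * (ennreal (u x) * indicator ?V x)) \<partial>M)"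
      by (rule nn_integral_mono[OF pw])
    also have "\<dots> = (\<integral>\<^sup>+x. ?g R x \<partial>M) + (\<integral>\<^sup>+x. ennreal ?c * (ennreal (u x) * indicator ?B x) + ennreal ?c * (ennreal (u x) * indicator ?V x) \<partial>M)"
      by (rule nn_integral_add[OF gm]) measurable
    also have "(\<integral>\<^sup>+x. ennreal ?c * (ennreal (u x) * indicator ?B x) + ennreal ?c * (ennreal (u x) * indicator ?V x) \<partial>M)
      = (\<integral>\<^sup>+x. ennreal ?c * (ennreal (u x) * indicator ?B x) \<partial>M) + (\<integral>\<^sup>+x. ennreal ?c * (ennreal (u x) * indicator ?V x) \<partial>M)"
      by (rule nn_integral_add) measurable
    also have "(\<integral>\<^sup>+x. ennreal ?c * (ennreal (u x) * indicator ?B x) \<partial>M) = ennreal ?c * (\<integral>\<^sup>+x. ennreal (u x) * indicator ?B x \<partial>M)"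
      by (rule nn_integral_cmult) measurable
    also have "(\<integral>\<^sup>+x. ennreal ?c * (ennreal (u x) * indicator ?V x) \<partial>M) = ennreal ?c * (\<integral>\<^sup>+x. ennreal (u x) * indicator ?V x \<partial>M)"
      by (rule nn_integral_cmult) measurable
    finally have 1: "ennreal ?c * (\<integral>\<^sup>+x. ennreal (u x) * indicator (E \<inter> R) x \<partial>M)
      \<le> (\<integral>\<^sup>+x. ?g R x \<partial>M) + (ennreal ?c * (\<integral>\<^sup>+x. ennreal (u x) * indicator ?B x \<partial>M) + ennreal ?c * (\<integral>\<^sup>+x. ennreal (u x) * indicator ?V x \<partial>M))" .
    have tail: "emeasure M ?B \<le> ennreal (3 * z powr (- real L) * m R)"
      by (rule cnt_tail[OF fin lami sets m(1) _ car \<Lambda> z R]) (use m(2) in \<open>auto intro: less_imp_le\<close>)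
    have "(\<integral>\<^sup>+x. ennreal (u x) * indicator ?B x \<partial>M) \<le> ennreal (c3 * m R) * lam R"
      by (rule Cb[OF R Bs _ tail]) auto
    moreover have "(\<integral>\<^sup>+x. ennreal (u x) * indicator ?V x \<partial>M) \<le> ennreal (c2 * m R) * lam R" by (rule Ca[OF R])
    ultimately have "ennreal ?c * (\<integral>\<^sup>+x. ennreal (u x) * indicator ?B x \<partial>M) + ennreal ?c * (\<integral>\<^sup>+x. ennreal (u x) * indicator ?V x \<partial>M)
      \<le> ennreal ?c * (ennreal (c3 * m R) * lam R) + ennreal ?c * (ennreal (c2 * m R) * lam R)"
      by (intro add_mono mult_left_mono) auto
    also have "\<dots> = ennreal (c3 + c2) * (lam R * ennreal (b R))"
    proof -
      have e: "ennreal ?c * (ennreal (c * m R) * l) = ennreal c * (l * ennreal (b R))" if "0 \<le> c" for c l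
      proof -
        have "ennreal ?c * ennreal (c * m R) = ennreal c * ennreal (b R)"
          using c0 that m(2)[OF R] b(1)[OF R] by (simp add: ennreal_mult'[symmetric])
        then show ?thesis by (metis mult.assoc mult.commute)
      qed
      show ?thesis unfolding e[OF pos(3)] e[OF pos(4)] using pos by (simp add: ennreal_plus distrib_right)
    qed
    finally show ?thesis using 1 by (meson add_left_mono order_trans)
  qed
  have gm: "?g R \<in> borel_measurable M" if "R \<in> \<F>" for R
  proof -
    have [measurable]: "{x\<in>R. cnt \<F> R x \<le> L} \<in> sets M" using sets_cnt[OF fin sets Rs[OF that]] by auto
    show ?thesis by measurable
  qed
  have "(\<Sum>R\<in>\<F>. \<integral>\<^sup>+x. ?g R x \<partial>M) = (\<integral>\<^sup>+x. (\<Sum>R\<in>\<F>. ?g R x) \<partial>M)"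
    by (rule nn_integral_sum[symmetric]) (rule gm)
  also have "\<dots> \<le> (\<integral>\<^sup>+x. ennreal (\<tau> / \<epsilon> * real L) * (ennreal (u x * v x) * indicator E x) \<partial>M)"
  proof (rule nn_integral_mono)
    fix x
    let ?w = "ennreal (\<tau> / \<epsilon>) * (ennreal (u x * v x) * indicator E x)"
    have "(\<Sum>R\<in>\<F>. ?g R x) = (\<Sum>R\<in>{R\<in>\<F>. x \<in> R \<and> cnt \<F> R x \<le> L}. ?w)"
      by (rule sum.mono_neutral_cong_right) (use fin in \<open>auto simp: indicator_def\<close>)
    also have "\<dots> = of_nat (card {R\<in>\<F>. x \<in> R \<and> cnt \<F> R x \<le> L}) * ?w" by simp
    also have "\<dots> \<le> of_nat L * ?w"
      using card_cnt_le[OF fin lami, of x L] by (intro mult_right_mono of_nat_mono) auto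
    also have "\<dots> = ennreal (real L) * ennreal (\<tau> / \<epsilon>) * (ennreal (u x * v x) * indicator E x)"
      by (simp add: ennreal_of_nat_eq_real_of_nat mult.assoc)
    also have "ennreal (real L) * ennreal (\<tau> / \<epsilon>) = ennreal (\<tau> / \<epsilon> * real L)"
      by (simp add: ennreal_mult'[symmetric] mult.commute)
    finally show "(\<Sum>R\<in>\<F>. ?g R x) \<le> ennreal (\<tau> / \<epsilon> * real L) * (ennreal (u x * v x) * indicator E x)" .
  qed
  also have "\<dots> = ennreal (\<tau> / \<epsilon> * real L) * ?I" by (rule nn_integral_cmult) measurable
  finally have G: "(\<Sum>R\<in>\<F>. \<integral>\<^sup>+x. ?g R x \<partial>M) \<le> ennreal (\<tau> / \<epsilon> * real L) * ?I" .
  have "(\<Sum>R\<in>\<F>. ennreal (b R / m R) * (\<integral>\<^sup>+x. ennreal (u x) * indicator (E \<inter> R) x \<partial>M))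
    \<le> (\<Sum>R\<in>\<F>. (\<integral>\<^sup>+x. ?g R x \<partial>M) + ennreal (c3 + c2) * (lam R * ennreal (b R)))"
    by (rule sum_mono[OF each])
  also have "\<dots> = (\<Sum>R\<in>\<F>. \<integral>\<^sup>+x. ?g R x \<partial>M) + ennreal (c3 + c2) * (\<Sum>R\<in>\<F>. lam R * ennreal (b R))"
    by (simp only: sum.distrib sum_distrib_left)
  also have "\<dots> \<le> ennreal (\<tau> / \<epsilon> * real L) * ?I + ennreal (c3 + c2) * (\<Sum>R\<in>\<F>. lam R * ennreal (b R))"
    by (rule add_right_mono[OF G])
  finally show ?thesis .
qed

section \<open>Summation over the levels of the density\<close>

lemma geometric_le:
  fixes r :: real assumes "0 \<le> r" "r < 1" shows "(\<Sum>k\<le>N. r ^ k) \<le> 1 / (1 - r)"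
proof -
  have "(1 - r) * (\<Sum>k\<le>N. r ^ k) = 1 - r ^ Suc N"
    by (metis (no_types, lifting) lessThan_Suc_atMost one_diff_power_eq)
  also have "\<dots> \<le> 1" using assms by simp
  finally show ?thesis using assms by (simp add: pos_le_divide_eq mult.commute)
qed

lemma dyadic_level:
  fixes b A :: real assumes "0 < b" "b \<le> A" obtains k :: nat where "A * (1/2) ^ Suc k < b" "b \<le> A * (1/2) ^ k"
proof -
  have "\<exists>k. A * (1/2) ^ Suc k < b"
  proof -
    have A: "0 < A" using assms by simp
    obtain k where "(1/2::real) ^ k < b / A" using real_arch_pow_inv[of "b / A" "1/2"] assms A by auto
    then have "A * (1/2) ^ k < b" using A by (simp add: pos_less_divide_eq mult.commute)
    moreover have "A * (1/2) ^ Suc k \<le> A * (1/2) ^ k" using A by simp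
    ultimately show ?thesis by (meson le_less_trans)
  qed
  define k where "k = (LEAST k. A * (1/2) ^ Suc k < b)"
  have 1: "A * (1/2) ^ Suc k < b" unfolding k_def using \<open>\<exists>k. _\<close> by (rule LeastI_ex)
  have "b \<le> A * (1/2) ^ k"
  proof (cases k)
    case (Suc i)
    then have "i < k" by simp
    then have "\<not> A * (1/2) ^ Suc i < b" unfolding k_def by (rule not_less_Least)
    then show ?thesis using Suc by simp
  qed (use assms in simp)
  with 1 show ?thesis using that by blast
qed

text \<open>The first factor is the \<open>2 * L\<close> of \<open>laminar_sum_le\<close> for
  \<open>K = 2 * C1 * \<Lambda>\<close>. The bracket sums two geometric series over the levels:
  points of large rank contribute with ratio \<open>2 powr (- \<delta> / 2)\<close>, points of small
  \<open>v\<close> with ratio \<open>2 powr (- \<theta> / 4)\<close>.\<close>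

definition laminar_const :: "real \<Rightarrow> real \<Rightarrow> real \<Rightarrow> real \<Rightarrow> real \<Rightarrow> real \<Rightarrow> real \<Rightarrow> real" where
  "laminar_const C1 C2 C3 \<theta> \<delta> \<Lambda> \<eta> = 2 * real (nat \<lceil>4 * C1 * \<Lambda>\<rceil> + 1) *
    (C3 * (\<eta> * (1 - 2 powr (-1/4))) powr (- \<delta>) / (1 - 2 powr (- \<delta> / 2)) + C2 / (1 - 2 powr (- \<theta> / 4)))"

lemma two_powr_less_1: "0 < s \<Longrightarrow> 2 powr (- s) < (1::real)"
  by (simp add: powr_less_one)

text \<open>
  Members with \<open>b R\<close> about \<open>t * a R * m R / 2 ^ k\<close> are treated together. Inside such an \<open>R\<close>, three parts are
  distinguished: the points in at most \<open>L\<close> of the members inside \<open>R\<close>, with \<open>L\<close> about \<open>2 powr (k / 2)\<close>, which are counted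
  at most \<open>L\<close> times; the remaining points, whose measure is exponentially small in \<open>L\<close>; and the points where
  \<open>v\<close> is smaller than \<open>2 powr (- k / 4) * a R\<close>.
\<close>

lemma laminar_bound:
  fixes u v :: "'a \<Rightarrow> real" and lam :: "'a set \<Rightarrow> ennreal" and g X :: "'a \<Rightarrow> ennreal"
  assumes fin: "finite \<F>" and lami: "laminar \<F>" and sets: "\<F> \<subseteq> sets M"
    and u: "u \<in> borel_measurable M" and v: "v \<in> borel_measurable M" and g: "g \<in> borel_measurable M"
    and u0: "\<And>x. 0 \<le> u x" and E: "E \<in> sets M"
    and m: "\<And>R. R \<in> \<F> \<Longrightarrow> emeasure M R = ennreal (m R)" "\<And>R. R \<in> \<F> \<Longrightarrow> 0 < m R"
    and a: "\<And>R. R \<in> \<F> \<Longrightarrow> 0 < a R" "\<And>R R'. R \<in> \<F> \<Longrightarrow> R' \<in> \<F> \<Longrightarrow> R' \<subseteq> R \<Longrightarrow> a R' \<le> C1 * a R"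
    and b: "\<And>R. R \<in> \<F> \<Longrightarrow> (\<integral>\<^sup>+x. g x * indicator R x \<partial>M) = ennreal (b R)" "\<And>R. R \<in> \<F> \<Longrightarrow> 0 \<le> b R"
      "\<And>R. R \<in> \<F> \<Longrightarrow> b R \<le> t * a R * m R"
    and car: "\<And>R. R \<in> \<F> \<Longrightarrow> (\<Sum>R'\<in>{R'\<in>\<F>. R' \<subseteq> R}. m R') \<le> \<Lambda> * m R"
    and \<Lambda>: "1 \<le> \<Lambda>" and z: "z = 1 + 1 / (2 * \<Lambda>)"
    and Ca: "\<And>R \<epsilon>. R \<in> \<F> \<Longrightarrow> 0 < \<epsilon> \<Longrightarrow> \<epsilon> \<le> 1 \<Longrightarrow>
      (\<integral>\<^sup>+x. ennreal (u x) * indicator {x\<in>R. v x < \<epsilon> * a R} x \<partial>M) \<le> ennreal (C2 * \<epsilon> powr \<theta> * m R) * lam R"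
    and Cb: "\<And>R G L. R \<in> \<F> \<Longrightarrow> G \<in> sets M \<Longrightarrow> G \<subseteq> R \<Longrightarrow> emeasure M G \<le> ennreal (3 * z powr (- real L) * m R) \<Longrightarrow>
      (\<integral>\<^sup>+x. ennreal (u x) * indicator G x \<partial>M) \<le> ennreal (C3 * (1 + real L) powr (- \<delta>) * m R) * lam R"
    and X: "AE x in M. \<forall>R\<in>\<F>. x \<in> R \<longrightarrow> lam R * g x \<le> X x"
    and pos: "0 < t" "0 < C1" "0 \<le> C2" "0 \<le> C3" "0 < \<theta>" "0 < \<delta>" "0 < \<eta>"
  shows "(\<Sum>R\<in>\<F>. ennreal (b R / m R) * (\<integral>\<^sup>+x. ennreal (u x) * indicator (E \<inter> R) x \<partial>M))
    \<le> ennreal (\<eta> * t) * (\<integral>\<^sup>+x. ennreal (u x * v x) * indicator E x \<partial>M)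
      + ennreal (laminar_const C1 C2 C3 \<theta> \<delta> \<Lambda> \<eta>) * (\<integral>\<^sup>+x. X x \<partial>M)"
proof -
  define r0 :: real where "r0 = 2 powr (-1/4)"
  have r0: "0 < r0" "r0 < 1" using two_powr_less_1[of "1/4"] by (auto simp: r0_def)
  \<comment> \<open>The absorbed terms form a geometric series of ratio \<open>r0\<close>; the
    factor \<open>1 - r0\<close> keeps their sum below \<open>\<eta> * t\<close>.\<close>
  define \<eta>' where "\<eta>' = \<eta> * (1 - r0)"
  have \<eta>': "0 < \<eta>'" using r0 pos by (simp add: \<eta>'_def)
  define Lk where "Lk = (\<lambda>k::nat. nat \<lfloor>\<eta>' * 2 powr (real k / 2)\<rfloor>)"
  define L0 where "L0 = nat \<lceil>4 * C1 * \<Lambda>\<rceil> + 1"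
  define rd :: real where "rd = 2 powr (- \<delta> / 2)"
  define rt :: real where "rt = 2 powr (- \<theta> / 4)"
  have rd: "0 < rd" "rd < 1" using two_powr_less_1[of "\<delta>/2"] pos by (auto simp: rd_def)
  have rt: "0 < rt" "rt < 1" using two_powr_less_1[of "\<theta>/4"] pos by (auto simp: rt_def)
  let ?I = "\<integral>\<^sup>+x. ennreal (u x * v x) * indicator E x \<partial>M" and ?X = "\<integral>\<^sup>+x. X x \<partial>M"
  let ?F = "{R\<in>\<F>. 0 < b R}"
  have "\<forall>R\<in>?F. \<exists>k::nat. t * a R * m R * (1/2) ^ Suc k < b R \<and> b R \<le> t * a R * m R * (1/2) ^ k"
  proof
    fix R assume "R \<in> ?F"
    then have "0 < b R" "b R \<le> t * a R * m R" using b(3) by auto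
    from dyadic_level[OF this] show "\<exists>k::nat. t * a R * m R * (1/2) ^ Suc k < b R \<and> b R \<le> t * a R * m R * (1/2) ^ k" by blast
  qed
  from bchoice[OF this] obtain kk :: "'a set \<Rightarrow> nat" where
    kk: "\<And>R. R \<in> ?F \<Longrightarrow> t * a R * m R * (1/2) ^ Suc (kk R) < b R" "\<And>R. R \<in> ?F \<Longrightarrow> b R \<le> t * a R * m R * (1/2) ^ kk R"
    by blast
  define N where "N = Max (insert 0 (kk ` ?F))"
  have kkN: "kk R \<le> N" if "R \<in> ?F" for R unfolding N_def using fin that by (intro Max_ge) auto
  let ?T = "\<lambda>R. ennreal (b R / m R) * (\<integral>\<^sup>+x. ennreal (u x) * indicator (E \<inter> R) x \<partial>M)"
  let ?A = "\<lambda>k. t * \<eta>' * r0 ^ k" and ?B = "\<lambda>k. C3 * \<eta>' powr (- \<delta>) * rd ^ k + C2 * rt ^ k"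
  have level: "(\<Sum>R\<in>{R\<in>?F. kk R = k}. ?T R) \<le> ennreal (?A k) * ?I + ennreal (?B k) * (ennreal (2 * real L0) * ?X)" for k
  proof -
    let ?G = "{R\<in>?F. kk R = k}"
    define \<tau> where "\<tau> = t * (1/2) ^ k"
    define \<epsilon> :: real where "\<epsilon> = 2 powr (- real k / 4)"
    have \<tau>: "0 < \<tau>" using pos by (simp add: \<tau>_def)
    have \<epsilon>: "0 < \<epsilon>" "\<epsilon> \<le> 1" using powr_mono[of "- real k / 4" 0 2] by (simp_all add: \<epsilon>_def)
    have sub: "?G \<subseteq> \<F>" by blast
    have carG: "(\<Sum>R'\<in>{R'\<in>?G. R' \<subseteq> R}. m R') \<le> \<Lambda> * m R" if "R \<in> ?G" for R
    proof -
      have "(\<Sum>R'\<in>{R'\<in>?G. R' \<subseteq> R}. m R') \<le> (\<Sum>R'\<in>{R'\<in>\<F>. R' \<subseteq> R}. m R')"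
        by (rule sum_mono2) (use fin m(2) in \<open>auto intro: less_imp_le\<close>)
      also have "\<dots> \<le> \<Lambda> * m R" by (rule car) (use that in simp)
      finally show ?thesis .
    qed
    have bG: "b R \<le> \<tau> * a R * m R" "\<tau> * a R * m R \<le> 2 * b R" if "R \<in> ?G" for R
      using kk[of R] that by (auto simp: \<tau>_def mult_ac)
    have "(\<Sum>R\<in>?G. ?T R) \<le> ennreal (\<tau> / \<epsilon> * real (Lk k)) * ?I
      + ennreal (C3 * (1 + real (Lk k)) powr (- \<delta>) + C2 * \<epsilon> powr \<theta>) * (\<Sum>R\<in>?G. lam R * ennreal (b R))"
    proof (rule one_level[where m = m and a = a and z = z and \<Lambda> = \<Lambda>, OF _ laminar_subset[OF lami sub] _ u v u0 E])
      show "finite ?G" "?G \<subseteq> sets M" using fin sets by auto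
      show "1 \<le> \<Lambda>" "z = 1 + 1 / (2 * \<Lambda>)" by (fact \<Lambda>, fact z)
      show "0 < \<epsilon>" "0 \<le> \<tau>" "0 \<le> C2 * \<epsilon> powr \<theta>" "0 \<le> C3 * (1 + real (Lk k)) powr (- \<delta>)"
        using \<epsilon> \<tau> pos by auto
      fix R assume R: "R \<in> ?G"
      then have RF: "R \<in> \<F>" by simp
      show "(\<Sum>R'\<in>{R'\<in>?G. R' \<subseteq> R}. m R') \<le> \<Lambda> * m R" by (rule carG[OF R])
      show "emeasure M R = ennreal (m R)" "0 < m R" "0 < a R" "0 \<le> b R" by (fact m(1)[OF RF], fact m(2)[OF RF], fact a(1)[OF RF], fact b(2)[OF RF])
      show "b R \<le> \<tau> * a R * m R" by (rule bG(1)[OF R])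
      show "(\<integral>\<^sup>+x. ennreal (u x) * indicator {x\<in>R. v x < \<epsilon> * a R} x \<partial>M) \<le> ennreal (C2 * \<epsilon> powr \<theta> * m R) * lam R"
        by (rule Ca[OF RF \<epsilon>])
      show "(\<integral>\<^sup>+x. ennreal (u x) * indicator G x \<partial>M) \<le> ennreal (C3 * (1 + real (Lk k)) powr (- \<delta>) * m R) * lam R"
        if "G \<in> sets M" "G \<subseteq> R" "emeasure M G \<le> ennreal (3 * z powr (- real (Lk k)) * m R)" for G
        by (rule Cb[OF RF that])
    qed
    also have "\<dots> \<le> ennreal (?A k) * ?I + ennreal (?B k) * (ennreal (2 * real L0) * ?X)"
    proof (rule add_mono[OF mult_right_mono[OF ennreal_leI] mult_mono[OF ennreal_leI]])
      have fl: "real (Lk k) \<le> \<eta>' * 2 powr (real k / 2)" "\<eta>' * 2 powr (real k / 2) \<le> 1 + real (Lk k)"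
      proof -
        have nn: "0 \<le> \<eta>' * 2 powr (real k / 2)" using \<eta>' by simp
        then show "real (Lk k) \<le> \<eta>' * 2 powr (real k / 2)" unfolding Lk_def by (simp add: of_nat_nat)
        show "\<eta>' * 2 powr (real k / 2) \<le> 1 + real (Lk k)" unfolding Lk_def using nn
          by (simp add: of_nat_nat) linarith
      qed
      have pw: "(s powr c) ^ k = s powr (c * real k)" if "0 < s" for s c :: real
        using that by (simp add: powr_realpow[symmetric] powr_powr)
      \<comment> \<open>The exponents of 2 are \<open>- k\<close> from \<open>\<tau>\<close>,
        \<open>k / 4\<close> from \<open>1 / \<epsilon>\<close> and \<open>k / 2\<close> from
        \<open>Lk k\<close>, in total \<open>- k / 4\<close>.\<close>
      show "\<tau> / \<epsilon> * real (Lk k) \<le> t * \<eta>' * r0 ^ k"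
      proof -
        have "\<tau> / \<epsilon> * real (Lk k) \<le> \<tau> / \<epsilon> * (\<eta>' * 2 powr (real k / 2))"
          using fl(1) \<tau> \<epsilon> by (intro mult_left_mono) auto
        also have "\<dots> = t * \<eta>' * ((1/2) ^ k / 2 powr (- real k / 4) * 2 powr (real k / 2))"
          by (simp add: \<tau>_def \<epsilon>_def)
        also have "(1/2) ^ k / 2 powr (- real k / 4) * 2 powr (real k / 2) = r0 ^ k"
        proof -
          have "(1/2::real) ^ k = 2 powr (- real k)" by (simp add: powr_minus powr_realpow power_one_over inverse_eq_divide)
          then have "(1/2) ^ k / 2 powr (- real k / 4) * 2 powr (real k / 2) = (2::real) powr (- real k - (- real k / 4) + real k / 2)"
            by (simp only: powr_diff powr_add)
          also have "- real k - (- real k / 4) + real k / 2 = -1/4 * real k" by simp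
          finally show ?thesis unfolding r0_def by (simp only: pw[OF zero_less_numeral])
        qed
        finally show ?thesis .
      qed
      show "C3 * (1 + real (Lk k)) powr (- \<delta>) + C2 * \<epsilon> powr \<theta> \<le> C3 * \<eta>' powr (- \<delta>) * rd ^ k + C2 * rt ^ k"
      proof (intro add_mono)
        have "(1 + real (Lk k)) powr (- \<delta>) \<le> (\<eta>' * 2 powr (real k / 2)) powr (- \<delta>)"
          using fl(2) \<eta>' pos by (intro powr_mono2') auto
        also have "\<dots> = \<eta>' powr (- \<delta>) * rd ^ k"
          using \<eta>' by (simp add: powr_mult powr_powr rd_def pw mult_ac)
        finally show "C3 * (1 + real (Lk k)) powr (- \<delta>) \<le> C3 * \<eta>' powr (- \<delta>) * rd ^ k"
          using pos by (simp add: mult.assoc mult_left_mono)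
        show "C2 * \<epsilon> powr \<theta> \<le> C2 * rt ^ k"
          by (simp add: \<epsilon>_def rt_def pw powr_powr mult_ac)
      qed
      show "(\<Sum>R\<in>?G. lam R * ennreal (b R)) \<le> ennreal (2 * real L0) * ?X"
      proof (rule laminar_sum_le[OF _ laminar_subset[OF lami sub] _ g, where K = "2 * C1 * \<Lambda>"])
        show "finite ?G" "?G \<subseteq> sets M" using fin sets by auto
        \<comment> \<open>The grouping pays off here: within a level, \<open>b R\<close> and
          \<open>\<tau> * a R * m R\<close> agree up to a factor 2, so the packing of
          \<open>m\<close> becomes a packing of \<open>b\<close>. The factor \<open>C1\<close> comes
          from comparing \<open>a R'\<close> with \<open>a R\<close>.\<close>
        show "(\<Sum>R'\<in>{R'\<in>?G. R' \<subseteq> R}. b R') \<le> 2 * C1 * \<Lambda> * b R" if R: "R \<in> ?G" for R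
        proof -
          have "(\<Sum>R'\<in>{R'\<in>?G. R' \<subseteq> R}. b R') \<le> (\<Sum>R'\<in>{R'\<in>?G. R' \<subseteq> R}. \<tau> * (C1 * a R) * m R')"
          proof (rule sum_mono)
            fix R' assume R': "R' \<in> {R'\<in>?G. R' \<subseteq> R}"
            then have "b R' \<le> \<tau> * a R' * m R'" using bG by blast
            also have "\<dots> \<le> \<tau> * (C1 * a R) * m R'"
              using a(2)[of R R'] R R' \<tau> m(2)[of R'] by (intro mult_right_mono mult_left_mono) auto
            finally show "b R' \<le> \<tau> * (C1 * a R) * m R'" .
          qed
          also have "\<dots> = \<tau> * (C1 * a R) * (\<Sum>R'\<in>{R'\<in>?G. R' \<subseteq> R}. m R')" by (simp only: sum_distrib_left)
          also have "\<dots> \<le> \<tau> * (C1 * a R) * (\<Lambda> * m R)"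
            using carG[OF R] \<tau> pos a(1)[of R] R by (intro mult_left_mono) auto
          also have "\<dots> = C1 * \<Lambda> * (\<tau> * a R * m R)" by simp
          also have "\<dots> \<le> C1 * \<Lambda> * (2 * b R)" using bG(2)[OF R] pos \<Lambda> by (intro mult_left_mono) auto
          finally show ?thesis by simp
        qed
        show "AE x in M. \<forall>R\<in>?G. x \<in> R \<longrightarrow> lam R * g x \<le> X x" using X by eventually_elim blast
        show "2 * (2 * C1 * \<Lambda>) \<le> real L0" unfolding L0_def by linarith
      qed (use b pos \<Lambda> in \<open>auto simp: L0_def\<close>)
    qed auto
    finally show ?thesis .
  qed
  have "(\<Sum>R\<in>\<F>. ?T R) = (\<Sum>R\<in>?F. ?T R)"
  proof (rule sum.mono_neutral_right[OF fin])
    show "\<forall>R\<in>\<F> - ?F. ?T R = 0"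
    proof
      fix R assume "R \<in> \<F> - ?F"
      then have "b R = 0" using b(2)[of R] by auto
      then show "?T R = 0" by simp
    qed
  qed auto
  also have "\<dots> = (\<Sum>k\<le>N. \<Sum>R\<in>{R\<in>?F. kk R = k}. ?T R)"
    by (rule sum.group[symmetric]) (use fin kkN in auto)
  also have "\<dots> \<le> (\<Sum>k\<le>N. ennreal (?A k) * ?I + ennreal (?B k) * (ennreal (2 * real L0) * ?X))"
    by (rule sum_mono[OF level])
  also have "\<dots> = (\<Sum>k\<le>N. ennreal (?A k)) * ?I + (\<Sum>k\<le>N. ennreal (?B k)) * (ennreal (2 * real L0) * ?X)"
    by (simp only: sum.distrib sum_distrib_right)
  also have "(\<Sum>k\<le>N. ennreal (?A k)) = ennreal (\<Sum>k\<le>N. ?A k)"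
    by (rule sum_ennreal) (use \<eta>' r0 pos in auto)
  also have "(\<Sum>k\<le>N. ennreal (?B k)) = ennreal (\<Sum>k\<le>N. ?B k)"
    by (rule sum_ennreal) (use rd rt pos in auto)
  also have "ennreal (\<Sum>k\<le>N. ?A k) * ?I + ennreal (\<Sum>k\<le>N. ?B k) * (ennreal (2 * real L0) * ?X)
    \<le> ennreal (\<eta> * t) * ?I + ennreal (C3 * \<eta>' powr (- \<delta>) / (1 - rd) + C2 / (1 - rt)) * (ennreal (2 * real L0) * ?X)"
  proof (rule add_mono[OF mult_right_mono[OF ennreal_leI] mult_right_mono[OF ennreal_leI]])
    have "(\<Sum>k\<le>N. ?A k) = t * \<eta>' * (\<Sum>k\<le>N. r0 ^ k)" by (simp only: sum_distrib_left)
    also have "\<dots> \<le> t * \<eta>' * (1 / (1 - r0))" using geometric_le[of r0 N] r0 \<eta>' pos by (intro mult_left_mono) auto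
    also have "\<dots> = \<eta> * t" using r0 by (simp add: \<eta>'_def)
    finally show "(\<Sum>k\<le>N. ?A k) \<le> \<eta> * t" .
    have "(\<Sum>k\<le>N. ?B k) = C3 * \<eta>' powr (- \<delta>) * (\<Sum>k\<le>N. rd ^ k) + C2 * (\<Sum>k\<le>N. rt ^ k)"
      by (simp only: sum.distrib sum_distrib_left)
    also have "\<dots> \<le> C3 * \<eta>' powr (- \<delta>) * (1 / (1 - rd)) + C2 * (1 / (1 - rt))"
      using geometric_le[of rd N] geometric_le[of rt N] rd rt pos by (intro add_mono mult_left_mono) auto
    finally show "(\<Sum>k\<le>N. ?B k) \<le> C3 * \<eta>' powr (- \<delta>) / (1 - rd) + C2 / (1 - rt)" by simp
  qed auto
  also have "ennreal (C3 * \<eta>' powr (- \<delta>) / (1 - rd) + C2 / (1 - rt)) * (ennreal (2 * real L0) * ?X)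
    = ennreal (laminar_const C1 C2 C3 \<theta> \<delta> \<Lambda> \<eta>) * ?X"
  proof -
    have "0 \<le> C3 * \<eta>' powr (- \<delta>) / (1 - rd) + C2 / (1 - rt)" using pos rd rt by simp
    then have "ennreal (C3 * \<eta>' powr (- \<delta>) / (1 - rd) + C2 / (1 - rt)) * ennreal (2 * real L0)
      = ennreal ((C3 * \<eta>' powr (- \<delta>) / (1 - rd) + C2 / (1 - rt)) * (2 * real L0))"
      by (rule ennreal_mult'[symmetric])
    also have "(C3 * \<eta>' powr (- \<delta>) / (1 - rd) + C2 / (1 - rt)) * (2 * real L0) = laminar_const C1 C2 C3 \<theta> \<delta> \<Lambda> \<eta>"
      unfolding laminar_const_def L0_def \<eta>'_def r0_def rd_def rt_def by (simp only: mult.commute)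
    finally show ?thesis by (simp add: mult.assoc[symmetric])
  qed
  finally show ?thesis .
qed

subsection \<open>Orlicz averages with respect to the weight\<close>

text \<open>The conventions for division are harmless: over 0 the quotient is infinite unless the
  numerator is 0 as well, and for an infinite denominator the claim is trivial.\<close>

lemma ennreal_le_if_divide_le_1:
  fixes a b :: ennreal assumes "a / b \<le> 1" shows "a \<le> b"
proof (cases "b = 0 \<or> b = \<infinity>")
  case True
  then show ?thesis
  proof
    assume b: "b = 0"
    show ?thesis
    proof (cases "a = 0")
      case False
      then have "a / b = \<infinity>" using b by (simp add: ennreal_divide_zero)
      moreover have "a / b < \<infinity>" using le_less_trans[OF assms ennreal_one_less_top] by simp
      ultimately show ?thesis by simp
    qed simp
  qed simp
next
  case False
  then have "a = a / b * b" by (simp add: ennreal_divide_times ennreal_times_divide mult.commute mult_divide_eq_ennreal)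
  also have "\<dots> \<le> 1 * b" using assms by (rule mult_right_mono) simp
  finally show ?thesis by simp
qed

text \<open>Reduces a bound by a Luxemburg norm to a bound for each admissible \<open>r\<close>. If
  there is no such \<open>r\<close>, the right side is infinite because \<open>c\<close> is
  positive.\<close>

lemma ennreal_le_cmult_INF:
  fixes U :: ennreal
  assumes "0 < c" and "\<And>r. r \<in> A \<Longrightarrow> U \<le> ennreal c * f r"
  shows "U \<le> ennreal c * (INF r\<in>A. f r)"
proof -
  have 1: "ennreal c * ennreal (1 / c) = 1" using assms(1) by (simp flip: ennreal_mult')
  have "ennreal (1 / c) * U \<le> (INF r\<in>A. f r)"
  proof (rule INF_greatest)
    fix r assume "r \<in> A"
    from assms(2)[OF this] have "ennreal (1 / c) * U \<le> ennreal (1 / c) * (ennreal c * f r)" by (rule mult_left_mono) simp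
    also have "\<dots> = f r" using 1 by (simp add: mult.assoc[symmetric] mult.commute)
    finally show "ennreal (1 / c) * U \<le> f r" .
  qed
  then have "ennreal c * (ennreal (1 / c) * U) \<le> ennreal c * (INF r\<in>A. f r)" by (rule mult_left_mono) simp
  then show ?thesis using 1 by (simp add: mult.assoc[symmetric])
qed

lemma phi_log_ge: "0 \<le> z \<Longrightarrow> 0 \<le> \<delta> \<Longrightarrow> z \<le> phi_log \<delta> z"
  unfolding phi_log_def log_plus_def
  by (rule mult_left_mono[of 1 "(1 + max (ln z) 0) powr \<delta>" z, simplified]) (auto intro: ge_one_powr_ge_zero)

lemma phi_log_ge_large:
  assumes "1 \<le> T" "T \<le> z" "0 \<le> \<delta>" shows "z * (1 + ln T) powr \<delta> \<le> phi_log \<delta> z"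
  unfolding phi_log_def log_plus_def
proof (rule mult_left_mono)
  have "ln T \<le> ln z" "0 \<le> ln T" using assms by auto
  then show "(1 + ln T) powr \<delta> \<le> (1 + max (ln z) 0) powr \<delta>" using assms by (intro powr_mono2) auto
qed (use assms in simp)

text \<open>Spreading the exponential by
  \<open>1 + x \<le> (1 + \<delta>) * exp (x / (1 + \<delta>))\<close> leaves the exponent
  \<open>x * \<delta> / (1 + \<delta>)\<close>, at most \<open>x\<close>, after the power is
  taken.\<close>

lemma power_le_exp:
  fixes x \<delta> :: real assumes "0 \<le> x" "0 < \<delta>" shows "(1 + x) powr \<delta> \<le> (1 + \<delta>) powr \<delta> * exp x"
proof -
  have "1 + x \<le> (1 + \<delta>) * (1 + x / (1 + \<delta>))" using assms by (simp add: field_simps)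
  also have "\<dots> \<le> (1 + \<delta>) * exp (x / (1 + \<delta>))" using assms by (intro mult_left_mono exp_ge_add_one_self) auto
  finally have "(1 + x) powr \<delta> \<le> ((1 + \<delta>) * exp (x / (1 + \<delta>))) powr \<delta>" using assms by (intro powr_mono2) auto
  also have "\<dots> = (1 + \<delta>) powr \<delta> * exp (x / (1 + \<delta>) * \<delta>)"
    using assms by (simp add: powr_mult exp_powr_real)
  also have "\<dots> \<le> (1 + \<delta>) powr \<delta> * exp x"
  proof -
    have "x / (1 + \<delta>) * \<delta> \<le> x" using assms by (simp add: field_simps)
    then show ?thesis by (intro mult_left_mono) auto
  qed
  finally show ?thesis .
qed

text \<open>The two summands stem from the values of \<open>u\<close> below and above the threshold
  in \<open>small_set_bound\<close>. The factor with the minimum replaces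
  \<open>1 + L * ln z / 2\<close> by a multiple of \<open>1 + L\<close>.\<close>

definition orlicz_const :: "real \<Rightarrow> real \<Rightarrow> real \<Rightarrow> real \<Rightarrow> real \<Rightarrow> real" where
  "orlicz_const z \<delta> s C1 C2 = (min 1 (ln z / 2)) powr (- \<delta>) * (3 * (1 + \<delta>) powr \<delta> + C1 powr s * C2)"

lemma measure_cube_pos: "Q \<in> cubes \<Longrightarrow> 0 < measure lebesgue (Q :: (real ^ 'n) set)"
  by (force simp: cubes_def content_cbox_cart interval_eq_empty_cart)

text \<open>What is used of the weights, with \<open>s\<close> standing for q' - 1 = 1/(q - 1):
  \<open>v_le_avg\<close> is RH_infinity, and \<open>mass_w\<close> is the A_q condition solved for
  the mass of \<open>v powr (- s)\<close>. The constants are parameters so that they can be followed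
  to the end.\<close>

locale mixed_weights =
  fixes u v :: "real ^ 'n \<Rightarrow> real" and s \<delta> C1 C2 :: real
  assumes u_nonneg: "\<And>x. 0 \<le> u x" and u_meas: "u \<in> borel_measurable lebesgue"
    and v_meas: "v \<in> borel_measurable lebesgue" and v_pos: "AE x in lebesgue. 0 < v x"
    and s_pos: "0 < s" and delta_pos: "0 < \<delta>" and C1_pos: "0 < C1" and C2_pos: "0 < C2"
    and avg_pos: "\<And>Q. Q \<in> cubes \<Longrightarrow> 0 < avg v Q"
    and v_le_avg: "\<And>Q. Q \<in> cubes \<Longrightarrow> AE x in lebesgue. x \<in> Q \<longrightarrow> v x \<le> C1 * avg v Q"
    and mass_v: "\<And>Q. Q \<in> cubes \<Longrightarrow> mass v Q = ennreal (avg v Q * measure lebesgue Q)"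
    and mass_w: "\<And>Q. Q \<in> cubes \<Longrightarrow> mass (\<lambda>y. v y powr (- s)) Q
      \<le> ennreal (C2 * avg v Q powr (- s) * measure lebesgue Q)"
begin

abbreviation "lux \<equiv> \<lambda>Q. luxemburg_norm (phi_log \<delta>) Q (\<lambda>y. v y powr (- s)) u"

text \<open>Writes \<open>u\<close> as \<open>(u / r) * v powr (- s)\<close> times
  \<open>r * v powr s\<close>. The last power is at most \<open>h powr s\<close> on
  \<open>G\<close>. Up to \<open>1 / k\<close>, the gain of the Young function over the identity,
  the rest is the integrand of the norm, whose integral is at most the mass of
  \<open>v powr (- s)\<close> because \<open>r\<close> is admissible.\<close>

lemma phi_integral_bound:
  assumes Q: "Q \<in> cubes" and r: "0 < r"
    and le: "(\<integral>\<^sup>+y\<in>Q. ennreal (phi_log \<delta> (\<bar>u y\<bar> / r) * v y powr (- s)) \<partial>lebesgue) / mass (\<lambda>y. v y powr (- s)) Q \<le> 1"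
    and G: "G \<in> sets lebesgue" "G \<subseteq> Q" and h: "0 \<le> h" "AE x in lebesgue. x \<in> G \<longrightarrow> v x \<le> h"
    and k: "0 < k" "\<And>x. x \<in> G \<Longrightarrow> k * (u x / r) \<le> phi_log \<delta> (u x / r)"
  shows "(\<integral>\<^sup>+x. ennreal (u x) * indicator G x \<partial>lebesgue)
    \<le> ennreal (h powr s * (C2 * avg v Q powr (- s) * measure lebesgue Q) / k) * ennreal r"
proof -
  note [measurable] = u_meas v_meas G(1)
  let ?w = "\<lambda>y. v y powr (- s)" and ?ph = "\<lambda>y. phi_log \<delta> (\<bar>u y\<bar> / r)"
  have Qs [measurable]: "Q \<in> sets lebesgue" using Q by (auto simp: cubes_def)
  have phm [measurable]: "?ph \<in> borel_measurable lebesgue" unfolding phi_log_def log_plus_def by measurable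
  have I: "(\<integral>\<^sup>+y. ennreal (?ph y * ?w y) * indicator Q y \<partial>lebesgue) \<le> ennreal (C2 * avg v Q powr (- s) * measure lebesgue Q)"
    using order_trans[OF ennreal_le_if_divide_le_1[OF le] mass_w[OF Q]] .
  let ?c = "h powr s * r / k"
  have "(\<integral>\<^sup>+x. ennreal (u x) * indicator G x \<partial>lebesgue)
    \<le> (\<integral>\<^sup>+x. ennreal ?c * (ennreal (?ph x * ?w x) * indicator Q x) \<partial>lebesgue)"
  proof (rule nn_integral_mono_AE)
    show "AE x in lebesgue. ennreal (u x) * indicator G x \<le> ennreal ?c * (ennreal (?ph x * ?w x) * indicator Q x)"
      using v_pos h(2)
    proof eventually_elim
      case (elim x)
      show ?case
      proof (cases "x \<in> G")
        case True
        have vs: "v x powr (- s) * v x powr s = 1" using elim(1) by (simp flip: powr_add)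
        have "u x = (u x / r) * (v x powr (- s) * v x powr s) * r" using r vs by simp
        also have "\<dots> = v x powr s * r / k * (k * (u x / r) * v x powr (- s))" using k r by simp
        also have "\<dots> \<le> v x powr s * r / k * (?ph x * ?w x)"
          using k(2)[OF True] u_nonneg[of x] r k(1) by (intro mult_left_mono mult_right_mono) auto
        also have "\<dots> \<le> ?c * (?ph x * ?w x)"
        proof (intro mult_right_mono divide_right_mono)
          show "v x powr s \<le> h powr s" using elim True s_pos by (intro powr_mono2) auto
          show "0 \<le> ?ph x * ?w x" by (auto simp: phi_log_def intro!: mult_nonneg_nonneg divide_nonneg_nonneg less_imp_le[OF r])
        qed (use r k in auto)
        finally have "ennreal (u x) \<le> ennreal (?c * (?ph x * ?w x))" by (rule ennreal_leI)
        also have "\<dots> = ennreal ?c * ennreal (?ph x * ?w x)" by (rule ennreal_mult') (use r k in simp)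
        finally show ?thesis using True G(2) by (auto simp: indicator_def)
      qed simp
    qed
  qed
  also have "\<dots> = ennreal ?c * (\<integral>\<^sup>+x. ennreal (?ph x * ?w x) * indicator Q x \<partial>lebesgue)"
    by (rule nn_integral_cmult) measurable
  also have "\<dots> \<le> ennreal ?c * ennreal (C2 * avg v Q powr (- s) * measure lebesgue Q)"
    by (rule mult_left_mono[OF I]) simp
  also have "\<dots> = ennreal (h powr s * (C2 * avg v Q powr (- s) * measure lebesgue Q) / k) * ennreal r"
    using r k C2_pos by (simp add: ennreal_mult'[symmetric] ennreal_mult''[symmetric] mult_ac)
  finally show ?thesis .
qed

text \<open>With \<open>h = e * avg v Q\<close> the powers of the mean cancel and
  \<open>e powr s\<close> is left: A_q makes the contribution of the points with small
  \<open>v\<close> decay.\<close>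

lemma small_v_bound:
  assumes Q: "Q \<in> cubes" and e: "0 < e" and G: "G \<in> sets lebesgue" "G \<subseteq> Q" "\<And>x. x \<in> G \<Longrightarrow> v x < e * avg v Q"
  shows "(\<integral>\<^sup>+x. ennreal (u x) * indicator G x \<partial>lebesgue) \<le> ennreal (C2 * e powr s * measure lebesgue Q) * lux Q"
  unfolding luxemburg_norm_def
proof (rule ennreal_le_cmult_INF)
  let ?a = "avg v Q"
  have a: "0 < ?a" by (rule avg_pos[OF Q])
  show "0 < C2 * e powr s * measure lebesgue Q" using C2_pos e measure_cube_pos[OF Q] by simp
  fix r assume r: "r \<in> {r. 0 < r \<and> (\<integral>\<^sup>+y\<in>Q. ennreal (phi_log \<delta> (\<bar>u y\<bar> / r) * v y powr - s) \<partial>lebesgue) / mass (\<lambda>y. v y powr - s) Q \<le> 1}"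
  have "(\<integral>\<^sup>+x. ennreal (u x) * indicator G x \<partial>lebesgue)
     \<le> ennreal ((e * ?a) powr s * (C2 * ?a powr (- s) * measure lebesgue Q) / 1) * ennreal r"
  proof (rule phi_integral_bound[OF Q _ _ G(1,2)])
    show "AE x in lebesgue. x \<in> G \<longrightarrow> v x \<le> e * ?a" using G(3) by (auto intro: less_imp_le)
    show "1 * (u x / r) \<le> phi_log \<delta> (u x / r)" for x
      using phi_log_ge[of "u x / r" \<delta>] u_nonneg r delta_pos by simp
  qed (use r e a in auto)
  also have "(e * ?a) powr s * (C2 * ?a powr (- s) * measure lebesgue Q) / 1 = C2 * e powr s * measure lebesgue Q"
    using e a by (simp add: powr_mult powr_minus)
  finally show "(\<integral>\<^sup>+x. ennreal (u x) * indicator G x \<partial>lebesgue) \<le> ennreal (C2 * e powr s * measure lebesgue Q) * ennreal r" .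
qed

lemma whole_cube_bound:
  assumes Q: "Q \<in> cubes" and G: "G \<in> sets lebesgue" "G \<subseteq> Q"
  shows "(\<integral>\<^sup>+x. ennreal (u x) * indicator G x \<partial>lebesgue) \<le> ennreal (C1 powr s * C2 * measure lebesgue Q) * lux Q"
  unfolding luxemburg_norm_def
proof (rule ennreal_le_cmult_INF)
  let ?a = "avg v Q"
  have a: "0 < ?a" by (rule avg_pos[OF Q])
  show "0 < C1 powr s * C2 * measure lebesgue Q" using C1_pos C2_pos measure_cube_pos[OF Q] by simp
  fix r assume r: "r \<in> {r. 0 < r \<and> (\<integral>\<^sup>+y\<in>Q. ennreal (phi_log \<delta> (\<bar>u y\<bar> / r) * v y powr - s) \<partial>lebesgue) / mass (\<lambda>y. v y powr - s) Q \<le> 1}"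
  have "(\<integral>\<^sup>+x. ennreal (u x) * indicator G x \<partial>lebesgue)
     \<le> ennreal ((C1 * ?a) powr s * (C2 * ?a powr (- s) * measure lebesgue Q) / 1) * ennreal r"
  proof (rule phi_integral_bound[OF Q _ _ G])
    show "AE x in lebesgue. x \<in> G \<longrightarrow> v x \<le> C1 * ?a" using v_le_avg[OF Q] by eventually_elim (use G in auto)
    show "1 * (u x / r) \<le> phi_log \<delta> (u x / r)" for x
      using phi_log_ge[of "u x / r" \<delta>] u_nonneg r delta_pos by simp
  qed (use r C1_pos a in auto)
  also have "(C1 * ?a) powr s * (C2 * ?a powr (- s) * measure lebesgue Q) / 1 = C1 powr s * C2 * measure lebesgue Q"
    using C1_pos a by (simp add: powr_mult powr_minus)
  finally show "(\<integral>\<^sup>+x. ennreal (u x) * indicator G x \<partial>lebesgue) \<le> ennreal (C1 powr s * C2 * measure lebesgue Q) * ennreal r" .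
qed

text \<open>The values of \<open>u\<close> are split at \<open>T * r\<close> with
  \<open>T = z powr (L / 2)\<close>, the square root of the reciprocal of the decay assumed for
  \<open>G\<close>. Below it, \<open>T\<close> times the measure of \<open>G\<close> is still
  exponentially small in \<open>L\<close>, hence smaller than the required power. Above it, the
  logarithm in the Young function gains \<open>(1 + ln T) powr \<delta>\<close>, which is of the
  order of \<open>(1 + L) powr \<delta>\<close>.\<close>

lemma small_set_bound:
  assumes Q: "Q \<in> cubes" and z: "1 < z" and G: "G \<in> sets lebesgue" "G \<subseteq> Q"
    and small: "emeasure lebesgue G \<le> ennreal (3 * z powr (- real L) * measure lebesgue Q)"
  shows "(\<integral>\<^sup>+x. ennreal (u x) * indicator G x \<partial>lebesgue)
    \<le> ennreal (orlicz_const z \<delta> s C1 C2 * (1 + real L) powr (- \<delta>) * measure lebesgue Q) * lux Q"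
  unfolding luxemburg_norm_def
proof (rule ennreal_le_cmult_INF)
  note [measurable] = u_meas v_meas G(1)
  let ?a = "avg v Q" and ?m = "measure lebesgue Q"
  define y where "y = real L / 2 * ln z"
  define T where "T = exp y"
  define \<kappa> where "\<kappa> = min 1 (ln z / 2)"
  have lz: "0 < ln z" using z by simp
  have \<kappa>: "0 < \<kappa>" "\<kappa> \<le> 1" using lz by (auto simp: \<kappa>_def)
  have y0: "0 \<le> y" using lz by (simp add: y_def)
  have T1: "1 \<le> T" using y0 by (simp add: T_def)
  have m: "0 < ?m" by (rule measure_cube_pos[OF Q])
  have a: "0 < ?a" by (rule avg_pos[OF Q])
  show "0 < orlicz_const z \<delta> s C1 C2 * (1 + real L) powr (- \<delta>) * ?m"
    unfolding orlicz_const_def \<kappa>_def[symmetric] using \<kappa> m delta_pos C1_pos C2_pos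
    by (intro mult_pos_pos add_pos_pos) auto
  have yk: "(1 + y) powr (- \<delta>) \<le> \<kappa> powr (- \<delta>) * (1 + real L) powr (- \<delta>)"
  proof -
    have "\<kappa> * real L \<le> ln z / 2 * real L" unfolding \<kappa>_def by (intro mult_right_mono) auto
    then have "\<kappa> * (1 + real L) \<le> 1 + y" using \<kappa> by (simp add: y_def algebra_simps)
    then have "(1 + y) powr (- \<delta>) \<le> (\<kappa> * (1 + real L)) powr (- \<delta>)"
      using \<kappa> delta_pos by (intro powr_mono2') auto
    also have "\<dots> = \<kappa> powr (- \<delta>) * (1 + real L) powr (- \<delta>)" using \<kappa> by (simp add: powr_mult)
    finally show ?thesis .
  qed
  fix r assume r: "r \<in> {r. 0 < r \<and> (\<integral>\<^sup>+y\<in>Q. ennreal (phi_log \<delta> (\<bar>u y\<bar> / r) * v y powr - s) \<partial>lebesgue) / mass (\<lambda>y. v y powr - s) Q \<le> 1}"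
  then have r0: "0 < r" by simp
  let ?G1 = "G \<inter> {x\<in>space lebesgue. u x \<le> T * r}" and ?G2 = "G \<inter> {x\<in>space lebesgue. T * r < u x}"
  have G1: "?G1 \<in> sets lebesgue" and G2: "?G2 \<in> sets lebesgue" by measurable
  have "(\<integral>\<^sup>+x. ennreal (u x) * indicator G x \<partial>lebesgue)
    = (\<integral>\<^sup>+x. ennreal (u x) * indicator ?G1 x + ennreal (u x) * indicator ?G2 x \<partial>lebesgue)"
    by (rule nn_integral_cong) (auto simp: indicator_def)
  also have "\<dots> = (\<integral>\<^sup>+x. ennreal (u x) * indicator ?G1 x \<partial>lebesgue) + (\<integral>\<^sup>+x. ennreal (u x) * indicator ?G2 x \<partial>lebesgue)"
    by (rule nn_integral_add) measurable
  also have "\<dots> \<le> ennreal (\<kappa> powr (- \<delta>) * (1 + real L) powr (- \<delta>) * (3 * (1 + \<delta>) powr \<delta>) * ?m) * ennreal r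
     + ennreal (\<kappa> powr (- \<delta>) * (1 + real L) powr (- \<delta>) * (C1 powr s * C2) * ?m) * ennreal r"
  proof (rule add_mono)
    have "(\<integral>\<^sup>+x. ennreal (u x) * indicator ?G1 x \<partial>lebesgue) \<le> (\<integral>\<^sup>+x. ennreal (T * r) * indicator G x \<partial>lebesgue)"
      by (rule nn_integral_mono) (auto simp: indicator_def intro: ennreal_leI)
    also have "\<dots> = ennreal (T * r) * emeasure lebesgue G" by (rule nn_integral_cmult_indicator[OF G(1)])
    also have "\<dots> \<le> ennreal (T * r) * ennreal (3 * z powr (- real L) * ?m)" by (rule mult_left_mono[OF small]) simp
    also have "\<dots> = ennreal (T * (3 * z powr (- real L) * ?m)) * ennreal r"
      using T1 r0 m by (simp add: ennreal_mult'[symmetric] ennreal_mult''[symmetric] mult_ac)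
    also have "\<dots> \<le> ennreal (\<kappa> powr (- \<delta>) * (1 + real L) powr (- \<delta>) * (3 * (1 + \<delta>) powr \<delta>) * ?m) * ennreal r"
    proof (rule mult_right_mono[OF ennreal_leI])
      have "z powr (- real L) = exp (- 2 * y)" using z by (simp add: powr_def y_def)
      then have "T * z powr (- real L) = exp (- y)" by (simp add: T_def flip: exp_add)
      also have "\<dots> \<le> (1 + \<delta>) powr \<delta> * (1 + y) powr (- \<delta>)"
      proof -
        have "exp (- y) * ((1 + y) powr \<delta>) \<le> exp (- y) * ((1 + \<delta>) powr \<delta> * exp y)"
          using power_le_exp[OF y0 delta_pos] by (rule mult_left_mono) simp
        also have "\<dots> = (1 + \<delta>) powr \<delta>" by (simp add: exp_minus)
        finally have "exp (- y) * ((1 + y) powr \<delta>) \<le> (1 + \<delta>) powr \<delta>" .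
        then show ?thesis using y0 by (simp add: powr_minus pos_le_divide_eq[symmetric] divide_inverse)
      qed
      also have "\<dots> \<le> (1 + \<delta>) powr \<delta> * (\<kappa> powr (- \<delta>) * (1 + real L) powr (- \<delta>))"
        using yk by (rule mult_left_mono) simp
      finally have "(3 * ?m) * (T * z powr (- real L)) \<le> (3 * ?m) * ((1 + \<delta>) powr \<delta> * (\<kappa> powr (- \<delta>) * (1 + real L) powr (- \<delta>)))"
        using m by (intro mult_left_mono) auto
      then show "T * (3 * z powr (- real L) * ?m) \<le> \<kappa> powr (- \<delta>) * (1 + real L) powr (- \<delta>) * (3 * (1 + \<delta>) powr \<delta>) * ?m"
        by (simp only: mult_ac)
    qed simp
    finally show "(\<integral>\<^sup>+x. ennreal (u x) * indicator ?G1 x \<partial>lebesgue)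
      \<le> ennreal (\<kappa> powr (- \<delta>) * (1 + real L) powr (- \<delta>) * (3 * (1 + \<delta>) powr \<delta>) * ?m) * ennreal r" .
    have "(\<integral>\<^sup>+x. ennreal (u x) * indicator ?G2 x \<partial>lebesgue)
       \<le> ennreal ((C1 * ?a) powr s * (C2 * ?a powr (- s) * ?m) / (1 + y) powr \<delta>) * ennreal r"
    proof (rule phi_integral_bound[OF Q _ _ G2])
      show "?G2 \<subseteq> Q" using G(2) by blast
      show "AE x in lebesgue. x \<in> ?G2 \<longrightarrow> v x \<le> C1 * ?a" using v_le_avg[OF Q] by eventually_elim (use G in auto)
      fix x assume "x \<in> ?G2"
      then have "T \<le> u x / r" using r0 by (simp add: pos_le_divide_eq)
      from phi_log_ge_large[OF T1 this, of \<delta>] show "(1 + y) powr \<delta> * (u x / r) \<le> phi_log \<delta> (u x / r)"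
        using delta_pos by (simp add: T_def mult.commute)
    qed (use r C1_pos a y0 in auto)
    also have "\<dots> \<le> ennreal (\<kappa> powr (- \<delta>) * (1 + real L) powr (- \<delta>) * (C1 powr s * C2) * ?m) * ennreal r"
    proof (rule mult_right_mono[OF ennreal_leI])
      have "(C1 * ?a) powr s * (C2 * ?a powr (- s) * ?m) / (1 + y) powr \<delta> = (C1 powr s * C2 * ?m) * (1 + y) powr (- \<delta>)"
        using C1_pos a by (simp add: powr_mult powr_minus divide_inverse)
      also have "\<dots> \<le> (C1 powr s * C2 * ?m) * (\<kappa> powr (- \<delta>) * (1 + real L) powr (- \<delta>))"
        using yk C1_pos C2_pos m by (intro mult_left_mono) auto
      finally show "(C1 * ?a) powr s * (C2 * ?a powr (- s) * ?m) / (1 + y) powr \<delta>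
        \<le> \<kappa> powr (- \<delta>) * (1 + real L) powr (- \<delta>) * (C1 powr s * C2) * ?m" by (simp only: mult_ac)
    qed simp
    finally show "(\<integral>\<^sup>+x. ennreal (u x) * indicator ?G2 x \<partial>lebesgue)
      \<le> ennreal (\<kappa> powr (- \<delta>) * (1 + real L) powr (- \<delta>) * (C1 powr s * C2) * ?m) * ennreal r" .
  qed
  also have "\<dots> = ennreal (orlicz_const z \<delta> s C1 C2 * (1 + real L) powr (- \<delta>) * ?m) * ennreal r"
  proof -
    have "ennreal A * ennreal r + ennreal B * ennreal r = ennreal (A + B) * ennreal r" if "0 \<le> A" "0 \<le> B" for A B
      using that by (simp add: distrib_right)
    moreover have "0 \<le> \<kappa> powr (- \<delta>) * (1 + real L) powr (- \<delta>) * (3 * (1 + \<delta>) powr \<delta>) * ?m"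
      "0 \<le> \<kappa> powr (- \<delta>) * (1 + real L) powr (- \<delta>) * (C1 powr s * C2) * ?m" using C2_pos by auto
    moreover have "\<kappa> powr (- \<delta>) * (1 + real L) powr (- \<delta>) * (3 * (1 + \<delta>) powr \<delta>) * ?m
      + \<kappa> powr (- \<delta>) * (1 + real L) powr (- \<delta>) * (C1 powr s * C2) * ?m
      = orlicz_const z \<delta> s C1 C2 * (1 + real L) powr (- \<delta>) * ?m"
      unfolding orlicz_const_def \<kappa>_def[symmetric] by (simp add: algebra_simps)
    ultimately show ?thesis by presburger
  qed
  finally show "(\<integral>\<^sup>+x. ennreal (u x) * indicator G x \<partial>lebesgue)
    \<le> ennreal (orlicz_const z \<delta> s C1 C2 * (1 + real L) powr (- \<delta>) * ?m) * ennreal r" .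
qed

end

section \<open>Half-open cubes\<close>

definition half_open :: "real ^ 'n \<Rightarrow> real \<Rightarrow> (real ^ 'n) set" where
  "half_open a l = {p. \<forall>k. a $ k \<le> p $ k \<and> p $ k < a $ k + l}"

definition closed_cube :: "real ^ 'n \<Rightarrow> real \<Rightarrow> (real ^ 'n) set" where
  "closed_cube a l = cbox a (a + (\<chi> i. l))"

lemma closed_cube_in_cubes: "0 < l \<Longrightarrow> closed_cube a l \<in> cubes"
  by (auto simp: closed_cube_def cubes_def)

lemma half_open_subset: "half_open a l \<subseteq> closed_cube a l"
  by (simp add: half_open_def closed_cube_def mem_box_cart subset_iff less_imp_le)

lemma sets_half_open [measurable]: "half_open a l \<in> sets lebesgue"
proof -
  have "half_open a l = (\<Inter>k. {p. a $ k \<le> p $ k} \<inter> {p. p $ k < a $ k + l})"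
    by (auto simp: half_open_def)
  moreover have "{p. a $ k \<le> p $ k} \<inter> {p. p $ k < a $ k + l} \<in> sets borel" for k
    using closed_halfspace_component_ge_cart[of "a $ k" k] open_halfspace_component_lt_cart[of k "a $ k + l"]
    by (intro sets.Int borel_closed borel_open) auto
  ultimately show ?thesis by (simp add: sets.countable_INT')
qed

text \<open>The two sets differ inside the boundary of a box, a null set. Half-open cubes partition
  the space exactly, whereas \<open>cubes\<close> consists of closed ones; means and norms do not
  see the difference.\<close>

lemma AE_half_open: "AE p in lebesgue. p \<in> half_open a l \<longleftrightarrow> p \<in> closed_cube a l"
proof -
  have "cbox a (a + (\<chi> i. l)) - box a (a + (\<chi> i. l)) \<in> null_sets lebesgue"
    using negligible_frontier_interval negligible_iff_null_sets by blast
  then have "AE p in lebesgue. p \<notin> cbox a (a + (\<chi> i. l)) - box a (a + (\<chi> i. l))"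
    by (rule AE_not_in)
  then show ?thesis
  proof eventually_elim
    case (elim p)
    have "box a (a + (\<chi> i. l)) \<subseteq> half_open a l"
      by (auto simp: half_open_def mem_box_cart intro: less_imp_le)
    then show ?case using elim half_open_subset[of a l] unfolding closed_cube_def by blast
  qed
qed

lemma emeasure_closed_cube: "0 \<le> l \<Longrightarrow> emeasure lebesgue (closed_cube (a :: real ^ 'n) l) = ennreal (l ^ CARD('n))"
proof -
  assume l: "0 \<le> l"
  then have "cbox a (a + (\<chi> i. l)) \<noteq> {}" by (simp add: interval_ne_empty_cart)
  then have "measure lborel (cbox a (a + (\<chi> i. l))) = l ^ CARD('n)"
    by (simp add: content_cbox_cart)
  moreover have "emeasure lborel (cbox a (a + (\<chi> i. l))) \<noteq> \<infinity>"
    using emeasure_lborel_cbox_finite[of a "a + (\<chi> i. l)"] by simp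
  ultimately have "emeasure lborel (cbox a (a + (\<chi> i. l))) = ennreal (l ^ CARD('n))"
    by (simp add: emeasure_eq_ennreal_measure)
  then show ?thesis unfolding closed_cube_def by simp
qed

lemma measure_closed_cube: "0 \<le> l \<Longrightarrow> measure lebesgue (closed_cube (a :: real ^ 'n) l) = l ^ CARD('n)"
  using emeasure_closed_cube[of l a] by (simp add: measure_def)

lemma sets_closed_cube [measurable]: "closed_cube a l \<in> sets lebesgue"
  by (simp add: closed_cube_def)

lemma emeasure_half_open: "0 \<le> l \<Longrightarrow> emeasure lebesgue (half_open (a :: real ^ 'n) l) = ennreal (l ^ CARD('n))"
  using emeasure_closed_cube[of l a]
    emeasure_eq_AE[OF AE_half_open[of a l] sets_half_open sets_closed_cube] by simp

lemma measure_half_open: "0 \<le> l \<Longrightarrow> measure lebesgue (half_open (a :: real ^ 'n) l) = l ^ CARD('n)"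
  using emeasure_half_open[of l a] by (simp add: measure_def)

subsection \<open>Square integrable functions\<close>

definition l2n :: "(real ^ 'n \<Rightarrow> complex) \<Rightarrow> real" where
  "l2n f = sqrt (\<integral>x. (norm (f x))\<^sup>2 \<partial>lebesgue)"

lemma L2_measurable: "f \<in> L2 \<Longrightarrow> f \<in> borel_measurable lebesgue" by (simp add: L2_def)

lemma l2n_nonneg [simp]: "0 \<le> l2n f" by (simp add: l2n_def)

lemma L2_cmult: "f \<in> L2 \<Longrightarrow> (\<lambda>x. a * f x) \<in> L2"
  by (auto simp: L2_def norm_mult power_mult_distrib)

lemma L2_add: assumes "f \<in> L2" "g \<in> L2" shows "(\<lambda>x. f x + g x) \<in> L2"
proof -
  have [measurable]: "f \<in> borel_measurable lebesgue" "g \<in> borel_measurable lebesgue"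
    using assms by (auto simp: L2_def)
  have "integrable lebesgue (\<lambda>x. (norm (f x + g x))\<^sup>2)"
  proof (rule Bochner_Integration.integrable_bound)
    show "integrable lebesgue (\<lambda>x. 2 * (norm (f x))\<^sup>2 + 2 * (norm (g x))\<^sup>2)"
      using assms by (intro Bochner_Integration.integrable_add integrable_mult_right) (auto simp: L2_def)
    have "(norm (f x + g x))\<^sup>2 \<le> 2 * (norm (f x))\<^sup>2 + 2 * (norm (g x))\<^sup>2" for x
    proof -
      have "(norm (f x + g x))\<^sup>2 \<le> (norm (f x) + norm (g x))\<^sup>2"
        by (intro power_mono norm_triangle_ineq) auto
      also have "\<dots> \<le> 2 * (norm (f x))\<^sup>2 + 2 * (norm (g x))\<^sup>2"
        using zero_le_power2[of "norm (f x) - norm (g x)"] by (simp add: power2_sum power2_diff)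
      finally show ?thesis .
    qed
    then show "AE x in lebesgue. norm ((norm (f x + g x))\<^sup>2) \<le> norm (2 * (norm (f x))\<^sup>2 + 2 * (norm (g x))\<^sup>2)"
      by auto
  qed measurable
  then show ?thesis by (simp add: L2_def)
qed

lemma L2_zero: "(\<lambda>_. 0) \<in> L2" by (simp add: L2_def)

lemma L2_sum: "finite I \<Longrightarrow> (\<And>i. i \<in> I \<Longrightarrow> f i \<in> L2) \<Longrightarrow> (\<lambda>x. \<Sum>i\<in>I. f i x) \<in> L2"
  by (induction I rule: finite_induct) (auto intro: L2_zero L2_add)

lemma L2_bounded:
  assumes "f \<in> borel_measurable lebesgue" "\<And>x. norm (f x) \<le> M" "\<And>x. x \<notin> S \<Longrightarrow> f x = 0"
    "S \<in> sets lebesgue" "emeasure lebesgue S < \<infinity>"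
  shows "f \<in> L2"
proof -
  note [measurable] = assms(1)
  have "integrable lebesgue (\<lambda>x. (norm (f x))\<^sup>2)"
  proof (rule integrableI_bounded_set[where A = S and B = "M\<^sup>2"])
    show "AE x in lebesgue. x \<in> S \<longrightarrow> norm ((norm (f x))\<^sup>2) \<le> M\<^sup>2"
      using assms(2) by (auto intro!: power_mono)
  qed (use assms in auto)
  then show ?thesis using assms(1) by (simp add: L2_def)
qed

lemma ennreal_le_if_power2_le:
  fixes a :: ennreal assumes "0 \<le> b" "a\<^sup>2 \<le> (ennreal b)\<^sup>2" shows "a \<le> ennreal b"
proof (cases a)
  case (real r)
  then have "r\<^sup>2 \<le> b\<^sup>2" using assms by (simp add: ennreal_power)
  then have "r \<le> b" using assms(1) by (rule power2_le_imp_le)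
  then show ?thesis by (simp add: real ennreal_leI)
next
  case top
  then show ?thesis using assms by (simp add: ennreal_power top_unique)
qed

lemma L2_product:
  assumes "f \<in> L2" "g \<in> L2"
  shows "integrable lebesgue (\<lambda>x. f x * g x)" "norm (\<integral>x. f x * g x \<partial>lebesgue) \<le> l2n f * l2n g"
    "(\<integral>\<^sup>+x. ennreal (norm (f x) * norm (g x)) \<partial>lebesgue) \<le> ennreal (l2n f * l2n g)"
proof -
  have [measurable]: "f \<in> borel_measurable lebesgue" "g \<in> borel_measurable lebesgue"
    using assms by (auto simp: L2_def)
  have sq: "(\<integral>\<^sup>+x. (ennreal (norm (f x)))\<^sup>2 \<partial>lebesgue) = ennreal ((l2n f)\<^sup>2)" if "f \<in> L2" for f :: "real ^ 'n \<Rightarrow> complex"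
    using that unfolding L2_def l2n_def
    by (simp add: ennreal_power nn_integral_eq_integral integral_nonneg_AE)
  have "(\<integral>\<^sup>+x. ennreal (norm (f x)) * ennreal (norm (g x)) \<partial>lebesgue)\<^sup>2 \<le> ennreal ((l2n f)\<^sup>2) * ennreal ((l2n g)\<^sup>2)"
    unfolding sq[OF assms(1), symmetric] sq[OF assms(2), symmetric]
    by (rule Cauchy_Schwarz_nn_integral) measurable
  also have "\<dots> = (ennreal (l2n f * l2n g))\<^sup>2"
    by (simp add: ennreal_mult' power_mult_distrib ennreal_power)
  finally have "(\<integral>\<^sup>+x. ennreal (norm (f x)) * ennreal (norm (g x)) \<partial>lebesgue) \<le> ennreal (l2n f * l2n g)"
    by (rule ennreal_le_if_power2_le[rotated]) simp
  then show le: "(\<integral>\<^sup>+x. ennreal (norm (f x) * norm (g x)) \<partial>lebesgue) \<le> ennreal (l2n f * l2n g)"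
    by (simp add: ennreal_mult')
  show int: "integrable lebesgue (\<lambda>x. f x * g x)"
    by (rule integrableI_bounded) (use le in \<open>auto simp: norm_mult le_less_trans\<close>)
  have "ennreal (norm (\<integral>x. f x * g x \<partial>lebesgue)) \<le> (\<integral>\<^sup>+x. ennreal (norm (f x * g x)) \<partial>lebesgue)"
    by (rule integral_norm_bound_ennreal[OF int])
  also have "\<dots> \<le> ennreal (l2n f * l2n g)" using le by (simp add: norm_mult)
  finally show "norm (\<integral>x. f x * g x \<partial>lebesgue) \<le> l2n f * l2n g" by simp
qed

subsection \<open>The bilinear form of a singular integral operator\<close>

text \<open>All constants are merged into a single \<open>c\<close>, and the smoothness condition is
  stated for two vectors in place of \<open>x - y\<close> and \<open>x - z\<close>.\<close>

locale singular_operator =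
  fixes T :: "(real ^ 'n \<Rightarrow> complex) \<Rightarrow> real ^ 'n \<Rightarrow> complex" and K :: "real ^ 'n \<Rightarrow> complex" and c :: real
  assumes T_L2: "\<And>f. f \<in> L2 \<Longrightarrow> T f \<in> L2"
    and T_linear: "\<And>f g a b. f \<in> L2 \<Longrightarrow> g \<in> L2 \<Longrightarrow>
      AE x in lebesgue. T (\<lambda>y. a * f y + b * g y) x = a * T f x + b * T g x"
    and T_bound: "\<And>f. f \<in> L2 \<Longrightarrow> l2n (T f) \<le> c * l2n f"
    and c_pos: "0 < c"
    and K_size: "\<And>x. x \<noteq> 0 \<Longrightarrow> norm (K x) \<le> c / norm x ^ CARD('n)"
    and K_smooth: "\<And>a b. 2 * norm (a - b) < norm a \<Longrightarrow>
      norm (K a - K b) \<le> c * (norm (a - b) / norm a ^ (CARD('n) + 1))"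
    and T_kernel: "\<And>f. f \<in> L2 \<Longrightarrow> compact (supp f) \<Longrightarrow>
      AE x in lebesgue. x \<notin> supp f \<longrightarrow> T f x = (\<integral>y. K (x - y) * f y \<partial>lebesgue)"

lemma calderon_zygmund_singular_operator:
  assumes "calderon_zygmund (T :: (real ^ 'n \<Rightarrow> complex) \<Rightarrow> real ^ 'n \<Rightarrow> complex)"
  obtains K c where "singular_operator T K c"
proof -
  have B: "bounded_linear_L2 T" using assms by (simp add: calderon_zygmund_def)
  obtain K where K: "cz_kernel K" "\<And>f. f \<in> L2 \<Longrightarrow> compact (supp f) \<Longrightarrow>
      AE x in lebesgue. x \<notin> supp f \<longrightarrow> T f x = (\<integral>y. K (x - y) * f y \<partial>lebesgue)"
    using assms unfolding calderon_zygmund_def by blast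
  obtain c1 where c1: "0 < c1" "\<And>x. x \<noteq> 0 \<Longrightarrow> norm (K x) \<le> c1 * (1 / norm x ^ CARD('n))"
    using K(1) unfolding cz_kernel_def by blast
  obtain c2 where c2: "0 < c2" "\<And>x y z. norm (x - y) > 2 * norm (y - z) \<Longrightarrow>
        norm (K (x - y) - K (x - z)) \<le> c2 * (norm (y - z) / norm (x - y) ^ (CARD('n) + 1))"
    using K(1) unfolding cz_kernel_def by blast
  obtain c3 where c3: "0 < c3" "\<And>f. f \<in> L2 \<Longrightarrow> l2n (T f) \<le> c3 * l2n f"
    using B unfolding bounded_linear_L2_def l2n_def by blast
  define c where "c = c1 + c2 + c3"
  have c: "c1 \<le> c" "c2 \<le> c" "c3 \<le> c" "0 < c" using c1 c2 c3 by (auto simp: c_def)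
  have "singular_operator T K c"
  proof
    show "T f \<in> L2" if "f \<in> L2" for f using B that unfolding bounded_linear_L2_def by blast
    show "AE x in lebesgue. T (\<lambda>y. a * f y + b * g y) x = a * T f x + b * T g x"
      if "f \<in> L2" "g \<in> L2" for f g a b using B that unfolding bounded_linear_L2_def by blast
    show "l2n (T f) \<le> c * l2n f" if "f \<in> L2" for f
      using c3(2)[OF that] mult_right_mono[OF c(3) l2n_nonneg[of f]] by linarith
    show "0 < c" by (rule c(4))
    show "norm (K x) \<le> c / norm x ^ CARD('n)" if "x \<noteq> 0" for x
    proof -
      have "norm (K x) \<le> c1 / norm x ^ CARD('n)" using c1(2)[OF that] by simp
      also have "\<dots> \<le> c / norm x ^ CARD('n)" using c by (intro divide_right_mono) auto
      finally show ?thesis .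
    qed
    show "norm (K a - K b) \<le> c * (norm (a - b) / norm a ^ (CARD('n) + 1))" if "2 * norm (a - b) < norm a" for a b
    proof -
      have "norm (K a - K b) \<le> c2 * (norm (a - b) / norm a ^ (CARD('n) + 1))"
        using c2(2)[where x = a and y = 0 and z = "a - b"] that by (simp add: norm_minus_commute)
      also have "\<dots> \<le> c * (norm (a - b) / norm a ^ (CARD('n) + 1))"
        using c by (intro mult_right_mono) auto
      finally show ?thesis .
    qed
  qed (rule K(2))
  then show ?thesis using that by blast
qed

context singular_operator
begin

text \<open>Without a complex conjugate, so that the form is linear in both arguments like the
  discrete form \<open>bf\<close>.\<close>

definition Bt :: "(real ^ 'n \<Rightarrow> complex) \<Rightarrow> (real ^ 'n \<Rightarrow> complex) \<Rightarrow> complex" where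
  "Bt f g = (\<integral>x. T f x * g x \<partial>lebesgue)"

lemma Bt_bound: "f \<in> L2 \<Longrightarrow> g \<in> L2 \<Longrightarrow> norm (Bt f g) \<le> c * l2n f * l2n g"
  unfolding Bt_def
  by (rule order_trans[OF L2_product(2)[OF T_L2]]) (auto intro: mult_right_mono T_bound)

lemma Bt_linear_left:
  assumes "f \<in> L2" "g \<in> L2" "w \<in> L2"
  shows "Bt (\<lambda>y. a * f y + b * g y) w = a * Bt f w + b * Bt g w"
proof -
  have fg: "(\<lambda>y. a * f y + b * g y) \<in> L2" by (intro L2_add L2_cmult assms)
  have "Bt (\<lambda>y. a * f y + b * g y) w = (\<integral>x. a * (T f x * w x) + b * (T g x * w x) \<partial>lebesgue)"
    unfolding Bt_def
  proof (rule integral_cong_AE)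
    show "AE x in lebesgue. T (\<lambda>y. a * f y + b * g y) x * w x = a * (T f x * w x) + b * (T g x * w x)"
      using T_linear[OF assms(1,2), of a b] by eventually_elim (simp add: algebra_simps)
  qed (use L2_measurable[OF T_L2[OF fg]] L2_measurable[OF T_L2[OF assms(1)]] L2_measurable[OF T_L2[OF assms(2)]]
        L2_measurable[OF assms(3)] in measurable)
  also have "\<dots> = a * Bt f w + b * Bt g w"
    unfolding Bt_def using L2_product(1)[OF T_L2[OF assms(1)] assms(3)] L2_product(1)[OF T_L2[OF assms(2)] assms(3)]
    by (subst Bochner_Integration.integral_add) auto
  finally show ?thesis .
qed

lemma Bt_linear_right:
  assumes "f \<in> L2" "g \<in> L2" "w \<in> L2"
  shows "Bt w (\<lambda>y. a * f y + b * g y) = a * Bt w f + b * Bt w g"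
proof -
  have "Bt w (\<lambda>y. a * f y + b * g y) = (\<integral>x. a * (T w x * f x) + b * (T w x * g x) \<partial>lebesgue)"
    unfolding Bt_def by (simp add: algebra_simps)
  also have "\<dots> = a * Bt w f + b * Bt w g"
    unfolding Bt_def using L2_product(1)[OF T_L2[OF assms(3)] assms(1)] L2_product(1)[OF T_L2[OF assms(3)] assms(2)]
    by (subst Bochner_Integration.integral_add) auto
  finally show ?thesis .
qed

lemma Bt_sum_left:
  assumes "finite I" "\<And>i. i \<in> I \<Longrightarrow> f i \<in> L2" "w \<in> L2"
  shows "Bt (\<lambda>y. \<Sum>i\<in>I. a i * f i y) w = (\<Sum>i\<in>I. a i * Bt (f i) w)"
  using assms(1,2)
proof (induction I rule: finite_induct)
  case empty
  then show ?case using Bt_linear_left[OF L2_zero L2_zero assms(3), of 0 0] by simp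
next
  case (insert i I)
  have "(\<lambda>y. \<Sum>i\<in>I. a i * f i y) \<in> L2" by (rule L2_sum) (use insert in \<open>auto intro: L2_cmult\<close>)
  then show ?case
    using Bt_linear_left[of "f i" "\<lambda>y. \<Sum>i\<in>I. a i * f i y" w "a i" 1] insert assms(3) by simp
qed

lemma Bt_sum_right:
  assumes "finite I" "\<And>i. i \<in> I \<Longrightarrow> f i \<in> L2" "w \<in> L2"
  shows "Bt w (\<lambda>y. \<Sum>i\<in>I. a i * f i y) = (\<Sum>i\<in>I. a i * Bt w (f i))"
  using assms(1,2)
proof (induction I rule: finite_induct)
  case empty
  then show ?case using Bt_linear_right[OF L2_zero L2_zero assms(3), of 0 0] by simp
next
  case (insert i I)
  have "(\<lambda>y. \<Sum>i\<in>I. a i * f i y) \<in> L2" by (rule L2_sum) (use insert in \<open>auto intro: L2_cmult\<close>)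
  then show ?case
    using Bt_linear_right[of "f i" "\<lambda>y. \<Sum>i\<in>I. a i * f i y" w "a i" 1] insert assms(3) by simp
qed

text \<open>The smoothness condition covers only perturbations of less than half the length. For
  larger ones \<open>L \<le> 2 * D\<close>, and the size of the two values alone is at most
  \<open>4 * c * D / L ^ (n + 1)\<close>.\<close>

lemma K_smooth_far:
  assumes a: "L \<le> norm a" and b: "L \<le> norm b" and L: "0 < L" and ab: "norm (a - b) \<le> D"
  shows "norm (K a - K b) \<le> 5 * c * D / L ^ (CARD('n) + 1)"
proof (cases "2 * norm (a - b) < norm a")
  case True
  have D: "0 \<le> D" using order_trans[OF norm_ge_zero ab] .
  have "norm (K a - K b) \<le> c * (norm (a - b) / norm a ^ (CARD('n) + 1))" by (rule K_smooth[OF True])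
  also have "\<dots> \<le> c * (D / L ^ (CARD('n) + 1))"
    using c_pos ab a L D by (intro mult_left_mono frac_le power_mono) auto
  finally have "norm (K a - K b) \<le> c * (D / L ^ (CARD('n) + 1))" .
  moreover have "0 \<le> c * (D / L ^ (CARD('n) + 1))" using c_pos D L by simp
  moreover have "x \<le> 5 * y" if "x \<le> y" "0 \<le> y" for x y :: real using that by simp
  ultimately have "norm (K a - K b) \<le> 5 * (c * (D / L ^ (CARD('n) + 1)))" by blast
  then show ?thesis by simp
next
  case False
  then have LD: "L \<le> 2 * D" using a ab by linarith
  have nz: "a \<noteq> 0" "b \<noteq> 0" using a b L by auto
  have le: "c / norm d ^ CARD('n) \<le> c / L ^ CARD('n)" if "L \<le> norm d" for d :: "real ^ 'n"
    using that c_pos L by (intro frac_le power_mono) auto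
  have "norm (K a) \<le> c / L ^ CARD('n)" "norm (K b) \<le> c / L ^ CARD('n)"
    by (rule order_trans[OF K_size[OF nz(1)] le[OF a]], rule order_trans[OF K_size[OF nz(2)] le[OF b]])
  then have "norm (K a - K b) \<le> 2 * (c / L ^ CARD('n))"
    using norm_triangle_ineq4[of "K a" "K b"] by linarith
  also have "\<dots> = 2 * c * L / L ^ (CARD('n) + 1)" using L by simp
  also have "\<dots> \<le> 5 * c * D / L ^ (CARD('n) + 1)"
    using LD L c_pos by (intro divide_right_mono) auto
  finally show ?thesis .
qed

text \<open>Serves to integrate the kernel over a cell away from its singularity; the smoothness
  condition applies to all small perturbations.\<close>

lemma continuous_on_K: "continuous_on (- {0}) K"
proof (rule continuous_at_imp_continuous_on, rule ballI)
  fix a :: "real ^ 'n" assume "a \<in> - {0}"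
  then have a: "0 < norm a" by simp
  show "isCont K a"
    unfolding isCont_def
  proof (rule LIM_I)
    fix e :: real assume e: "0 < e"
    define d where "d = min (norm a / 2) (e * norm a ^ (CARD('n) + 1) / c)"
    have d: "0 < d" unfolding d_def using a e c_pos by simp
    show "\<exists>d>0. \<forall>x'. x' \<noteq> a \<and> norm (x' - a) < d \<longrightarrow> norm (K x' - K a) < e"
    proof (intro exI[of _ d] conjI allI impI d)
      fix b assume "b \<noteq> a \<and> norm (b - a) < d"
      then have b: "norm (b - a) < d" by simp
      then have "2 * norm (a - b) < norm a" by (simp add: d_def norm_minus_commute)
      then have "norm (K a - K b) \<le> c * (norm (a - b) / norm a ^ (CARD('n) + 1))" by (rule K_smooth)
      also have "\<dots> < c * ((e * norm a ^ (CARD('n) + 1) / c) / norm a ^ (CARD('n) + 1))"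
        using b a c_pos by (intro mult_strict_left_mono divide_strict_right_mono) (auto simp: d_def norm_minus_commute)
      also have "\<dots> = e" using a c_pos by simp
      finally show "norm (K b - K a) < e" by (simp add: norm_minus_commute)
    qed
  qed
qed

end

subsection \<open>Discretization of the operator\<close>

text \<open>The kernel scales with exponent - n, so the factor \<open>h ^ n\<close> removes the mesh
  from the smoothness bounds.\<close>

lemma scale_cancel:
  fixes h c :: real assumes "0 < h"
  shows "h ^ n * (c * (d * h) / (2 ^ m * h) ^ (n + 1)) = c * d / 2 ^ (m * (n + 1))"
proof -
  have "(2 ^ m * h) ^ (n + 1) = 2 ^ (m * (n + 1)) * (h ^ n * h)"
    unfolding power_mult_distrib power_mult[symmetric] by simp
  then show ?thesis using assms by simp
qed

locale grid = singular_operator T K c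
  for T :: "(real ^ 'n \<Rightarrow> complex) \<Rightarrow> real ^ 'n \<Rightarrow> complex" and K :: "real ^ 'n \<Rightarrow> complex" and c :: real +
  fixes a0 :: "real ^ 'n" and h :: real
  assumes h_pos: "0 < h"
begin

definition gi :: "real ^ 'n \<Rightarrow> 'n \<Rightarrow> int" where "gi p = (\<lambda>k. \<lfloor>(p $ k - a0 $ k) / h\<rfloor>)"

definition corner :: "('n \<Rightarrow> int) \<Rightarrow> real ^ 'n" where "corner i = (\<chi> k. a0 $ k + h * of_int (i k))"

definition cell :: "('n \<Rightarrow> int) \<Rightarrow> (real ^ 'n) set" where "cell i = half_open (corner i) h"

definition reg_corner :: "int \<Rightarrow> nat \<times> ('n \<Rightarrow> int) \<Rightarrow> real ^ 'n" where
  "reg_corner d P = (\<chi> k. a0 $ k + h * 2 ^ fst P * of_int (snd P k - d))"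

definition reg_side :: "int \<Rightarrow> nat \<times> ('n \<Rightarrow> int) \<Rightarrow> real" where
  "reg_side d P = of_int (2 * d + 1) * 2 ^ fst P * h"

text \<open>The region of space covered by the cells with index in \<open>dil d P\<close>. By
  \<open>reg_iff\<close>, relations between dilates of integer cubes become relations between
  half-open cubes.\<close>

definition reg :: "int \<Rightarrow> nat \<times> ('n \<Rightarrow> int) \<Rightarrow> (real ^ 'n) set" where
  "reg d P = half_open (reg_corner d P) (reg_side d P)"

lemma reg_iff: "p \<in> reg d P \<longleftrightarrow> gi p \<in> dil d P"
proof -
  have "(a0 $ k + h * 2 ^ j * of_int (b - d) \<le> y \<and> y < a0 $ k + h * 2 ^ j * of_int (b - d) + of_int (2 * d + 1) * 2 ^ j * h)
    \<longleftrightarrow> (b - d) * 2 ^ j \<le> \<lfloor>(y - a0 $ k) / h\<rfloor> \<and> \<lfloor>(y - a0 $ k) / h\<rfloor> < (b + d + 1) * 2 ^ j" for y :: real and b k j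
  proof -
    have 1: "a0 $ k + h * 2 ^ j * of_int (b - d) \<le> y \<longleftrightarrow> of_int ((b - d) * 2 ^ j) \<le> (y - a0 $ k) / h"
      unfolding pos_le_divide_eq[OF h_pos] by (simp add: algebra_simps)
    have 2: "y < a0 $ k + h * 2 ^ j * of_int (b - d) + of_int (2 * d + 1) * 2 ^ j * h
       \<longleftrightarrow> (y - a0 $ k) / h < of_int ((b + d + 1) * 2 ^ j)"
      unfolding pos_divide_less_eq[OF h_pos] by (simp add: algebra_simps)
    show ?thesis unfolding 1 2 le_floor_iff floor_less_iff ..
  qed
  then show ?thesis
    unfolding reg_def half_open_def reg_corner_def reg_side_def
    by (cases P) (simp add: dil_box PiE_def Pi_def gi_def extensional_def)
qed

lemma cell_iff: "p \<in> cell i \<longleftrightarrow> gi p = i"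
proof -
  have "cell i = reg 0 (0, i)"
    by (simp add: cell_def reg_def corner_def reg_corner_def reg_side_def)
  then show ?thesis unfolding reg_iff by (auto simp: reg_iff dil_def)
qed

lemma sets_cell [measurable]: "cell i \<in> sets lebesgue" by (simp add: cell_def)

lemma sets_reg [measurable]: "reg d P \<in> sets lebesgue" by (simp add: reg_def)

lemma measure_cell: "measure lebesgue (cell i) = h ^ CARD('n)" "emeasure lebesgue (cell i) = ennreal (h ^ CARD('n))"
  by (simp_all only: cell_def measure_half_open[OF less_imp_le[OF h_pos]] emeasure_half_open[OF less_imp_le[OF h_pos]])

definition ch :: "('n \<Rightarrow> int) \<Rightarrow> real ^ 'n \<Rightarrow> complex" where "ch i = (\<lambda>p. of_real (indicator (cell i) p))"

lemma ch_L2: "ch i \<in> L2"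
  by (rule L2_bounded[where M = 1 and S = "cell i"])
     (auto simp: ch_def measure_cell indicator_def of_bool_def intro!: borel_measurable_indicator)

lemma norm_ch: "norm (ch i p) = indicator (cell i) p" by (simp add: ch_def indicator_def)

definition stepf :: "('n \<Rightarrow> int) set \<Rightarrow> (('n \<Rightarrow> int) \<Rightarrow> complex) \<Rightarrow> real ^ 'n \<Rightarrow> complex" where
  "stepf U F = (\<lambda>p. \<Sum>y\<in>U. F y * ch y p)"

lemma stepf_L2: "finite U \<Longrightarrow> stepf U F \<in> L2"
  unfolding stepf_def by (intro L2_sum L2_cmult ch_L2)

lemma stepf_eq: "finite U \<Longrightarrow> stepf U F p = (if gi p \<in> U then F (gi p) else 0)"
proof -
  assume U: "finite U"
  have "stepf U F p = (\<Sum>y\<in>U. if y = gi p then F y else 0)"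
    unfolding stepf_def by (rule sum.cong) (auto simp: ch_def indicator_def cell_iff)
  then show ?thesis using U by simp
qed

lemma l2n_stepf: assumes U: "finite U"
  shows "l2n (stepf U F) = sqrt (h ^ CARD('n)) * sqrt (\<Sum>y\<in>U. (norm (F y))\<^sup>2)"
proof -
  have "(norm (stepf U F p))\<^sup>2 = (\<Sum>y\<in>U. (norm (F y))\<^sup>2 * indicator (cell y) p)" for p
  proof -
    have "(\<Sum>y\<in>U. (norm (F y))\<^sup>2 * indicator (cell y) p) = (\<Sum>y\<in>U. if y = gi p then (norm (F y))\<^sup>2 else 0)"
      by (rule sum.cong) (auto simp: indicator_def cell_iff)
    then show ?thesis using U by (simp add: stepf_eq)
  qed
  then have "(\<integral>p. (norm (stepf U F p))\<^sup>2 \<partial>lebesgue) = (\<integral>p. (\<Sum>y\<in>U. (norm (F y))\<^sup>2 * indicator (cell y) p) \<partial>lebesgue)"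
    by simp
  also have "\<dots> = (\<Sum>y\<in>U. \<integral>p. (norm (F y))\<^sup>2 * indicator (cell y) p \<partial>lebesgue)"
    by (rule Bochner_Integration.integral_sum) (auto simp: measure_cell intro!: integrable_mult_right integrable_real_indicator)
  also have "\<dots> = (\<Sum>y\<in>U. (norm (F y))\<^sup>2 * h ^ CARD('n))"
    by (rule sum.cong) (auto simp: measure_cell)
  also have "\<dots> = h ^ CARD('n) * (\<Sum>y\<in>U. (norm (F y))\<^sup>2)" by (simp add: sum_distrib_left mult.commute)
  finally show ?thesis unfolding l2n_def by (simp add: real_sqrt_mult)
qed

text \<open>
  The factor \<open>1 / h ^ n\<close> makes the constants of the discrete kernel independent of the mesh \<open>h\<close>.
\<close>

definition kap :: "('n \<Rightarrow> int) \<Rightarrow> ('n \<Rightarrow> int) \<Rightarrow> complex" where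
  "kap x y = Bt (ch y) (ch x) / of_real (h ^ CARD('n))"

lemma kap_form:
  assumes U: "finite U"
  shows "(\<Sum>x\<in>U. \<Sum>y\<in>U. kap x y * F y * H x) = Bt (stepf U F) (stepf U H) / of_real (h ^ CARD('n))"
proof -
  have "Bt (stepf U F) (stepf U H) = (\<Sum>x\<in>U. H x * Bt (stepf U F) (ch x))"
    unfolding stepf_def[of U H] by (rule Bt_sum_right[OF U ch_L2 stepf_L2[OF U]])
  also have "\<dots> = (\<Sum>x\<in>U. H x * (\<Sum>y\<in>U. F y * Bt (ch y) (ch x)))"
    unfolding stepf_def by (subst Bt_sum_left[OF U ch_L2 ch_L2]) auto
  finally show ?thesis
    by (simp add: kap_def sum_divide_distrib sum_distrib_left mult_ac)
qed

definition cdiff :: "('n \<Rightarrow> int) \<Rightarrow> ('n \<Rightarrow> int) \<Rightarrow> real ^ 'n" where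
  "cdiff x y = corner x - corner y"

text \<open>In \<open>points_far\<close> the excess of 1 over \<open>2 ^ m\<close> pays for the
  positions of the points inside their cells.\<close>

lemma far_coord: "\<not> near m x y \<Longrightarrow> \<exists>k. 2 ^ m + 1 \<le> \<bar>x k - y k\<bar>"
proof -
  assume "\<not> near m x y"
  then obtain k where k: "\<not> \<bar>x k div 2 ^ m - y k div 2 ^ m\<bar> \<le> 1" by (auto simp: near_def)
  have "\<not> \<bar>x k - y k\<bar> \<le> 2 ^ m"
  proof
    assume a: "\<bar>x k - y k\<bar> \<le> 2 ^ m"
    have s: "(w + 2 ^ m) div 2 ^ m = w div 2 ^ m + 1" for w :: int by simp
    have "x k \<le> y k + 2 ^ m" "y k \<le> x k + 2 ^ m" using a by linarith+
    from zdiv_mono1[OF this(1), of "2 ^ m"] zdiv_mono1[OF this(2), of "2 ^ m"]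
    have "x k div 2 ^ m \<le> (y k + 2 ^ m) div 2 ^ m" "y k div 2 ^ m \<le> (x k + 2 ^ m) div 2 ^ m"
      by (simp_all only: zero_less_power zero_less_numeral simp_thms)
    then show False using k unfolding s by linarith
  qed
  then show ?thesis by (intro exI[of _ k]) linarith
qed

lemma norm_le_card: assumes "\<And>k. \<bar>w $ k\<bar> \<le> d" shows "norm (w :: real ^ 'n) \<le> real CARD('n) * d"
proof -
  have "norm w \<le> (\<Sum>k\<in>UNIV. \<bar>w $ k\<bar>)" by (rule norm_le_l1_cart)
  also have "\<dots> \<le> (\<Sum>k\<in>(UNIV :: 'n set). d)" by (rule sum_mono) (rule assms)
  finally show ?thesis by simp
qed

lemma points_far:
  assumes "\<not> near m x y" "p \<in> closed_cube (corner x) h" "q \<in> closed_cube (corner y) h"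
  shows "2 ^ m * h \<le> norm (p - q)"
proof -
  obtain k where k: "2 ^ m + 1 \<le> \<bar>x k - y k\<bar>" using far_coord[OF assms(1)] by blast
  then have "real_of_int (2 ^ m + 1) \<le> real_of_int \<bar>x k - y k\<bar>" by (simp only: of_int_le_iff)
  then have k': "2 ^ m + 1 \<le> \<bar>real_of_int (x k) - real_of_int (y k)\<bar>" by simp
  have p: "a0 $ k + h * x k \<le> p $ k" "p $ k \<le> a0 $ k + h * x k + h"
    and q: "a0 $ k + h * y k \<le> q $ k" "q $ k \<le> a0 $ k + h * y k + h"
    using assms(2,3) by (auto simp: closed_cube_def mem_box_cart corner_def)
  have "(2 ^ m + 1) * h \<le> \<bar>real_of_int (x k) - real_of_int (y k)\<bar> * h" using k' h_pos by (intro mult_right_mono) auto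
  also have "\<dots> = \<bar>h * x k - h * y k\<bar>" using h_pos by (simp add: abs_mult right_diff_distrib[symmetric] mult.commute)
  also have "\<dots> \<le> \<bar>p $ k - q $ k\<bar> + h" using p q by linarith
  finally have "2 ^ m * h \<le> \<bar>(p - q) $ k\<bar>" by (simp add: distrib_right)
  also have "\<dots> \<le> norm (p - q)" by (rule component_le_norm_cart)
  finally show ?thesis .
qed

lemma hm_pos: "0 < 2 ^ m * h" using h_pos by simp

lemma corner_in: "corner x \<in> closed_cube (corner x) h"
  using h_pos by (auto simp: closed_cube_def mem_box_cart)

text \<open>Cells that are not near have disjoint closures, so the kernel formula for
  \<open>T\<close> is available on one of them. The kernel is then replaced by its value at the
  difference of the corners. Over two cells this argument moves by at most \<open>n * h\<close>, and
  the smoothness of the kernel bounds the error.\<close>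

lemma kap_approx:
  assumes far: "\<not> near m x y"
  shows "norm (kap x y - of_real (h ^ CARD('n)) * K (cdiff x y)) \<le> 5 * c * real CARD('n) / 2 ^ (m * (CARD('n) + 1))"
proof -
  let ?n = "CARD('n)" and ?b = "cdiff x y"
  let ?e = "5 * c * (real ?n * h) / (2 ^ m * h) ^ (?n + 1)"
  let ?hn = "h ^ ?n"
  have e0: "0 \<le> ?e" using c_pos h_pos by simp
  have hn: "0 < ?hn" using h_pos by simp
  have cellc: "p \<in> closed_cube (corner i) h" if "p \<in> cell i" for p i
    using that half_open_subset unfolding cell_def by blast
  have Kd: "norm (K (p - q) - K ?b) \<le> ?e" if "p \<in> cell x" "q \<in> cell y" for p q
  proof (rule K_smooth_far)
    show "2 ^ m * h \<le> norm (p - q)" by (rule points_far[OF far cellc[OF that(1)] cellc[OF that(2)]])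
    show "2 ^ m * h \<le> norm ?b" unfolding cdiff_def by (rule points_far[OF far corner_in corner_in])
    show "norm (p - q - ?b) \<le> real ?n * h"
    proof (rule norm_le_card)
      fix k
      have "corner x $ k \<le> p $ k" "p $ k < corner x $ k + h" "corner y $ k \<le> q $ k" "q $ k < corner y $ k + h"
        using that by (auto simp: cell_def half_open_def)
      then show "\<bar>(p - q - ?b) $ k\<bar> \<le> h" by (simp add: cdiff_def abs_le_iff)
    qed
  qed (use h_pos in simp)
  \<comment> \<open>\<open>supp\<close> is a closure and includes the faces missing from the
    half-open cell, which is why \<open>points_far\<close> is stated for closed cubes.\<close>
  have supp_sub: "supp (ch y) \<subseteq> closed_cube (corner y) h"
    unfolding supp_def
  proof (rule closure_minimal)
    show "{p. ch y p \<noteq> 0} \<subseteq> closed_cube (corner y) h" using cellc by (auto simp: ch_def indicator_def)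
  qed (simp add: closed_cube_def closed_cbox)
  have csupp: "compact (supp (ch y))"
    using supp_sub bounded_subset[OF bounded_cbox] by (auto simp: compact_eq_bounded_closed supp_def closed_cube_def)
  have intK: "integrable lebesgue (\<lambda>q. K (p - q) * ch y q)" if p: "p \<in> cell x" for p
  proof -
    have "continuous_on (closed_cube (corner y) h) (\<lambda>q. K (p - q))"
    proof (rule continuous_on_compose2[OF continuous_on_K])
      show "(\<lambda>q. p - q) ` closed_cube (corner y) h \<subseteq> - {0}"
      proof clarify
        fix q assume "q \<in> closed_cube (corner y) h" "p - q = 0"
        then have "2 ^ m * h \<le> 0" using points_far[OF far cellc[OF p], of q] by simp
        then show False using hm_pos[of m] by simp
      qed
    qed (intro continuous_intros)
    then have "(\<lambda>q. K (p - q)) absolutely_integrable_on closed_cube (corner y) h"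
      unfolding closed_cube_def by (rule absolutely_integrable_continuous)
    then have "(\<lambda>q. K (p - q)) absolutely_integrable_on cell y"
      by (rule set_integrable_subset) (use half_open_subset in \<open>auto simp: cell_def\<close>)
    then show ?thesis unfolding set_integrable_def
      by (rule Bochner_Integration.integrable_cong[THEN iffD1, rotated 2]) (auto simp: ch_def indicator_def)
  qed
  have intch: "integrable lebesgue (ch y)" for y
    unfolding ch_def by (intro integrable_of_real integrable_real_indicator) (auto simp: measure_cell)
  have ich: "(\<integral>q. ch y q \<partial>lebesgue) = of_real ?hn" for y
    unfolding ch_def by (subst integral_of_real) (simp_all add: measure_cell)
  have inner: "norm ((\<integral>q. K (p - q) * ch y q \<partial>lebesgue) - of_real ?hn * K ?b) \<le> ?hn * ?e" if p: "p \<in> cell x" for p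
  proof -
    have "(\<integral>q. K (p - q) * ch y q \<partial>lebesgue) - of_real ?hn * K ?b = (\<integral>q. K (p - q) * ch y q - K ?b * ch y q \<partial>lebesgue)"
      using intK[OF p] intch[of y] by (subst Bochner_Integration.integral_diff) (auto simp: ich)
    also have "norm \<dots> \<le> (\<integral>q. ?e * indicator (cell y) q \<partial>lebesgue)"
    proof (rule Bochner_Integration.integral_norm_bound_integral)
      show "integrable lebesgue (\<lambda>q. K (p - q) * ch y q - K ?b * ch y q)"
        using intK[OF p] intch[of y] by auto
      show "integrable lebesgue (\<lambda>q. ?e * indicator (cell y) q)"
        by (intro integrable_mult_right integrable_real_indicator) (auto simp: measure_cell)
      fix q
      show "norm (K (p - q) * ch y q - K ?b * ch y q) \<le> ?e * indicator (cell y) q"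
        using Kd[OF p, of q] by (cases "q \<in> cell y") (auto simp: ch_def)
    qed
    also have "\<dots> = ?hn * ?e" by (simp add: measure_cell)
    finally show ?thesis .
  qed
  have outer: "norm (Bt (ch y) (ch x) - of_real ?hn * (of_real ?hn * K ?b)) \<le> ?hn * (?hn * ?e)"
  proof -
    have int1: "integrable lebesgue (\<lambda>p. T (ch y) p * ch x p)" by (rule L2_product(1)[OF T_L2[OF ch_L2] ch_L2])
    have "Bt (ch y) (ch x) - of_real ?hn * (of_real ?hn * K ?b)
       = (\<integral>p. T (ch y) p * ch x p - (of_real ?hn * K ?b) * ch x p \<partial>lebesgue)"
      unfolding Bt_def using int1 intch[of x] by (subst Bochner_Integration.integral_diff) (auto simp: ich)
    also have "norm \<dots> \<le> (\<integral>p. norm (T (ch y) p * ch x p - (of_real ?hn * K ?b) * ch x p) \<partial>lebesgue)"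
      by (rule integral_norm_bound)
    also have "\<dots> \<le> (\<integral>p. (?hn * ?e) * indicator (cell x) p \<partial>lebesgue)"
    proof (rule integral_mono_AE)
      show "integrable lebesgue (\<lambda>p. norm (T (ch y) p * ch x p - (of_real ?hn * K ?b) * ch x p))"
        using int1 intch[of x] by auto
      show "integrable lebesgue (\<lambda>p. (?hn * ?e) * indicator (cell x) p)"
        by (intro integrable_mult_right integrable_real_indicator) (auto simp: measure_cell)
      show "AE p in lebesgue. norm (T (ch y) p * ch x p - (of_real ?hn * K ?b) * ch x p) \<le> (?hn * ?e) * indicator (cell x) p"
        using T_kernel[OF ch_L2 csupp]
      proof eventually_elim
        case (elim p)
        show ?case
        proof (cases "p \<in> cell x")
          case True
          have "p \<notin> supp (ch y)"
          proof
            assume "p \<in> supp (ch y)"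
            then have "p \<in> closed_cube (corner y) h" using supp_sub by blast
            from points_far[OF far cellc[OF True] this] show False using hm_pos[of m] by simp
          qed
          then have "T (ch y) p = (\<integral>q. K (p - q) * ch y q \<partial>lebesgue)" using elim by blast
          then show ?thesis using inner[OF True] True by (simp add: ch_def)
        qed (simp add: ch_def)
      qed
    qed
    also have "\<dots> = ?hn * (?hn * ?e)" by (simp add: measure_cell)
    finally show ?thesis .
  qed
  have "kap x y - of_real ?hn * K ?b = (Bt (ch y) (ch x) - of_real ?hn * (of_real ?hn * K ?b)) / of_real ?hn"
    using hn by (simp add: kap_def diff_divide_distrib)
  then have "norm (kap x y - of_real ?hn * K ?b) = norm (Bt (ch y) (ch x) - of_real ?hn * (of_real ?hn * K ?b)) / ?hn"
    using hn by (simp add: norm_divide del: of_real_power)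
  also have "\<dots> \<le> ?hn * (?hn * ?e) / ?hn" using outer hn by (intro divide_right_mono) auto
  also have "\<dots> = ?hn * ?e" using hn by simp
  also have "\<dots> = 5 * c * real ?n / 2 ^ (m * (?n + 1))" by (rule scale_cancel[OF h_pos])
  finally show ?thesis .
qed

lemma K_corner_diff:
  assumes "\<not> near m x y" "\<not> near m x' y'" and d: "\<And>k. \<bar>(x k - y k) - (x' k - y' k)\<bar> \<le> 2 ^ j"
  shows "norm (of_real (h ^ CARD('n)) * K (cdiff x y) - of_real (h ^ CARD('n)) * K (cdiff x' y'))
    \<le> 5 * c * real CARD('n) * 2 ^ j / 2 ^ (m * (CARD('n) + 1))"
proof -
  let ?n = "CARD('n)" let ?hn = "h ^ ?n"
  have "norm (K (cdiff x y) - K (cdiff x' y')) \<le> 5 * c * (real ?n * (2 ^ j * h)) / (2 ^ m * h) ^ (?n + 1)"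
  proof (rule K_smooth_far)
    show "2 ^ m * h \<le> norm (cdiff x y)" "2 ^ m * h \<le> norm (cdiff x' y')"
      unfolding cdiff_def
      by (rule points_far[OF assms(1) corner_in corner_in], rule points_far[OF assms(2) corner_in corner_in])
    show "norm (cdiff x y - cdiff x' y') \<le> real ?n * (2 ^ j * h)"
    proof (rule norm_le_card)
      fix k
      have "(cdiff x y - cdiff x' y') $ k = h * of_int ((x k - y k) - (x' k - y' k))"
        by (simp add: cdiff_def corner_def algebra_simps)
      moreover have "\<bar>of_int ((x k - y k) - (x' k - y' k)) :: real\<bar> \<le> 2 ^ j"
      proof -
        have "real_of_int \<bar>(x k - y k) - (x' k - y' k)\<bar> \<le> real_of_int (2 ^ j)"
          using d[of k] by (simp only: of_int_le_iff)
        then show ?thesis by simp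
      qed
      ultimately show "\<bar>(cdiff x y - cdiff x' y') $ k\<bar> \<le> 2 ^ j * h"
        using h_pos by (simp only: abs_mult) (simp add: mult.commute)
    qed
  qed (use h_pos in simp)
  then have "?hn * norm (K (cdiff x y) - K (cdiff x' y')) \<le> ?hn * (5 * c * (real ?n * (2 ^ j * h)) / (2 ^ m * h) ^ (?n + 1))"
    using h_pos by (intro mult_left_mono) auto
  also have "\<dots> = 5 * c * (real ?n * 2 ^ j) / 2 ^ (m * (?n + 1))"
    using scale_cancel[OF h_pos, of ?n "5 * c" "real ?n * 2 ^ j" m] by (simp only: mult.assoc)
  finally show ?thesis using h_pos
    by (simp add: right_diff_distrib[symmetric] norm_mult norm_power mult.assoc)
qed

lemma same_cube_diff: "cube_at j y = cube_at j y' \<Longrightarrow> \<bar>y k - y' k\<bar> \<le> (2::int) ^ j"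
proof -
  assume "cube_at j y = cube_at j y'"
  then have e: "y k div 2 ^ j = y' k div 2 ^ j" by (auto simp: cube_at_def fun_eq_iff)
  have "y k = y k div 2 ^ j * 2 ^ j + y k mod 2 ^ j" "y' k = y' k div 2 ^ j * 2 ^ j + y' k mod 2 ^ j"
    by (rule div_mult_mod_eq[symmetric])+
  moreover have "0 \<le> y k mod 2 ^ j" "y k mod 2 ^ j < 2 ^ j" "0 \<le> y' k mod 2 ^ j" "y' k mod 2 ^ j < 2 ^ j" by simp_all
  ultimately show ?thesis unfolding e by linarith
qed

text \<open>Both values are compared with the kernel at the difference of corners, where the
  smoothness applies. Two replacements by \<open>kap_approx\<close> and one change of the corners
  make three errors of size 5, the last one with the factor \<open>2 ^ j \<ge> 1\<close>; hence
  15.\<close>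

lemma kap_diff:
  assumes far: "\<not> near m x y" "\<not> near m x' y'" and d: "\<And>k. \<bar>(x k - y k) - (x' k - y' k)\<bar> \<le> 2 ^ j"
  shows "norm (kap x y - kap x' y') \<le> 15 * c * real CARD('n) * 2 ^ j / 2 ^ (m * (CARD('n) + 1))"
proof -
  let ?n = "CARD('n)" let ?hn = "of_real (h ^ ?n) :: complex"
  let ?e = "5 * c * real ?n / 2 ^ (m * (?n + 1))"
  have e0: "0 \<le> ?e" using c_pos by simp
  have "norm (kap x y - kap x' y') \<le> norm (kap x y - ?hn * K (cdiff x y)) + norm (kap x' y' - ?hn * K (cdiff x' y'))
     + norm (?hn * K (cdiff x y) - ?hn * K (cdiff x' y'))"
    by (rule order_trans[OF _ add_mono[OF norm_triangle_ineq4 order_refl]], rule order_trans[OF _ norm_triangle_ineq])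
       (simp add: algebra_simps)
  also have "\<dots> \<le> ?e + ?e + ?e * 2 ^ j"
    using kap_approx[OF far(1)] kap_approx[OF far(2)] K_corner_diff[OF far d] by (intro add_mono) auto
  also have "\<dots> \<le> 3 * (?e * 2 ^ j)"
  proof -
    have "?e * 1 \<le> ?e * 2 ^ j" using e0 by (intro mult_left_mono) auto
    moreover have "r + r + t \<le> 3 * t" if "r * 1 \<le> t" for r t :: real using that by simp
    ultimately show ?thesis by blast
  qed
  finally show ?thesis by simp
qed

text \<open>In the square mean bound, the factors \<open>sqrt (h ^ n)\<close> from the norms of the
  two step functions cancel the division by \<open>h ^ n\<close> in \<open>kap\<close>. All other
  conditions come from the values at the differences of corners.\<close>

lemma dyadic_kernel_kap: assumes U: "finite U" shows "dyadic_kernel kap (15 * c * real CARD('n)) U"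
proof
  let ?n = "CARD('n)" let ?B = "15 * c * real ?n"
  have n1: "1 \<le> real ?n" by (simp add: Suc_leI)
  have "1 \<le> 15 * real ?n" using n1 by linarith
  then have "c * 1 \<le> c * (15 * real ?n)" using c_pos by (intro mult_left_mono) auto
  then have cB: "c \<le> ?B" by (simp only: mult_ac mult_1_right mult_1_left)
  show "finite U" by fact
  show "0 \<le> ?B" using c_pos by simp
  have L2c: "norm (\<Sum>x\<in>V. \<Sum>y\<in>V. kap x y * F y * H x)
      \<le> c * sqrt (\<Sum>x\<in>V. (norm (F x))\<^sup>2) * sqrt (\<Sum>x\<in>V. (norm (H x))\<^sup>2)" if V: "finite V" for V F H
  proof -
    have hn: "0 < h ^ ?n" using h_pos by simp
    have "norm (\<Sum>x\<in>V. \<Sum>y\<in>V. kap x y * F y * H x) = norm (Bt (stepf V F) (stepf V H)) / h ^ ?n"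
      unfolding kap_form[OF V] using hn by (simp add: norm_divide del: of_real_power)
    also have "\<dots> \<le> (c * l2n (stepf V F) * l2n (stepf V H)) / h ^ ?n"
      using hn by (intro divide_right_mono Bt_bound stepf_L2 V) auto
    also have "\<dots> = c * sqrt (\<Sum>x\<in>V. (norm (F x))\<^sup>2) * sqrt (\<Sum>x\<in>V. (norm (H x))\<^sup>2)
        * (sqrt (h ^ ?n) * sqrt (h ^ ?n) / h ^ ?n)"
      unfolding l2n_stepf[OF V] by (simp add: mult_ac)
    also have "sqrt (h ^ ?n) * sqrt (h ^ ?n) / h ^ ?n = 1" using h_pos by simp
    finally show ?thesis by simp
  qed
  show "norm (\<Sum>x\<in>U. \<Sum>y\<in>U. kap x y * F y * H x)
      \<le> ?B * sqrt (\<Sum>x\<in>U. (norm (F x))\<^sup>2) * sqrt (\<Sum>x\<in>U. (norm (H x))\<^sup>2)" for F H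
  proof -
    have "c * sqrt (\<Sum>x\<in>U. (norm (F x))\<^sup>2) * sqrt (\<Sum>x\<in>U. (norm (H x))\<^sup>2)
      \<le> ?B * sqrt (\<Sum>x\<in>U. (norm (F x))\<^sup>2) * sqrt (\<Sum>x\<in>U. (norm (H x))\<^sup>2)"
      using cB by (intro mult_right_mono) (auto intro!: sum_nonneg)
    with L2c[OF U, of F H] show ?thesis by (rule order_trans)
  qed
  show "norm (kap x y) \<le> ?B" for x y
  proof -
    have l1: "l2n (ch i) = sqrt (h ^ ?n)" for i
      using l2n_stepf[of "{i}" "\<lambda>_. 1"] by (simp add: stepf_def)
    have "norm (kap x y) = norm (Bt (ch y) (ch x)) / h ^ ?n"
      unfolding kap_def using h_pos by (simp add: norm_divide norm_power)
    also have "\<dots> \<le> (c * l2n (ch y) * l2n (ch x)) / h ^ ?n"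
      using h_pos by (intro divide_right_mono Bt_bound ch_L2) auto
    also have "\<dots> = c * (sqrt (h ^ ?n) * sqrt (h ^ ?n) / h ^ ?n)" unfolding l1 by simp
    also have "sqrt (h ^ ?n) * sqrt (h ^ ?n) / h ^ ?n = 1" using h_pos by simp
    finally show ?thesis using cB by linarith
  qed
  show "norm (kap x y) \<le> ?B / 2 ^ (j * ?n)" if far: "\<not> near j x y" for j x y
  proof -
    have b: "2 ^ j * h \<le> norm (cdiff x y)"
      unfolding cdiff_def by (rule points_far[OF far corner_in corner_in])
    have bp: "0 < 2 ^ j * h" using h_pos by simp
    have "norm (K (cdiff x y)) \<le> c / norm (cdiff x y) ^ ?n" using b bp by (intro K_size) auto
    also have "\<dots> \<le> c / (2 ^ j * h) ^ ?n" using b bp c_pos by (intro frac_le power_mono) auto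
    finally have "h ^ ?n * norm (K (cdiff x y)) \<le> h ^ ?n * (c / (2 ^ j * h) ^ ?n)"
      using h_pos by (intro mult_left_mono) auto
    also have "\<dots> = c / 2 ^ (j * ?n)" using h_pos by (simp add: power_mult_distrib power_mult[symmetric])
    finally have 1: "norm (of_real (h ^ ?n) * K (cdiff x y)) \<le> c / 2 ^ (j * ?n)"
      using h_pos by (simp add: norm_mult norm_power)
    have 2: "5 * c * real ?n / 2 ^ (j * (?n + 1)) \<le> 5 * c * real ?n / 2 ^ (j * ?n)"
      using c_pos by (intro divide_left_mono power_increasing) auto
    have "norm (kap x y) \<le> norm (kap x y - of_real (h ^ ?n) * K (cdiff x y)) + norm (of_real (h ^ ?n) * K (cdiff x y))"
      using norm_triangle_ineq[of "kap x y - of_real (h ^ ?n) * K (cdiff x y)" "of_real (h ^ ?n) * K (cdiff x y)"] by simp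
    also have "\<dots> \<le> 5 * c * real ?n / 2 ^ (j * ?n) + c / 2 ^ (j * ?n)"
      using kap_approx[OF far] 1 2 by (intro add_mono) auto
    also have "\<dots> = (5 * c * real ?n + c) / 2 ^ (j * ?n)" by (simp add: add_divide_distrib)
    also have "\<dots> \<le> ?B / 2 ^ (j * ?n)"
    proof (rule divide_right_mono)
      have "c * 1 \<le> c * real ?n" using n1 c_pos by (intro mult_left_mono) auto
      moreover have "5 * M + c \<le> 15 * M" if "c * 1 \<le> M" for M using that c_pos by simp
      ultimately show "5 * c * real ?n + c \<le> ?B" unfolding mult.assoc by blast
    qed simp
    finally show ?thesis .
  qed
  fix j m :: nat and x y x' y' :: "'n \<Rightarrow> int"
  show "norm (kap x y - kap x y') \<le> ?B * 2 ^ j / 2 ^ (m * (?n + 1))"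
    if "cube_at j y = cube_at j y'" "j \<le> m" "\<not> near m x y"
  proof (rule kap_diff[OF that(3)])
    have "cube_at m y = cube_at m y'" using cube_at_mono that by blast
    then show "\<not> near m x y'" using that(3) near_sym near_cube_at_cong by blast
    show "\<bar>(x k - y k) - (x k - y' k)\<bar> \<le> 2 ^ j" for k using same_cube_diff[OF that(1), of k] by simp
  qed
  show "norm (kap x y - kap x' y) \<le> ?B * 2 ^ j / 2 ^ (m * (?n + 1))"
    if "cube_at j x = cube_at j x'" "j \<le> m" "\<not> near m x y"
  proof (rule kap_diff[OF that(3)])
    have "cube_at m x = cube_at m x'" using cube_at_mono that by blast
    then show "\<not> near m x' y" using that(3) near_cube_at_cong by blast
    show "\<bar>(x k - y k) - (x' k - y k)\<bar> \<le> 2 ^ j" for k using same_cube_diff[OF that(1), of k] by simp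
  qed
qed

end

section \<open>Approximation by step functions in square mean\<close>

lemma continuous_approximation:
  fixes F :: "real ^ 'n \<Rightarrow> complex"
  assumes F: "F \<in> borel_measurable lebesgue" "\<And>x. norm (F x) \<le> M" and M: "0 < M"
    and S: "S \<in> sets lebesgue" "emeasure lebesgue S < \<infinity>" and e: "0 < e"
  obtains g where "continuous_on UNIV g" "\<forall>x. norm (g x) \<le> M"
    "(\<integral>x. norm (g x - F x) * indicator S x \<partial>lebesgue) < e"
proof -
  note [measurable] = F(1) S(1)
  have "F measurable_on UNIV" using F(1) by (rule lebesgue_measurable_imp_measurable_on) auto
  then obtain N f where N: "negligible N" and f: "\<And>n. continuous_on UNIV (f n)"
    "\<And>x. x \<notin> N \<Longrightarrow> (\<lambda>n. f n x) \<longlonglongrightarrow> F x"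
    unfolding measurable_on_def by auto
  \<comment> \<open>The approximating continuous functions need not be bounded. Radial clipping at
    height \<open>M\<close> is continuous, fixes all values of \<open>F\<close>, and makes dominated
    convergence applicable.\<close>
  define clip where "clip = (\<lambda>z. z / complex_of_real (max 1 (norm z / M)))"
  have clip_cont: "continuous_on UNIV clip"
    unfolding clip_def by (intro continuous_intros) (use M in \<open>auto simp: max_def\<close>)
  have clip_le: "norm (clip z) \<le> M" for z
  proof (cases "norm z \<le> M")
    case True
    then have "norm z / M \<le> 1" using M by simp
    then show ?thesis using True by (simp add: clip_def max_absorb1)
  next
    case False
    then have "1 \<le> norm z / M" using M by simp
    then have "norm (clip z) = norm z / (norm z / M)" using M by (simp add: clip_def max_absorb2 norm_divide norm_mult)
    also have "\<dots> = M" using False M by (auto simp: not_le)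
    finally show ?thesis by simp
  qed
  have clip_id: "clip (F x) = F x" for x
  proof -
    have "norm (F x) / M \<le> 1" using F(2)[of x] M by simp
    then show ?thesis by (simp add: clip_def max_absorb1)
  qed
  have cont: "continuous_on UNIV (\<lambda>x. clip (f n x))" for n
    by (rule continuous_on_compose2[OF clip_cont f(1)]) auto
  have lim: "(\<lambda>n. clip (f n x)) \<longlonglongrightarrow> F x" if "x \<notin> N" for x
  proof -
    have "isCont clip (F x)" using clip_cont by (simp add: continuous_on_eq_continuous_at)
    then have "(\<lambda>n. clip (f n x)) \<longlonglongrightarrow> clip (F x)" using f(2)[OF that] by (rule isCont_tendsto_compose)
    then show ?thesis by (simp add: clip_id)
  qed
  have fm [measurable]: "(\<lambda>x. clip (f n x)) \<in> borel_measurable lebesgue" for n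
    using cont[of n] by (intro measurable_completion) (simp add: borel_measurable_continuous_onI)
  have "(\<lambda>n. \<integral>x. norm (clip (f n x) - F x) * indicator S x \<partial>lebesgue) \<longlonglongrightarrow> (\<integral>x. 0 \<partial>(lebesgue :: (real ^ 'n) measure))"
  proof (rule integral_dominated_convergence[where M = lebesgue and f = "\<lambda>_. 0"
        and s = "\<lambda>n x. norm (clip (f n x) - F x) * indicator S x" and w = "\<lambda>x. 2 * M * indicator S x"])
    show "integrable lebesgue (\<lambda>x. 2 * M * indicator S x)"
      using S by (intro integrable_mult_right integrable_real_indicator) auto
    have "AE x in lebesgue. x \<notin> N" using N by (intro AE_not_in) (simp add: negligible_iff_null_sets)
    then show "AE x in lebesgue. (\<lambda>n. norm (clip (f n x) - F x) * indicator S x) \<longlonglongrightarrow> 0"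
    proof eventually_elim
      case (elim x)
      have "(\<lambda>n. norm (clip (f n x) - F x) * indicator S x) \<longlonglongrightarrow> norm (F x - F x) * indicator S x"
        by (intro tendsto_intros lim[OF elim])
      then show ?case by simp
    qed
    show "AE x in lebesgue. norm (norm (clip (f n x) - F x) * indicator S x) \<le> 2 * M * indicator S x" for n
    proof (rule AE_I2)
      fix x
      have "norm (clip (f n x) - F x) \<le> 2 * M"
        using norm_triangle_ineq4[of "clip (f n x)" "F x"] clip_le[of "f n x"] F(2)[of x] by linarith
      then show "norm (norm (clip (f n x) - F x) * indicator S x) \<le> 2 * M * indicator S x"
        by (simp add: indicator_def)
    qed
    show "(\<lambda>x. norm (clip (f n x) - F x) * indicator S x) \<in> borel_measurable lebesgue" for n
      by measurable
  qed simp
  then have "(\<lambda>n. \<integral>x. norm (clip (f n x) - F x) * indicator S x \<partial>lebesgue) \<longlonglongrightarrow> 0" by simp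
  then have "\<forall>\<^sub>F n in sequentially. (\<integral>x. norm (clip (f n x) - F x) * indicator S x \<partial>lebesgue) < e"
    using e by (rule order_tendstoD(2))
  then obtain n where "\<forall>k\<ge>n. (\<integral>x. norm (clip (f k x) - F x) * indicator S x \<partial>lebesgue) < e"
    unfolding eventually_sequentially ..
  then have "(\<integral>x. norm (clip (f n x) - F x) * indicator S x \<partial>lebesgue) < e" by simp
  then show ?thesis by (rule that[OF cont allI[OF clip_le]])
qed

lemma integrable_bounded_on:
  fixes F :: "'a \<Rightarrow> 'b::{banach, second_countable_topology}"
  assumes "F \<in> borel_measurable M" "\<And>x. norm (F x) \<le> C" "S \<in> sets M" "emeasure M S < \<infinity>"
  shows "integrable M (\<lambda>x. norm (F x) * indicator S x)"
proof (rule integrableI_bounded_set[where A = S and B = C])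
  show "(\<lambda>x. norm (F x) * indicator S x) \<in> borel_measurable M" using assms by measurable
  show "AE x in M. x \<in> S \<longrightarrow> norm (norm (F x) * indicator S x) \<le> C" using assms(2) by auto
qed (use assms in auto)

context grid begin

definition ave :: "(real ^ 'n \<Rightarrow> complex) \<Rightarrow> ('n \<Rightarrow> int) \<Rightarrow> complex" where
  "ave F y = (\<integral>p. F p * ch y p \<partial>lebesgue) / of_real (h ^ CARD('n))"

lemma emeasure_reg: "0 \<le> d \<Longrightarrow> emeasure lebesgue (reg d P) = ennreal (reg_side d P ^ CARD('n))"
  unfolding reg_def by (rule emeasure_half_open) (use h_pos in \<open>simp add: reg_side_def\<close>)

lemma norm_mult_ch: "norm (F p * ch y p) = norm (F p) * indicator (cell y) p"
  by (simp add: norm_mult norm_ch)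

lemma integrable_cell:
  assumes "F \<in> borel_measurable lebesgue" "\<And>x. norm (F x) \<le> M"
  shows "integrable lebesgue (\<lambda>p. F p * ch y p)"
proof (rule integrable_norm_cancel)
  show "integrable lebesgue (\<lambda>p. norm (F p * ch y p))"
    unfolding norm_mult_ch by (rule integrable_bounded_on[OF assms]) (simp_all add: measure_cell)
  show "(\<lambda>p. F p * ch y p) \<in> borel_measurable lebesgue"
    using assms(1) L2_measurable[OF ch_L2[of y]] by measurable
qed

lemma norm_ave:
  assumes "F \<in> borel_measurable lebesgue" "\<And>x. norm (F x) \<le> M"
  shows "norm (ave F y) \<le> (\<integral>p. norm (F p) * indicator (cell y) p \<partial>lebesgue) / h ^ CARD('n)"
proof -
  have "norm (ave F y) = norm (\<integral>p. F p * ch y p \<partial>lebesgue) / h ^ CARD('n)"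
    unfolding ave_def using h_pos by (simp add: norm_divide norm_power)
  also have "\<dots> \<le> (\<integral>p. norm (F p * ch y p) \<partial>lebesgue) / h ^ CARD('n)"
    using h_pos by (intro divide_right_mono integral_norm_bound) auto
  finally show ?thesis by (simp only: norm_mult_ch)
qed

lemma indicator_reg: "indicator (reg d P) p = (\<Sum>y\<in>dil d P. indicator (cell y) p :: real)"
proof -
  have "(\<Sum>y\<in>dil d P. indicator (cell y) p :: real) = (\<Sum>y\<in>dil d P. if y = gi p then 1 else 0)"
    by (rule sum.cong) (auto simp: indicator_def cell_iff)
  then show ?thesis by (simp add: indicator_def reg_iff)
qed

lemma sum_cell_integrals:
  fixes F :: "real ^ 'n \<Rightarrow> complex"
  assumes "F \<in> borel_measurable lebesgue" "\<And>x. norm (F x) \<le> M"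
  shows "(\<Sum>y\<in>dil d P. \<integral>p. norm (F p) * indicator (cell y) p \<partial>lebesgue) = (\<integral>p. norm (F p) * indicator (reg d P) p \<partial>lebesgue)"
proof -
  have "(\<integral>p. norm (F p) * indicator (reg d P) p \<partial>lebesgue) = (\<integral>p. (\<Sum>y\<in>dil d P. norm (F p) * indicator (cell y) p) \<partial>lebesgue)"
    unfolding indicator_reg by (simp add: sum_distrib_left)
  also have "\<dots> = (\<Sum>y\<in>dil d P. \<integral>p. norm (F p) * indicator (cell y) p \<partial>lebesgue)"
    by (rule Bochner_Integration.integral_sum) (rule integrable_bounded_on[OF assms], simp_all add: measure_cell)
  finally show ?thesis by simp
qed

lemma asum_ave:
  assumes "F \<in> borel_measurable lebesgue" "\<And>x. norm (F x) \<le> M"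
  shows "asum (ave F) (dil d P) \<le> (\<integral>p. norm (F p) * indicator (reg d P) p \<partial>lebesgue) / h ^ CARD('n)"
proof -
  have "asum (ave F) (dil d P) \<le> (\<Sum>y\<in>dil d P. (\<integral>p. norm (F p) * indicator (cell y) p \<partial>lebesgue) / h ^ CARD('n))"
    unfolding asum_def by (rule sum_mono) (rule norm_ave[OF assms])
  also have "\<dots> = (\<integral>p. norm (F p) * indicator (reg d P) p \<partial>lebesgue) / h ^ CARD('n)"
    by (simp only: sum_divide_distrib[symmetric] sum_cell_integrals[OF assms])
  finally show ?thesis .
qed

lemma ave_const_approx:
  assumes g: "g \<in> borel_measurable lebesgue" "\<And>x. norm (g x) \<le> M"
    and e: "\<And>q. q \<in> cell y \<Longrightarrow> norm (g q - w) \<le> e" and e0: "0 \<le> e"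
  shows "norm (ave g y - w) \<le> e"
proof -
  have hn: "0 < h ^ CARD('n)" using h_pos by simp
  have ich: "integrable lebesgue (\<lambda>p. w * ch y p)"
    by (rule integrable_cell[of "\<lambda>_. w" "norm w"]) auto
  have I: "(\<integral>p. w * ch y p \<partial>lebesgue) = w * of_real (h ^ CARD('n))"
    unfolding ch_def by (subst integral_mult_right_zero, subst integral_of_real) (simp_all add: measure_cell)
  have "ave g y - w = ((\<integral>p. g p * ch y p \<partial>lebesgue) - (\<integral>p. w * ch y p \<partial>lebesgue)) / of_real (h ^ CARD('n))"
    unfolding I using h_pos by (simp add: ave_def diff_divide_distrib)
  also have "(\<integral>p. g p * ch y p \<partial>lebesgue) - (\<integral>p. w * ch y p \<partial>lebesgue) = (\<integral>p. g p * ch y p - w * ch y p \<partial>lebesgue)"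
    by (rule Bochner_Integration.integral_diff[symmetric]) (rule integrable_cell[OF g], rule ich)
  finally have "norm (ave g y - w) = norm (\<integral>p. g p * ch y p - w * ch y p \<partial>lebesgue) / h ^ CARD('n)"
    using h_pos by (simp add: norm_divide norm_power)
  also have "\<dots> \<le> (\<integral>p. e * indicator (cell y) p \<partial>lebesgue) / h ^ CARD('n)"
  proof (rule divide_right_mono[OF Bochner_Integration.integral_norm_bound_integral])
    show "integrable lebesgue (\<lambda>p. g p * ch y p - w * ch y p)"
      by (intro Bochner_Integration.integrable_diff integrable_cell[OF g] ich)
    show "integrable lebesgue (\<lambda>p. e * indicator (cell y) p)"
      by (intro integrable_mult_right integrable_real_indicator) (auto simp: measure_cell)
    show "norm (g p * ch y p - w * ch y p) \<le> e * indicator (cell y) p" for p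
      using e[of p] by (cases "p \<in> cell y") (auto simp: ch_def)
  qed (use hn in simp)
  also have "\<dots> = e" using h_pos by (simp add: measure_cell)
  finally show ?thesis .
qed

text \<open>Passes through the nearly constant function \<open>g\<close>: the error is at most that
  of \<open>g\<close>, plus \<open>g - F\<close>, plus the cell means of \<open>g - F\<close>.
  Taking cell means does not increase the integral of the norm, hence the factor 2.\<close>

lemma ave_L1_error:
  assumes F: "F \<in> borel_measurable lebesgue" "\<And>x. norm (F x) \<le> M"
    and g: "g \<in> borel_measurable lebesgue" "\<And>x. norm (g x) \<le> M"
    and osc: "\<And>p q. p \<in> reg 1 Q \<Longrightarrow> gi q = gi p \<Longrightarrow> norm (g q - g p) \<le> e" and e0: "0 \<le> e"
  shows "(\<integral>p. norm (ave F (gi p) - F p) * indicator (reg 1 Q) p \<partial>lebesgue)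
    \<le> 2 * (\<integral>p. norm (g p - F p) * indicator (reg 1 Q) p \<partial>lebesgue) + e * reg_side 1 Q ^ CARD('n)"
proof -
  let ?S = "reg 1 Q" and ?hn = "h ^ CARD('n)"
  have hn: "0 < ?hn" using h_pos by simp
  have gF: "(\<lambda>p. g p - F p) \<in> borel_measurable lebesgue" using F g by measurable
  have gF2: "norm (g p - F p) \<le> 2 * M" for p
    using norm_triangle_ineq4[of "g p" "F p"] F(2)[of p] g(2)[of p] by linarith
  have Sfin: "emeasure lebesgue ?S < \<infinity>" by (simp only: emeasure_reg) simp
  define A where "A = (\<lambda>y. (\<integral>p. norm (g p - F p) * indicator (cell y) p \<partial>lebesgue) / ?hn)"
  have pw: "norm (ave F (gi p) - F p) * indicator ?S p
    \<le> (\<Sum>y\<in>dil 1 Q. A y * indicator (cell y) p) + e * indicator ?S p + norm (g p - F p) * indicator ?S p" for p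
  proof (cases "p \<in> ?S")
    case True
    let ?y = "gi p"
    have y: "?y \<in> dil 1 Q" using True by (simp add: reg_iff)
    have "(\<Sum>y\<in>dil 1 Q. A y * indicator (cell y) p) = (\<Sum>y\<in>dil 1 Q. if y = ?y then A y else 0)"
      by (rule sum.cong) (auto simp: indicator_def cell_iff)
    then have s: "(\<Sum>y\<in>dil 1 Q. A y * indicator (cell y) p) = A ?y" using y by simp
    have "ave F ?y = ave g ?y - ave (\<lambda>p. g p - F p) ?y"
      unfolding ave_def left_diff_distrib
      by (subst Bochner_Integration.integral_diff[OF integrable_cell[OF g] integrable_cell[OF F]])
         (simp add: diff_divide_distrib)
    then have "ave F ?y - F p = (ave g ?y - g p) - ave (\<lambda>p. g p - F p) ?y + (g p - F p)" by simp
    then have "norm (ave F ?y - F p) \<le> norm (ave g ?y - g p) + norm (ave (\<lambda>p. g p - F p) ?y) + norm (g p - F p)"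
      by (simp only:) (rule order_trans[OF norm_triangle_ineq add_right_mono[OF norm_triangle_ineq4]])
    moreover have "norm (ave g ?y - g p) \<le> e"
      by (rule ave_const_approx[OF g _ e0]) (use osc[OF True] in \<open>simp add: cell_iff\<close>)
    moreover have "norm (ave (\<lambda>p. g p - F p) ?y) \<le> A ?y" unfolding A_def by (rule norm_ave[OF gF gF2])
    ultimately show ?thesis unfolding s using True by simp
  next
    case False
    have "0 \<le> A y" for y unfolding A_def using hn by (intro divide_nonneg_pos integral_nonneg_AE) auto
    then show ?thesis using False by (simp add: sum_nonneg)
  qed
  have i1: "integrable lebesgue (\<lambda>p. \<Sum>y\<in>dil 1 Q. A y * indicator (cell y) p)"
    by (intro Bochner_Integration.integrable_sum integrable_mult_right integrable_real_indicator) (auto simp: measure_cell)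
  have i2: "integrable lebesgue (\<lambda>p. e * indicator ?S p)"
    by (intro integrable_mult_right integrable_real_indicator) (use Sfin in auto)
  have i3: "integrable lebesgue (\<lambda>p. norm (g p - F p) * indicator ?S p)"
    by (rule integrable_bounded_on[OF gF gF2]) (use Sfin in auto)
  have i12: "integrable lebesgue (\<lambda>p. (\<Sum>y\<in>dil 1 Q. A y * indicator (cell y) p) + e * indicator ?S p)"
    using i1 i2 by (rule Bochner_Integration.integrable_add)
  have "(\<integral>p. norm (ave F (gi p) - F p) * indicator ?S p \<partial>lebesgue)
    \<le> (\<integral>p. (\<Sum>y\<in>dil 1 Q. A y * indicator (cell y) p) + e * indicator ?S p + norm (g p - F p) * indicator ?S p \<partial>lebesgue)"
    by (rule integral_mono_AE', rule Bochner_Integration.integrable_add[OF i12 i3], rule AE_I2, rule pw,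
        rule AE_I2, rule order_trans[OF _ pw], simp)
  also have "\<dots> = (\<Sum>y\<in>dil 1 Q. A y * ?hn) + e * measure lebesgue ?S + (\<integral>p. norm (g p - F p) * indicator ?S p \<partial>lebesgue)"
    unfolding Bochner_Integration.integral_add[OF i12 i3] Bochner_Integration.integral_add[OF i1 i2]
    by (subst Bochner_Integration.integral_sum)
       (auto simp: measure_cell intro!: integrable_mult_right integrable_real_indicator)
  also have "(\<Sum>y\<in>dil 1 Q. A y * ?hn) = (\<integral>p. norm (g p - F p) * indicator ?S p \<partial>lebesgue)"
    unfolding A_def using hn h_pos sum_cell_integrals[OF gF gF2, of 1 Q] by simp
  also have "measure lebesgue ?S = reg_side 1 Q ^ CARD('n)"
    unfolding reg_def by (rule measure_half_open) (use h_pos in \<open>simp add: reg_side_def\<close>)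
  finally show ?thesis by simp
qed

lemma stepf_ave_bounded:
  assumes F: "F \<in> borel_measurable lebesgue" "\<And>x. norm (F x) \<le> M" and M: "0 \<le> M"
  shows "norm (ave F y) \<le> M"
  using ave_const_approx[OF F, of y 0 M] F(2) M by simp

text \<open>The error is bounded by \<open>2 * M\<close>, so smallness of its integral gives
  smallness in square mean.\<close>

lemma l2n_ave_error:
  assumes F: "F \<in> borel_measurable lebesgue" "\<And>x. norm (F x) \<le> M" and M: "0 < M"
    and F0: "\<And>x. x \<notin> reg 1 Q \<Longrightarrow> F x = 0"
  shows "(l2n (\<lambda>p. stepf (dil 1 Q) (ave F) p - F p))\<^sup>2
    \<le> 2 * M * (\<integral>p. norm (ave F (gi p) - F p) * indicator (reg 1 Q) p \<partial>lebesgue)"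
proof -
  let ?S = "reg 1 Q" and ?D = "\<lambda>p. stepf (dil 1 Q) (ave F) p - F p"
  have Dm: "?D \<in> borel_measurable lebesgue"
    using L2_measurable[OF stepf_L2[OF finite_dil[of 1 Q], of "ave F"]] F(1) by measurable
  have eq: "norm (ave F (gi p) - F p) * indicator ?S p = norm (?D p)" for p
    using F0[of p] by (simp add: stepf_eq reg_iff indicator_def)
  have D2: "norm (?D p) \<le> 2 * M" for p
  proof -
    have "norm (stepf (dil 1 Q) (ave F) p) \<le> M"
      using stepf_ave_bounded[OF F, of "gi p"] M by (simp add: stepf_eq)
    then show ?thesis using norm_triangle_ineq4[of "stepf (dil 1 Q) (ave F) p" "F p"] F(2)[of p] by linarith
  qed
  have D0: "?D p = 0" if "p \<notin> ?S" for p using F0[OF that] that by (simp add: stepf_eq reg_iff)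
  have Sfin: "emeasure lebesgue ?S < \<infinity>" by (simp only: emeasure_reg) simp
  have i1: "integrable lebesgue (\<lambda>p. norm (?D p))"
    using integrable_bounded_on[OF Dm D2 sets_reg Sfin] by (rule Bochner_Integration.integrable_cong[THEN iffD1, rotated 2])
      (use D0 in \<open>auto simp: indicator_def\<close>)
  have "(l2n ?D)\<^sup>2 = (\<integral>p. (norm (?D p))\<^sup>2 \<partial>lebesgue)"
    unfolding l2n_def by (rule real_sqrt_pow2) (rule integral_nonneg_AE, simp)
  also have "\<dots> \<le> (\<integral>p. 2 * M * norm (?D p) \<partial>lebesgue)"
  proof (rule integral_mono_AE')
    show "integrable lebesgue (\<lambda>p. 2 * M * norm (?D p))" using i1 by (rule integrable_mult_right)
    show "AE p in lebesgue. (norm (?D p))\<^sup>2 \<le> 2 * M * norm (?D p)"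
      unfolding power2_eq_square by (intro AE_I2 mult_right_mono D2) auto
  qed (use M in auto)
  also have "\<dots> = 2 * M * (\<integral>p. norm (?D p) \<partial>lebesgue)" by simp
  finally show ?thesis by (simp only: eq)
qed

end

context grid begin

text \<open>Each sum of cell means is at most an integral divided by \<open>h ^ n\<close>. Two such
  factors and the \<open>h ^ n\<close> between \<open>Bt\<close> and the discrete form leave the
  reciprocal of \<open>(2 ^ fst P * h) ^ n\<close>, the volume of the cube \<open>P\<close>.\<close>

lemma stepf_pairing:
  assumes F: "F \<in> borel_measurable lebesgue" "\<And>x. norm (F x) \<le> M"
    and H: "H \<in> borel_measurable lebesgue" "\<And>x. norm (H x) \<le> M"
    and H0: "\<And>x. x \<notin> reg 0 Q \<Longrightarrow> H x = 0"
  shows "\<exists>S. finite S \<and> (\<forall>R\<in>S. dil 0 R \<subseteq> dil 0 Q) \<and>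
    (\<forall>R. (\<Sum>P\<in>{P\<in>S. dil 0 P \<subseteq> dil 0 R}. card (dil 0 P)) \<le> 2 * card (dil 0 R)) \<and>
    norm (Bt (stepf (dil 1 Q) (ave F)) (stepf (dil 1 Q) (ave H))) \<le> dyadic_kernel.Cst TYPE('n) * (15 * c * real CARD('n)) *
      (\<Sum>P\<in>S. (\<integral>p. norm (F p) * indicator (reg 1 P) p \<partial>lebesgue) * (\<integral>p. norm (H p) * indicator (reg 0 P) p \<partial>lebesgue)
         / (2 ^ fst P * h) ^ CARD('n))"
proof -
  interpret dk: dyadic_kernel kap "15 * c * real CARD('n)" "dil 1 Q"
    by (rule dyadic_kernel_kap) simp
  let ?n = "CARD('n)" and ?C = "dyadic_kernel.Cst TYPE('n) * (15 * c * real CARD('n))"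
  define F' where "F' = restr (ave F) (dil 1 Q)"
  define H' where "H' = restr (ave H) (dil 0 Q)"
  have hn: "0 < h ^ ?n" using h_pos by simp
  have H'0: "ave H y = 0" if "y \<notin> dil 0 Q" for y
  proof -
    have "H p * ch y p = 0" for p
      using that H0[of p] by (auto simp: ch_def indicator_def cell_iff reg_iff)
    then have "(\<lambda>p. H p * ch y p) = (\<lambda>p. 0)" by (rule ext)
    then show ?thesis by (simp only: ave_def integral_zero div_0)
  qed
  have sF: "stepf (dil 1 Q) (ave F) = stepf (dil 1 Q) F'" by (auto simp: stepf_eq F'_def restr_def)
  have sH: "stepf (dil 1 Q) (ave H) = stepf (dil 1 Q) H'" using H'0 by (auto simp: stepf_eq H'_def restr_def)
  have "\<exists>S. finite S \<and> (\<forall>R\<in>S. dil 0 R \<subseteq> dil 0 Q) \<and>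
    (\<forall>R. (\<Sum>P\<in>{P\<in>S. dil 0 P \<subseteq> dil 0 R}. card (dil 0 P)) \<le> 2 * card (dil 0 R)) \<and>
    norm (dk.bf F' H') \<le> ?C * (\<Sum>P\<in>S. asum F' (dil 1 P) * asum H' (dil 0 P) / 2 ^ (fst P * ?n))"
    by (rule dk.sparse_domination) (auto simp: F'_def H'_def restr_def)
  then obtain S where S: "finite S" "\<forall>R\<in>S. dil 0 R \<subseteq> dil 0 Q"
    "\<forall>R. (\<Sum>P\<in>{P\<in>S. dil 0 P \<subseteq> dil 0 R}. card (dil 0 P)) \<le> 2 * card (dil 0 R)"
    "norm (dk.bf F' H') \<le> ?C * (\<Sum>P\<in>S. asum F' (dil 1 P) * asum H' (dil 0 P) / 2 ^ (fst P * ?n))"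
    by blast
  have "norm (Bt (stepf (dil 1 Q) F') (stepf (dil 1 Q) H')) = h ^ ?n * norm (dk.bf F' H')"
    unfolding dk.bf_def kap_form[OF finite_dil] using h_pos by (simp add: norm_divide norm_power)
  also have "\<dots> \<le> h ^ ?n * (?C * (\<Sum>P\<in>S. asum F' (dil 1 P) * asum H' (dil 0 P) / 2 ^ (fst P * ?n)))"
    using S(4) hn by (intro mult_left_mono) auto
  also have "\<dots> = ?C * (\<Sum>P\<in>S. h ^ ?n * (asum F' (dil 1 P) * asum H' (dil 0 P) / 2 ^ (fst P * ?n)))"
    by (simp only: sum_distrib_left mult.left_commute)
  also have "\<dots> \<le> ?C * (\<Sum>P\<in>S. (\<integral>p. norm (F p) * indicator (reg 1 P) p \<partial>lebesgue) * (\<integral>p. norm (H p) * indicator (reg 0 P) p \<partial>lebesgue)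
         / (2 ^ fst P * h) ^ ?n)"
  proof (rule mult_left_mono[OF sum_mono])
    fix P
    let ?IF = "\<integral>p. norm (F p) * indicator (reg 1 P) p \<partial>lebesgue" and ?IH = "\<integral>p. norm (H p) * indicator (reg 0 P) p \<partial>lebesgue"
    have IF: "asum F' (dil 1 P) \<le> ?IF / h ^ ?n"
      unfolding F'_def by (rule order_trans[OF dk.asum_restr_le asum_ave[OF F]])
    have IH: "asum H' (dil 0 P) \<le> ?IH / h ^ ?n"
      unfolding H'_def by (rule order_trans[OF dk.asum_restr_le asum_ave[OF H]])
    have nn: "0 \<le> ?IF / h ^ ?n" by (rule order_trans[OF asum_nonneg IF])
    have "asum F' (dil 1 P) * asum H' (dil 0 P) \<le> (?IF / h ^ ?n) * (?IH / h ^ ?n)"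
      by (rule mult_mono[OF IF IH nn asum_nonneg])
    then have "h ^ ?n * (asum F' (dil 1 P) * asum H' (dil 0 P) / 2 ^ (fst P * ?n))
      \<le> h ^ ?n * ((?IF / h ^ ?n) * (?IH / h ^ ?n) / 2 ^ (fst P * ?n))"
      using hn by (intro mult_left_mono divide_right_mono) auto
    also have "\<dots> = ?IF * ?IH / (2 ^ fst P * h) ^ ?n"
    proof -
      have "(2 ^ fst P * h) ^ ?n = 2 ^ (fst P * ?n) * h ^ ?n" by (simp only: power_mult_distrib power_mult)
      then show ?thesis using h_pos by simp
    qed
    finally show "h ^ ?n * (asum F' (dil 1 P) * asum H' (dil 0 P) / 2 ^ (fst P * ?n)) \<le> ?IF * ?IH / (2 ^ fst P * h) ^ ?n" .
  qed (use c_pos dk.Cst_pos in simp)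
  finally show ?thesis unfolding sF sH using S(1-3) by blast
qed

end

context singular_operator begin

lemma ave_L2_converges:
  fixes F :: "real ^ 'n \<Rightarrow> complex" and b :: "real ^ 'n"
  assumes F: "F \<in> borel_measurable lebesgue" "\<And>x. norm (F x) \<le> M" and M: "0 < M" and l: "0 < l"
    and F0: "\<And>x. x \<notin> half_open (b - (\<chi> i. l)) (3 * l) \<Longrightarrow> F x = 0" and e: "0 < e"
  shows "\<exists>N0. \<forall>N\<ge>N0. l2n (\<lambda>p. grid.stepf b (l / 2 ^ N) (dil 1 (N, \<lambda>_. 0)) (grid.ave b (l / 2 ^ N) F) p - F p) < e"
proof -
  let ?S = "half_open (b - (\<chi> i. l)) (3 * l)" and ?n = "CARD('n)"
  have Sfin: "emeasure lebesgue ?S < \<infinity>" using l by (subst emeasure_half_open) auto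
  \<comment> \<open>Chosen so that the final estimate \<open>2 * M * (2 * e1 + e1)\<close> equals
    three quarters of the square of \<open>e\<close>.\<close>
  define e1 where "e1 = e\<^sup>2 / (8 * M)"
  have e1: "0 < e1" using e M by (simp add: e1_def)
  obtain g where g: "continuous_on UNIV g" "\<forall>x. norm (g x) \<le> M"
    "(\<integral>x. norm (g x - F x) * indicator ?S x \<partial>lebesgue) < e1"
    by (rule continuous_approximation[OF F M sets_half_open Sfin e1]) (rule that; assumption)
  have gm: "g \<in> borel_measurable lebesgue"
    using g(1) by (intro measurable_completion) (simp add: borel_measurable_continuous_onI)
  define e2 where "e2 = e1 / (3 * l) ^ ?n"
  have e2: "0 < e2" using e1 l by (simp add: e2_def)
  let ?Q = "closed_cube (b - (\<chi> i. l)) (3 * l)"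
  have uc: "uniformly_continuous_on ?Q g"
    unfolding closed_cube_def
    by (rule compact_uniformly_continuous[OF continuous_on_subset[OF g(1) subset_UNIV] compact_cbox])
  from uc[unfolded uniformly_continuous_on_def, THEN spec, THEN mp, OF e2]
  obtain d where d: "0 < d" "\<forall>p\<in>?Q. \<forall>q\<in>?Q. dist q p < d \<longrightarrow> dist (g q) (g p) < e2" by blast
  have "0 < d / (real ?n * l)" using d l by simp
  then obtain N0 where N0: "(1/2::real) ^ N0 < d / (real ?n * l)"
    using real_arch_pow_inv[of "d / (real ?n * l)" "1/2"] by auto
  show ?thesis
  proof (intro exI[of _ N0] allI impI)
    fix N assume N: "N0 \<le> N"
    define h where "h = l / 2 ^ N"
    let ?P = "(N, \<lambda>_. 0) :: nat \<times> ('n \<Rightarrow> int)"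
    interpret gr: grid T K c b h by unfold_locales (use l in \<open>simp add: h_def\<close>)
    have side: "gr.reg_side 1 ?P = 3 * l" unfolding gr.reg_side_def by (simp add: h_def)
    have reg: "gr.reg 1 ?P = ?S"
    proof -
      have "gr.reg_corner 1 ?P = b - (\<chi> i. l)" unfolding gr.reg_corner_def by (simp add: h_def vec_eq_iff)
      then show ?thesis by (simp add: gr.reg_def side)
    qed
    have nh: "real ?n * h < d"
    proof -
      have "(1/2::real) ^ N \<le> (1/2) ^ N0" using N by (intro power_decreasing) auto
      then have "(1/2::real) ^ N < d / (real ?n * l)" using N0 by linarith
      moreover have "0 < real ?n * l" using l by simp
      ultimately have "(1/2) ^ N * (real ?n * l) < d" by (simp only: pos_less_divide_eq)
      moreover have "(1/2) ^ N * (real ?n * l) = real ?n * h" by (simp add: h_def power_one_over)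
      ultimately show ?thesis by simp
    qed
    have osc: "norm (g q - g p) \<le> e2" if p: "p \<in> gr.reg 1 ?P" and q: "gr.gi q = gr.gi p" for p q
    proof -
      have qr: "q \<in> gr.reg 1 ?P" using p q by (simp add: gr.reg_iff)
      have "norm (q - p) \<le> real ?n * h"
      proof (rule gr.norm_le_card)
        fix k
        have "p \<in> gr.cell (gr.gi p)" "q \<in> gr.cell (gr.gi p)" using q by (auto simp: gr.cell_iff)
        then have "gr.corner (gr.gi p) $ k \<le> p $ k" "p $ k < gr.corner (gr.gi p) $ k + h"
           "gr.corner (gr.gi p) $ k \<le> q $ k" "q $ k < gr.corner (gr.gi p) $ k + h"
          unfolding gr.cell_def half_open_def by blast+
        then show "\<bar>(q - p) $ k\<bar> \<le> h" by (simp add: abs_le_iff)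
      qed
      then have "dist q p < d" using nh by (simp add: dist_norm)
      moreover have "p \<in> ?Q" "q \<in> ?Q" using p qr half_open_subset unfolding reg by blast+
      ultimately have "dist (g q) (g p) < e2" using d(2) by blast
      then show ?thesis by (simp add: dist_norm)
    qed
    let ?D = "\<lambda>p. gr.stepf (dil 1 ?P) (gr.ave F) p - F p"
    have "(l2n ?D)\<^sup>2 \<le> 2 * M * (\<integral>p. norm (gr.ave F (gr.gi p) - F p) * indicator (gr.reg 1 ?P) p \<partial>lebesgue)"
      by (rule gr.l2n_ave_error[OF F M], rule F0) (simp only: reg not_False_eq_True)
    also have "\<dots> \<le> 2 * M * (2 * (\<integral>p. norm (g p - F p) * indicator (gr.reg 1 ?P) p \<partial>lebesgue) + e2 * gr.reg_side 1 ?P ^ ?n)"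
      using M e2 by (intro mult_left_mono gr.ave_L1_error[OF F gm spec[OF g(2)] osc]) auto
    also have "\<dots> < 2 * M * (2 * e1 + e2 * gr.reg_side 1 ?P ^ ?n)"
      using M g(3) unfolding reg by (intro mult_strict_left_mono add_strict_right_mono) auto
    also have "\<dots> = 2 * M * (3 * e1)" using l by (simp add: side e2_def)
    also have "\<dots> = 3 / 4 * e\<^sup>2" using M by (simp add: e1_def)
    also have "\<dots> \<le> e\<^sup>2" by simp
    finally have "(l2n ?D)\<^sup>2 < e\<^sup>2" .
    then have "l2n ?D < e" by (rule power2_less_imp_less) (use e in simp)
    then show "l2n (\<lambda>p. grid.stepf b (l / 2 ^ N) (dil 1 ?P) (grid.ave b (l / 2 ^ N) F) p - F p) < e"
      unfolding h_def .
  qed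
qed

end

subsection \<open>Sparse bound for the bilinear form\<close>

text \<open>The residue modulo 3 of the starting point of the triple in each coordinate, a form of
  the one-third trick.\<close>

definition cls :: "nat \<times> ('n::finite \<Rightarrow> int) \<Rightarrow> 'n \<Rightarrow> int" where
  "cls P = (\<lambda>k. (snd P k - 1) * 2 ^ fst P mod 3)"

lemma finite_range_cls: "finite (range (cls :: nat \<times> ('n::finite \<Rightarrow> int) \<Rightarrow> _))"
  and card_range_cls: "card (range (cls :: nat \<times> ('n::finite \<Rightarrow> int) \<Rightarrow> _)) \<le> 3 ^ CARD('n)"
proof -
  have sub: "range (cls :: nat \<times> ('n \<Rightarrow> int) \<Rightarrow> _) \<subseteq> (\<Pi>\<^sub>E k\<in>UNIV. {0..<3})"
    by (auto simp: cls_def)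
  have fin: "finite (\<Pi>\<^sub>E k\<in>(UNIV :: 'n set). {0..<3 :: int})" by (rule finite_PiE) auto
  show "finite (range (cls :: nat \<times> ('n \<Rightarrow> int) \<Rightarrow> _))" by (rule finite_subset[OF sub fin])
  have "card (range (cls :: nat \<times> ('n \<Rightarrow> int) \<Rightarrow> _)) \<le> card (\<Pi>\<^sub>E k\<in>(UNIV :: 'n set). {0..<3 :: int})"
    by (rule card_mono[OF fin sub])
  then show "card (range (cls :: nat \<times> ('n \<Rightarrow> int) \<Rightarrow> _)) \<le> 3 ^ CARD('n)" by (simp add: card_PiE)
qed

text \<open>
  The triple of the cube \<open>(j, a)\<close> starts at \<open>(a k - 1) * 2 ^ j\<close> in coordinate \<open>k\<close> and has the side \<open>3 * 2 ^ j\<close>.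
  Two triples are nested or disjoint if their starting points are congruent modulo 3.
\<close>

lemma cls_nested_coordinate:
  fixes a a' x y :: int
  assumes c: "(a - 1) * 2 ^ j mod 3 = (a' - 1) * 2 ^ (j + d) mod 3"
    and x: "\<bar>x div 2 ^ j - a\<bar> \<le> 1" "\<bar>x div 2 ^ (j + d) - a'\<bar> \<le> 1" and y: "\<bar>y div 2 ^ j - a\<bar> \<le> 1"
  shows "\<bar>y div 2 ^ (j + d) - a'\<bar> \<le> 1"
proof -
  have 2: "(2::int) ^ d > 0" by simp
  have "3 dvd (a - 1) * 2 ^ j - (a' - 1) * 2 ^ (j + d)" using c by (simp add: mod_eq_dvd_iff)
  also have "(a - 1) * 2 ^ j - (a' - 1) * 2 ^ (j + d) = ((a - 1) - (a' - 1) * 2 ^ d) * 2 ^ j"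
    by (simp add: power_add algebra_simps)
  finally have "3 dvd (a - 1) - (a' - 1) * 2 ^ d"
  proof (rule coprime_dvd_mult_left_iff[THEN iffD1, rotated])
    have "coprime (3::int) 2" by (simp add: coprime_right_2_iff_odd)
    then show "coprime (3::int) (2 ^ j)" by simp
  qed
  \<comment> \<open>In units of \<open>2 ^ j\<close> the small triple starts \<open>3 * k\<close>
    after the large one, because powers of 2 are invertible modulo 3. The lengths 3 and
    \<open>3 * 2 ^ d\<close> are multiples of 3 too, so a common point forces the small triple
    inside the large one.\<close>
  then obtain k where k: "(a - 1) - (a' - 1) * 2 ^ d = 3 * k" by blast
  have l: "\<bar>z div 2 ^ (j + d) - a'\<bar> \<le> 1 \<longleftrightarrow> (a' - 1) * 2 ^ d \<le> z div 2 ^ j \<and> z div 2 ^ j < (a' - 1) * 2 ^ d + 3 * 2 ^ d" for z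
  proof -
    have "a' - 1 \<le> z div 2 ^ j div 2 ^ d \<longleftrightarrow> (a' - 1) * 2 ^ d \<le> z div 2 ^ j" by (rule le_div_iff_int[OF 2])
    moreover have "a' + 2 \<le> z div 2 ^ j div 2 ^ d \<longleftrightarrow> (a' + 2) * 2 ^ d \<le> z div 2 ^ j" by (rule le_div_iff_int[OF 2])
    moreover have "(a' + 2) * 2 ^ d = (a' - 1) * 2 ^ d + 3 * 2 ^ d" by (simp add: algebra_simps)
    ultimately show ?thesis unfolding div_pow_add by linarith
  qed
  have "(a' - 1) * 2 ^ d \<le> x div 2 ^ j" "x div 2 ^ j < (a' - 1) * 2 ^ d + 3 * 2 ^ d" using x(2) l by blast+
  then have "0 \<le> k" "k < 2 ^ d" using k x(1) by linarith+
  then show ?thesis unfolding l using k y by linarith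
qed

lemma cls_nested:
  assumes "cls P = cls R" "fst P \<le> fst R" "x \<in> dil 1 P" "x \<in> dil 1 R" shows "dil 1 P \<subseteq> dil 1 R"
proof
  fix y assume y: "y \<in> dil 1 P"
  obtain d where d: "fst R = fst P + d" using assms(2) by (auto simp: le_iff_add)
  show "y \<in> dil 1 R"
    unfolding dil_def
  proof clarify
    fix k
    show "\<bar>y k div 2 ^ fst R - snd R k\<bar> \<le> 1"
      unfolding d
    proof (rule cls_nested_coordinate)
      show "(snd P k - 1) * 2 ^ fst P mod 3 = (snd R k - 1) * 2 ^ (fst P + d) mod 3"
        using fun_cong[OF assms(1), of k] by (simp add: cls_def d)
      show "\<bar>x k div 2 ^ fst P - snd P k\<bar> \<le> 1" "\<bar>x k div 2 ^ (fst P + d) - snd R k\<bar> \<le> 1" "\<bar>y k div 2 ^ fst P - snd P k\<bar> \<le> 1"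
        using assms(3,4) y by (auto simp: dil_def d)
    qed
  qed
qed

lemma dil1_inj:
  assumes "dil 1 P = dil 1 (R :: nat \<times> ('n::finite \<Rightarrow> int))" shows "P = R"
proof -
  have "nat 3 ^ CARD('n) * 2 ^ (fst P * CARD('n)) = nat 3 ^ CARD('n) * 2 ^ (fst R * CARD('n))"
    using arg_cong[OF assms, of card] by (simp add: card_dil)
  then have l: "fst P = fst R" by simp
  have key: "b k \<le> a k" if s: "dil 1 (j, a) \<subseteq> dil 1 (j, b)" for a b :: "'n \<Rightarrow> int" and j k
  proof -
    have "(\<lambda>k. (a k - 1) * 2 ^ j) \<in> dil 1 (j, a)" by (simp add: dil_def)
    then have "(\<lambda>k. (a k - 1) * 2 ^ j) \<in> dil 1 (j, b)" using s by blast
    then have "\<bar>a k - 1 - b k\<bar> \<le> 1" by (simp add: dil_def)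
    then show ?thesis by linarith
  qed
  obtain j a where P: "P = (j, a)" by (cases P)
  obtain b where R: "R = (j, b)" using l P by (cases R) auto
  have "a k = b k" for k
    using key[of j a b k] key[of j b a k] assms unfolding P R by simp
  then show ?thesis unfolding P R by (simp add: fun_eq_iff)
qed

lemma sum_UN_le_nat:
  fixes g :: "'a \<Rightarrow> nat"
  assumes "finite I" "\<And>i. i \<in> I \<Longrightarrow> finite (A i)"
  shows "sum g (\<Union>i\<in>I. A i) \<le> (\<Sum>i\<in>I. sum g (A i))"
  using assms
proof (induction I rule: finite_induct)
  case (insert i I)
  have "sum g (\<Union>j\<in>insert i I. A j) + sum g (A i \<inter> (\<Union>j\<in>I. A j)) = sum g (A i) + sum g (\<Union>j\<in>I. A j)"
    using sum.union_inter[of "A i" "\<Union>j\<in>I. A j" g] insert by simp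
  then show ?case using insert by simp
qed simp

text \<open>The triple of \<open>R\<close> consists of \<open>3 ^ n\<close> dyadic cubes of the
  level of \<open>R\<close>. A cube whose triple lies in it is contained in one of them, so the
  packing bound is applied \<open>3 ^ n\<close> times.\<close>

lemma tripled_carleson:
  assumes fin: "finite S"
    and car: "\<And>R :: nat \<times> ('n::finite \<Rightarrow> int). (\<Sum>P\<in>{P\<in>S. dil 0 P \<subseteq> dil 0 R}. card (dil 0 P)) \<le> 2 * card (dil 0 R)"
  shows "(\<Sum>P\<in>{P\<in>S. dil 1 P \<subseteq> dil 1 R}. card (dil 0 P)) \<le> 2 * 3 ^ CARD('n) * card (dil 0 R)"
proof -
  let ?A = "{P\<in>S. dil 1 P \<subseteq> dil 1 R}" and ?I = "dil 1 (0::nat, snd R)"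
  let ?f = "\<lambda>b. {P\<in>S. dil 0 P \<subseteq> dil 0 (fst R, b)}"
  have sub: "?A \<subseteq> (\<Union>b\<in>?I. ?f b)"
  proof
    fix P assume P: "P \<in> ?A"
    have "card (dil 1 P) \<le> card (dil 1 R)" using P by (intro card_mono) auto
    then have "fst P \<le> fst R" by (simp add: card_dil)
    have "card (dil 0 P) > 0" by (simp add: card_dil)
    then obtain x where x: "x \<in> dil 0 P" by (metis all_not_in_conv card.empty less_irrefl)
    then have "x \<in> dil 1 R" using P dil_mono[of 0 1 P] by auto
    then obtain b where b: "b \<in> ?I" "x \<in> dil 0 (fst R, b)" using dil1_partition[of "fst R" "snd R"] by auto
    then have "(fst R, b) = anc (fst R - fst P) P" using dil_laminar[OF x b(2)] \<open>fst P \<le> fst R\<close> by simp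
    then have "dil 0 P \<subseteq> dil 0 (fst R, b)" by (metis dil_anc)
    then show "P \<in> (\<Union>b\<in>?I. ?f b)" using P b by blast
  qed
  have "(\<Sum>P\<in>?A. card (dil 0 P)) \<le> (\<Sum>P\<in>(\<Union>b\<in>?I. ?f b). card (dil 0 P))"
    by (rule sum_mono2[OF _ sub]) (use fin in auto)
  also have "\<dots> \<le> (\<Sum>b\<in>?I. \<Sum>P\<in>?f b. card (dil 0 P))"
    by (rule sum_UN_le_nat) (use fin in auto)
  also have "\<dots> \<le> (\<Sum>b\<in>?I. 2 * card (dil 0 (fst R, b)))"
    by (rule sum_mono) (rule car)
  also have "\<dots> = 2 * 3 ^ CARD('n) * card (dil 0 R)" by (simp add: card_dil)
  finally show ?thesis .
qed

context singular_operator begin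

lemma Bt_diff_left: "f \<in> L2 \<Longrightarrow> g \<in> L2 \<Longrightarrow> w \<in> L2 \<Longrightarrow> Bt (\<lambda>y. f y - g y) w = Bt f w - Bt g w"
  using Bt_linear_left[of f g w 1 "-1"] by simp

lemma Bt_diff_right: "f \<in> L2 \<Longrightarrow> g \<in> L2 \<Longrightarrow> w \<in> L2 \<Longrightarrow> Bt w (\<lambda>y. f y - g y) = Bt w f - Bt w g"
  using Bt_linear_right[of f g w 1 "-1"] by simp

lemma L2_diff: "f \<in> L2 \<Longrightarrow> g \<in> L2 \<Longrightarrow> (\<lambda>y. f y - g y) \<in> L2"
  using L2_add[of f "\<lambda>y. - g y"] L2_cmult[of g "-1"] by simp

definition sparse_const :: real where
  "sparse_const = dyadic_kernel.Cst TYPE('n) * (15 * c * real CARD('n))"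

text \<open>The functions live on one cube, which is the dyadic cube of level \<open>N\<close> for
  the mesh \<open>l / 2 ^ N\<close>. Both are replaced by their cell means, and continuity of
  \<open>Bt\<close> in square mean turns this into the additive error \<open>e\<close>.\<close>

theorem pairing_bound:
  fixes F H :: "real ^ 'n \<Rightarrow> complex" and b :: "real ^ 'n"
  assumes F: "F \<in> borel_measurable lebesgue" "\<And>x. norm (F x) \<le> M"
    and H: "H \<in> borel_measurable lebesgue" "\<And>x. norm (H x) \<le> M" and M: "0 < M" and l: "0 < l"
    and F0: "\<And>x. x \<notin> half_open b l \<Longrightarrow> F x = 0" and H0: "\<And>x. x \<notin> half_open b l \<Longrightarrow> H x = 0" and e: "0 < e"
  shows "\<exists>N S. finite S \<and> (\<forall>R\<in>S. dil 0 R \<subseteq> dil 0 (N, \<lambda>_. 0)) \<and>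
    (\<forall>R. (\<Sum>P\<in>{P\<in>S. dil 0 P \<subseteq> dil 0 R}. card (dil 0 P)) \<le> 2 * card (dil 0 R)) \<and>
    norm (Bt F H) \<le> e + sparse_const *
      (\<Sum>P\<in>S. (\<integral>p. norm (F p) * indicator (grid.reg b (l / 2 ^ N) 1 P) p \<partial>lebesgue) *
        (\<integral>p. norm (H p) * indicator (grid.reg b (l / 2 ^ N) 0 P) p \<partial>lebesgue) / (2 ^ fst P * (l / 2 ^ N)) ^ CARD('n))"
proof -
  have sub: "half_open b l \<subseteq> half_open (b - (\<chi> i. l)) (3 * l)"
  proof
    fix p assume p: "p \<in> half_open b l"
    have "b $ k - l \<le> p $ k \<and> p $ k < b $ k - l + 3 * l" for k
    proof -
      have "b $ k \<le> p $ k" "p $ k < b $ k + l" using p by (auto simp: half_open_def)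
      then show ?thesis using l by linarith
    qed
    then show "p \<in> half_open (b - (\<chi> i. l)) (3 * l)" by (simp add: half_open_def)
  qed
  have Sfin: "emeasure lebesgue (half_open b l) < \<infinity>" using l by (subst emeasure_half_open) auto
  have FL: "F \<in> L2" by (rule L2_bounded[OF F F0 sets_half_open Sfin])
  have HL: "H \<in> L2" by (rule L2_bounded[OF H H0 sets_half_open Sfin])
  \<comment> \<open>The difference of the two forms splits into three terms, which sum to at most
    \<open>G * e'\<close> when both approximation errors are below
    \<open>e' \<le> 1\<close>.\<close>
  define G where "G = c * (l2n F + l2n H + 1)"
  have G: "0 < G" unfolding G_def by (intro mult_pos_pos c_pos add_nonneg_pos add_nonneg_nonneg) auto
  define e' where "e' = min 1 (e / G)"
  have e': "0 < e'" "e' \<le> 1" "G * e' \<le> e" using e G by (auto simp: e'_def min_def field_simps)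
  have F0': "F x = 0" and H0': "H x = 0" if "x \<notin> half_open (b - (\<chi> i. l)) (3 * l)" for x
    using F0[of x] H0[of x] sub that by blast+
  obtain N1 where N1: "\<forall>N\<ge>N1. l2n (\<lambda>p. grid.stepf b (l / 2 ^ N) (dil 1 (N, \<lambda>_. 0)) (grid.ave b (l / 2 ^ N) F) p - F p) < e'"
    using ave_L2_converges[OF F M l F0' e'(1)] ..
  obtain N2 where N2: "\<forall>N\<ge>N2. l2n (\<lambda>p. grid.stepf b (l / 2 ^ N) (dil 1 (N, \<lambda>_. 0)) (grid.ave b (l / 2 ^ N) H) p - H p) < e'"
    using ave_L2_converges[OF H M l H0' e'(1)] ..
  define N where "N = max N1 N2"
  define h where "h = l / 2 ^ N"
  let ?Q = "(N, \<lambda>_. 0) :: nat \<times> ('n \<Rightarrow> int)"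
  interpret gr: grid T K c b h by unfold_locales (use l in \<open>simp add: h_def\<close>)
  let ?F = "gr.stepf (dil 1 ?Q) (gr.ave F)" and ?H = "gr.stepf (dil 1 ?Q) (gr.ave H)"
  have reg: "gr.reg 0 ?Q = half_open b l"
  proof -
    have "gr.reg_corner 0 ?Q = b" unfolding gr.reg_corner_def by (simp add: vec_eq_iff)
    moreover have "gr.reg_side 0 ?Q = l" unfolding gr.reg_side_def by (simp add: h_def)
    ultimately show ?thesis by (simp add: gr.reg_def)
  qed
  have FsL: "?F \<in> L2" "?H \<in> L2" by (rule gr.stepf_L2[OF finite_dil])+
  have dF: "l2n (\<lambda>p. ?F p - F p) < e'" using N1 unfolding h_def N_def by simp
  have dH: "l2n (\<lambda>p. ?H p - H p) < e'" using N2 unfolding h_def N_def by simp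
  have DL: "(\<lambda>p. ?F p - F p) \<in> L2" "(\<lambda>p. ?H p - H p) \<in> L2" by (rule L2_diff, fact, fact)+
  have "Bt ?F ?H - Bt F H = Bt (\<lambda>p. ?F p - F p) (\<lambda>p. ?H p - H p) + Bt (\<lambda>p. ?F p - F p) H + Bt F (\<lambda>p. ?H p - H p)"
    using Bt_diff_left[OF FsL(1) FL DL(2)] Bt_diff_left[OF FsL(1) FL HL]
      Bt_diff_right[OF FsL(2) HL FsL(1)] Bt_diff_right[OF FsL(2) HL FL] by simp
  then have "norm (Bt ?F ?H - Bt F H) \<le> c * l2n (\<lambda>p. ?F p - F p) * l2n (\<lambda>p. ?H p - H p)
    + c * l2n (\<lambda>p. ?F p - F p) * l2n H + c * l2n F * l2n (\<lambda>p. ?H p - H p)"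
    by (simp only:) (rule order_trans[OF norm_triangle_ineq add_mono[OF order_trans[OF norm_triangle_ineq
      add_mono[OF Bt_bound[OF DL] Bt_bound[OF DL(1) HL]]] Bt_bound[OF FL DL(2)]]])
  also have "\<dots> \<le> c * e' * 1 + c * e' * l2n H + c * l2n F * e'"
  proof -
    have "l2n (\<lambda>p. ?H p - H p) \<le> 1" using dH e' by linarith
    then show ?thesis using dF dH e' c_pos by (intro add_mono mult_mono) auto
  qed
  also have "\<dots> = G * e'" by (simp add: G_def algebra_simps)
  also have "\<dots> \<le> e" by (rule e'(3))
  finally have close: "norm (Bt ?F ?H - Bt F H) \<le> e" .
  have H0r: "H x = 0" if "x \<notin> gr.reg 0 ?Q" for x using H0 that by (simp add: reg)
  from gr.stepf_pairing[OF F H H0r, folded sparse_const_def] obtain S where SS: "finite S \<and> (\<forall>R\<in>S. dil 0 R \<subseteq> dil 0 ?Q) \<and>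
    (\<forall>R. (\<Sum>P\<in>{P\<in>S. dil 0 P \<subseteq> dil 0 R}. card (dil 0 P)) \<le> 2 * card (dil 0 R)) \<and>
    norm (Bt ?F ?H) \<le> sparse_const * (\<Sum>P\<in>S. (\<integral>p. norm (F p) * indicator (gr.reg 1 P) p \<partial>lebesgue) *
        (\<integral>p. norm (H p) * indicator (gr.reg 0 P) p \<partial>lebesgue) / (2 ^ fst P * h) ^ CARD('n))" ..
  note S = SS[THEN conjunct1] SS[THEN conjunct2, THEN conjunct1] SS[THEN conjunct2, THEN conjunct2, THEN conjunct1]
    SS[THEN conjunct2, THEN conjunct2, THEN conjunct2]
  have "norm (Bt F H) \<le> norm (Bt ?F ?H - Bt F H) + norm (Bt ?F ?H)"
    using norm_triangle_ineq4[of "Bt ?F ?H" "Bt ?F ?H - Bt F H"] by simp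
  also have "\<dots> \<le> e + sparse_const * (\<Sum>P\<in>S. (\<integral>p. norm (F p) * indicator (gr.reg 1 P) p \<partial>lebesgue) *
        (\<integral>p. norm (H p) * indicator (gr.reg 0 P) p \<partial>lebesgue) / (2 ^ fst P * h) ^ CARD('n))"
    using close S(4) by (rule add_mono)
  finally have "norm (Bt F H) \<le> e + sparse_const * (\<Sum>P\<in>S. (\<integral>p. norm (F p) * indicator (gr.reg 1 P) p \<partial>lebesgue) *
        (\<integral>p. norm (H p) * indicator (gr.reg 0 P) p \<partial>lebesgue) / (2 ^ fst P * h) ^ CARD('n))" .
  from conjI[OF S(1) conjI[OF S(2) conjI[OF S(3) this]]] show ?thesis
    unfolding h_def by (rule exI[of _ N, OF exI[of _ S]])
qed

lemma T_cong_AE: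
  assumes "f \<in> L2" "g \<in> L2" "AE x in lebesgue. f x = g x"
  shows "AE x in lebesgue. T f x = T g x"
proof -
  let ?d = "\<lambda>y. 1 * f y + (- 1) * g y"
  have dL: "?d \<in> L2" using L2_diff[OF assms(1,2)] by simp
  have [measurable]: "?d \<in> borel_measurable lebesgue" "T ?d \<in> borel_measurable lebesgue"
    using L2_measurable[OF dL] L2_measurable[OF T_L2[OF dL]] by auto
  note [measurable] = L2_measurable[OF assms(1)] L2_measurable[OF assms(2)]
  have "l2n ?d = 0"
  proof -
    have "(\<integral>x. (norm (?d x))\<^sup>2 \<partial>lebesgue) = (\<integral>x. 0 \<partial>(lebesgue :: (real ^ 'n) measure))"
      by (rule integral_cong_AE) (use assms(3) in auto)
    then show ?thesis by (simp add: l2n_def)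
  qed
  then have "l2n (T ?d) \<le> 0" using T_bound[OF dL] by (simp only: mult_zero_right)
  then have "l2n (T ?d) = 0" using l2n_nonneg by (rule antisym)
  then have "(\<integral>x. (norm (T ?d x))\<^sup>2 \<partial>lebesgue) = 0" by (simp add: l2n_def)
  moreover have "integrable lebesgue (\<lambda>x. (norm (T ?d x))\<^sup>2)" using T_L2[OF dL] by (simp add: L2_def)
  ultimately have "AE x in lebesgue. (norm (T ?d x))\<^sup>2 = 0"
    by (subst (asm) integral_nonneg_eq_0_iff_AE) auto
  with T_linear[OF assms(1,2), of 1 "-1"] show ?thesis by eventually_elim simp
qed

end

section \<open>The weights on half-open cubes\<close>

context mixed_weights begin

lemma mass_half_open: "mass g (half_open a l) = mass g (closed_cube a l)"
  unfolding mass_def by (rule nn_integral_cong_AE) (use AE_half_open[of a l] in \<open>eventually_elim, simp add: indicator_def\<close>)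

lemma lux_half_open: "lux (half_open a l) = lux (closed_cube a l)"
proof -
  have "(\<integral>\<^sup>+y\<in>half_open a l. h y \<partial>lebesgue) = (\<integral>\<^sup>+y\<in>closed_cube a l. h y \<partial>lebesgue)" for h
    by (rule nn_integral_cong_AE) (use AE_half_open[of a l] in \<open>eventually_elim, simp add: indicator_def\<close>)
  then show ?thesis by (simp add: luxemburg_norm_def mass_half_open)
qed

lemma avg_half_open:
  assumes "0 \<le> l" shows "avg v (half_open a l) = avg v (closed_cube a l)"
proof -
  have "set_lebesgue_integral lebesgue (half_open a l) v = set_lebesgue_integral lebesgue (closed_cube a l) v"
    unfolding set_lebesgue_integral_def
    by (rule integral_cong_AE) (use v_meas AE_half_open[of a l] in \<open>auto simp: indicator_def\<close>)
  then show ?thesis using assms by (simp add: avg_def measure_half_open measure_closed_cube)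
qed

text \<open>
  The factor \<open>1 / C1\<close> compensates \<open>v \<le> C1 * M v\<close>. Keeping it here avoids taking a constant out of the integral of the
  maximal functions, which would require their measurability.
\<close>

definition lam :: "(real ^ 'n) set \<Rightarrow> ennreal" where "lam R = ennreal (1 / C1) * lux R"

lemma lux_eq_lam: "lux R = ennreal C1 * lam R"
  using C1_pos by (simp add: lam_def mult.assoc[symmetric] flip: ennreal_mult')

definition boxes :: "(real ^ 'n) set set" where "boxes = {half_open a l | a l. 0 < l}"

lemma boxesE:
  assumes "R \<in> boxes"
  obtains Q where "Q \<in> cubes" "R \<subseteq> Q" "lux R = lux Q" "avg v R = avg v Q" "mass v R = mass v Q"
    "measure lebesgue R = measure lebesgue Q" "R \<in> sets lebesgue"
    "emeasure lebesgue R = ennreal (measure lebesgue R)" "0 < measure lebesgue R"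
proof -
  obtain a l where R: "R = half_open a l" "0 < l" using assms by (auto simp: boxes_def)
  show ?thesis
    by (rule that[of "closed_cube a l"])
       (use R emeasure_half_open[of l a] in \<open>simp_all only: closed_cube_in_cubes half_open_subset lux_half_open avg_half_open
          mass_half_open measure_half_open measure_closed_cube sets_half_open less_imp_le zero_less_power\<close>)
qed

lemma box_facts:
  assumes "R \<in> boxes"
  shows "0 < avg v R" "0 < measure lebesgue R" "emeasure lebesgue R = ennreal (measure lebesgue R)" "R \<in> sets lebesgue"
    "AE x in lebesgue. x \<in> R \<longrightarrow> v x \<le> C1 * avg v R"
    "mass v R = ennreal (avg v R * measure lebesgue R)"
proof -
  obtain Q where Q: "Q \<in> cubes" "R \<subseteq> Q" "lux R = lux Q" "avg v R = avg v Q" "mass v R = mass v Q"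
    "measure lebesgue R = measure lebesgue Q" "R \<in> sets lebesgue"
    "emeasure lebesgue R = ennreal (measure lebesgue R)" "0 < measure lebesgue R"
    by (rule boxesE[OF assms])
  show "0 < avg v R" "0 < measure lebesgue R" "emeasure lebesgue R = ennreal (measure lebesgue R)" "R \<in> sets lebesgue"
    using Q avg_pos by auto
  show "AE x in lebesgue. x \<in> R \<longrightarrow> v x \<le> C1 * avg v R"
    using v_le_avg[OF Q(1)] by eventually_elim (use Q in auto)
  show "mass v R = ennreal (avg v R * measure lebesgue R)" using mass_v[OF Q(1)] Q by simp
qed

text \<open>By RH_infinity, \<open>v\<close> is almost everywhere at most \<open>C1\<close> times
  its mean over the larger cube, hence so is its mean over the smaller one.\<close>

lemma avg_mono:
  assumes R: "R \<in> boxes" and R': "R' \<in> boxes" and sub: "R' \<subseteq> R" shows "avg v R' \<le> C1 * avg v R"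
proof -
  note r = box_facts[OF R] and r' = box_facts[OF R']
  note [measurable] = r'(4)
  have "ennreal (avg v R' * measure lebesgue R') = mass v R'" using r'(6) ..
  also have "\<dots> \<le> (\<integral>\<^sup>+x. ennreal (C1 * avg v R) * indicator R' x \<partial>lebesgue)"
    unfolding mass_def by (rule nn_integral_mono_AE, use r(5) in eventually_elim)
       (use sub in \<open>auto simp: indicator_def intro: ennreal_leI\<close>)
  also have "\<dots> = ennreal (C1 * avg v R) * emeasure lebesgue R'" by (rule nn_integral_cmult_indicator[OF r'(4)])
  also have "\<dots> = ennreal (C1 * avg v R * measure lebesgue R')"
    unfolding r'(3) using C1_pos r(1) by (simp add: ennreal_mult)
  finally have "avg v R' * measure lebesgue R' \<le> C1 * avg v R * measure lebesgue R'"
    using C1_pos r(1) r'(2) by (subst (asm) ennreal_le_iff) auto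
  then show ?thesis using r'(2) by (simp add: mult_le_cancel_right)
qed

lemma ennreal_mult_lux: "0 \<le> x \<Longrightarrow> ennreal x * lux R = ennreal (x * C1) * lam R"
  unfolding lux_eq_lam using C1_pos by (simp add: ennreal_mult' mult.assoc)

lemma box_small_v:
  assumes R: "R \<in> boxes" and e: "0 < e"
  shows "(\<integral>\<^sup>+x. ennreal (u x) * indicator {x\<in>R. v x < e * avg v R} x \<partial>lebesgue)
    \<le> ennreal (C2 * C1 * e powr s * measure lebesgue R) * lam R"
proof -
  obtain Q where Q: "Q \<in> cubes" "R \<subseteq> Q" "lux R = lux Q" "avg v R = avg v Q" "mass v R = mass v Q"
    "measure lebesgue R = measure lebesgue Q" "R \<in> sets lebesgue"
    "emeasure lebesgue R = ennreal (measure lebesgue R)" "0 < measure lebesgue R"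
    by (rule boxesE[OF R])
  note [measurable] = v_meas Q(7)
  have eq: "{x\<in>R. v x < e * avg v R} = R \<inter> {x\<in>space lebesgue. v x < e * avg v R}" by auto
  have "{x\<in>R. v x < e * avg v R} \<in> sets lebesgue" unfolding eq by measurable
  then have "(\<integral>\<^sup>+x. ennreal (u x) * indicator {x\<in>R. v x < e * avg v R} x \<partial>lebesgue)
    \<le> ennreal (C2 * e powr s * measure lebesgue Q) * lux Q"
    by (rule small_v_bound[OF Q(1) e]) (use Q in auto)
  also have "\<dots> = ennreal (C2 * e powr s * measure lebesgue R * C1) * lam R"
    unfolding Q(3,6)[symmetric] using C2_pos e by (intro ennreal_mult_lux) auto
  finally show ?thesis by (simp only: mult_ac)
qed

lemma box_small_set:
  assumes R: "R \<in> boxes" and z: "1 < z" and G: "G \<in> sets lebesgue" "G \<subseteq> R"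
    and small: "emeasure lebesgue G \<le> ennreal (3 * z powr (- real L) * measure lebesgue R)"
  shows "(\<integral>\<^sup>+x. ennreal (u x) * indicator G x \<partial>lebesgue)
    \<le> ennreal (orlicz_const z \<delta> s C1 C2 * C1 * (1 + real L) powr (- \<delta>) * measure lebesgue R) * lam R"
proof -
  obtain Q where Q: "Q \<in> cubes" "R \<subseteq> Q" "lux R = lux Q" "avg v R = avg v Q" "mass v R = mass v Q"
    "measure lebesgue R = measure lebesgue Q" "R \<in> sets lebesgue"
    "emeasure lebesgue R = ennreal (measure lebesgue R)" "0 < measure lebesgue R"
    by (rule boxesE[OF R])
  have "(\<integral>\<^sup>+x. ennreal (u x) * indicator G x \<partial>lebesgue)
    \<le> ennreal (orlicz_const z \<delta> s C1 C2 * (1 + real L) powr (- \<delta>) * measure lebesgue Q) * lux Q"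
    by (rule small_set_bound[OF Q(1) z G(1)]) (use Q G small in auto)
  also have "\<dots> = ennreal (orlicz_const z \<delta> s C1 C2 * (1 + real L) powr (- \<delta>) * measure lebesgue R * C1) * lam R"
    unfolding Q(3,6)[symmetric] using C2_pos delta_pos by (intro ennreal_mult_lux) (auto simp: orlicz_const_def)
  finally show ?thesis by (simp only: mult_ac)
qed

text \<open>Behind the estimate of the exceptional set. One extra factor \<open>C1\<close> bounds
  \<open>v\<close> by its mean, which takes \<open>v\<close> out of the integral; the other converts
  \<open>lux\<close> into \<open>lam\<close>.\<close>

lemma box_whole:
  assumes R: "R \<in> boxes"
  shows "mass (\<lambda>x. u x * v x) R \<le> ennreal (C1 powr s * C2 * C1\<^sup>2 * (avg v R * measure lebesgue R)) * lam R"
proof -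
  obtain Q where Q: "Q \<in> cubes" "R \<subseteq> Q" "lux R = lux Q" "avg v R = avg v Q" "mass v R = mass v Q"
    "measure lebesgue R = measure lebesgue Q" "R \<in> sets lebesgue"
    "emeasure lebesgue R = ennreal (measure lebesgue R)" "0 < measure lebesgue R"
    by (rule boxesE[OF R])
  note r = box_facts[OF R]
  note [measurable] = Q(7) u_meas
  have "mass (\<lambda>x. u x * v x) R \<le> (\<integral>\<^sup>+x. ennreal (C1 * avg v R) * (ennreal (u x) * indicator R x) \<partial>lebesgue)"
    unfolding mass_def
  proof (rule nn_integral_mono_AE, use r(5) in eventually_elim)
    fix x assume x: "x \<in> R \<longrightarrow> v x \<le> C1 * avg v R"
    show "ennreal (u x * v x) * indicator R x \<le> ennreal (C1 * avg v R) * (ennreal (u x) * indicator R x)"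
    proof (cases "x \<in> R")
      case True
      have "u x * v x \<le> C1 * avg v R * u x"
        using mult_left_mono[of "v x" "C1 * avg v R" "u x"] x True u_nonneg by (simp add: mult_ac)
      then have "ennreal (u x * v x) \<le> ennreal (C1 * avg v R) * ennreal (u x)"
        using C1_pos r(1) by (subst ennreal_mult'[symmetric]) (auto intro: ennreal_leI)
      then show ?thesis using True by simp
    qed simp
  qed
  also have "\<dots> = ennreal (C1 * avg v R) * (\<integral>\<^sup>+x. ennreal (u x) * indicator R x \<partial>lebesgue)"
    by (rule nn_integral_cmult) measurable
  also have "\<dots> \<le> ennreal (C1 * avg v R) * (ennreal (C1 powr s * C2 * measure lebesgue Q) * lux Q)"
    by (rule mult_left_mono[OF whole_cube_bound[OF Q(1,7,2)]]) simp
  also have "\<dots> = ennreal (C1 * avg v R * (C1 powr s * C2 * measure lebesgue R)) * lux R"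
    unfolding Q(3,6)[symmetric] mult.assoc[symmetric]
    using C1_pos C2_pos r(1) by (simp add: ennreal_mult'[symmetric] mult.assoc)
  also have "\<dots> = ennreal (C1 * avg v R * (C1 powr s * C2 * measure lebesgue R) * C1) * lam R"
    using C1_pos C2_pos r(1) by (intro ennreal_mult_lux) auto
  also have "C1 * avg v R * (C1 powr s * C2 * measure lebesgue R) * C1 = C1 powr s * C2 * C1\<^sup>2 * (avg v R * measure lebesgue R)"
    by (simp only: power2_eq_square mult_ac)
  finally show ?thesis .
qed

end

section \<open>Triples of grid cubes as nested families in space\<close>

context grid begin

lemma gi_surj: "\<exists>p. gi p = i"
proof
  have "corner i \<in> cell i" using h_pos by (simp add: cell_def half_open_def)
  then show "gi (corner i) = i" by (simp add: cell_iff)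
qed

lemma reg_subset_iff: "reg d P \<subseteq> reg e R \<longleftrightarrow> dil d P \<subseteq> dil e R"
proof
  assume s: "reg d P \<subseteq> reg e R"
  show "dil d P \<subseteq> dil e R"
  proof
    fix i assume i: "i \<in> dil d P"
    obtain p where p: "gi p = i" using gi_surj ..
    then have "p \<in> reg d P" using i by (simp only: reg_iff)
    then have "p \<in> reg e R" using s by blast
    then show "i \<in> dil e R" using p by (simp only: reg_iff)
  qed
qed (auto simp: reg_iff)

lemma inj_reg1: "inj (reg 1)"
proof
  fix P R assume "reg 1 P = reg 1 R"
  then have "dil 1 P \<subseteq> dil 1 R" "dil 1 R \<subseteq> dil 1 P" by (simp_all flip: reg_subset_iff)
  then show "P = R" by (intro dil1_inj equalityI)
qed

lemma laminar_cls: "laminar (reg 1 ` {P\<in>S. cls P = \<kappa>})"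
proof -
  have "reg 1 P \<inter> reg 1 R = {} \<or> reg 1 P \<subseteq> reg 1 R \<or> reg 1 R \<subseteq> reg 1 P" if c: "cls P = cls R" for P R
  proof (cases "reg 1 P \<inter> reg 1 R = {}")
    case False
    then obtain p where "gi p \<in> dil 1 P" "gi p \<in> dil 1 R" by (auto simp: reg_iff)
    then show ?thesis
      unfolding reg_subset_iff using cls_nested[OF c] cls_nested[OF c[symmetric]] by (meson nle_le)
  qed simp
  then show ?thesis unfolding laminar_def by auto
qed

lemma measure_reg1: "measure lebesgue (reg 1 P) = (3 * h) ^ CARD('n) * real (card (dil 0 P))"
  unfolding reg_def using h_pos
  by (subst measure_half_open) (auto simp: reg_side_def card_dil power_mult_distrib mult_ac simp flip: power_mult)

lemma carleson_cls:
  assumes fin: "finite S" and sub: "S' \<subseteq> S"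
    and car: "\<And>R. (\<Sum>P\<in>{P\<in>S. dil 0 P \<subseteq> dil 0 R}. card (dil 0 P)) \<le> 2 * card (dil 0 R)"
  shows "(\<Sum>R'\<in>{R'\<in>reg 1 ` S'. R' \<subseteq> reg 1 P}. measure lebesgue R') \<le> 2 * 3 ^ CARD('n) * measure lebesgue (reg 1 P)"
proof -
  have eq: "{R'\<in>reg 1 ` S'. R' \<subseteq> reg 1 P} = reg 1 ` {R\<in>S'. dil 1 R \<subseteq> dil 1 P}"
    unfolding reg_subset_iff[symmetric] by blast
  have "(\<Sum>R'\<in>{R'\<in>reg 1 ` S'. R' \<subseteq> reg 1 P}. measure lebesgue R')
    = (\<Sum>R\<in>{R\<in>S'. dil 1 R \<subseteq> dil 1 P}. measure lebesgue (reg 1 R))"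
    unfolding eq by (rule sum.reindex_cong[OF inj_on_subset[OF inj_reg1]]) auto
  also have "\<dots> \<le> (\<Sum>R\<in>{R\<in>S. dil 1 R \<subseteq> dil 1 P}. measure lebesgue (reg 1 R))"
    by (rule sum_mono2) (use fin sub in auto)
  also have "\<dots> = (3 * h) ^ CARD('n) * real (\<Sum>R\<in>{R\<in>S. dil 1 R \<subseteq> dil 1 P}. card (dil 0 R))"
    by (simp only: measure_reg1 sum_distrib_left of_nat_sum)
  also have "\<dots> \<le> (3 * h) ^ CARD('n) * real (2 * 3 ^ CARD('n) * card (dil 0 P))"
    using tripled_carleson[OF fin car, of P] h_pos by (intro mult_left_mono) (simp_all only: of_nat_le_iff zero_le_power mult_nonneg_nonneg less_imp_le zero_le_numeral)
  also have "\<dots> = 2 * 3 ^ CARD('n) * measure lebesgue (reg 1 P)" by (simp add: measure_reg1)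
  finally show ?thesis .
qed

end

subsection \<open>The weak type estimate\<close>

lemma mass_eq_emeasure:
  "g \<in> borel_measurable lebesgue \<Longrightarrow> A \<in> sets lebesgue \<Longrightarrow> mass g A = emeasure (density lebesgue (\<lambda>x. ennreal (g x))) A"
  unfolding mass_def by (subst emeasure_density) auto

lemma mass_UN_le:
  assumes "g \<in> borel_measurable lebesgue" "finite I" "\<And>i. i \<in> I \<Longrightarrow> A i \<in> sets lebesgue"
  shows "mass g (\<Union>i\<in>I. A i) \<le> (\<Sum>i\<in>I. mass g (A i))"
proof -
  have "mass g (\<Union>i\<in>I. A i) = emeasure (density lebesgue (\<lambda>x. ennreal (g x))) (\<Union>i\<in>I. A i)"
    using assms by (intro mass_eq_emeasure sets.finite_UN) auto
  also have "\<dots> \<le> (\<Sum>i\<in>I. emeasure (density lebesgue (\<lambda>x. ennreal (g x))) (A i))"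
    using assms by (intro emeasure_subadditive_finite) auto
  also have "\<dots> = (\<Sum>i\<in>I. mass g (A i))"
    using assms by (intro sum.cong refl mass_eq_emeasure[symmetric]) auto
  finally show ?thesis .
qed

lemma mass_incseq_le:
  assumes g: "g \<in> borel_measurable lebesgue" and A: "\<And>k. A k \<in> sets lebesgue" "incseq A" and le: "\<And>k. mass g (A k) \<le> B"
  shows "mass g (\<Union>k. A k) \<le> B"
proof -
  let ?D = "density lebesgue (\<lambda>x. ennreal (g x))"
  have "mass g (\<Union>k. A k) = emeasure ?D (\<Union>k. A k)" using A by (intro mass_eq_emeasure[OF g]) auto
  also have "\<dots> = (SUP k. emeasure ?D (A k))" by (rule SUP_emeasure_incseq[symmetric]) (use A in auto)
  also have "\<dots> \<le> B" using le by (intro SUP_least) (simp add: mass_eq_emeasure[OF g A(1)])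
  finally show ?thesis .
qed

lemma mass_mono: "A \<subseteq> B \<Longrightarrow> mass g A \<le> mass g B"
  unfolding mass_def by (intro nn_integral_mono) (auto simp: indicator_def)

lemma mass_Un_le:
  assumes g: "g \<in> borel_measurable lebesgue" and A: "A \<in> sets lebesgue" "B \<in> sets lebesgue"
  shows "mass g (A \<union> B) \<le> mass g A + mass g B"
proof -
  let ?D = "density lebesgue (\<lambda>x. ennreal (g x))"
  have "mass g (A \<union> B) = emeasure ?D (A \<union> B)" using A by (intro mass_eq_emeasure[OF g]) auto
  also have "\<dots> \<le> emeasure ?D A + emeasure ?D B" by (rule emeasure_subadditive) (use A in auto)
  finally show ?thesis by (simp add: mass_eq_emeasure[OF g] A)
qed

text \<open>\<open>F\<close> stands for the product of \<open>f\<close> and \<open>v\<close>, made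
  bounded by a change on a null set, and \<open>X\<close> for the integrand of the right side, of
  which only the lower bound \<open>X_bound\<close> is used.\<close>

locale weak_type = mixed_weights u v s \<delta> C1 C2 + singular_operator T K c
  for u v :: "real ^ 'n \<Rightarrow> real" and s \<delta> C1 C2 :: real
    and T :: "(real ^ 'n \<Rightarrow> complex) \<Rightarrow> real ^ 'n \<Rightarrow> complex" and K :: "real ^ 'n \<Rightarrow> complex" and c +
  fixes F :: "real ^ 'n \<Rightarrow> complex" and b :: "real ^ 'n" and M l t :: real and X :: "real ^ 'n \<Rightarrow> ennreal"
  assumes F_meas: "F \<in> borel_measurable lebesgue" and F_bound: "\<And>x. norm (F x) \<le> M" and M_pos: "0 < M"
    and F_zero: "\<And>x. x \<notin> half_open b l \<Longrightarrow> F x = 0" and l_pos: "0 < l" and t_pos: "0 < t"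
    and X_bound: "AE p in lebesgue. \<forall>R\<in>boxes. p \<in> R \<longrightarrow> lam R * ennreal (norm (F p)) \<le> X p"
begin

definition bF :: "(real ^ 'n) set \<Rightarrow> real" where
  "bF R = (\<integral>p. norm (F p) * indicator R p \<partial>lebesgue)"

lemma F_L2: "F \<in> L2"
  using l_pos by (intro L2_bounded[OF F_meas F_bound F_zero sets_half_open]) (auto simp: emeasure_half_open simp del: emeasure_completion)

lemma F_integrable: "R \<in> sets lebesgue \<Longrightarrow> integrable lebesgue (\<lambda>p. norm (F p) * indicator R p)"
proof (rule integrableI_bounded_set[where A = "half_open b l" and B = M])
  note [measurable] = F_meas
  assume [measurable]: "R \<in> sets lebesgue"
  show "(\<lambda>p. norm (F p) * indicator R p) \<in> borel_measurable lebesgue" by measurable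
  show "AE x in lebesgue. x \<in> half_open b l \<longrightarrow> norm (norm (F x) * indicator R x) \<le> M"
    using F_bound M_pos by (auto simp: indicator_def)
qed (use l_pos in \<open>auto simp: emeasure_half_open F_zero simp del: emeasure_completion\<close>)

lemma bF_nonneg: "0 \<le> bF R" unfolding bF_def by (intro integral_nonneg_AE) auto

lemma nn_bF: "R \<in> sets lebesgue \<Longrightarrow> (\<integral>\<^sup>+p. ennreal (norm (F p)) * indicator R p \<partial>lebesgue) = ennreal (bF R)"
proof -
  assume "R \<in> sets lebesgue"
  then have "(\<integral>\<^sup>+p. ennreal (norm (F p) * indicator R p) \<partial>lebesgue) = ennreal (bF R)"
    unfolding bF_def by (intro nn_integral_eq_integral F_integrable) auto
  moreover have "(\<lambda>p. ennreal (norm (F p)) * indicator R p) = (\<lambda>p. ennreal (norm (F p) * indicator R p))"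
    by (auto simp: fun_eq_iff indicator_def)
  ultimately show ?thesis by simp
qed

lemma uv_meas [measurable]: "(\<lambda>x. u x * v x) \<in> borel_measurable lebesgue"
  using u_meas v_meas by measurable

definition bad :: "(real ^ 'n) set \<Rightarrow> bool" where "bad R \<longleftrightarrow> t * avg v R * measure lebesgue R < bF R"

text \<open>The factor 4 is the \<open>2 * L\<close> of \<open>laminar_sum_le\<close> with
  \<open>L = 2\<close>; the bracket is the constant of \<open>box_whole\<close>.\<close>

definition union_const :: real where "union_const = 4 * (C1 powr s * C2 * C1\<^sup>2)"

text \<open>The maximal members cover the union and contain no other maximal member, so packing
  holds for \<open>bF\<close> with the constant 1. On a bad set the mass of \<open>v\<close> is less
  than \<open>bF R / t\<close>, which turns \<open>box_whole\<close> into the summand of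
  \<open>laminar_sum_le\<close>.\<close>

lemma bad_laminar:
  assumes fin: "finite \<F>" and lami: "laminar \<F>" and box: "\<F> \<subseteq> boxes" and bad: "\<And>R. R \<in> \<F> \<Longrightarrow> bad R"
  shows "mass (\<lambda>x. u x * v x) (\<Union>\<F>) \<le> ennreal (union_const / t) * (\<integral>\<^sup>+x. X x \<partial>lebesgue)"
proof -
  let ?U = "\<lambda>x. u x * v x" and ?C = "C1 powr s * C2 * C1\<^sup>2"
  define \<M> where "\<M> = {R\<in>\<F>. \<forall>R'\<in>\<F>. R \<subseteq> R' \<longrightarrow> R = R'}"
  have Msub: "\<M> \<subseteq> \<F>" by (auto simp: \<M>_def)
  have Mfin: "finite \<M>" using fin Msub by (rule rev_finite_subset)
  have Mbox: "R \<in> boxes" if "R \<in> \<M>" for R using that Msub box by blast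
  have Msets: "\<M> \<subseteq> sets lebesgue" using Mbox box_facts(4) by blast
  have C: "0 < ?C" using C1_pos C2_pos by simp
  have "\<Union>\<F> \<subseteq> (\<Union>R\<in>\<M>. R)"
  proof
    fix x assume "x \<in> \<Union>\<F>"
    then obtain R where R: "R \<in> \<F>" "x \<in> R" ..
    from finite_has_maximal2[OF fin R(1)] obtain R' where R': "R' \<in> \<F>" "R \<subseteq> R'" "\<forall>S\<in>\<F>. R' \<subseteq> S \<longrightarrow> R' = S" by blast
    then have "R' \<in> \<M>" by (simp add: \<M>_def)
    then show "x \<in> (\<Union>R\<in>\<M>. R)" using R R' by blast
  qed
  then have "mass ?U (\<Union>\<F>) \<le> mass ?U (\<Union>R\<in>\<M>. R)" by (rule mass_mono)
  also have "\<dots> \<le> (\<Sum>R\<in>\<M>. mass ?U R)"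
    by (rule mass_UN_le[OF uv_meas Mfin]) (use Msets in blast)
  also have "\<dots> \<le> (\<Sum>R\<in>\<M>. ennreal (?C / t) * (lam R * ennreal (bF R)))"
  proof (rule sum_mono)
    fix R assume R: "R \<in> \<M>"
    have "mass ?U R \<le> ennreal (?C * (avg v R * measure lebesgue R)) * lam R" by (rule box_whole[OF Mbox[OF R]])
    also have "\<dots> \<le> ennreal (?C / t * bF R) * lam R"
    proof (intro mult_right_mono ennreal_leI)
      have "t * (avg v R * measure lebesgue R) \<le> bF R" using bad[of R] R Msub unfolding bad_def mult.assoc by auto
      then have "avg v R * measure lebesgue R \<le> bF R / t" using t_pos by (simp add: pos_le_divide_eq mult.commute)
      then have "?C * (avg v R * measure lebesgue R) \<le> ?C * (bF R / t)" using C by (intro mult_left_mono) auto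
      then show "?C * (avg v R * measure lebesgue R) \<le> ?C / t * bF R" by simp
    qed simp
    also have "\<dots> = ennreal (?C / t) * (lam R * ennreal (bF R))"
      using C t_pos bF_nonneg[of R] by (subst ennreal_mult) (auto simp: mult_ac)
    finally show "mass ?U R \<le> ennreal (?C / t) * (lam R * ennreal (bF R))" .
  qed
  also have "\<dots> = ennreal (?C / t) * (\<Sum>R\<in>\<M>. lam R * ennreal (bF R))" by (simp only: sum_distrib_left)
  also have "(\<Sum>R\<in>\<M>. lam R * ennreal (bF R)) \<le> ennreal (2 * real 2) * (\<integral>\<^sup>+x. X x \<partial>lebesgue)"
  proof (rule laminar_sum_le[where K = 1 and g = "\<lambda>p. ennreal (norm (F p))"])
    show "laminar \<M>" by (rule laminar_subset[OF lami Msub])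
    show "(\<lambda>p. ennreal (norm (F p))) \<in> borel_measurable lebesgue" using F_meas by measurable
    show "(\<integral>\<^sup>+x. ennreal (norm (F x)) * indicator R x \<partial>lebesgue) = ennreal (bF R)" if "R \<in> \<M>" for R
      using that Msets by (intro nn_bF) blast
    show "(\<Sum>R'\<in>{R'\<in>\<M>. R' \<subseteq> R}. bF R') \<le> 1 * bF R" if "R \<in> \<M>" for R
    proof -
      have "{R'\<in>\<M>. R' \<subseteq> R} = {R}" using that Msub unfolding \<M>_def by blast
      then show ?thesis by simp
    qed
    show "AE x in lebesgue. \<forall>R\<in>\<M>. x \<in> R \<longrightarrow> lam R * ennreal (norm (F x)) \<le> X x"
      using X_bound by eventually_elim (use Mbox in blast)
  qed (use Mfin Msets bF_nonneg in auto)
  finally have "mass ?U (\<Union>\<F>) \<le> ennreal (?C / t) * (ennreal (2 * real 2) * (\<integral>\<^sup>+x. X x \<partial>lebesgue))"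
    by (simp add: mult_left_mono)
  also have "\<dots> = ennreal (?C / t * 4) * (\<integral>\<^sup>+x. X x \<partial>lebesgue)"
    using C t_pos by (subst ennreal_mult'') (auto simp: mult.assoc)
  finally show ?thesis by (simp add: union_const_def mult.commute)
qed

end

section \<open>The exceptional set\<close>

context weak_type begin

text \<open>Levels are counted downwards from the base cube: \<open>fst i\<close> halvings of the
  side \<open>l\<close>. This names the triples independently of the mesh, so that
  \<open>Omega\<close> is fixed before the mesh is chosen in terms of the error in
  \<open>pairing_bound\<close>.\<close>

definition tri :: "nat \<times> ('n \<Rightarrow> int) \<Rightarrow> (real ^ 'n) set" where
  "tri i = half_open (\<chi> k. b $ k + l / 2 ^ fst i * of_int (snd i k - 1)) (3 * (l / 2 ^ fst i))"

lemma tri_box: "tri i \<in> boxes"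
  unfolding boxes_def tri_def using l_pos by fastforce

lemma grid_at: "grid T K c (l / 2 ^ N)"
  by unfold_locales (use l_pos in simp)

lemma reg_eq_tri: assumes "j \<le> N" shows "grid.reg b (l / 2 ^ N) 1 (N - j, a) = tri (j, a)"
proof -
  interpret gr: grid T K c b "l / 2 ^ N" by (rule grid_at)
  have e: "l / 2 ^ N * 2 ^ (N - j) = l / 2 ^ j"
  proof -
    have "(2::real) ^ N = 2 ^ j * 2 ^ (N - j)" using assms by (simp flip: power_add)
    then show ?thesis by simp
  qed
  then have e': "3 * 2 ^ (N - j) * (l / 2 ^ N) = 3 * (l / 2 ^ j)" by (simp only: mult.assoc mult.commute[of "2 ^ (N - j)"])
  show ?thesis unfolding gr.reg_def gr.reg_corner_def gr.reg_side_def tri_def using e e' by simp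
qed

text \<open>Finitely many triples fit into one grid, that of the finest level among them. There
  \<open>cls\<close> splits them into at most \<open>3 ^ n\<close> nested families.\<close>

lemma bad_union_finite:
  assumes fin: "finite A" and bad: "\<And>i. i \<in> A \<Longrightarrow> bad (tri i)"
  shows "mass (\<lambda>x. u x * v x) (\<Union>i\<in>A. tri i) \<le> 3 ^ CARD('n) * (ennreal (union_const / t) * (\<integral>\<^sup>+x. X x \<partial>lebesgue))"
proof -
  define N where "N = Max (insert 0 (fst ` A))"
  have N: "fst i \<le> N" if "i \<in> A" for i unfolding N_def using fin that by (intro Max_ge) auto
  interpret gr: grid T K c b "l / 2 ^ N" by (rule grid_at)
  define P where "P = (\<lambda>i :: nat \<times> ('n \<Rightarrow> int). (N - fst i, snd i))"
  have tri: "gr.reg 1 (P i) = tri i" if "i \<in> A" for i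
    using reg_eq_tri[OF N[OF that], of "snd i"] by (simp add: P_def)
  let ?F = "\<lambda>\<kappa>. gr.reg 1 ` {R\<in>P ` A. cls R = \<kappa>}" and ?I = "range (cls :: nat \<times> ('n \<Rightarrow> int) \<Rightarrow> _)"
  have Fbox: "R \<in> boxes \<and> bad R" if "R \<in> ?F \<kappa>" for R \<kappa> using that tri tri_box bad by auto
  have "(\<Union>i\<in>A. tri i) \<subseteq> (\<Union>\<kappa>\<in>?I. \<Union>(?F \<kappa>))"
  proof (rule UN_least)
    fix i assume i: "i \<in> A"
    then have "tri i \<in> ?F (cls (P i))" by (intro image_eqI[of _ _ "P i"]) (simp_all add: tri)
    then show "tri i \<subseteq> (\<Union>\<kappa>\<in>?I. \<Union>(?F \<kappa>))" by blast
  qed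
  then have "mass (\<lambda>x. u x * v x) (\<Union>i\<in>A. tri i) \<le> mass (\<lambda>x. u x * v x) (\<Union>\<kappa>\<in>?I. \<Union>(?F \<kappa>))" by (rule mass_mono)
  also have "\<dots> \<le> (\<Sum>\<kappa>\<in>?I. mass (\<lambda>x. u x * v x) (\<Union>(?F \<kappa>)))"
    by (rule mass_UN_le[OF uv_meas finite_range_cls]) (use fin in \<open>intro sets.finite_Union; auto\<close>)
  also have "\<dots> \<le> (\<Sum>\<kappa>\<in>?I. ennreal (union_const / t) * (\<integral>\<^sup>+x. X x \<partial>lebesgue))"
    by (intro sum_mono bad_laminar gr.laminar_cls) (use fin Fbox in auto)
  also have "\<dots> \<le> of_nat (3 ^ CARD('n)) * (ennreal (union_const / t) * (\<integral>\<^sup>+x. X x \<partial>lebesgue))"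
    unfolding sum_constant by (intro mult_right_mono of_nat_mono card_range_cls) simp
  finally show ?thesis by simp
qed

definition Omega :: "(real ^ 'n) set" where "Omega = (\<Union>i\<in>{i. bad (tri i)}. tri i)"

lemma sets_tri [measurable]: "tri i \<in> sets lebesgue" by (simp add: tri_def)

lemma sets_Omega [measurable]: "Omega \<in> sets lebesgue"
  unfolding Omega_def by (intro sets.countable_UN') auto

text \<open>There may be infinitely many bad triples, while the estimates for nested families need
  finite ones. An enumeration exhausts \<open>Omega\<close> by finite unions, with the same bound
  for all of them.\<close>

lemma mass_Omega: "mass (\<lambda>x. u x * v x) Omega \<le> 3 ^ CARD('n) * (ennreal (union_const / t) * (\<integral>\<^sup>+x. X x \<partial>lebesgue))"
proof -
  let ?A = "\<lambda>k. {i. bad (tri i) \<and> to_nat i < k}"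
  have fin: "finite (?A k)" for k
  proof (rule finite_subset)
    show "?A k \<subseteq> to_nat -` {..<k}" by auto
    show "finite (to_nat -` {..<k} :: (nat \<times> ('n \<Rightarrow> int)) set)" by (intro finite_vimageI) auto
  qed
  have "Omega = (\<Union>k. \<Union>i\<in>?A k. tri i)" unfolding Omega_def by blast
  also have "mass (\<lambda>x. u x * v x) \<dots> \<le> 3 ^ CARD('n) * (ennreal (union_const / t) * (\<integral>\<^sup>+x. X x \<partial>lebesgue))"
  proof (rule mass_incseq_le[OF uv_meas])
    show "(\<Union>i\<in>?A k. tri i) \<in> sets lebesgue" for k by (intro sets.finite_UN fin sets_tri)
    show "incseq (\<lambda>k. \<Union>i\<in>?A k. tri i)" by (rule incseq_SucI) (auto intro: less_SucI)
    show "mass (\<lambda>x. u x * v x) (\<Union>i\<in>?A k. tri i) \<le> 3 ^ CARD('n) * (ennreal (union_const / t) * (\<integral>\<^sup>+x. X x \<partial>lebesgue))" for k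
      by (rule bad_union_finite[OF fin]) simp
  qed
  finally show ?thesis .
qed

end

section \<open>Points outside the exceptional set\<close>

context weak_type begin

text \<open>The base \<open>z\<close> of \<open>exp_moment\<close> for the packing constant
  \<open>2 * 3 ^ n\<close> of \<open>carleson_cls\<close>.\<close>

definition moment_base :: real where "moment_base = 1 + 1 / (2 * (2 * 3 ^ CARD('n)))"

text \<open>Multiplied by \<open>sparse_const\<close> and the two factors \<open>3 ^ n\<close> of
  \<open>sparse_sum_bound\<close> it gives 1/2, so that half of the left side can be
  absorbed.\<close>

definition absorb_const :: real where "absorb_const = 1 / (2 * (sparse_const * (3 ^ CARD('n) * 3 ^ CARD('n))))"

definition class_const :: real where
  "class_const = laminar_const C1 (C2 * C1) (orlicz_const moment_base \<delta> s C1 C2 * C1) s \<delta> (2 * 3 ^ CARD('n)) absorb_const"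

lemma sparse_const_pos: "0 < sparse_const"
proof -
  interpret gr: grid T K c b l by unfold_locales (rule l_pos)
  have "0 < dyadic_kernel.Cst TYPE('n)" by (rule dyadic_kernel.Cst_pos[OF gr.dyadic_kernel_kap[of "{}"]]) simp
  then show ?thesis using c_pos by (simp add: sparse_const_def)
qed

lemma moment_base_gt: "1 < moment_base" by (simp add: moment_base_def)

lemma absorb_const_pos: "0 < absorb_const" using sparse_const_pos by (simp add: absorb_const_def)

text \<open>Only triples that meet \<open>E\<close> are kept. As \<open>E\<close> avoids
  \<open>Omega\<close>, none of them is bad, and this is the density bound
  \<open>b R \<le> t * a R * m R\<close> that \<open>laminar_bound\<close> requires.\<close>

lemma class_bound:
  fixes S :: "(nat \<times> ('n \<Rightarrow> int)) set" and \<kappa> :: "'n \<Rightarrow> int"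
  assumes fin: "finite S" and E: "E \<in> sets lebesgue" and disj: "E \<inter> Omega = {}" and N: "\<And>P. P \<in> S \<Longrightarrow> fst P \<le> N"
    and car: "\<And>R. (\<Sum>P\<in>{P\<in>S. dil 0 P \<subseteq> dil 0 R}. card (dil 0 P)) \<le> 2 * card (dil 0 R)"
  defines "\<F> \<equiv> grid.reg b (l / 2 ^ N) 1 ` {P\<in>{P\<in>S. grid.reg b (l / 2 ^ N) 1 P \<inter> E \<noteq> {}}. cls P = \<kappa>}"
  shows "(\<Sum>R\<in>\<F>. ennreal (bF R / measure lebesgue R) * (\<integral>\<^sup>+x. ennreal (u x) * indicator (E \<inter> R) x \<partial>lebesgue))
    \<le> ennreal (absorb_const * t) * mass (\<lambda>x. u x * v x) E + ennreal class_const * (\<integral>\<^sup>+x. X x \<partial>lebesgue)"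
proof -
  interpret gr: grid T K c b "l / 2 ^ N" by (rule grid_at)
  have tri: "gr.reg 1 P = tri (N - fst P, snd P)" if "P \<in> S" for P
    using reg_eq_tri[of "N - fst P" N "snd P"] N[OF that] by simp
  have Fbox: "R \<in> boxes" and notbad: "\<not> bad R" if R: "R \<in> \<F>" for R
  proof -
    obtain P where P: "P \<in> S" "R = gr.reg 1 P" "R \<inter> E \<noteq> {}" using R unfolding \<F>_def by blast
    have R': "R = tri (N - fst P, snd P)" using P tri by simp
    then show "R \<in> boxes" using tri_box by simp
    show "\<not> bad R"
    proof
      assume "bad R"
      then have "R \<subseteq> Omega" unfolding R' Omega_def by blast
      then show False using P disj by blast
    qed
  qed
  have Fsets: "\<F> \<subseteq> sets lebesgue" using Fbox box_facts(4) by blast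
  have "(\<Sum>R\<in>\<F>. ennreal (bF R / measure lebesgue R) * (\<integral>\<^sup>+x. ennreal (u x) * indicator (E \<inter> R) x \<partial>lebesgue))
    \<le> ennreal (absorb_const * t) * (\<integral>\<^sup>+x. ennreal (u x * v x) * indicator E x \<partial>lebesgue)
      + ennreal (laminar_const C1 (C2 * C1) (orlicz_const moment_base \<delta> s C1 C2 * C1) s \<delta> (2 * 3 ^ CARD('n)) absorb_const) * (\<integral>\<^sup>+x. X x \<partial>lebesgue)"
  proof (rule laminar_bound[where a = "avg v" and lam = lam and g = "\<lambda>p. ennreal (norm (F p))" and z = moment_base])
    show "finite \<F>" using fin by (simp add: \<F>_def)
    show "laminar \<F>" unfolding \<F>_def by (rule gr.laminar_cls)
    show "(\<lambda>p. ennreal (norm (F p))) \<in> borel_measurable lebesgue" using F_meas by measurable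
    show "avg v R' \<le> C1 * avg v R" if "R \<in> \<F>" "R' \<in> \<F>" "R' \<subseteq> R" for R R' using that Fbox by (intro avg_mono) auto
    show "(\<integral>\<^sup>+x. ennreal (norm (F x)) * indicator R x \<partial>lebesgue) = ennreal (bF R)" if "R \<in> \<F>" for R
      using that Fsets by (intro nn_bF) blast
    show "bF R \<le> t * avg v R * measure lebesgue R" if "R \<in> \<F>" for R using notbad[OF that] by (simp add: bad_def)
    show "(\<Sum>R'\<in>{R'\<in>\<F>. R' \<subseteq> R}. measure lebesgue R') \<le> (2 * 3 ^ CARD('n)) * measure lebesgue R" if R: "R \<in> \<F>" for R
    proof -
      obtain P where P: "R = gr.reg 1 P" using R unfolding \<F>_def by blast
      show ?thesis unfolding P \<F>_def by (rule gr.carleson_cls[OF fin _ car]) auto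
    qed
    show "1 \<le> 2 * (3::real) ^ CARD('n)" using one_le_power[of "3::real" "CARD('n)"] by linarith
    show "(\<integral>\<^sup>+x. ennreal (u x) * indicator {x \<in> R. v x < e * avg v R} x \<partial>lebesgue)
      \<le> ennreal (C2 * C1 * e powr s * measure lebesgue R) * lam R" if "R \<in> \<F>" "0 < e" for R e
      using that Fbox by (intro box_small_v) auto
    show "(\<integral>\<^sup>+x. ennreal (u x) * indicator G x \<partial>lebesgue)
      \<le> ennreal (orlicz_const moment_base \<delta> s C1 C2 * C1 * (1 + real L) powr (- \<delta>) * measure lebesgue R) * lam R"
      if "R \<in> \<F>" "G \<in> sets lebesgue" "G \<subseteq> R" "emeasure lebesgue G \<le> ennreal (3 * moment_base powr (- real L) * measure lebesgue R)" for R G L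
      using that Fbox by (intro box_small_set moment_base_gt) auto
    show "AE x in lebesgue. \<forall>R\<in>\<F>. x \<in> R \<longrightarrow> lam R * ennreal (norm (F x)) \<le> X x"
      using X_bound by eventually_elim (use Fbox in blast)
    show "0 \<le> orlicz_const moment_base \<delta> s C1 C2 * C1" using C1_pos C2_pos delta_pos by (simp add: orlicz_const_def)
  qed (use Fsets u_meas v_meas u_nonneg E Fbox box_facts bF_nonneg t_pos C1_pos C2_pos s_pos delta_pos absorb_const_pos
      in \<open>auto simp: moment_base_def simp del: emeasure_completion\<close>)
  then show ?thesis by (simp only: mass_def class_const_def)
qed

end

context weak_type begin

text \<open>The integral of \<open>H\<close> over a cube is enlarged to its triple, because only
  triples of one class form nested families. One factor \<open>3 ^ n\<close> is the ratio of the
  volumes, the other the number of classes.\<close>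

lemma sparse_sum_bound:
  fixes S :: "(nat \<times> ('n \<Rightarrow> int)) set" and H :: "real ^ 'n \<Rightarrow> complex"
  assumes fin: "finite S" and E: "E \<in> sets lebesgue" and disj: "E \<inter> Omega = {}" and N: "\<And>P. P \<in> S \<Longrightarrow> fst P \<le> N"
    and car: "\<And>R. (\<Sum>P\<in>{P\<in>S. dil 0 P \<subseteq> dil 0 R}. card (dil 0 P)) \<le> 2 * card (dil 0 R)"
    and H: "\<And>x. norm (H x) = u x * indicator E x" and int: "integrable lebesgue (\<lambda>x. u x * indicator E x)"
  shows "ennreal (\<Sum>P\<in>S. bF (grid.reg b (l / 2 ^ N) 1 P) *
        (\<integral>p. norm (H p) * indicator (grid.reg b (l / 2 ^ N) 0 P) p \<partial>lebesgue) / (2 ^ fst P * (l / 2 ^ N)) ^ CARD('n))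
    \<le> 3 ^ CARD('n) * 3 ^ CARD('n) * (ennreal (absorb_const * t) * mass (\<lambda>x. u x * v x) E
       + ennreal class_const * (\<integral>\<^sup>+x. X x \<partial>lebesgue))"
    (is "ennreal (\<Sum>P\<in>S. ?T P) \<le> _ * _ * ?B")
proof -
  interpret gr: grid T K c b "l / 2 ^ N" by (rule grid_at)
  note [measurable] = E
  define U where "U = (\<lambda>R. \<integral>x. u x * indicator (E \<inter> R) x \<partial>lebesgue)"
  define G where "G = (\<lambda>R. bF R / measure lebesgue R * U R)"
  have intR: "integrable lebesgue (\<lambda>x. u x * indicator (E \<inter> R) x)" if [measurable]: "R \<in> sets lebesgue" for R
    by (rule Bochner_Integration.integrable_bound[OF int]) (use u_meas u_nonneg in \<open>auto simp: indicator_def\<close>)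
  have U0: "0 \<le> U R" for R unfolding U_def by (intro integral_nonneg_AE) (simp add: u_nonneg)
  have G0: "0 \<le> G R" for R unfolding G_def using U0 bF_nonneg by simp
  have Unn: "(\<integral>\<^sup>+x. ennreal (u x) * indicator (E \<inter> R) x \<partial>lebesgue) = ennreal (U R)" if "R \<in> sets lebesgue" for R
  proof -
    have "(\<integral>\<^sup>+x. ennreal (u x * indicator (E \<inter> R) x) \<partial>lebesgue) = ennreal (U R)"
      unfolding U_def using u_nonneg by (intro nn_integral_eq_integral intR that) auto
    moreover have "(\<lambda>x. ennreal (u x) * indicator (E \<inter> R) x) = (\<lambda>x. ennreal (u x * indicator (E \<inter> R) x))"
      by (auto simp: fun_eq_iff indicator_def)
    ultimately show ?thesis by simp
  qed
  have term_le: "?T P \<le> 3 ^ CARD('n) * G (gr.reg 1 P)" for P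
  proof -
    define s0 where "s0 = (2 ^ fst P * (l / 2 ^ N)) ^ CARD('n)"
    have s0: "0 < s0" using l_pos by (simp add: s0_def)
    have m: "measure lebesgue (gr.reg 1 P) = 3 ^ CARD('n) * s0"
      unfolding gr.reg_def gr.reg_side_def using l_pos
      by (subst measure_half_open) (auto simp: s0_def power_mult_distrib power_divide)
    have "(\<integral>p. norm (H p) * indicator (gr.reg 0 P) p \<partial>lebesgue) \<le> U (gr.reg 1 P)"
      unfolding U_def
    proof (rule integral_mono)
      have eq: "(\<lambda>p. norm (H p) * indicator (gr.reg 0 P) p) = (\<lambda>p. u p * indicator (E \<inter> gr.reg 0 P) p)"
        by (auto simp: fun_eq_iff H indicator_def)
      show "integrable lebesgue (\<lambda>p. norm (H p) * indicator (gr.reg 0 P) p)" unfolding eq by (rule intR) simp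
      show "integrable lebesgue (\<lambda>x. u x * indicator (E \<inter> gr.reg 1 P) x)" by (rule intR) simp
      have "gr.reg 0 P \<subseteq> gr.reg 1 P" unfolding gr.reg_subset_iff by (rule dil_mono) simp
      then show "norm (H p) * indicator (gr.reg 0 P) p \<le> u p * indicator (E \<inter> gr.reg 1 P) p" for p
        using u_nonneg[of p] by (auto simp: H indicator_def)
    qed
    then have "?T P \<le> bF (gr.reg 1 P) * U (gr.reg 1 P) / s0"
      unfolding s0_def[symmetric] using s0 bF_nonneg by (intro divide_right_mono mult_left_mono) auto
    also have "\<dots> = 3 ^ CARD('n) * G (gr.reg 1 P)" unfolding G_def m by simp
    finally show ?thesis .
  qed
  define S' where "S' = {P\<in>S. gr.reg 1 P \<inter> E \<noteq> {}}"
  have finS': "finite S'" using fin by (simp add: S'_def)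
  let ?F = "\<lambda>\<kappa>. {P\<in>S'. cls P = \<kappa>}" and ?I = "range (cls :: nat \<times> ('n \<Rightarrow> int) \<Rightarrow> _)"
  have cls_le: "ennreal (\<Sum>P\<in>?F \<kappa>. G (gr.reg 1 P)) \<le> ?B" for \<kappa>
  proof -
    have "ennreal (\<Sum>P\<in>?F \<kappa>. G (gr.reg 1 P)) = ennreal (\<Sum>R\<in>gr.reg 1 ` ?F \<kappa>. G R)"
      by (subst sum.reindex[OF inj_on_subset[OF gr.inj_reg1]]) auto
    also have "\<dots> = (\<Sum>R\<in>gr.reg 1 ` ?F \<kappa>. ennreal (G R))" by (rule sum_ennreal[symmetric]) (rule G0)
    also have "\<dots> = (\<Sum>R\<in>gr.reg 1 ` ?F \<kappa>. ennreal (bF R / measure lebesgue R) * (\<integral>\<^sup>+x. ennreal (u x) * indicator (E \<inter> R) x \<partial>lebesgue))"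
    proof (rule sum.cong[OF refl])
      fix R assume "R \<in> gr.reg 1 ` ?F \<kappa>"
      then have "R \<in> sets lebesgue" by auto
      from Unn[OF this] show "ennreal (G R) = ennreal (bF R / measure lebesgue R) * (\<integral>\<^sup>+x. ennreal (u x) * indicator (E \<inter> R) x \<partial>lebesgue)"
        by (simp only: G_def ennreal_mult divide_nonneg_nonneg measure_nonneg bF_nonneg U0)
    qed
    also have "\<dots> \<le> ?B" unfolding S'_def by (rule class_bound[OF fin E disj N car])
    finally show ?thesis .
  qed
  have "(\<Sum>P\<in>S. ?T P) \<le> (\<Sum>P\<in>S. 3 ^ CARD('n) * G (gr.reg 1 P))" by (rule sum_mono) (rule term_le)
  also have "\<dots> = (\<Sum>P\<in>S'. 3 ^ CARD('n) * G (gr.reg 1 P))"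
  proof (rule sum.mono_neutral_right[OF fin])
    show "\<forall>P\<in>S - S'. 3 ^ CARD('n) * G (gr.reg 1 P) = 0"
    proof
      fix P assume "P \<in> S - S'"
      then have "E \<inter> gr.reg 1 P = {}" unfolding S'_def by blast
      then show "3 ^ CARD('n) * G (gr.reg 1 P) = 0" by (simp add: G_def U_def)
    qed
  qed (auto simp: S'_def)
  also have "\<dots> = 3 ^ CARD('n) * (\<Sum>P\<in>S'. G (gr.reg 1 P))" by (rule sum_distrib_left[symmetric])
  also have "(\<Sum>P\<in>S'. G (gr.reg 1 P)) = (\<Sum>\<kappa>\<in>?I. \<Sum>P\<in>?F \<kappa>. G (gr.reg 1 P))"
    by (rule sum.group[symmetric, OF finS' finite_range_cls]) auto
  finally have "ennreal (\<Sum>P\<in>S. ?T P) \<le> ennreal (3 ^ CARD('n) * (\<Sum>\<kappa>\<in>?I. \<Sum>P\<in>?F \<kappa>. G (gr.reg 1 P)))"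
    by (rule ennreal_leI)
  also have "\<dots> = 3 ^ CARD('n) * ennreal (\<Sum>\<kappa>\<in>?I. \<Sum>P\<in>?F \<kappa>. G (gr.reg 1 P))"
    by (simp add: ennreal_mult'' sum_nonneg G0 flip: ennreal_power)
  also have "ennreal (\<Sum>\<kappa>\<in>?I. \<Sum>P\<in>?F \<kappa>. G (gr.reg 1 P)) = (\<Sum>\<kappa>\<in>?I. ennreal (\<Sum>P\<in>?F \<kappa>. G (gr.reg 1 P)))"
    by (rule sum_ennreal[symmetric]) (simp add: sum_nonneg G0)
  also have "\<dots> \<le> (\<Sum>\<kappa>\<in>?I. ?B)" by (rule sum_mono) (rule cls_le)
  also have "\<dots> \<le> of_nat (3 ^ CARD('n)) * ?B"
    unfolding sum_constant by (intro mult_right_mono of_nat_mono card_range_cls) simp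
  finally show ?thesis by (simp add: mult.assoc mult_left_mono)
qed

end

lemma level_le_if_subset:
  assumes "dil 0 P \<subseteq> dil 0 (R :: nat \<times> ('n::finite \<Rightarrow> int))" shows "fst P \<le> fst R"
  using card_mono[OF finite_dil assms] by (simp add: card_dil)

text \<open>First \<open>e\<close> tends to 0, then half of the left side is moved over.\<close>

lemma absorb_half:
  fixes w t A B :: real
  assumes "0 < t" and "\<And>e. 0 < e \<Longrightarrow> t * w \<le> e + (t * w / 2 + A * B)" shows "w \<le> 2 * A / t * B"
proof -
  have "t * w \<le> t * w / 2 + A * B + e" if "0 < e" for e using assms(2)[OF that] by (simp add: add_ac)
  then have "t * w \<le> t * w / 2 + A * B" by (rule field_le_epsilon)
  then have "t * w \<le> 2 * (A * B)" by (simp add: field_simps)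
  then show ?thesis using assms(1) by (simp add: field_simps)
qed

context weak_type begin

lemma class_const_pos: "0 < class_const"
proof -
  have o: "0 \<le> orlicz_const moment_base \<delta> s C1 C2 * C1" using C1_pos C2_pos delta_pos by (simp add: orlicz_const_def)
  have d: "0 < 1 - 2 powr (- \<delta> / 2)" "0 < 1 - 2 powr (- s / 4)"
    using two_powr_less_1[of "\<delta> / 2"] two_powr_less_1[of "s / 4"] delta_pos s_pos by simp_all
  note add_nonneg_pos[OF divide_nonneg_pos[OF mult_nonneg_nonneg[OF o powr_ge_zero] d(1)]
    divide_pos_pos[OF mult_pos_pos[OF C2_pos C1_pos] d(2)]]
  then show ?thesis unfolding class_const_def laminar_const_def by (intro mult_pos_pos) auto
qed

definition good_const :: real where "good_const = 2 * (sparse_const * (3 ^ CARD('n) * 3 ^ CARD('n)) * class_const)"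

lemma good_const_pos: "0 < good_const"
  unfolding good_const_def using class_const_pos sparse_const_pos by simp

text \<open>The absorption needs a finite left side. It is finite because \<open>u\<close> is at
  most \<open>k\<close> on \<open>E\<close> and \<open>v\<close> is integrable on the base cube;
  \<open>k\<close> does not enter the constant.\<close>

lemma good_bound:
  assumes E: "E \<in> sets lebesgue" "E \<subseteq> half_open b l" "E \<inter> Omega = {}" and k: "0 < k"
    and Ex: "\<And>x. x \<in> E \<Longrightarrow> u x \<le> k \<and> 0 < v x \<and> t * v x < norm (T F x)"
  shows "mass (\<lambda>x. u x * v x) E \<le> ennreal (good_const / t) * (\<integral>\<^sup>+x. X x \<partial>lebesgue)"
proof (cases "(\<integral>\<^sup>+x. X x \<partial>lebesgue) = \<infinity>")
  case True
  then show ?thesis using good_const_pos t_pos by (simp add: ennreal_mult_top)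
next
  case False
  then obtain \<xi> where \<xi>: "0 \<le> \<xi>" "(\<integral>\<^sup>+x. X x \<partial>lebesgue) = ennreal \<xi>"
    by (cases "\<integral>\<^sup>+x. X x \<partial>lebesgue") auto
  have TF: "T F \<in> L2" by (rule T_L2[OF F_L2])
  note [measurable] = E(1) u_meas v_meas L2_measurable[OF TF]
  have box: "half_open b l \<in> boxes" using l_pos by (auto simp: boxes_def)
  have fin_box: "emeasure lebesgue (half_open b l) < \<infinity>" using box_facts(3)[OF box] by simp
  define w where "w = measure (density lebesgue (\<lambda>x. ennreal (u x * v x))) E"
  have w: "mass (\<lambda>x. u x * v x) E = ennreal w" "0 \<le> w"
  proof -
    have "mass (\<lambda>x. u x * v x) E \<le> (\<integral>\<^sup>+x. ennreal k * (ennreal (v x) * indicator (half_open b l) x) \<partial>lebesgue)"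
      unfolding mass_def
    proof (rule nn_integral_mono)
      fix x
      show "ennreal (u x * v x) * indicator E x \<le> ennreal k * (ennreal (v x) * indicator (half_open b l) x)"
        using Ex[of x] E(2) k by (auto simp: indicator_def ennreal_mult'[symmetric] intro!: ennreal_leI mult_right_mono)
    qed
    also have "\<dots> = ennreal k * mass v (half_open b l)" unfolding mass_def by (rule nn_integral_cmult) measurable
    also have "\<dots> < \<infinity>" unfolding box_facts(6)[OF box] by (simp add: ennreal_mult_less_top)
    finally have "mass (\<lambda>x. u x * v x) E < \<infinity>" .
    then show "mass (\<lambda>x. u x * v x) E = ennreal w" "0 \<le> w"
      by (simp_all add: w_def mass_eq_emeasure[OF uv_meas E(1)] emeasure_eq_ennreal_measure)
  qed
  \<comment> \<open>The conjugate sign makes the product with \<open>T F\<close> nonnegative, so the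
    integral equals its norm and \<open>E\<close> contributes at least \<open>t\<close> times its
    mass. On \<open>E\<close> the division is legitimate because
    \<open>t * v x < norm (T F x)\<close>.\<close>
  define H where "H = (\<lambda>x. of_real (u x * indicator E x) * (cnj (T F x) / of_real (norm (T F x))))"
  have nz: "0 < norm (T F x)" if "x \<in> E" for x
    using Ex[OF that] t_pos mult_pos_pos[of t "v x"] by linarith
  have nH: "norm (H x) = u x * indicator E x" for x
    using nz[of x] u_nonneg[of x] by (auto simp: H_def norm_mult norm_divide indicator_def)
  have cnjm [measurable]: "(\<lambda>x. cnj (T F x)) \<in> borel_measurable lebesgue"
    by (rule measurable_compose[OF L2_measurable[OF TF] borel_measurable_continuous_onI]) (intro continuous_intros)
  have Hm: "H \<in> borel_measurable lebesgue" unfolding H_def by measurable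
  have Hb: "norm (H x) \<le> max M k" for x
    using Ex[of x] k by (auto simp: nH indicator_def)
  have Fb: "norm (F x) \<le> max M k" for x using F_bound[of x] by simp
  have H0: "H x = 0" if "x \<notin> half_open b l" for x using that E(2) by (auto simp: H_def indicator_def)
  have HL: "H \<in> L2" by (rule L2_bounded[OF Hm Hb H0 sets_half_open fin_box])
  have int: "integrable lebesgue (\<lambda>x. u x * indicator E x)"
  proof (rule integrableI_bounded_set[where A = "half_open b l" and B = k])
    show "AE x in lebesgue. x \<in> half_open b l \<longrightarrow> norm (u x * indicator E x) \<le> k"
      using Ex k u_nonneg by (auto simp: indicator_def)
  qed (use E(2) fin_box in \<open>auto simp: indicator_def\<close>)
  define r where "r = (\<lambda>x. norm (T F x * H x))"
  have rint: "integrable lebesgue r" unfolding r_def by (rule integrable_norm[OF L2_product(1)[OF TF HL]])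
  have "T F x * H x = complex_of_real (r x)" for x
  proof (cases "x \<in> E")
    case True
    have "T F x * (cnj (T F x) / of_real (norm (T F x))) = of_real (norm (T F x))"
    proof -
      have "T F x * cnj (T F x) = of_real (norm (T F x)) * of_real (norm (T F x))"
        using complex_norm_square[of "T F x"] by (simp add: power2_eq_square)
      then show ?thesis using nz[OF True] by simp
    qed
    from arg_cong[OF this, of "\<lambda>z. of_real (u x) * z"]
    have "T F x * H x = of_real (u x * norm (T F x))" using True by (simp add: H_def mult_ac)
    then show ?thesis using u_nonneg[of x] by (simp add: r_def norm_mult nH True)
  qed (simp add: H_def r_def)
  then have "Bt F H = of_real (\<integral>x. r x \<partial>lebesgue)" by (simp add: Bt_def)
  moreover have "0 \<le> (\<integral>x. r x \<partial>lebesgue)" by (intro integral_nonneg_AE) (simp add: r_def)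
  ultimately have Br: "norm (Bt F H) = (\<integral>x. r x \<partial>lebesgue)" by simp
  have "ennreal (t * w) = ennreal t * mass (\<lambda>x. u x * v x) E" unfolding w(1) using t_pos w(2) by (simp add: ennreal_mult)
  also have "\<dots> = (\<integral>\<^sup>+x. ennreal t * (ennreal (u x * v x) * indicator E x) \<partial>lebesgue)"
    unfolding mass_def by (rule nn_integral_cmult[symmetric]) measurable
  also have "\<dots> \<le> (\<integral>\<^sup>+x. ennreal (r x) \<partial>lebesgue)"
  proof (rule nn_integral_mono)
    fix x
    show "ennreal t * (ennreal (u x * v x) * indicator E x) \<le> ennreal (r x)"
    proof (cases "x \<in> E")
      case True
      have "t * (u x * v x) = t * v x * u x" by simp
      also have "\<dots> \<le> norm (T F x) * u x" using Ex[OF True] u_nonneg by (intro mult_right_mono) auto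
      also have "\<dots> = r x" using True by (simp add: r_def norm_mult nH)
      finally have "t * (u x * v x) \<le> r x" .
      then show ?thesis using True t_pos by (simp add: ennreal_leI flip: ennreal_mult')
    qed simp
  qed
  also have "\<dots> = ennreal (\<integral>x. r x \<partial>lebesgue)" by (rule nn_integral_eq_integral[OF rint]) (simp add: r_def)
  finally have low: "t * w \<le> norm (Bt F H)" unfolding Br using t_pos by (subst (asm) ennreal_le_iff) (auto simp: r_def)
  have up: "t * w \<le> e + (t * w / 2 + sparse_const * (3 ^ CARD('n) * 3 ^ CARD('n)) * class_const * \<xi>)" if e: "0 < e" for e
  proof -
    have "0 < max M k" using k by simp
    have "\<exists>N S. finite S \<and> (\<forall>R\<in>S. dil 0 R \<subseteq> dil 0 (N, \<lambda>_. 0)) \<and>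
      (\<forall>R. (\<Sum>P\<in>{P\<in>S. dil 0 P \<subseteq> dil 0 R}. card (dil 0 P)) \<le> 2 * card (dil 0 R)) \<and>
      norm (Bt F H) \<le> e + sparse_const *
      (\<Sum>P\<in>S. (\<integral>p. norm (F p) * indicator (grid.reg b (l / 2 ^ N) 1 P) p \<partial>lebesgue) *
        (\<integral>p. norm (H p) * indicator (grid.reg b (l / 2 ^ N) 0 P) p \<partial>lebesgue) / (2 ^ fst P * (l / 2 ^ N)) ^ CARD('n))"
      by (rule pairing_bound[where b = b, OF F_meas Fb Hm Hb \<open>0 < max M k\<close> l_pos F_zero H0 e])
    then obtain N S where NS: "finite S \<and> (\<forall>R\<in>S. dil 0 R \<subseteq> dil 0 (N, \<lambda>_. 0)) \<and>
      (\<forall>R. (\<Sum>P\<in>{P\<in>S. dil 0 P \<subseteq> dil 0 R}. card (dil 0 P)) \<le> 2 * card (dil 0 R)) \<and>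
      norm (Bt F H) \<le> e + sparse_const *
      (\<Sum>P\<in>S. (\<integral>p. norm (F p) * indicator (grid.reg b (l / 2 ^ N) 1 P) p \<partial>lebesgue) *
        (\<integral>p. norm (H p) * indicator (grid.reg b (l / 2 ^ N) 0 P) p \<partial>lebesgue) / (2 ^ fst P * (l / 2 ^ N)) ^ CARD('n))"
      by (elim exE)
    define Sg where "Sg = (\<Sum>P\<in>S. bF (grid.reg b (l / 2 ^ N) 1 P) *
        (\<integral>p. norm (H p) * indicator (grid.reg b (l / 2 ^ N) 0 P) p \<partial>lebesgue) / (2 ^ fst P * (l / 2 ^ N)) ^ CARD('n))"
    have fin: "finite S" by (rule NS[THEN conjunct1])
    have lev: "fst P \<le> N" if "P \<in> S" for P
      using level_le_if_subset[OF bspec[OF NS[THEN conjunct2, THEN conjunct1] that]] by simp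
    have car: "(\<Sum>P\<in>{P\<in>S. dil 0 P \<subseteq> dil 0 R}. card (dil 0 P)) \<le> 2 * card (dil 0 R)" for R
      by (rule NS[THEN conjunct2, THEN conjunct2, THEN conjunct1, rule_format])
    have bd: "norm (Bt F H) \<le> e + sparse_const * Sg"
      unfolding Sg_def bF_def by (rule NS[THEN conjunct2, THEN conjunct2, THEN conjunct2])
    have "ennreal Sg \<le> 3 ^ CARD('n) * 3 ^ CARD('n) * (ennreal (absorb_const * t) * ennreal w + ennreal class_const * ennreal \<xi>)"
      using sparse_sum_bound[OF fin E(1,3) lev car nH int] unfolding w(1) \<xi>(2) Sg_def .
    also have "\<dots> = ennreal (3 ^ CARD('n) * 3 ^ CARD('n) * (absorb_const * t * w + class_const * \<xi>))"
    proof -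
      have "ennreal (absorb_const * t) * ennreal w + ennreal class_const * ennreal \<xi> = ennreal (absorb_const * t * w + class_const * \<xi>)"
        using absorb_const_pos t_pos w(2) class_const_pos \<xi>(1) by (simp add: ennreal_mult'[symmetric])
      moreover have "ennreal (3 ^ CARD('n) * 3 ^ CARD('n)) = 3 ^ CARD('n) * 3 ^ CARD('n)"
        by (simp add: ennreal_mult flip: ennreal_power)
      moreover have "0 \<le> absorb_const * t * w + class_const * \<xi>" using absorb_const_pos t_pos w(2) class_const_pos \<xi>(1) by simp
      ultimately show ?thesis by (simp add: ennreal_mult)
    qed
    finally have "Sg \<le> 3 ^ CARD('n) * 3 ^ CARD('n) * (absorb_const * t * w + class_const * \<xi>)"
      using absorb_const_pos t_pos w(2) class_const_pos \<xi>(1) by (subst (asm) ennreal_le_iff) auto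
    then have "sparse_const * Sg \<le> sparse_const * (3 ^ CARD('n) * 3 ^ CARD('n) * (absorb_const * t * w + class_const * \<xi>))"
      using sparse_const_pos by (intro mult_left_mono) auto
    also have "\<dots> = t * w / 2 + sparse_const * (3 ^ CARD('n) * 3 ^ CARD('n)) * class_const * \<xi>"
      unfolding absorb_const_def using sparse_const_pos by (simp add: distrib_left)
    finally show ?thesis using low bd by linarith
  qed
  have "w \<le> 2 * (sparse_const * (3 ^ CARD('n) * 3 ^ CARD('n)) * class_const) / t * \<xi>"
    using t_pos up by (rule absorb_half)
  then have "ennreal w \<le> ennreal (good_const / t * \<xi>)" unfolding good_const_def by (rule ennreal_leI)
  also have "\<dots> = ennreal (good_const / t) * ennreal \<xi>" using good_const_pos t_pos \<xi> by (simp add: ennreal_mult flip: times_divide_eq_left)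
  finally show ?thesis unfolding w(1) \<xi>(2) .
qed

end

section \<open>The level set inside one cube\<close>

context weak_type begin

definition weak_const :: real where "weak_const = 3 ^ CARD('n) * union_const + good_const"

lemma box_bound:
  assumes k: "0 < k"
  shows "mass (\<lambda>x. u x * v x) {x\<in>half_open b l. t < norm (T F x) / v x \<and> u x \<le> k} \<le> ennreal (weak_const / t) * (\<integral>\<^sup>+x. X x \<partial>lebesgue)"
proof -
  note [measurable] = u_meas v_meas L2_measurable[OF T_L2[OF F_L2]]
  define E where "E = (half_open b l - Omega) \<inter> {x\<in>space lebesgue. u x \<le> k \<and> 0 < v x \<and> t * v x < norm (T F x)}"
  have E: "E \<in> sets lebesgue" unfolding E_def by measurable
  let ?I = "\<integral>\<^sup>+x. X x \<partial>lebesgue"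
  have "mass (\<lambda>x. u x * v x) {x\<in>half_open b l. t < norm (T F x) / v x \<and> u x \<le> k} \<le> mass (\<lambda>x. u x * v x) (Omega \<union> E)"
    unfolding mass_def
  proof (rule nn_integral_mono)
    fix x
    show "ennreal (u x * v x) * indicator {x\<in>half_open b l. t < norm (T F x) / v x \<and> u x \<le> k} x \<le> ennreal (u x * v x) * indicator (Omega \<union> E) x"
    proof (cases "0 < v x")
      case True
      then have "t < norm (T F x) / v x \<longleftrightarrow> t * v x < norm (T F x)" by (rule pos_less_divide_eq)
      then show ?thesis using True by (auto simp: indicator_def E_def)
    next
      case False
      \<comment> \<open>Where \<open>v\<close> is not positive, a point may satisfy the quotient
        condition, but its density is 0 because \<open>ennreal\<close> sends nonpositive numbers to
        0.\<close>
      then have "u x * v x \<le> 0" using u_nonneg by (simp add: mult_nonneg_nonpos)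
      then show ?thesis by (simp add: ennreal_neg)
    qed
  qed
  also have "\<dots> \<le> mass (\<lambda>x. u x * v x) Omega + mass (\<lambda>x. u x * v x) E" by (rule mass_Un_le[OF uv_meas sets_Omega E])
  also have "\<dots> \<le> 3 ^ CARD('n) * (ennreal (union_const / t) * ?I) + ennreal (good_const / t) * ?I"
    by (intro add_mono mass_Omega good_bound[OF E _ _ k]) (auto simp: E_def)
  also have "\<dots> = ennreal (weak_const / t) * ?I"
  proof -
    have "0 \<le> union_const" using C2_pos by (simp add: union_const_def)
    then have "0 \<le> union_const / t" "0 \<le> good_const / t" using good_const_pos t_pos by auto
    moreover have "3 ^ CARD('n) * ennreal a = ennreal (3 ^ CARD('n) * a)" if "0 \<le> a" for a
      using that by (simp only: ennreal_mult zero_le_power zero_le_numeral ennreal_numeral flip: ennreal_power)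
    ultimately have "3 ^ CARD('n) * ennreal (union_const / t) + ennreal (good_const / t) = ennreal (3 ^ CARD('n) * (union_const / t) + good_const / t)"
      by (simp only: ennreal_plus mult_nonneg_nonneg zero_le_power zero_le_numeral)
    then have "ennreal (weak_const / t) = 3 ^ CARD('n) * ennreal (union_const / t) + ennreal (good_const / t)"
      by (simp add: weak_const_def add_divide_distrib)
    then show ?thesis by (simp only: distrib_right mult.assoc)
  qed
  finally show ?thesis .
qed

lemma weak_const_pos: "0 < weak_const"
  unfolding weak_const_def using C1_pos C2_pos by (intro add_nonneg_pos good_const_pos) (simp add: union_const_def)

end

section \<open>From the hypotheses on the weights to the constants\<close>

lemma locally_integrable_cube: "locally_integrable g \<Longrightarrow> Q \<in> cubes \<Longrightarrow> g absolutely_integrable_on Q"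
  unfolding locally_integrable_def cubes_def by auto

text \<open>Local integrability speaks only of restrictions to compact sets; the function is the
  pointwise limit of its restrictions to growing cubes.\<close>

lemma locally_integrable_measurable:
  assumes "locally_integrable (g :: real ^ 'n \<Rightarrow> real)" shows "g \<in> borel_measurable lebesgue"
proof -
  let ?B = "\<lambda>k::nat. cbox (\<chi> i. - real k) (\<chi> i. real k) :: (real ^ 'n) set"
  have "(\<lambda>x. indicator (?B k) x * g x) \<in> borel_measurable lebesgue" for k
  proof -
    have "g absolutely_integrable_on ?B k" using assms unfolding locally_integrable_def by auto
    then have "integrable lebesgue (\<lambda>x. indicator (?B k) x *\<^sub>R g x)" by (simp add: set_integrable_def)
    then have "(\<lambda>x. indicator (?B k) x *\<^sub>R g x) \<in> borel_measurable lebesgue" by (rule borel_measurable_integrable)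
    then show ?thesis by simp
  qed
  moreover have "(\<lambda>k. indicator (?B k) x * g x) \<longlonglongrightarrow> g x" for x
  proof (rule tendsto_eventually)
    obtain k0 :: nat where k0: "norm x \<le> real k0" using real_arch_simple by blast
    show "\<forall>\<^sub>F k in sequentially. indicator (?B k) x * g x = g x"
      using eventually_ge_at_top[of k0]
    proof eventually_elim
      case (elim k)
      have "\<bar>x $ i\<bar> \<le> real k" for i using component_le_norm_cart[of x i] k0 elim by linarith
      then have "x \<in> ?B k" by (simp add: mem_box_cart abs_le_iff minus_le_iff)
      then show ?case by simp
    qed
  qed
  ultimately show ?thesis by (rule borel_measurable_LIMSEQ_real[rotated])
qed

lemma mass_eq_avg:
  assumes Q: "Q \<in> cubes" and int: "g absolutely_integrable_on (Q :: (real ^ 'n) set)" and nonneg: "AE x in lebesgue. 0 \<le> g x"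
  shows "mass g Q = ennreal (avg g Q * measure lebesgue Q)" "0 \<le> avg g Q"
proof -
  have int': "integrable lebesgue (\<lambda>x. indicator Q x * g x)" using int by (simp add: set_integrable_def)
  have AE0: "AE x in lebesgue. 0 \<le> indicator Q x * g x" using nonneg by eventually_elim (auto simp: indicator_def)
  have "mass g Q = (\<integral>\<^sup>+x. ennreal (indicator Q x * g x) \<partial>lebesgue)"
    unfolding mass_def by (intro nn_integral_cong) (simp add: indicator_def)
  also have "\<dots> = ennreal (\<integral>x. indicator Q x * g x \<partial>lebesgue)" by (rule nn_integral_eq_integral[OF int' AE0])
  also have "(\<integral>x. indicator Q x * g x \<partial>lebesgue) = avg g Q * measure lebesgue Q"
    using measure_cube_pos[OF Q] by (simp add: avg_def set_lebesgue_integral_def)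
  finally show "mass g Q = ennreal (avg g Q * measure lebesgue Q)" .
  have "0 \<le> (\<integral>x. indicator Q x * g x \<partial>lebesgue)" by (rule integral_nonneg_AE[OF AE0])
  then show "0 \<le> avg g Q" using measure_cube_pos[OF Q] by (simp add: avg_def set_lebesgue_integral_def)
qed

lemma weight_avg_pos:
  assumes w: "weight w" and Q: "Q \<in> cubes" shows "0 < avg w (Q :: (real ^ 'n) set)"
proof -
  have pos: "AE x in lebesgue. 0 < w x" and loc: "locally_integrable w" using w by (auto simp: weight_def)
  have nonneg: "AE x in lebesgue. 0 \<le> w x" using pos by eventually_elim simp
  note m = mass_eq_avg[OF Q locally_integrable_cube[OF loc Q] nonneg]
  have Qs: "Q \<in> sets lebesgue" using Q by (auto simp: cubes_def)
  have "avg w Q \<noteq> 0"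
  proof
    assume "avg w Q = 0"
    then have "(\<integral>\<^sup>+x. ennreal (w x) * indicator Q x \<partial>lebesgue) = 0" using m(1) by (simp add: mass_def)
    then have "AE x in lebesgue. ennreal (w x) * indicator Q x = 0"
      using locally_integrable_measurable[OF loc] Qs by (subst (asm) nn_integral_0_iff_AE) auto
    then have "AE x in lebesgue. x \<notin> Q" using pos by eventually_elim (auto simp: indicator_def split: if_splits)
    then have "Q \<in> null_sets lebesgue" using Qs by (simp add: AE_iff_null_sets)
    then show False using measure_cube_pos[OF Q] by (simp add: null_sets_def measure_def)
  qed
  then show ?thesis using m(2) by simp
qed

lemma mixed_weights_if_RH_A:
  fixes u v :: "real ^ 'n \<Rightarrow> real"
  assumes u: "\<And>x. 0 \<le> u x" "locally_integrable u" and q: "1 < q" and v: "v \<in> RH_infinity" "v \<in> A_class q" and \<delta>: "0 < \<delta>"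
  obtains C1 C2 where "mixed_weights u v (1 / (q - 1)) \<delta> C1 C2"
proof -
  let ?s = "1 / (q - 1)"
  have e: "1 - conj_exp q = - ?s" using q by (simp add: conj_exp_def field_simps)
  have wv: "weight v" using v by (simp add: RH_infinity_def)
  have pos: "AE x in lebesgue. 0 < v x" and loc: "locally_integrable v" using wv by (auto simp: weight_def)
  have nonneg: "AE x in lebesgue. 0 \<le> v x" using pos by eventually_elim simp
  have vm: "v \<in> borel_measurable lebesgue" by (rule locally_integrable_measurable[OF loc])
  from v(1) obtain C1 where C1: "0 < C1" "\<And>Q. Q \<in> cubes \<Longrightarrow> esssup (lebesgue_on Q) (\<lambda>x. ereal (v x)) \<le> ereal (C1 * avg v Q)"
    unfolding RH_infinity_def by blast
  from v(2) obtain C where C: "0 < C" "\<And>Q. Q \<in> cubes \<Longrightarrow> (\<lambda>x. v x powr (- ?s)) absolutely_integrable_on Q \<and>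
     avg v Q * avg (\<lambda>x. v x powr (- ?s)) Q powr (q - 1) \<le> C"
    unfolding A_class_def e by blast
  have "mixed_weights u v ?s \<delta> C1 (C powr ?s)"
  proof
    show "u \<in> borel_measurable lebesgue" by (rule locally_integrable_measurable[OF u(2)])
    fix Q :: "(real ^ 'n) set" assume Q: "Q \<in> cubes"
    have Qs: "Q \<in> sets lebesgue" using Q by (auto simp: cubes_def)
    show a: "0 < avg v Q" by (rule weight_avg_pos[OF wv Q])
    show "mass v Q = ennreal (avg v Q * measure lebesgue Q)"
      by (rule mass_eq_avg(1)[OF Q locally_integrable_cube[OF loc Q] nonneg])
    show "AE x in lebesgue. x \<in> Q \<longrightarrow> v x \<le> C1 * avg v Q"
    proof -
      have "(\<lambda>x. ereal (v x)) \<in> borel_measurable (lebesgue_on Q)" using vm by (intro borel_measurable_ereal measurable_restrict_space1)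
      from esssup_AE[of "\<lambda>x. ereal (v x)" "lebesgue_on Q"]
      have "AE x in lebesgue_on Q. v x \<le> C1 * avg v Q"
        by eventually_elim (use order_trans[OF _ C1(2)[OF Q]] in fastforce)
      then show ?thesis using Qs by (simp add: AE_restrict_space_iff)
    qed
    let ?w = "\<lambda>x. v x powr (- ?s)"
    have w: "mass ?w Q = ennreal (avg ?w Q * measure lebesgue Q)" "0 \<le> avg ?w Q"
      by (rule mass_eq_avg[OF Q], use C(2)[OF Q] in blast, simp)+
    \<comment> \<open>The A_q inequality raised to the power 1/(q - 1).\<close>
    have "avg ?w Q = (avg ?w Q powr (q - 1)) powr ?s" using w(2) q by (simp add: powr_powr)
    also have "\<dots> \<le> (C / avg v Q) powr ?s"
      using C(2)[OF Q] a q by (intro powr_mono2) (auto simp: pos_le_divide_eq mult.commute)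
    also have "\<dots> = C powr ?s * avg v Q powr (- ?s)" using C(1) a by (simp add: powr_divide powr_minus_divide)
    finally show "mass ?w Q \<le> ennreal (C powr ?s * avg v Q powr (- ?s) * measure lebesgue Q)"
      unfolding w(1) by (intro ennreal_leI mult_right_mono) auto
  qed (use u vm pos q \<delta> C1 C in auto)
  then show ?thesis by (rule that)
qed

text \<open>From \<open>q < p\<close> the conjugate exponents satisfy p' \<le> q'. So the exponent
  p' + 1 - q' on [0, 1] is at most 1, while the exponent p' on the other piece is at least
  1.\<close>

lemma Psi_ge:
  assumes q: "1 < q" and p: "q < p" and z: "0 \<le> z" shows "z \<le> Psi p q z"
proof -
  have c: "conj_exp p \<le> conj_exp q" "1 \<le> conj_exp p" using q p by (auto simp: conj_exp_def field_simps)
  show ?thesis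
  proof (cases "z \<le> 1")
    case True
    have "z = z powr 1" using z by simp
    also have "\<dots> \<le> z powr (conj_exp p + 1 - conj_exp q)"
    proof (cases "z = 0")
      case False
      then show ?thesis using z True c by (intro powr_mono') auto
    qed simp
    finally show ?thesis using True z by (simp add: Psi_def indicator_def)
  next
    case False
    then have "z powr 1 \<le> z powr conj_exp p" using c by (intro powr_mono) auto
    then show ?thesis using False by (simp add: Psi_def indicator_def)
  qed
qed

context mixed_weights begin

text \<open>The null set in RH_infinity depends on the cube. Countably many cubes around the origin
  already contain every point, so a single null set suffices.\<close>

lemma v_le_hl_maximal:
  assumes \<Psi>: "\<And>z. 0 \<le> z \<Longrightarrow> z \<le> \<Psi> z"
  shows "AE x in lebesgue. ennreal (v x) \<le> ennreal C1 * hl_maximal (\<lambda>y. \<Psi> (v y)) x"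
proof -
  let ?Q = "\<lambda>k::nat. closed_cube (\<chi> i. - (real k + 1)) (2 * (real k + 1)) :: (real ^ 'n) set"
  have Qc: "?Q k \<in> cubes" for k by (rule closed_cube_in_cubes) simp
  have "AE x in lebesgue. \<forall>k. x \<in> ?Q k \<longrightarrow> v x \<le> C1 * avg v (?Q k)"
    unfolding AE_all_countable using v_le_avg[OF Qc] by blast
  then show ?thesis
  proof eventually_elim
    case (elim x)
    obtain k :: nat where k: "norm x \<le> real k" using real_arch_simple by blast
    have "\<bar>x $ i\<bar> \<le> real k" for i using component_le_norm_cart[of x i] k by linarith
    then have x: "x \<in> ?Q k"
      unfolding closed_cube_def mem_box_cart by (auto simp: abs_le_iff minus_le_iff intro: order_trans[of _ "real k"])
        (smt (verit) of_nat_0_le_iff)+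
    let ?m = "measure lebesgue (?Q k)"
    have m: "0 < ?m" by (rule measure_cube_pos[OF Qc])
    have em: "emeasure lebesgue (?Q k) = ennreal ?m" by (simp add: emeasure_closed_cube measure_closed_cube del: emeasure_completion)
    have "ennreal (avg v (?Q k)) = mass v (?Q k) / emeasure lebesgue (?Q k)"
    proof -
      have "ennreal a = ennreal (a * r) / ennreal r" if "0 < a" "0 < r" for a r
        using that by (simp add: divide_ennreal)
      from this[OF avg_pos[OF Qc] m] show ?thesis unfolding mass_v[OF Qc] em .
    qed
    also have "\<dots> \<le> (\<integral>\<^sup>+y\<in>?Q k. ennreal \<bar>\<Psi> (v y)\<bar> \<partial>lebesgue) / emeasure lebesgue (?Q k)"
      unfolding mass_def
    proof (intro divide_right_mono_ennreal nn_integral_mono_AE, use v_pos in eventually_elim)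
      fix y assume "0 < v y"
      then show "ennreal (v y) * indicator (?Q k) y \<le> ennreal \<bar>\<Psi> (v y)\<bar> * indicator (?Q k) y"
        using \<Psi>[of "v y"] by (intro mult_right_mono ennreal_leI) auto
    qed
    also have "\<dots> \<le> hl_maximal (\<lambda>y. \<Psi> (v y)) x"
      unfolding hl_maximal_def by (rule SUP_upper) (use x Qc in simp)
    finally have "ennreal C1 * ennreal (avg v (?Q k)) \<le> ennreal C1 * hl_maximal (\<lambda>y. \<Psi> (v y)) x" by (rule mult_left_mono) simp
    moreover have "ennreal (v x) \<le> ennreal C1 * ennreal (avg v (?Q k))"
      using elim x C1_pos by (simp add: ennreal_leI flip: ennreal_mult')
    ultimately show ?case by (rule order_trans[rotated])
  qed
qed

lemma lam_le_maximal:
  assumes \<Psi>: "\<And>z. 0 \<le> z \<Longrightarrow> z \<le> \<Psi> z"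
  shows "AE p in lebesgue. \<forall>R\<in>boxes. p \<in> R \<longrightarrow> lam R * ennreal (norm (f p) * v p)
    \<le> ennreal (norm (f p)) * orlicz_maximal (phi_log \<delta>) (\<lambda>y. v y powr (- s)) u p * hl_maximal (\<lambda>y. \<Psi> (v y)) p"
proof -
  have "AE x in lebesgue. ennreal (v x) \<le> ennreal C1 * hl_maximal (\<lambda>y. \<Psi> (v y)) x"
    by (rule v_le_hl_maximal) (rule \<Psi>)
  then show ?thesis
  proof eventually_elim
    case (elim p)
    show ?case
    proof (intro ballI impI)
      fix R assume R: "R \<in> boxes" "p \<in> R"
      let ?O = "orlicz_maximal (phi_log \<delta>) (\<lambda>y. v y powr (- s)) u p" and ?M = "hl_maximal (\<lambda>y. \<Psi> (v y)) p"
      obtain Q where Q: "Q \<in> cubes" "R \<subseteq> Q" "lux R = lux Q" by (rule boxesE[OF R(1)])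
      have "lux Q \<le> ?O" unfolding orlicz_maximal_def by (rule SUP_upper) (use Q R in auto)
      then have "lam R * ennreal (norm (f p) * v p) \<le> ennreal (1 / C1) * ?O * (ennreal (norm (f p)) * (ennreal C1 * ?M))"
        unfolding lam_def Q(3) ennreal_mult'[OF norm_ge_zero] by (intro mult_mono elim) auto
      also have "\<dots> = (ennreal (1 / C1) * ennreal C1) * (ennreal (norm (f p)) * ?O * ?M)" by (simp only: mult_ac)
      also have "ennreal (1 / C1) * ennreal C1 = 1" using C1_pos by (simp flip: ennreal_mult')
      finally show "lam R * ennreal (norm (f p) * v p) \<le> ennreal (norm (f p)) * ?O * ?M" by simp
    qed
  qed
qed

end

text \<open>The constant must be chosen before \<open>f\<close> and \<open>t\<close>. It depends on
  neither, so its positivity is read off from an instance of the locale with the zero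
  function.\<close>

lemma weak_type_const_pos:
  fixes u v :: "real ^ 'n \<Rightarrow> real" and T :: "(real ^ 'n \<Rightarrow> complex) \<Rightarrow> real ^ 'n \<Rightarrow> complex"
  assumes "mixed_weights u v s \<delta> C1 C2" and "singular_operator T K c"
  shows "0 < weak_type.weak_const TYPE('n) s \<delta> C1 C2 c"
proof -
  interpret mixed_weights u v s \<delta> C1 C2 by fact
  interpret singular_operator T K c by fact
  interpret weak_type u v s \<delta> C1 C2 T K c "\<lambda>_. 0" 0 1 1 1 "\<lambda>_. 0"
    by unfold_locales auto
  show ?thesis by (rule weak_const_pos)
qed

text \<open>\<open>box_bound\<close> holds for every sufficiently large base cube and every bound on
  \<open>u\<close> with the same constant and the same right side, so the level set is exhausted by
  its parts in growing cubes on which \<open>u\<close> is bounded.\<close>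

lemma weak_type_estimate:
  fixes u v :: "real ^ 'n \<Rightarrow> real" and T :: "(real ^ 'n \<Rightarrow> complex) \<Rightarrow> real ^ 'n \<Rightarrow> complex" and f :: "real ^ 'n \<Rightarrow> complex"
  assumes mw: "mixed_weights u v s \<delta> C1 C2" and so: "singular_operator T K c"
    and f: "f \<in> borel_measurable lebesgue" "bounded (range f)" "compact (supp f)" and t: "0 < t"
    and \<Psi>: "\<And>z. 0 \<le> z \<Longrightarrow> z \<le> \<Psi> z"
  shows "mass (\<lambda>x. u x * v x) {x. t < norm (T (\<lambda>y. f y * of_real (v y)) x) / v x}
    \<le> ennreal (weak_type.weak_const TYPE('n) s \<delta> C1 C2 c / t) *
      (\<integral>\<^sup>+x. ennreal (norm (f x)) * orlicz_maximal (phi_log \<delta>) (\<lambda>y. v y powr (- s)) u x * hl_maximal (\<lambda>y. \<Psi> (v y)) x \<partial>lebesgue)"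
    (is "_ \<le> ?rhs")
proof -
  interpret mixed_weights u v s \<delta> C1 C2 by fact
  interpret so: singular_operator T K c by fact
  let ?X = "\<lambda>x. ennreal (norm (f x)) * orlicz_maximal (phi_log \<delta>) (\<lambda>y. v y powr (- s)) u x * hl_maximal (\<lambda>y. \<Psi> (v y)) x"
  let ?B = "\<lambda>k::nat. half_open (\<chi> i. - (real k + 1)) (2 * (real k + 1)) :: (real ^ 'n) set"
  let ?g = "\<lambda>y. f y * of_real (v y)"
  have B_iff: "x \<in> ?B k \<longleftrightarrow> (\<forall>i. - (real k + 1) \<le> x $ i \<and> x $ i < real k + 1)" for x k
    by (simp add: half_open_def)
  have in_B: "x \<in> ?B k" if "norm x \<le> real k" for x k
    unfolding B_iff
  proof
    fix i
    have "\<bar>x $ i\<bar> \<le> real k" using component_le_norm_cart[of x i] that by (rule order_trans)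
    then show "- (real k + 1) \<le> x $ i \<and> x $ i < real k + 1" by linarith
  qed
  have B_mono: "?B j \<subseteq> ?B k" if "j \<le> k" for j k
  proof
    fix x assume x: "x \<in> ?B j"
    have "- (real k + 1) \<le> y \<and> y < real k + 1" if "- (real j + 1) \<le> y \<and> y < real j + 1" for y :: real
      using that \<open>j \<le> k\<close> by linarith
    with x show "x \<in> ?B k" unfolding B_iff by simp
  qed
  obtain Mf where Mf: "\<And>x. norm (f x) \<le> Mf" using f(2) unfolding bounded_iff by blast
  have Mf0: "0 \<le> Mf" using order_trans[OF norm_ge_zero Mf[of 0]] .
  obtain R where R: "\<And>x. x \<in> supp f \<Longrightarrow> norm x \<le> R" using compact_imp_bounded[OF f(3)] unfolding bounded_iff by blast
  obtain k0 :: nat where k0: "R \<le> real k0" using real_arch_simple by blast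
  have f0: "f x = 0" if "x \<notin> ?B k0" for x
  proof (rule ccontr)
    assume "f x \<noteq> 0"
    then have "x \<in> supp f" unfolding supp_def by (intro subsetD[OF closure_subset]) simp
    then have "norm x \<le> real k0" using R[of x] k0 by linarith
    then have "x \<in> ?B k0" by (rule in_B)
    with that show False ..
  qed
  have box: "?B k \<in> boxes" for k 
  proof -
    have "0 < 2 * (real k + 1)" by simp
    then show ?thesis unfolding boxes_def by blast
  qed
  define M where "M = Mf * (C1 * avg v (?B k0)) + 1"
  have M: "0 < M" unfolding M_def
    by (intro add_nonneg_pos mult_nonneg_nonneg Mf0 less_imp_le[OF C1_pos] less_imp_le[OF box_facts(1)[OF box]]) simp
  \<comment> \<open>RH_infinity bounds \<open>v\<close> on the cube only almost everywhere. Setting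
    the product to 0 where it exceeds \<open>M\<close> changes it on a null set, which
    \<open>T\<close> does not see by \<open>T_cong_AE\<close>.\<close>
  define F where "F = (\<lambda>x. if norm (?g x) \<le> M then ?g x else 0)"
  note [measurable] = f(1) v_meas u_meas
  have gm: "?g \<in> borel_measurable lebesgue" by measurable
  have Fm: "F \<in> borel_measurable lebesgue" unfolding F_def by measurable
  have FM: "norm (F x) \<le> M" for x using M by (simp add: F_def)
  have F0: "F x = 0" if "x \<notin> ?B k" "k0 \<le> k" for x k
  proof -
    have "x \<notin> ?B k0" using B_mono[OF that(2)] that(1) by (rule contra_subsetD)
    then show ?thesis using f0 by (simp add: F_def)
  qed
  have FL: "F \<in> L2"
    by (rule L2_bounded[OF Fm FM F0[of _ k0]]) (auto simp: emeasure_half_open simp del: emeasure_completion)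
  have Fg: "AE x in lebesgue. F x = ?g x"
    using box_facts(5)[OF box, of k0] v_pos
  proof eventually_elim
    case (elim x)
    show ?case
    proof (cases "x \<in> ?B k0")
      case True
      then have "norm (?g x) \<le> Mf * (C1 * avg v (?B k0))"
        using elim Mf Mf0 unfolding norm_mult by (intro mult_mono) auto
      then show ?thesis by (simp add: F_def M_def)
    qed (simp add: F_def f0)
  qed
  have gL: "?g \<in> L2"
  proof -
    have "integrable lebesgue (\<lambda>x. (norm (F x))\<^sup>2) \<longleftrightarrow> integrable lebesgue (\<lambda>x. (norm (?g x))\<^sup>2)"
    proof (rule integrable_cong_AE)
      show "AE x in lebesgue. (norm (F x))\<^sup>2 = (norm (?g x))\<^sup>2" using Fg by eventually_elim simp
      show "(\<lambda>x. (norm (F x))\<^sup>2) \<in> borel_measurable lebesgue" using Fm by measurable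
    qed measurable
    then show ?thesis using FL gm by (simp add: L2_def)
  qed
  have X: "AE p in lebesgue. \<forall>R\<in>boxes. p \<in> R \<longrightarrow> lam R * ennreal (norm (F p)) \<le> ?X p"
  proof -
    have "AE p in lebesgue. \<forall>R\<in>boxes. p \<in> R \<longrightarrow> lam R * ennreal (norm (f p) * v p) \<le> ?X p"
      by (rule lam_le_maximal) (rule \<Psi>)
    then show ?thesis using v_pos
    proof eventually_elim
      case (elim p)
      have "norm (F p) \<le> norm (f p) * v p" using elim(2) by (simp add: F_def norm_mult)
      then show ?case using elim(1) by (meson ennreal_leI mult_left_mono order_trans zero_le)
    qed
  qed
  have wt: "weak_type u v s \<delta> C1 C2 T K c F (\<chi> i. - (real k + 1)) M (2 * (real k + 1)) t ?X" if "k0 \<le> k" for k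
    by unfold_locales (use Fm FM M F0[OF _ that] t X in auto)
  have TFm [measurable]: "T F \<in> borel_measurable lebesgue" by (rule L2_measurable[OF so.T_L2[OF FL]])
  \<comment> \<open>The cube and the height of \<open>u\<close> grow together; starting at
    \<open>k0\<close> keeps the set where \<open>f\<close> is nonzero inside the base cube.\<close>
  define A where "A = (\<lambda>j. {x\<in>?B (k0 + j). t < norm (T F x) / v x \<and> u x \<le> real (k0 + j) + 1})"
  have "mass (\<lambda>x. u x * v x) {x. t < norm (T ?g x) / v x} = mass (\<lambda>x. u x * v x) {x. t < norm (T F x) / v x}"
    unfolding mass_def
    by (rule nn_integral_cong_AE, use so.T_cong_AE[OF FL gL Fg] in eventually_elim) (simp add: indicator_def)
  also have "{x. t < norm (T F x) / v x} = (\<Union>j. A j)"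
  proof (intro equalityI subsetI)
    fix x assume x: "x \<in> {x. t < norm (T F x) / v x}"
    obtain j :: nat where j: "max (norm x) (u x) \<le> real j" using real_arch_simple by blast
    have "x \<in> ?B (k0 + j)" by (rule in_B) (use j in simp)
    then have "x \<in> A j" using x j by (simp add: A_def)
    then show "x \<in> (\<Union>j. A j)" by blast
  qed (auto simp: A_def)
  also have "mass (\<lambda>x. u x * v x) \<dots> \<le> ?rhs"
  proof (rule mass_incseq_le)
    show "(\<lambda>x. u x * v x) \<in> borel_measurable lebesgue" by measurable
    show "A j \<in> sets lebesgue" for j
    proof -
      have "A j = ?B (k0 + j) \<inter> {x\<in>space lebesgue. t < norm (T F x) / v x \<and> u x \<le> real (k0 + j) + 1}" by (auto simp: A_def)
      also have "\<dots> \<in> sets lebesgue" by measurable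
      finally show ?thesis .
    qed
    show "incseq A"
    proof (rule incseq_SucI)
      fix j show "A j \<le> A (Suc j)" using B_mono[of "k0 + j" "k0 + Suc j"] by (auto simp: A_def)
    qed
    show "mass (\<lambda>x. u x * v x) (A j) \<le> ?rhs" for j
      unfolding A_def by (rule weak_type.box_bound[OF wt]) auto
  qed
  finally show ?thesis .
qed

theorem theorem1:
  fixes u v :: "real ^ 'n \<Rightarrow> real"
    and T :: "(real ^ 'n \<Rightarrow> complex) \<Rightarrow> real ^ 'n \<Rightarrow> complex"
    and q \<delta> :: real
  assumes "\<And>x. 0 \<le> u x" and "locally_integrable u"
    and "1 < q"
    and "v \<in> RH_infinity \<inter> A_class q"
    and "calderon_zygmund T"
    and "0 < \<delta>"
  shows "\<forall>p > max q (1 + 1 / \<delta>). \<exists>C>0. \<forall>t>0. \<forall>f :: real ^ 'n \<Rightarrow> complex.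
    f \<in> borel_measurable lebesgue \<and> bounded (range f) \<and> compact (supp f) \<longrightarrow>
    mass (\<lambda>x. u x * v x) {x. norm (T (\<lambda>y. f y * of_real (v y)) x) / v x > t}
      \<le> ennreal (C / t) *
         (\<integral>\<^sup>+x. ennreal (norm (f x)) *
               orlicz_maximal (phi_log \<delta>) (\<lambda>y. v y powr (1 - conj_exp q)) u x *
               hl_maximal (\<lambda>y. Psi p q (v y)) x \<partial>lebesgue)"
proof (intro allI impI)
  fix p assume p: "max q (1 + 1 / \<delta>) < p"
  have e: "1 - conj_exp q = - (1 / (q - 1))" using assms(3) by (simp add: conj_exp_def field_simps)
  obtain C1 C2 where mw: "mixed_weights u v (1 / (q - 1)) \<delta> C1 C2"
    using mixed_weights_if_RH_A[OF assms(1,2,3) _ _ assms(6)] assms(4) by blast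
  obtain K c where so: "singular_operator T K c"
    by (rule calderon_zygmund_singular_operator[OF assms(5)])
  let ?C = "weak_type.weak_const TYPE('n) (1 / (q - 1)) \<delta> C1 C2 c"
  have \<Psi>: "z \<le> Psi p q z" if "0 \<le> z" for z using Psi_ge[OF assms(3) _ that] p by simp
  show "\<exists>C>0. \<forall>t>0. \<forall>f :: real ^ 'n \<Rightarrow> complex.
    f \<in> borel_measurable lebesgue \<and> bounded (range f) \<and> compact (supp f) \<longrightarrow>
    mass (\<lambda>x. u x * v x) {x. norm (T (\<lambda>y. f y * of_real (v y)) x) / v x > t}
      \<le> ennreal (C / t) *
         (\<integral>\<^sup>+x. ennreal (norm (f x)) *
               orlicz_maximal (phi_log \<delta>) (\<lambda>y. v y powr (1 - conj_exp q)) u x *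
               hl_maximal (\<lambda>y. Psi p q (v y)) x \<partial>lebesgue)"
    unfolding e
  proof (intro exI[of _ ?C] conjI allI impI)
    show "0 < ?C" by (rule weak_type_const_pos[OF mw so])
  qed (rule weak_type_estimate[OF mw so _ _ _ _ \<Psi>]; blast)
qed

end
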